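(* Let $\Gamma\text{-}\mathbf{Cat}$ be the $\mathbf{Cat}$-enriched multicategory of $\Gamma$-categories, and let $\mathbf{PermCat}^{\mathsf{sus}}$ be the $\mathbf{Cat}$-enriched multicategory of small permutative categories, strong multilinear functors, and multilinear transformations. Mandell's inverse $K$-theory functor $$\mathcal P:\Gamma\text{-}\mathbf{Cat}\longrightarrow \mathbf{PermCat}^{\mathsf{sus}}$$ is a non-symmetric $\mathbf{Cat}$-enriched multifunctor. That is, with the assignments on objects ($X\mapsto \mathcal P X$), on $k$-ary operations ($F\mapsto (\mathcal P F,\{(\mathcal P F)^2_b\}_{b=1}^k)$), and on morphisms between $k$-ary operations ($\theta\mapsto\mathcal P\theta$) described in the context, for all $k\ge 0$ and all $\Gamma$-categories $X_1,\dots,X_k,Z$ these give well-defined functors $$\mathcal P:\Gamma\text{-}\mathbf{Cat}(X_1,\dots,X_k;Z)\longrightarrow \mathbf{PermCat}^{\mathsf{sus}}(\mathcal P X_1,\dots,\mathcal P X_k;\mathcal P Z)$$ (in particular each $\mathcal P F$ is a strong $k$-linear functor and each $\mathcal P\theta$ is a $k$-linear transformation), and these functors preserve the units and the multicategorical composition.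
   Context: **Non-symmetric enriched multifunctors.** A $\mathbf{Cat}$-enriched multicategory $\mathsf M$ has objects, categories of $n$-ary operations $\mathsf M(c_1,\dots,c_n;c')$ for $n\ge 0$, units, composition functors $\gamma$, and symmetric group actions, satisfying the usual axioms. A non-symmetric $\mathbf{Cat}$-enriched multifunctor $\mathsf M\to\mathsf N$ consists of an object assignment $F$ and functors $\mathsf M(c_1,\dots,c_n;c')\to\mathsf N(Fc_1,\dots,Fc_n;Fc')$ which strictly preserve units and composition $\gamma$ (on both objects and morphisms of operation categories). Preservation of symmetric group actions is not required. **The category $\mathcal F$.** Write $\underline n=\{0,1,\dots,n\}$ (basepoint $0$) and $\overline n=\{1,\dots,n\}$ ($\overline 0=\emptyset$). $\mathcal F$ has objects $\underline n$, $n\ge0$, and pointed maps. It is permutative under smash product, $\underline m\wedge\underline n=\underline{mn}$ via the lexicographic bijection $(x,y)\mapsto n(x-1)+y$ for $x,y>0$, with strict unit $\underline 1$; iterating identifies $\overline{p_1}\times\cdots\times\overline{p_k}$ with $\overline{p_1\cdots p_k}$. **$\Gamma\text{-}\mathbf{Cat}$.** A $\Gamma$-category is a functor $X:\mathcal F\to\mathbf{Cat}$ (small categories) with $X\underline 0=\mathbf 1$ the terminal category; each $X\underline n$ is pointed, with basepoint $*$ the image of $X\underline 0\to X\underline n$. $\Gamma\text{-}\mathbf{Cat}$ is symmetric monoidal closed under Day convolution $\wedge$ of pointed diagrams, with unit $J$ given by $J\underline n=\underline n$ (discrete pointed category), and is enriched over pointed categories. The resulting $\mathbf{Cat}$-enriched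 multicategory has as $k$-ary operations $(X_1,\dots,X_k)\to Z$ the morphisms of $\Gamma$-categories $F:X_1\wedge\cdots\wedge X_k\to Z$; equivalently, families of pointed functors $$F: X_1\underline{p_1}\wedge\cdots\wedge X_k\underline{p_k}\to Z(\underline{p_1\cdots p_k})$$ (smash product of pointed categories) natural in $(\underline{p_1},\dots,\underline{p_k})$, where morphisms $\psi^i:\underline{p_i}\to\underline{p_i'}$ act on the target by $Z(\psi^1\wedge\cdots\wedge\psi^k)$. A morphism $\theta:F\to G$ of $k$-ary operations is a pointed modification: a family of pointed natural transformations (identity component at the basepoint) between these component functors, compatible with morphisms in the $\underline{p_i}$. For $k=0$, an operation $F:J\to Z$ is equivalently an object $F_1(1)\in Z\underline 1$, and $\theta:F\to G$ is equivalently a morphism $\theta_1:F_1(1)\to G_1(1)$ in $Z\underline 1$. Composition is composition of these component functors, horizontal composition for modifications; units are identities. **$\mathbf{PermCat}^{\mathsf{sus}}$.** A permutative category $(\mathsf C,\oplus,e,\xi)$ is a symmetric monoidal category with identity associativity and unit isomorphisms. For $n\geq 1$ an $n$-linear functor $\mathsf C_1\times\cdots\times\mathsf C_n\to\mathsf D$ is a functor $F$ with, for each $i$, a natural transformation ($i$-th linearity constraint) $$F^2_i:F\langle X\circ_i X_i\rangle\oplus F\langle X\circ_i X_i'\rangle\to F\langle X\circ_i(X_i\oplus X_i')\rangle$$ ($\langle X\circ_i Y\rangle$ is the tuple $\langle X\rangle=(X_1,\dots,X_n)$ with $i$-th entry replaced by $Y$) such that: (Unity) $F\langle X\rangle=e$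 if some $X_j=e$, and $F\langle f\rangle=1_e$ if some $f_j=1_e$; (Constraint unity) $F^2_i$ is an identity if some $X_j=e$ or $X_i'=e$; (Associativity) $F^2_i(F^2_i\oplus 1)=F^2_i(1\oplus F^2_i)$ as maps $F\langle X\circ_iX_i\rangle\oplus F\langle X\circ_iX'_i\rangle\oplus F\langle X\circ_iX''_i\rangle\to F\langle X\circ_i(X_i\oplus X_i'\oplus X_i'')\rangle$; (Symmetry) $F\langle1\circ_i\xi\rangle\, F^2_i=F^2_i\,\xi$; (2-by-2) for $i\ne k$, the two maps from $F\langle X\circ_i X_i\circ_k X_k\rangle\oplus F\langle X\circ_i X_i'\circ_k X_k\rangle\oplus F\langle X\circ_i X_i\circ_k X_k'\rangle\oplus F\langle X\circ_i X_i'\circ_k X_k'\rangle$ to $F\langle X\circ_i(X_i\oplus X_i')\circ_k(X_k\oplus X_k')\rangle$, namely $F^2_k(F^2_i\oplus F^2_i)$ and $F^2_i(F^2_k\oplus F^2_k)(1\oplus\xi\oplus1)$, are equal. A $0$-linear functor is an object of $\mathsf D$. $F$ is strong if all $F^2_i$ are isomorphisms. An $n$-linear transformation $\alpha:F\to F'$ is a natural transformation with $\alpha\circ F^2_i=(F')^2_i\circ(\alpha\oplus\alpha)$ for each $i$, and whose component at $\langle X\rangle$ is an identity whenever some $X_i=e$; for $n=0$ it is a morphism in $\mathsf D$. $\mathbf{PermCat}^{\mathsf{sus}}$ has small permutative categories as objects, and strong $n$-linear functors and $n$-linear transformations as categories of $n$-ary operations. The composite of $F$ with $F_1,\dots,F_k$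 ($F_i$ of arity $n_i$) is the functor $F\circ\prod_iF_i$, with linearity constraint in the variable $(i,j)$ given by $F\langle1\circ_i(F_i)^2_j\rangle\circ F^2_i$; composition of transformations is horizontal composition; units are identities. **$\mathcal P$ on objects.** The category $\mathcal A$ has as objects finite (possibly empty) sequences $m=(m_1,\dots,m_p)$ of positive integers. A morphism $\phi:m\to n=(n_1,\dots,n_q)$ is a map of sets $\coprod_i\overline{m_i}\to\coprod_j\overline{n_j}$ such that for each $j$ the preimage of $\overline{n_j}$ is empty or contained in a single $\overline{m_i}$. For a $\Gamma$-category $X$, the functor $AX:\mathcal A\to\mathbf{Cat}$ has $(AX)(m)=\prod_{i=1}^pX\underline{m_i}$ (and $\mathbf 1$ if $p=0$). For $\phi:m\to n$, the $j$-th coordinate of $\phi_*=(AX)(\phi)$ is constant at the basepoint of $X\underline{n_j}$ if $\phi^{-1}(\overline{n_j})=\emptyset$; if $\emptyset\ne\phi^{-1}(\overline{n_j})\subset\overline{m_i}$, it is projection to $X\underline{m_i}$ followed by $X\phi_{i,j}$, where $\phi_{i,j}:\underline{m_i}\to\underline{n_j}$ is $\phi$ on $\phi^{-1}(\overline{n_j})$ and $0$ elsewhere. $\mathcal P X=\int_{\mathcal A}AX$ is the Grothendieck construction: objects are pairs $(m,x)$ with $x=(x_1,\dots,x_p)\in(AX)(m)$; morphisms $(m,x)\to(n,y)$ are pairs $(\phi:m\to n,\ f:\phi_*x\to y)$; $(\psi,g)(\phi,f)=(\psi\phi,\,g\circ\psi_*f)$. It is permutative under concatenation $(m,x)\,\Box\,(n,y)=((m,n),(x,y))$,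 with unit $((),* )$ and braiding $(\tau,1)$, $\tau$ the block swap. **$\mathcal P$ on $k$-ary operations.** For $k=0$, $\mathcal P F$ is the object $((1),F_1(1))$ of $\mathcal P Z$. For $k>0$ and objects $(m^i,x^i)\in\mathcal P X_i$ with $m^i=(m^i_1,\dots,m^i_{r_i})$, $x^i=(x^i_1,\dots,x^i_{r_i})$, put $$(\mathcal P F)\big((m^1,x^1),\dots,(m^k,x^k)\big)=\big(m^{1,\dots,k},F(x^{1,\dots,k})\big),$$ where both are sequences of length $r_1\cdots r_k$ indexed by tuples $(j_1,\dots,j_k)$, $1\le j_i\le r_i$, ordered reverse lexicographically ($j_k$ compared first, ..., $j_1$ last); the entry of $m^{1,\dots,k}$ at $(j_1,\dots,j_k)$ is $\prod_im^i_{j_i}$, and that of $F(x^{1,\dots,k})$ is $F(x^1_{j_1},\dots,x^k_{j_k})\in Z(\underline{\prod_im^i_{j_i}})$. (If some $r_i=0$ this is $((),* )$.) On morphisms $(\phi^i,f^i):(m^i,x^i)\to(n^i,y^i)$, $\mathcal P F$ gives $(\phi,f)$, where $\phi(a_1,\dots,a_k)=(\phi^1(a_1),\dots,\phi^k(a_k))$ under the identifications $\overline{\prod_im^i_{j_i}}\cong\prod_i\overline{m^i_{j_i}}$ and similarly for $n$, and the component of $f$ at index $(\ell_1,\dots,\ell_k)$ is $F(f^1_{\ell_1},\dots,f^k_{\ell_k})$. **Linearity constraints.** For $1\le b\le k$ and an additional object $(\hat m^b,\hat x^b)\in\mathcal P X_b$, let $\hat m^{1,\dots,k}$ be formed from $m^1,\dots,\hat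 m^b,\dots,m^k$ and $\tilde m^{1,\dots,k}$ from $m^1,\dots,(m^b,\hat m^b),\dots,m^k$. Then $(\mathcal P F)^2_b=(\sigma,1)$, where $\sigma:(m^{1,\dots,k},\hat m^{1,\dots,k})\to\tilde m^{1,\dots,k}$ is the isomorphism in $\mathcal A$ which maps the block of $m^{1,\dots,k}$ with index $(j_1,\dots,j_k)$ identically to the block of $\tilde m^{1,\dots,k}$ with the same index, and the block of $\hat m^{1,\dots,k}$ with index $(j_1,\dots,j_k)$ identically to the block of $\tilde m^{1,\dots,k}$ whose index has $j_b$ replaced by $r_b+j_b$; the second component is an identity morphism. **$\mathcal P$ on modifications.** For $\theta:F\to G$ and $k>0$, the component of $\mathcal P\theta$ at $\langle(m^i,x^i)\rangle$ is the identity of $m^{1,\dots,k}$ together with the morphisms $\theta_{(x^1_{j_1},\dots,x^k_{j_k})}:F(x^1_{j_1},\dots,x^k_{j_k})\to G(x^1_{j_1},\dots,x^k_{j_k})$. For $k=0$, $\mathcal P\theta=(1_{(1)},\theta_1)$. *)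

theory Defs
  imports Main "HOL-Library.FuncSet"
begin

section \<open>Small categories\<close>

text \<open>
  A small category has its objects and arrows in two types. All functors and transformations
  below are extensional (undefined outside their domain), so that equality of functors, of
  transformations and of multilinear functors is literally equality of HOL values.
  Positions in lists count from 0; the elements of a block \<open>{1..n}\<close> count from 1.
\<close>

abbreviation tab :: "nat \<Rightarrow> (nat \<Rightarrow> 'a) \<Rightarrow> 'a list" where
  "tab n f \<equiv> map f [0..<n]"

record ('o, 'm) cat =
  Obj :: "'o set"
  Arr :: "'m set"
  Dom :: "'m \<Rightarrow> 'o"
  Cod :: "'m \<Rightarrow> 'o"
  Ident :: "'o \<Rightarrow> 'm"
  Comp :: "'m \<Rightarrow> 'm \<Rightarrow> 'm"  \<comment> \<open>\<open>Comp C g f\<close> is \<open>g\<close> after \<open>f\<close>\<close>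

definition hom :: "('o, 'm, 'z) cat_scheme \<Rightarrow> 'o \<Rightarrow> 'o \<Rightarrow> 'm set" where
  "hom C x y = {f \<in> Arr C. Dom C f = x \<and> Cod C f = y}"

locale category =
  fixes C :: "('o, 'm, 'z) cat_scheme"
  assumes dom_cod: "f \<in> Arr C \<Longrightarrow> Dom C f \<in> Obj C \<and> Cod C f \<in> Obj C"
    and ident: "x \<in> Obj C \<Longrightarrow> Ident C x \<in> hom C x x"
    and comp: "\<lbrakk>f \<in> hom C x y; g \<in> hom C y z\<rbrakk> \<Longrightarrow> Comp C g f \<in> hom C x z"
    and comp_ident: "f \<in> hom C x y \<Longrightarrow> Comp C f (Ident C x) = f"
    and ident_comp: "f \<in> hom C x y \<Longrightarrow> Comp C (Ident C y) f = f"
    and comp_assoc: "\<lbrakk>f \<in> hom C x y; g \<in> hom C y z; h \<in> hom C z w\<rbrakk>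
      \<Longrightarrow> Comp C h (Comp C g f) = Comp C (Comp C h g) f"

definition is_iso :: "('o, 'm, 'z) cat_scheme \<Rightarrow> 'm \<Rightarrow> bool" where
  "is_iso C f \<longleftrightarrow> f \<in> Arr C \<and> (\<exists>g \<in> hom C (Cod C f) (Dom C f).
     Comp C g f = Ident C (Dom C f) \<and> Comp C f g = Ident C (Cod C f))"

definition terminal_cat :: "('o, 'm, 'z) cat_scheme \<Rightarrow> bool" where
  "terminal_cat C \<longleftrightarrow> category C \<and> (\<exists>x. Obj C = {x}) \<and> (\<exists>f. Arr C = {f})"

text \<open>The product of a list of categories; the empty product is the terminal category.\<close>

definition prod_cat :: "('o, 'm, 'z) cat_scheme list \<Rightarrow> ('o list, 'm list) cat" where
  "prod_cat Cs = \<lparr>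
     Obj = {xs. length xs = length Cs \<and> (\<forall>i<length Cs. xs ! i \<in> Obj (Cs ! i))},
     Arr = {fs. length fs = length Cs \<and> (\<forall>i<length Cs. fs ! i \<in> Arr (Cs ! i))},
     Dom = (\<lambda>fs. tab (length Cs) (\<lambda>i. Dom (Cs ! i) (fs ! i))),
     Cod = (\<lambda>fs. tab (length Cs) (\<lambda>i. Cod (Cs ! i) (fs ! i))),
     Ident = (\<lambda>xs. tab (length Cs) (\<lambda>i. Ident (Cs ! i) (xs ! i))),
     Comp = (\<lambda>gs fs. tab (length Cs) (\<lambda>i. Comp (Cs ! i) (gs ! i) (fs ! i)))\<rparr>"

record ('o1, 'm1, 'o2, 'm2) ftor =
  FOb :: "'o1 \<Rightarrow> 'o2"
  FAr :: "'m1 \<Rightarrow> 'm2"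

locale cfunctor = C: category C + D: category D
  for C :: "('o1, 'm1, 'y) cat_scheme" and D :: "('o2, 'm2, 'z) cat_scheme" +
  fixes F :: "('o1, 'm1, 'o2, 'm2) ftor"
  assumes FOb_ext: "FOb F \<in> extensional (Obj C)"
    and FAr_ext: "FAr F \<in> extensional (Arr C)"
    and FOb_in: "x \<in> Obj C \<Longrightarrow> FOb F x \<in> Obj D"
    and FAr_in: "f \<in> hom C x y \<Longrightarrow> FAr F f \<in> hom D (FOb F x) (FOb F y)"
    and FAr_ident: "x \<in> Obj C \<Longrightarrow> FAr F (Ident C x) = Ident D (FOb F x)"
    and FAr_comp: "\<lbrakk>f \<in> hom C x y; g \<in> hom C y z\<rbrakk>
      \<Longrightarrow> FAr F (Comp C g f) = Comp D (FAr F g) (FAr F f)"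

definition id_ftor :: "('o, 'm, 'z) cat_scheme \<Rightarrow> ('o, 'm, 'o, 'm) ftor" where
  "id_ftor C = \<lparr>FOb = (\<lambda>x\<in>Obj C. x), FAr = (\<lambda>f\<in>Arr C. f)\<rparr>"

definition comp_ftor :: "('o1, 'm1, 'z) cat_scheme \<Rightarrow> ('o2, 'm2, 'o3, 'm3) ftor
    \<Rightarrow> ('o1, 'm1, 'o2, 'm2) ftor \<Rightarrow> ('o1, 'm1, 'o3, 'm3) ftor" where
  "comp_ftor C G F = \<lparr>FOb = compose (Obj C) (FOb G) (FOb F),
                      FAr = compose (Arr C) (FAr G) (FAr F)\<rparr>"

definition prod_ftor :: "('o1, 'm1, 'z) cat_scheme list \<Rightarrow> ('o1, 'm1, 'o2, 'm2) ftor list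
    \<Rightarrow> ('o1 list, 'm1 list, 'o2 list, 'm2 list) ftor" where
  "prod_ftor Cs Fs = \<lparr>
     FOb = (\<lambda>xs\<in>Obj (prod_cat Cs). tab (length Cs) (\<lambda>i. FOb (Fs ! i) (xs ! i))),
     FAr = (\<lambda>fs\<in>Arr (prod_cat Cs). tab (length Cs) (\<lambda>i. FAr (Fs ! i) (fs ! i)))\<rparr>"

definition nat_trans :: "('o1, 'm1, 'y) cat_scheme \<Rightarrow> ('o2, 'm2, 'z) cat_scheme
    \<Rightarrow> ('o1, 'm1, 'o2, 'm2) ftor \<Rightarrow> ('o1, 'm1, 'o2, 'm2) ftor \<Rightarrow> ('o1 \<Rightarrow> 'm2) \<Rightarrow> bool" where
  "nat_trans C D F G \<alpha> \<longleftrightarrow>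
     \<alpha> \<in> extensional (Obj C) \<and>
     (\<forall>x\<in>Obj C. \<alpha> x \<in> hom D (FOb F x) (FOb G x)) \<and>
     (\<forall>f\<in>Arr C. Comp D (\<alpha> (Cod C f)) (FAr F f) = Comp D (FAr G f) (\<alpha> (Dom C f)))"

text \<open>In all concrete categories below an arrow is a triple (source, target, datum).\<close>

type_synonym ('o, 'm) cat_arr = "('o, 'm) cat \<times> ('o, 'm) cat \<times> ('o, 'm, 'o, 'm) ftor"

definition CAT :: "(('o, 'm) cat, ('o, 'm) cat_arr) cat" where
  "CAT = \<lparr>
     Obj = {C. category C},
     Arr = {(C, D, F). cfunctor C D F},
     Dom = (\<lambda>(C, D, F). C),
     Cod = (\<lambda>(C, D, F). D),
     Ident = (\<lambda>C. (C, C, id_ftor C)),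
     Comp = (\<lambda>(C', D', G) (C, D, F). (C, D', comp_ftor C G F))\<rparr>"

text \<open>The functor of categories \<open>X u\<close>, for \<open>X\<close> valued in \<open>CAT\<close> and \<open>u\<close> an arrow.\<close>

definition act :: "('b, 'u, ('o, 'm) cat, ('o, 'm) cat_arr) ftor \<Rightarrow> 'u \<Rightarrow> ('o, 'm, 'o, 'm) ftor" where
  "act X u = snd (snd (FAr X u))"

text \<open>Grothendieck construction of a functor \<open>G\<close> from \<open>B\<close> to \<open>CAT\<close>.\<close>

type_synonym ('b, 'u, 'o, 'm) groth_arr = "('b \<times> 'o) \<times> ('b \<times> 'o) \<times> ('u \<times> 'm)"

definition groth :: "('b, 'u) cat \<Rightarrow> ('b, 'u, ('o, 'm) cat, ('o, 'm) cat_arr) ftor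
    \<Rightarrow> ('b \<times> 'o, ('b, 'u, 'o, 'm) groth_arr) cat" where
  "groth B G = \<lparr>
     Obj = {(b, x). b \<in> Obj B \<and> x \<in> Obj (FOb G b)},
     Arr = {((b, x), (c, y), (u, f)). u \<in> hom B b c \<and> x \<in> Obj (FOb G b) \<and> y \<in> Obj (FOb G c) \<and>
              f \<in> hom (FOb G c) (FOb (act G u) x) y},
     Dom = (\<lambda>(s, t, d). s),
     Cod = (\<lambda>(s, t, d). t),
     Ident = (\<lambda>(b, x). ((b, x), (b, x), (Ident B b, Ident (FOb G b) x))),
     Comp = (\<lambda>(s', (c, z), (v, g)) (s, t, (u, f)).
               (s, (c, z), (Comp B v u, Comp (FOb G c) g (FAr (act G v) f))))\<rparr>"


section \<open>Non-symmetric Cat-enriched multifunctors\<close>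

text \<open>
  The data of a Cat-enriched multicategory that a non-symmetric multifunctor refers to; the
  symmetric group actions play no role here. The composition functor \<open>\<gamma>\<close> is indexed by the
  inputs \<open>xss\<close> of the inner operations, the inputs \<open>ys\<close> of the outer one and its output \<open>z\<close>.
\<close>

record ('x, 'f, 't) multicat =
  MObj :: "'x set"
  MOps :: "'x list \<Rightarrow> 'x \<Rightarrow> ('f, 't) cat"
  MUnit :: "'x \<Rightarrow> 'f"
  MCompOb :: "'x list list \<Rightarrow> 'x list \<Rightarrow> 'x \<Rightarrow> 'f \<Rightarrow> 'f list \<Rightarrow> 'f"
  MCompAr :: "'x list list \<Rightarrow> 'x list \<Rightarrow> 'x \<Rightarrow> 't \<Rightarrow> 't list \<Rightarrow> 't"

record ('x, 'f, 't, 'x2, 'f2, 't2) multiftor =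
  MFOb :: "'x \<Rightarrow> 'x2"
  MFOps :: "'x list \<Rightarrow> 'x \<Rightarrow> ('f, 't, 'f2, 't2) ftor"

locale nonsym_cat_multifunctor =
  fixes M :: "('x, 'f, 't) multicat" and N :: "('x2, 'f2, 't2) multicat"
    and P :: "('x, 'f, 't, 'x2, 'f2, 't2) multiftor"
  assumes objects: "x \<in> MObj M \<Longrightarrow> MFOb P x \<in> MObj N"
    and operations: "\<lbrakk>set xs \<subseteq> MObj M; z \<in> MObj M\<rbrakk>
      \<Longrightarrow> cfunctor (MOps M xs z) (MOps N (map (MFOb P) xs) (MFOb P z)) (MFOps P xs z)"
    and units: "x \<in> MObj M \<Longrightarrow> FOb (MFOps P [x] x) (MUnit M x) = MUnit N (MFOb P x)"
    and composition_Ob: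
      "\<lbrakk>set ys \<subseteq> MObj M; z \<in> MObj M; length xss = length ys; \<forall>xs\<in>set xss. set xs \<subseteq> MObj M;
        f \<in> Obj (MOps M ys z); length fs = length ys;
        \<forall>i<length ys. fs ! i \<in> Obj (MOps M (xss ! i) (ys ! i))\<rbrakk>
      \<Longrightarrow> FOb (MFOps P (concat xss) z) (MCompOb M xss ys z f fs) =
          MCompOb N (map (map (MFOb P)) xss) (map (MFOb P) ys) (MFOb P z)
            (FOb (MFOps P ys z) f) (tab (length ys) (\<lambda>i. FOb (MFOps P (xss ! i) (ys ! i)) (fs ! i)))"
    and composition_Ar:
      "\<lbrakk>set ys \<subseteq> MObj M; z \<in> MObj M; length xss = length ys; \<forall>xs\<in>set xss. set xs \<subseteq> MObj M;
        t \<in> Arr (MOps M ys z); length ts = length ys;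
        \<forall>i<length ys. ts ! i \<in> Arr (MOps M (xss ! i) (ys ! i))\<rbrakk>
      \<Longrightarrow> FAr (MFOps P (concat xss) z) (MCompAr M xss ys z t ts) =
          MCompAr N (map (map (MFOb P)) xss) (map (MFOb P) ys) (MFOb P z)
            (FAr (MFOps P ys z) t) (tab (length ys) (\<lambda>i. FAr (MFOps P (xss ! i) (ys ! i)) (ts ! i)))"

text \<open>Cutting a list into consecutive pieces of lengths \<open>ns\<close>, and the piece and the position in
  that piece of the \<open>l\<close>-th entry.\<close>

fun pieces :: "nat list \<Rightarrow> 'a list \<Rightarrow> 'a list list" where
  "pieces [] xs = []"
| "pieces (n # ns) xs = take n xs # pieces ns (drop n xs)"

fun locate :: "nat list \<Rightarrow> nat \<Rightarrow> nat \<times> nat" where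
  "locate [] l = (0, l)"
| "locate (n # ns) l = (if l < n then (0, l) else apfst Suc (locate ns (l - n)))"


section \<open>Gamma-categories\<close>

definition Fcat :: "(nat, nat \<times> nat \<times> (nat \<Rightarrow> nat)) cat" where
  "Fcat = \<lparr>
     Obj = UNIV,
     Arr = {(m, n, f). f \<in> {0..m} \<rightarrow>\<^sub>E {0..n} \<and> f 0 = 0},
     Dom = (\<lambda>(m, n, f). m),
     Cod = (\<lambda>(m, n, f). n),
     Ident = (\<lambda>n. (n, n, \<lambda>a\<in>{0..n}. a)),
     Comp = (\<lambda>(m', n', g) (m, n, f). (m, n', compose {0..m} g f))\<rparr>"

text \<open>
  \<open>lex_pos ps\<close> is the identification of \<open>{1..p\<^sub>1} \<times> \<dots> \<times> {1..p\<^sub>k}\<close> with \<open>{1..p\<^sub>1 \<cdots> p\<^sub>k}\<close> obtained by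
  iterating \<open>(x, y) \<mapsto> n (x - 1) + y\<close>, and \<open>lex_inv ps\<close> is its inverse.
\<close>

definition points :: "nat list \<Rightarrow> nat list set" where
  "points ps = {as. length as = length ps \<and> (\<forall>i<length ps. as ! i \<in> {1..ps ! i})}"

fun lex_pos :: "nat list \<Rightarrow> nat list \<Rightarrow> nat" where
  "lex_pos (p # ps) (a # as) = prod_list ps * (a - 1) + lex_pos ps as"
| "lex_pos _ _ = 1"

definition lex_inv :: "nat list \<Rightarrow> nat \<Rightarrow> nat list" where
  "lex_inv ps = the_inv_into (points ps) (lex_pos ps)"

definition smash_map :: "nat list \<Rightarrow> nat list \<Rightarrow> (nat \<Rightarrow> nat) list \<Rightarrow> nat \<Rightarrow> nat" where
  "smash_map ps qs \<psi>s = (\<lambda>a\<in>{0..prod_list ps}. if a = 0 then 0 else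
     let bs = tab (length ps) (\<lambda>i. (\<psi>s ! i) (lex_inv ps a ! i))
     in if 0 \<in> set bs then 0 else lex_pos qs bs)"

type_synonym ('o, 'm) gcat =
  "(nat, nat \<times> nat \<times> (nat \<Rightarrow> nat), ('o, 'm) cat, ('o, 'm) cat_arr) ftor"

definition gamma_category :: "('o, 'm) gcat \<Rightarrow> bool" where
  "gamma_category X \<longleftrightarrow> cfunctor Fcat CAT X \<and> terminal_cat (FOb X 0)"

definition basept :: "('o, 'm) gcat \<Rightarrow> nat \<Rightarrow> 'o" where
  "basept X n = FOb (act X (0, n, \<lambda>a\<in>{0..0}. 0)) (the_elem (Obj (FOb X 0)))"

text \<open>
  A k-ary operation is a family of pointed functors on smash products of pointed categories. The
  smash product is the quotient of the product by the subcategory of all tuples with some entry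
  the basepoint (on objects) or its identity (on arrows), so a pointed functor on it is a functor
  on the product that sends these tuples to the basepoint and its identity. For k = 0 the product
  is the terminal category and \<open>prod_list [] = 1\<close>, so the operation is an object of \<open>Z 1\<close>.
\<close>

type_synonym ('o, 'm) gop = "nat list \<Rightarrow> ('o list, 'm list, 'o, 'm) ftor"

abbreviation gcats :: "('o, 'm) gcat list \<Rightarrow> nat list \<Rightarrow> ('o, 'm) cat list" where
  "gcats Xs ps \<equiv> tab (length Xs) (\<lambda>i. FOb (Xs ! i) (ps ! i))"

definition gprod :: "('o, 'm) gcat list \<Rightarrow> nat list \<Rightarrow> ('o list, 'm list) cat" where
  "gprod Xs ps = prod_cat (gcats Xs ps)"

definition Fcat_tuple :: "nat list \<Rightarrow> nat list \<Rightarrow> (nat \<Rightarrow> nat) list \<Rightarrow> bool" where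
  "Fcat_tuple ps qs \<psi>s \<longleftrightarrow> length qs = length ps \<and> length \<psi>s = length ps \<and>
     (\<forall>i<length ps. (ps ! i, qs ! i, \<psi>s ! i) \<in> Arr Fcat)"

abbreviation smash_arr :: "nat list \<Rightarrow> nat list \<Rightarrow> (nat \<Rightarrow> nat) list \<Rightarrow> nat \<times> nat \<times> (nat \<Rightarrow> nat)" where
  "smash_arr ps qs \<psi>s \<equiv> (prod_list ps, prod_list qs, smash_map ps qs \<psi>s)"

definition gacts :: "('o, 'm) gcat list \<Rightarrow> nat list \<Rightarrow> nat list \<Rightarrow> (nat \<Rightarrow> nat) list
    \<Rightarrow> ('o list, 'm list, 'o list, 'm list) ftor" where
  "gacts Xs ps qs \<psi>s =
     prod_ftor (gcats Xs ps) (tab (length Xs) (\<lambda>i. act (Xs ! i) (ps ! i, qs ! i, \<psi>s ! i)))"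

definition gamma_op :: "('o, 'm) gcat list \<Rightarrow> ('o, 'm) gcat \<Rightarrow> ('o, 'm) gop \<Rightarrow> bool" where
  "gamma_op Xs Z F \<longleftrightarrow>
     F \<in> extensional {ps. length ps = length Xs} \<and>
     (\<forall>ps. length ps = length Xs \<longrightarrow>
        cfunctor (gprod Xs ps) (FOb Z (prod_list ps)) (F ps) \<and>
        (\<forall>xs\<in>Obj (gprod Xs ps). (\<exists>i<length Xs. xs ! i = basept (Xs ! i) (ps ! i)) \<longrightarrow>
           FOb (F ps) xs = basept Z (prod_list ps)) \<and>
        (\<forall>fs\<in>Arr (gprod Xs ps).
           (\<exists>i<length Xs. fs ! i = Ident (FOb (Xs ! i) (ps ! i)) (basept (Xs ! i) (ps ! i))) \<longrightarrow>
           FAr (F ps) fs = Ident (FOb Z (prod_list ps)) (basept Z (prod_list ps)))) \<and>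
     (\<forall>ps qs \<psi>s. length ps = length Xs \<and> Fcat_tuple ps qs \<psi>s \<longrightarrow>
        comp_ftor (gprod Xs ps) (act Z (smash_arr ps qs \<psi>s)) (F ps) =
        comp_ftor (gprod Xs ps) (F qs) (gacts Xs ps qs \<psi>s))"

definition gamma_mod :: "('o, 'm) gcat list \<Rightarrow> ('o, 'm) gcat \<Rightarrow> ('o, 'm) gop \<Rightarrow> ('o, 'm) gop
    \<Rightarrow> (nat list \<Rightarrow> 'o list \<Rightarrow> 'm) \<Rightarrow> bool" where
  "gamma_mod Xs Z F G \<theta> \<longleftrightarrow>
     \<theta> \<in> extensional {ps. length ps = length Xs} \<and>
     (\<forall>ps. length ps = length Xs \<longrightarrow>
        nat_trans (gprod Xs ps) (FOb Z (prod_list ps)) (F ps) (G ps) (\<theta> ps) \<and>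
        (\<forall>xs\<in>Obj (gprod Xs ps). (\<exists>i<length Xs. xs ! i = basept (Xs ! i) (ps ! i)) \<longrightarrow>
           \<theta> ps xs = Ident (FOb Z (prod_list ps)) (basept Z (prod_list ps)))) \<and>
     (\<forall>ps qs \<psi>s. length ps = length Xs \<and> Fcat_tuple ps qs \<psi>s \<longrightarrow>
        (\<forall>xs\<in>Obj (gprod Xs ps).
           FAr (act Z (smash_arr ps qs \<psi>s)) (\<theta> ps xs) = \<theta> qs (FOb (gacts Xs ps qs \<psi>s) xs)))"

type_synonym ('o, 'm) gop_arr = "('o, 'm) gop \<times> ('o, 'm) gop \<times> (nat list \<Rightarrow> 'o list \<Rightarrow> 'm)"

definition gamma_ops :: "('o, 'm) gcat list \<Rightarrow> ('o, 'm) gcat \<Rightarrow> (('o, 'm) gop, ('o, 'm) gop_arr) cat" where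
  "gamma_ops Xs Z = \<lparr>
     Obj = {F. gamma_op Xs Z F},
     Arr = {(F, G, \<theta>). gamma_op Xs Z F \<and> gamma_op Xs Z G \<and> gamma_mod Xs Z F G \<theta>},
     Dom = (\<lambda>(F, G, \<theta>). F),
     Cod = (\<lambda>(F, G, \<theta>). G),
     Ident = (\<lambda>F. (F, F, \<lambda>ps\<in>{ps. length ps = length Xs}. \<lambda>xs\<in>Obj (gprod Xs ps).
                Ident (FOb Z (prod_list ps)) (FOb (F ps) xs))),
     Comp = (\<lambda>(F', H, \<eta>) (F, G, \<theta>). (F, H, \<lambda>ps\<in>{ps. length ps = length Xs}.
                \<lambda>xs\<in>Obj (gprod Xs ps). Comp (FOb Z (prod_list ps)) (\<eta> ps xs) (\<theta> ps xs)))\<rparr>"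

definition gamma_unit :: "('o, 'm) gcat \<Rightarrow> ('o, 'm) gop" where
  "gamma_unit X = (\<lambda>ps\<in>{ps. length ps = 1}.
     \<lparr>FOb = (\<lambda>xs\<in>Obj (gprod [X] ps). hd xs), FAr = (\<lambda>fs\<in>Arr (gprod [X] ps). hd fs)\<rparr>)"

definition gamma_compOb :: "('o, 'm) gcat list list \<Rightarrow> ('o, 'm) gcat list \<Rightarrow> ('o, 'm) gcat
    \<Rightarrow> ('o, 'm) gop \<Rightarrow> ('o, 'm) gop list \<Rightarrow> ('o, 'm) gop" where
  "gamma_compOb Xss Ys Z F Fs = (\<lambda>ps\<in>{ps. length ps = length (concat Xss)}.
     let pss = pieces (map length Xss) ps in
     \<lparr>FOb = (\<lambda>xs\<in>Obj (gprod (concat Xss) ps). FOb (F (map prod_list pss))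
               (tab (length Ys) (\<lambda>i. FOb ((Fs ! i) (pss ! i)) (pieces (map length Xss) xs ! i)))),
      FAr = (\<lambda>fs\<in>Arr (gprod (concat Xss) ps). FAr (F (map prod_list pss))
               (tab (length Ys) (\<lambda>i. FAr ((Fs ! i) (pss ! i)) (pieces (map length Xss) fs ! i))))\<rparr>)"

definition gamma_compAr :: "('o, 'm) gcat list list \<Rightarrow> ('o, 'm) gcat list \<Rightarrow> ('o, 'm) gcat
    \<Rightarrow> ('o, 'm) gop_arr \<Rightarrow> ('o, 'm) gop_arr list \<Rightarrow> ('o, 'm) gop_arr" where
  "gamma_compAr Xss Ys Z = (\<lambda>(F, G, \<theta>) ts.
     (gamma_compOb Xss Ys Z F (map fst ts),
      gamma_compOb Xss Ys Z G (map (fst \<circ> snd) ts),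
      \<lambda>ps\<in>{ps. length ps = length (concat Xss)}. \<lambda>xs\<in>Obj (gprod (concat Xss) ps).
        let pss = pieces (map length Xss) ps; xss = pieces (map length Xss) xs;
            qs = map prod_list pss
        in Comp (FOb Z (prod_list qs))
             (\<theta> qs (tab (length Ys) (\<lambda>i. FOb (fst (snd (ts ! i)) (pss ! i)) (xss ! i))))
             (FAr (F qs) (tab (length Ys) (\<lambda>i. snd (snd (ts ! i)) (pss ! i) (xss ! i))))))"

definition GammaCat :: "(('o, 'm) gcat, ('o, 'm) gop, ('o, 'm) gop_arr) multicat" where
  "GammaCat = \<lparr>MObj = {X. gamma_category X}, MOps = gamma_ops, MUnit = gamma_unit,
               MCompOb = gamma_compOb, MCompAr = gamma_compAr\<rparr>"


section \<open>Permutative categories\<close>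

record ('o, 'm) permcat = "('o, 'm) cat" +
  TOb :: "'o \<Rightarrow> 'o \<Rightarrow> 'o"
  TAr :: "'m \<Rightarrow> 'm \<Rightarrow> 'm"
  TUnit :: 'o
  Braid :: "'o \<Rightarrow> 'o \<Rightarrow> 'm"

locale permutative = category C for C :: "('o, 'm) permcat" +
  assumes TOb_in: "\<lbrakk>x \<in> Obj C; y \<in> Obj C\<rbrakk> \<Longrightarrow> TOb C x y \<in> Obj C"
    and TAr_in: "\<lbrakk>f \<in> hom C x y; g \<in> hom C x' y'\<rbrakk> \<Longrightarrow> TAr C f g \<in> hom C (TOb C x x') (TOb C y y')"
    and TAr_ident: "\<lbrakk>x \<in> Obj C; y \<in> Obj C\<rbrakk>
      \<Longrightarrow> TAr C (Ident C x) (Ident C y) = Ident C (TOb C x y)"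
    and TAr_comp: "\<lbrakk>f \<in> hom C x y; g \<in> hom C y z; f' \<in> hom C x' y'; g' \<in> hom C y' z'\<rbrakk>
      \<Longrightarrow> TAr C (Comp C g f) (Comp C g' f') = Comp C (TAr C g g') (TAr C f f')"
    and TOb_assoc: "\<lbrakk>x \<in> Obj C; y \<in> Obj C; z \<in> Obj C\<rbrakk>
      \<Longrightarrow> TOb C (TOb C x y) z = TOb C x (TOb C y z)"
    and TAr_assoc: "\<lbrakk>f \<in> Arr C; g \<in> Arr C; h \<in> Arr C\<rbrakk>
      \<Longrightarrow> TAr C (TAr C f g) h = TAr C f (TAr C g h)"
    and TUnit_in: "TUnit C \<in> Obj C"
    and TOb_unit: "x \<in> Obj C \<Longrightarrow> TOb C (TUnit C) x = x \<and> TOb C x (TUnit C) = x"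
    and TAr_unit: "f \<in> Arr C
      \<Longrightarrow> TAr C (Ident C (TUnit C)) f = f \<and> TAr C f (Ident C (TUnit C)) = f"
    and Braid_in: "\<lbrakk>x \<in> Obj C; y \<in> Obj C\<rbrakk> \<Longrightarrow> Braid C x y \<in> hom C (TOb C x y) (TOb C y x)"
    and Braid_natural: "\<lbrakk>f \<in> hom C x y; g \<in> hom C x' y'\<rbrakk>
      \<Longrightarrow> Comp C (Braid C y y') (TAr C f g) = Comp C (TAr C g f) (Braid C x x')"
    and Braid_symmetric: "\<lbrakk>x \<in> Obj C; y \<in> Obj C\<rbrakk>
      \<Longrightarrow> Comp C (Braid C y x) (Braid C x y) = Ident C (TOb C x y)"
    and Braid_unit: "x \<in> Obj C \<Longrightarrow> Braid C x (TUnit C) = Ident C x"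
    and Braid_hexagon: "\<lbrakk>x \<in> Obj C; y \<in> Obj C; z \<in> Obj C\<rbrakk>
      \<Longrightarrow> Braid C x (TOb C y z) =
          Comp C (TAr C (Ident C y) (Braid C x z)) (TAr C (Braid C x y) (Ident C z))"

text \<open>
  A multilinear functor with its constraints: \<open>LC F i xs y\<close> is the \<open>i\<close>-th linearity constraint at
  the tuple \<open>xs\<close>, with \<open>X\<^sub>i = xs ! i\<close> and \<open>X\<^sub>i' = y\<close>. Arity 0 is covered uniformly: a functor on the
  empty product, with no constraints, is an object of the target, and a transformation is an arrow.
\<close>

record ('o, 'm) lin =
  LF :: "('o list, 'm list, 'o, 'm) ftor"
  LC :: "nat \<Rightarrow> 'o list \<Rightarrow> 'o \<Rightarrow> 'm"

definition constraint_dom :: "('o, 'm) permcat list \<Rightarrow> nat \<Rightarrow> 'o list \<Rightarrow> 'o \<Rightarrow> bool" where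
  "constraint_dom Cs i xs y \<longleftrightarrow> i < length Cs \<and> xs \<in> Obj (prod_cat Cs) \<and> y \<in> Obj (Cs ! i)"

locale linear_functor =
  cfunctor "prod_cat Cs" D "LF F" + D: permutative D
  for Cs :: "('o, 'm) permcat list" and D :: "('o, 'm) permcat" and F :: "('o, 'm) lin" +
  assumes permutative_Cs: "C \<in> set Cs \<Longrightarrow> permutative C"
    and LC_ext: "\<not> constraint_dom Cs i xs y \<Longrightarrow> LC F i xs y = undefined"
    and LC_in: "constraint_dom Cs i xs y \<Longrightarrow> LC F i xs y \<in>
      hom D (TOb D (FOb (LF F) xs) (FOb (LF F) (xs[i := y])))
            (FOb (LF F) (xs[i := TOb (Cs ! i) (xs ! i) y]))"
    and LC_natural: "\<lbrakk>i < length Cs; fs \<in> Arr (prod_cat Cs); g \<in> Arr (Cs ! i)\<rbrakk> \<Longrightarrow>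
      Comp D (LC F i (Cod (prod_cat Cs) fs) (Cod (Cs ! i) g))
             (TAr D (FAr (LF F) fs) (FAr (LF F) (fs[i := g]))) =
      Comp D (FAr (LF F) (fs[i := TAr (Cs ! i) (fs ! i) g]))
             (LC F i (Dom (prod_cat Cs) fs) (Dom (Cs ! i) g))"
    and unity_Ob: "\<lbrakk>xs \<in> Obj (prod_cat Cs); j < length Cs; xs ! j = TUnit (Cs ! j)\<rbrakk>
      \<Longrightarrow> FOb (LF F) xs = TUnit D"
    and unity_Ar: "\<lbrakk>fs \<in> Arr (prod_cat Cs); j < length Cs; fs ! j = Ident (Cs ! j) (TUnit (Cs ! j))\<rbrakk>
      \<Longrightarrow> FAr (LF F) fs = Ident D (TUnit D)"
    and constraint_unity: "\<lbrakk>constraint_dom Cs i xs y;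
        (\<exists>j<length Cs. xs ! j = TUnit (Cs ! j)) \<or> y = TUnit (Cs ! i)\<rbrakk>
      \<Longrightarrow> LC F i xs y = Ident D (TOb D (FOb (LF F) xs) (FOb (LF F) (xs[i := y])))"
    and associativity: "\<lbrakk>constraint_dom Cs i xs y; z \<in> Obj (Cs ! i)\<rbrakk> \<Longrightarrow>
      Comp D (LC F i (xs[i := TOb (Cs ! i) (xs ! i) y]) z)
             (TAr D (LC F i xs y) (Ident D (FOb (LF F) (xs[i := z])))) =
      Comp D (LC F i xs (TOb (Cs ! i) y z))
             (TAr D (Ident D (FOb (LF F) xs)) (LC F i (xs[i := y]) z))"
    and symmetry: "constraint_dom Cs i xs y \<Longrightarrow>
      Comp D (FAr (LF F) ((Ident (prod_cat Cs) xs)[i := Braid (Cs ! i) (xs ! i) y])) (LC F i xs y) =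
      Comp D (LC F i (xs[i := y]) (xs ! i)) (Braid D (FOb (LF F) xs) (FOb (LF F) (xs[i := y])))"
    and two_by_two: "\<lbrakk>constraint_dom Cs i xs y; constraint_dom Cs k xs z; i \<noteq> k\<rbrakk> \<Longrightarrow>
      Comp D (LC F k (xs[i := TOb (Cs ! i) (xs ! i) y]) z)
             (TAr D (LC F i xs y) (LC F i (xs[k := z]) y)) =
      Comp D (LC F i (xs[k := TOb (Cs ! k) (xs ! k) z]) y)
        (Comp D (TAr D (LC F k xs z) (LC F k (xs[i := y]) z))
          (TAr D (Ident D (FOb (LF F) xs))
            (TAr D (Braid D (FOb (LF F) (xs[i := y])) (FOb (LF F) (xs[k := z])))
                   (Ident D (FOb (LF F) (xs[i := y, k := z]))))))"

definition strong_linear :: "('o, 'm) permcat list \<Rightarrow> ('o, 'm) permcat \<Rightarrow> ('o, 'm) lin \<Rightarrow> bool" where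
  "strong_linear Cs D F \<longleftrightarrow> linear_functor Cs D F \<and>
     (\<forall>i xs y. constraint_dom Cs i xs y \<longrightarrow> is_iso D (LC F i xs y))"

definition linear_trans :: "('o, 'm) permcat list \<Rightarrow> ('o, 'm) permcat \<Rightarrow> ('o, 'm) lin \<Rightarrow> ('o, 'm) lin
    \<Rightarrow> ('o list \<Rightarrow> 'm) \<Rightarrow> bool" where
  "linear_trans Cs D F G \<alpha> \<longleftrightarrow>
     nat_trans (prod_cat Cs) D (LF F) (LF G) \<alpha> \<and>
     (\<forall>i xs y. constraint_dom Cs i xs y \<longrightarrow>
        Comp D (\<alpha> (xs[i := TOb (Cs ! i) (xs ! i) y])) (LC F i xs y) =
        Comp D (LC G i xs y) (TAr D (\<alpha> xs) (\<alpha> (xs[i := y])))) \<and>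
     (\<forall>xs\<in>Obj (prod_cat Cs). (\<exists>i<length Cs. xs ! i = TUnit (Cs ! i)) \<longrightarrow>
        \<alpha> xs = Ident D (FOb (LF F) xs))"

type_synonym ('o, 'm) lin_arr = "('o, 'm) lin \<times> ('o, 'm) lin \<times> ('o list \<Rightarrow> 'm)"

definition perm_ops :: "('o, 'm) permcat list \<Rightarrow> ('o, 'm) permcat
    \<Rightarrow> (('o, 'm) lin, ('o, 'm) lin_arr) cat" where
  "perm_ops Cs D = \<lparr>
     Obj = {F. strong_linear Cs D F},
     Arr = {(F, G, \<alpha>). strong_linear Cs D F \<and> strong_linear Cs D G \<and> linear_trans Cs D F G \<alpha>},
     Dom = (\<lambda>(F, G, \<alpha>). F),
     Cod = (\<lambda>(F, G, \<alpha>). G),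
     Ident = (\<lambda>F. (F, F, \<lambda>xs\<in>Obj (prod_cat Cs). Ident D (FOb (LF F) xs))),
     Comp = (\<lambda>(F', H, \<beta>) (F, G, \<alpha>). (F, H, \<lambda>xs\<in>Obj (prod_cat Cs). Comp D (\<beta> xs) (\<alpha> xs)))\<rparr>"

definition perm_unit :: "('o, 'm) permcat \<Rightarrow> ('o, 'm) lin" where
  "perm_unit C = \<lparr>
     LF = \<lparr>FOb = (\<lambda>xs\<in>Obj (prod_cat [C]). hd xs), FAr = (\<lambda>fs\<in>Arr (prod_cat [C]). hd fs)\<rparr>,
     LC = (\<lambda>i xs y. if constraint_dom [C] i xs y then Ident C (TOb C (hd xs) y) else undefined)\<rparr>"

definition perm_compOb :: "('o, 'm) permcat list list \<Rightarrow> ('o, 'm) permcat list \<Rightarrow> ('o, 'm) permcat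
    \<Rightarrow> ('o, 'm) lin \<Rightarrow> ('o, 'm) lin list \<Rightarrow> ('o, 'm) lin" where
  "perm_compOb Css Ds E F Fs = \<lparr>
     LF = \<lparr>
       FOb = (\<lambda>xs\<in>Obj (prod_cat (concat Css)). FOb (LF F)
                (tab (length Ds) (\<lambda>i. FOb (LF (Fs ! i)) (pieces (map length Css) xs ! i)))),
       FAr = (\<lambda>fs\<in>Arr (prod_cat (concat Css)). FAr (LF F)
                (tab (length Ds) (\<lambda>i. FAr (LF (Fs ! i)) (pieces (map length Css) fs ! i))))\<rparr>,
     LC = (\<lambda>l xs y. if constraint_dom (concat Css) l xs y then
             let (i, j) = locate (map length Css) l;
                 xss = pieces (map length Css) xs;
                 zs = tab (length Ds) (\<lambda>h. FOb (LF (Fs ! h)) (xss ! h))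
             in Comp E
                  (FAr (LF F) ((Ident (prod_cat Ds) zs)[i := LC (Fs ! i) j (xss ! i) y]))
                  (LC F i zs (FOb (LF (Fs ! i)) ((xss ! i)[j := y])))
           else undefined)\<rparr>"

definition perm_compAr :: "('o, 'm) permcat list list \<Rightarrow> ('o, 'm) permcat list \<Rightarrow> ('o, 'm) permcat
    \<Rightarrow> ('o, 'm) lin_arr \<Rightarrow> ('o, 'm) lin_arr list \<Rightarrow> ('o, 'm) lin_arr" where
  "perm_compAr Css Ds E = (\<lambda>(F, G, \<alpha>) ts.
     (perm_compOb Css Ds E F (map fst ts),
      perm_compOb Css Ds E G (map (fst \<circ> snd) ts),
      \<lambda>xs\<in>Obj (prod_cat (concat Css)).
        let xss = pieces (map length Css) xs
        in Comp E (\<alpha> (tab (length Ds) (\<lambda>i. FOb (LF (fst (snd (ts ! i)))) (xss ! i))))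
                  (FAr (LF F) (tab (length Ds) (\<lambda>i. snd (snd (ts ! i)) (xss ! i))))))"

definition PermCatSus :: "(('o, 'm) permcat, ('o, 'm) lin, ('o, 'm) lin_arr) multicat" where
  "PermCatSus = \<lparr>MObj = {C. permutative C}, MOps = perm_ops, MUnit = perm_unit,
                 MCompOb = perm_compOb, MCompAr = perm_compAr\<rparr>"


section \<open>Inverse K-theory on objects\<close>

text \<open>\<open>blocks m\<close> is the disjoint union of the sets \<open>{1..m ! i}\<close>, as a set of pairs \<open>(i, a)\<close>.\<close>

definition blocks :: "nat list \<Rightarrow> (nat \<times> nat) set" where
  "blocks m = (SIGMA i:{..<length m}. {1..m ! i})"

type_synonym Aarr = "nat list \<times> nat list \<times> (nat \<times> nat \<Rightarrow> nat \<times> nat)"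

definition preim :: "nat list \<Rightarrow> (nat \<times> nat \<Rightarrow> nat \<times> nat) \<Rightarrow> nat \<Rightarrow> (nat \<times> nat) set" where
  "preim m \<phi> j = {u \<in> blocks m. fst (\<phi> u) = j}"

definition Acat :: "(nat list, Aarr) cat" where
  "Acat = \<lparr>
     Obj = {m. \<forall>a\<in>set m. 0 < a},
     Arr = {(m, n, \<phi>). (\<forall>a\<in>set m. 0 < a) \<and> (\<forall>a\<in>set n. 0 < a) \<and> \<phi> \<in> blocks m \<rightarrow>\<^sub>E blocks n \<and>
              (\<forall>j<length n. preim m \<phi> j = {} \<or> (\<exists>i<length m. preim m \<phi> j \<subseteq> {i} \<times> {1..m ! i}))},
     Dom = (\<lambda>(m, n, \<phi>). m),
     Cod = (\<lambda>(m, n, \<phi>). n),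
     Ident = (\<lambda>m. (m, m, \<lambda>u\<in>blocks m. u)),
     Comp = (\<lambda>(m', n', \<psi>) (m, n, \<phi>). (m, n', compose (blocks m) \<psi> \<phi>))\<rparr>"

text \<open>The block \<open>i\<close> containing the preimage of the \<open>j\<close>-th block (if nonempty), and \<open>\<phi>\<^sub>i\<^sub>j\<close>.\<close>

definition src_block :: "nat list \<Rightarrow> (nat \<times> nat \<Rightarrow> nat \<times> nat) \<Rightarrow> nat \<Rightarrow> nat" where
  "src_block m \<phi> j = (THE i. i < length m \<and> preim m \<phi> j \<subseteq> {i} \<times> {1..m ! i})"

definition block_map :: "nat list \<Rightarrow> (nat \<times> nat \<Rightarrow> nat \<times> nat) \<Rightarrow> nat \<Rightarrow> nat \<Rightarrow> nat \<Rightarrow> nat" where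
  "block_map m \<phi> i j = (\<lambda>a\<in>{0..m ! i}. if (i, a) \<in> preim m \<phi> j then snd (\<phi> (i, a)) else 0)"

definition AXob :: "('o, 'm) gcat \<Rightarrow> nat list \<Rightarrow> ('o list, 'm list) cat" where
  "AXob X m = prod_cat (map (FOb X) m)"

definition AXact :: "('o, 'm) gcat \<Rightarrow> Aarr \<Rightarrow> ('o list, 'm list, 'o list, 'm list) ftor" where
  "AXact X = (\<lambda>(m, n, \<phi>).
     let coord = (\<lambda>j. act X (m ! src_block m \<phi> j, n ! j, block_map m \<phi> (src_block m \<phi> j) j)) in
     \<lparr>FOb = (\<lambda>xs\<in>Obj (AXob X m). tab (length n) (\<lambda>j.
               if preim m \<phi> j = {} then basept X (n ! j)
               else FOb (coord j) (xs ! src_block m \<phi> j))),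
      FAr = (\<lambda>fs\<in>Arr (AXob X m). tab (length n) (\<lambda>j.
               if preim m \<phi> j = {} then Ident (FOb X (n ! j)) (basept X (n ! j))
               else FAr (coord j) (fs ! src_block m \<phi> j)))\<rparr>)"

definition AX :: "('o, 'm) gcat
    \<Rightarrow> (nat list, Aarr, ('o list, 'm list) cat, ('o list, 'm list) cat_arr) ftor" where
  "AX X = \<lparr>FOb = (\<lambda>m\<in>Obj Acat. AXob X m),
           FAr = (\<lambda>u\<in>Arr Acat. (AXob X (Dom Acat u), AXob X (Cod Acat u), AXact X u))\<rparr>"

type_synonym 'o pob = "nat list \<times> 'o list"
type_synonym ('o, 'm) par = "(nat list, Aarr, 'o list, 'm list) groth_arr"

definition sum_map :: "nat list \<Rightarrow> nat list \<Rightarrow> nat list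
    \<Rightarrow> (nat \<times> nat \<Rightarrow> nat \<times> nat) \<Rightarrow> (nat \<times> nat \<Rightarrow> nat \<times> nat) \<Rightarrow> nat \<times> nat \<Rightarrow> nat \<times> nat" where
  "sum_map m n m' \<phi> \<psi> = (\<lambda>(i, a)\<in>blocks (m @ m').
     if i < length m then \<phi> (i, a) else apfst ((+) (length n)) (\<psi> (i - length m, a)))"

definition block_swap :: "nat list \<Rightarrow> nat list \<Rightarrow> nat \<times> nat \<Rightarrow> nat \<times> nat" where
  "block_swap m n = (\<lambda>(i, a)\<in>blocks (m @ n).
     if i < length m then (length n + i, a) else (i - length m, a))"

definition Pobj :: "('o, 'm) gcat \<Rightarrow> ('o pob, ('o, 'm) par) permcat" where
  "Pobj X = (let G = groth Acat (AX X) in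
     \<lparr>Obj = Obj G, Arr = Arr G, Dom = Dom G, Cod = Cod G, Ident = Ident G, Comp = Comp G,
      TOb = (\<lambda>(m, x) (n, y). (m @ n, x @ y)),
      TAr = (\<lambda>((m, x), (n, y), ((_, _, \<phi>), f)) ((m', x'), (n', y'), ((_, _, \<psi>), g)).
               ((m @ m', x @ x'), (n @ n', y @ y'),
                ((m @ m', n @ n', sum_map m n m' \<phi> \<psi>), f @ g))),
      TUnit = ([], []),
      Braid = (\<lambda>(m, x) (n, y). ((m @ n, x @ y), (n @ m, y @ x),
                 ((m @ n, n @ m, block_swap m n), Ident (AXob X (n @ m)) (y @ x))))\<rparr>)"


section \<open>Inverse K-theory on operations\<close>

text \<open>
  \<open>tuples [r\<^sub>1, \<dots>, r\<^sub>k]\<close> lists the tuples \<open>[j\<^sub>1, \<dots>, j\<^sub>k]\<close> with \<open>j\<^sub>i < r\<^sub>i\<close> in reverse lexicographic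
  order: \<open>j\<^sub>k\<close> is compared first, and \<open>j\<^sub>1\<close> varies fastest.
\<close>

fun tuples :: "nat list \<Rightarrow> nat list list" where
  "tuples [] = [[]]"
| "tuples (r # rs) = concat (map (\<lambda>js. map (\<lambda>j. j # js) [0..<r]) (tuples rs))"

definition pos :: "'a list \<Rightarrow> 'a \<Rightarrow> nat" where
  "pos ts = the_inv_into {..<length ts} ((!) ts)"

definition pick :: "'a list list \<Rightarrow> nat list \<Rightarrow> 'a list" where
  "pick ms js = map2 (!) ms js"

abbreviation indices :: "nat list list \<Rightarrow> nat list list" where
  "indices ms \<equiv> tuples (map length ms)"

definition multi_seq :: "nat list list \<Rightarrow> nat list" where
  "multi_seq ms = map (\<lambda>js. prod_list (pick ms js)) (indices ms)"

definition multi_val :: "('o, 'm) gop \<Rightarrow> nat list list \<Rightarrow> 'o list list \<Rightarrow> 'o list" where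
  "multi_val F ms xs = map (\<lambda>js. FOb (F (pick ms js)) (pick xs js)) (indices ms)"

definition multi_map :: "nat list list \<Rightarrow> nat list list \<Rightarrow> (nat \<times> nat \<Rightarrow> nat \<times> nat) list
    \<Rightarrow> nat \<times> nat \<Rightarrow> nat \<times> nat" where
  "multi_map ms ns \<phi>s = (\<lambda>(q, a)\<in>blocks (multi_seq ms).
     let js = indices ms ! q;
         as = lex_inv (pick ms js) a;
         us = tab (length ms) (\<lambda>i. (\<phi>s ! i) (js ! i, as ! i));
         ls = map fst us
     in (pos (indices ns) ls, lex_pos (pick ns ls) (map snd us)))"

definition PopOb :: "('o, 'm) gop \<Rightarrow> 'o pob list \<Rightarrow> 'o pob" where
  "PopOb F obs = (multi_seq (map fst obs), multi_val F (map fst obs) (map snd obs))"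

definition PopAr :: "('o, 'm) gop \<Rightarrow> ('o, 'm) par list \<Rightarrow> ('o, 'm) par" where
  "PopAr F gs = (let
       ss = map fst gs; ts = map (fst \<circ> snd) gs;
       \<phi>s = map (\<lambda>(s, t, ((m, n, \<phi>), f)). \<phi>) gs; fs = map (\<lambda>(s, t, (u, f)). f) gs;
       ms = map fst ss; ns = map fst ts
     in (PopOb F ss, PopOb F ts,
         ((multi_seq ms, multi_seq ns, multi_map ms ns \<phi>s),
          map (\<lambda>ls. FAr (F (pick ns ls)) (pick fs ls)) (indices ns))))"

text \<open>
  The permutation of blocks from the \<open>m\<close>-sequence of \<open>ms\<close> followed by that of \<open>ms[b := m']\<close> to that
  of \<open>ms[b := ms ! b @ m']\<close>.
\<close>

definition sigma_map :: "nat list list \<Rightarrow> nat \<Rightarrow> nat list \<Rightarrow> nat \<times> nat \<Rightarrow> nat \<times> nat" where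
  "sigma_map ms b m' = (let
       ms1 = ms[b := m']; ms2 = ms[b := ms ! b @ m']; R = length (indices ms)
     in (\<lambda>(q, a)\<in>blocks (multi_seq ms @ multi_seq ms1).
       if q < R then (pos (indices ms2) (indices ms ! q), a)
       else let js = indices ms1 ! (q - R)
            in (pos (indices ms2) (js[b := length (ms ! b) + js ! b]), a)))"

definition PopC :: "('o, 'm) gcat \<Rightarrow> ('o, 'm) gop \<Rightarrow> nat \<Rightarrow> 'o pob list \<Rightarrow> 'o pob \<Rightarrow> ('o, 'm) par" where
  "PopC Z F b obs ob = (let
       ms = map fst obs;
       (m, x) = PopOb F obs; (m', x') = PopOb F (obs[b := ob]);
       (n, y) = PopOb F (obs[b := (fst (obs ! b) @ fst ob, snd (obs ! b) @ snd ob)])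
     in ((m @ m', x @ x'), (n, y), ((m @ m', n, sigma_map ms b (fst ob)), Ident (AXob Z n) y)))"

definition Pop :: "('o, 'm) gcat list \<Rightarrow> ('o, 'm) gcat \<Rightarrow> ('o, 'm) gop \<Rightarrow> ('o pob, ('o, 'm) par) lin" where
  "Pop Xs Z F = \<lparr>
     LF = \<lparr>FOb = (\<lambda>obs\<in>Obj (prod_cat (map Pobj Xs)). PopOb F obs),
           FAr = (\<lambda>gs\<in>Arr (prod_cat (map Pobj Xs)). PopAr F gs)\<rparr>,
     LC = (\<lambda>b obs ob. if constraint_dom (map Pobj Xs) b obs ob then PopC Z F b obs ob
                      else undefined)\<rparr>"

definition Pmod :: "('o, 'm) gcat list \<Rightarrow> ('o, 'm) gcat \<Rightarrow> ('o, 'm) gop_arr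
    \<Rightarrow> ('o pob, ('o, 'm) par) lin_arr" where
  "Pmod Xs Z = (\<lambda>(F, G, \<theta>). (Pop Xs Z F, Pop Xs Z G,
     \<lambda>obs\<in>Obj (prod_cat (map Pobj Xs)).
       let ms = map fst obs; xs = map snd obs
       in (PopOb F obs, PopOb G obs,
           (Ident Acat (multi_seq ms),
            map (\<lambda>js. \<theta> (pick ms js) (pick xs js)) (indices ms)))))"

definition inverse_K :: "(('o, 'm) gcat, ('o, 'm) gop, ('o, 'm) gop_arr,
    ('o pob, ('o, 'm) par) permcat, ('o pob, ('o, 'm) par) lin, ('o pob, ('o, 'm) par) lin_arr) multiftor" where
  "inverse_K = \<lparr>
     MFOb = Pobj,
     MFOps = (\<lambda>Xs Z. \<lparr>FOb = (\<lambda>F\<in>Obj (gamma_ops Xs Z). Pop Xs Z F),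
                      FAr = (\<lambda>t\<in>Arr (gamma_ops Xs Z). Pmod Xs Z t)\<rparr>)\<rparr>"

end

theory Submission
  imports Defs
begin

text \<open>
  An arrow of \<open>\<P> X\<close> is determined by its map of blocks and by its component in \<open>(AX)(n)\<close>, and every
  identity to be proved splits accordingly. The maps of blocks do not depend on the operation: on
  the elements \<open>en ms us\<close> that enumerate the blocks of a product sequence they act as tuples of maps,
  so identities between them are checked entry by entry. The components of operations and of
  modifications are natural families of pointed maps, and applying such a family entrywise to
  sequences commutes with the action of \<open>\<A>\<close>. The structural arrows (linearity constraints and
  braidings) are pure, that is, have identity components, so an equation between composites of these
  reduces to one between maps of blocks. A linearity constraint is invertible because its map of
  blocks permutes the blocks and is the identity on each of them.
\<close>

section \<open>Lists cut into pieces\<close>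

text \<open>Three features of the definitions carry the argument. First, \<open>AX X\<close> is a
  functor because \<open>FOb X 0\<close> is terminal: a composite in \<open>Acat\<close> can miss a
  block although each factor hits the block that it should. Pushing forward along the composite then
  gives the basepoint, while pushing forward in two steps applies a zero map; the two agree because
  zero maps factor through degree 0. The analogous case for operations, a product block missed
  because one coordinate is missed, is what pointedness of operations settles. Second, entries of
  objects of \<open>Acat\<close> are positive, so every block has an element and statements about
  blocks can be tested on elements. Third, composition is preserved on the nose because two
  different orders are both strictly associative: the reverse lexicographic order of the blocks and
  the lexicographic order inside a block. The enumeration \<open>en\<close> joins them, and
  \<open>en_concat\<close> states both associativities at once.\<close>

lemma pieces_concat [simp]: "pieces (map length xss) (concat xss) = xss"
  by (induction xss) auto

lemma pieces_concat': "map length xss = ns \<Longrightarrow> pieces ns (concat xss) = xss"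
  by auto

lemma concat_pieces: "length xs = sum_list ns \<Longrightarrow> concat (pieces ns xs) = xs"
  by (induction ns arbitrary: xs) auto

lemma map_length_pieces: "length xs = sum_list ns \<Longrightarrow> map length (pieces ns xs) = ns"
  by (induction ns arbitrary: xs) auto

text \<open>Composites are defined with \<open>pieces\<close>, but their properties are proved for
  arguments written as \<open>concat xss\<close> with pieces of prescribed lengths. This rule brings
  an arbitrary argument into that form.\<close>

lemma concatE:
  assumes "length xs = length (concat yss)"
  obtains xss where "xs = concat xss" "map length xss = map length yss"
proof
  have "length xs = sum_list (map length yss)"
    using assms by (simp add: length_concat)
  then show "xs = concat (pieces (map length yss) xs)"
    "map length (pieces (map length yss) xs) = map length yss"
    by (simp_all add: concat_pieces map_length_pieces)
qed

lemma map_length_eqD: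
  assumes "map length xss = map length yss"
  shows "length xss = length yss" "i < length yss \<Longrightarrow> length (xss ! i) = length (yss ! i)"
    "length (concat xss) = length (concat yss)"
  using map_eq_imp_length_eq[OF assms] arg_cong[OF assms, of "\<lambda>ns. ns ! i"] arg_cong[OF assms, of sum_list]
  by (simp_all add: length_concat)

lemma map_length_eqI:
  "\<lbrakk>length xss = length yss; \<And>i. i < length yss \<Longrightarrow> length (xss ! i) = length (yss ! i)\<rbrakk>
    \<Longrightarrow> map length xss = map length yss"
  by (simp add: list_eq_iff_nth_eq)

lemma locate_bounds:
  "\<lbrakk>l < length (concat xss); locate (map length xss) l = (i, j)\<rbrakk>
    \<Longrightarrow> i < length xss \<and> j < length (xss ! i)"
proof (induction xss arbitrary: l i)
  case (Cons xs xss)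
  show ?case
  proof (cases "l < length xs")
    case False
    then obtain i' where "locate (map length xss) (l - length xs) = (i', j)" "i = Suc i'"
      using Cons.prems by (auto simp: apfst_def map_prod_def split: prod.splits)
    with Cons.IH[of "l - length xs" i'] Cons.prems False show ?thesis by auto
  qed (use Cons in auto)
qed simp

lemma locate_nth:
  "\<lbrakk>l < length (concat xss); locate (map length xss) l = (i, j)\<rbrakk> \<Longrightarrow> concat xss ! l = xss ! i ! j"
  by (induction xss arbitrary: l i)
    (auto split: if_splits simp: apfst_def map_prod_def nth_append split: prod.splits)

lemma locate_update:
  "\<lbrakk>l < length (concat xss); locate (map length xss) l = (i, j)\<rbrakk>
    \<Longrightarrow> (concat xss)[l := y] = concat (xss[i := (xss ! i)[j := y]])"
  by (induction xss arbitrary: l i)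
    (auto split: if_splits simp: apfst_def map_prod_def list_update_append split: prod.splits)

text \<open>\<open>locate\<close> depends only on the lengths of the pieces. Hence the pair
  \<open>(i, j)\<close> computed from \<open>yss\<close> addresses the corresponding entry in every
  list of lists of the same shape: inputs, objects, arrows or block elements.\<close>

lemma concat_cong_locate:
  assumes "map length xss = map length yss" "l < length (concat yss)"
    "locate (map length yss) l = (i, j)"
  shows "i < length xss" "j < length (xss ! i)" "concat xss ! l = xss ! i ! j"
    "(concat xss)[l := y] = concat (xss[i := (xss ! i)[j := y]])"
  using assms locate_bounds[of l xss i j] locate_nth[of l xss i j] locate_update[of l xss i j]
    map_length_eqD(3)[OF assms(1)] by simp_all

lemma locate_surj:
  "\<lbrakk>i < length xss; j < length (xss ! i)\<rbrakk> \<Longrightarrow> \<exists>l<length (concat xss). locate (map length xss) l = (i, j)"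
proof (induction xss arbitrary: i)
  case (Cons xs xss)
  show ?case
  proof (cases i)
    case 0
    then show ?thesis using Cons.prems by (intro exI[of _ j]) simp
  next
    case (Suc i')
    then obtain l where "l < length (concat xss)" "locate (map length xss) l = (i', j)"
      using Cons by auto
    then show ?thesis using Suc by (intro exI[of _ "length xs + l"]) simp
  qed
qed simp

text \<open>Four lists are compared at once because the typical condition relates an arrow, its
  source, its category and its target. For conditions on fewer lists an argument is
  repeated.\<close>

lemma all_concat_iff:
  assumes "map length wss = map length yss" "map length xss = map length yss" "map length zss = map length yss"
  shows "(\<forall>l<length (concat yss). P (concat wss ! l) (concat xss ! l) (concat yss ! l) (concat zss ! l)) \<longleftrightarrow>
    (\<forall>i<length yss. \<forall>j<length (yss ! i). P (wss ! i ! j) (xss ! i ! j) (yss ! i ! j) (zss ! i ! j))"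
proof -
  have *: "P (concat wss ! l) (concat xss ! l) (concat yss ! l) (concat zss ! l) \<longleftrightarrow>
      P (wss ! i ! j) (xss ! i ! j) (yss ! i ! j) (zss ! i ! j)"
    if l: "l < length (concat yss)" "locate (map length yss) l = (i, j)" for l i j
    by (simp only: concat_cong_locate(3)[OF assms(1) l] concat_cong_locate(3)[OF assms(2) l]
        concat_cong_locate(3)[OF refl l] concat_cong_locate(3)[OF assms(3) l])
  show ?thesis
  proof (intro iffI allI impI)
    fix i j
    assume a: "\<forall>l<length (concat yss). P (concat wss ! l) (concat xss ! l) (concat yss ! l) (concat zss ! l)"
      and ij: "i < length yss" "j < length (yss ! i)"
    obtain l where l: "l < length (concat yss)" "locate (map length yss) l = (i, j)"
      using locate_surj[OF ij] by blast
    then show "P (wss ! i ! j) (xss ! i ! j) (yss ! i ! j) (zss ! i ! j)"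
      using a *[OF l] by blast
  next
    fix l
    assume a: "\<forall>i<length yss. \<forall>j<length (yss ! i). P (wss ! i ! j) (xss ! i ! j) (yss ! i ! j) (zss ! i ! j)"
      and l: "l < length (concat yss)"
    obtain i j where ij: "locate (map length yss) l = (i, j)" by fastforce
    show "P (concat wss ! l) (concat xss ! l) (concat yss ! l) (concat zss ! l)"
      using a *[OF l ij] concat_cong_locate(1,2)[OF refl l ij] by blast
  qed
qed

lemma map2_concat:
  "map length xss = map length yss
    \<Longrightarrow> map2 f (concat xss) (concat yss) = concat (map2 (map2 f) xss yss)"
proof (induction xss arbitrary: yss)
  case (Cons xs xss)
  then show ?case by (cases yss) auto
qed simp

section \<open>Tuples of positions\<close>

lemma set_tuples: "set (tuples rs) = {js. list_all2 (<) js rs}"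
  by (induction rs) (auto simp: list_all2_Cons2)

lemma mem_tuples: "js \<in> set (tuples rs) \<longleftrightarrow> length js = length rs \<and> (\<forall>i<length rs. js ! i < rs ! i)"
  by (auto simp: set_tuples list_all2_conv_all_nth)

lemma distinct_tuples [simp]: "distinct (tuples rs)"
proof (induction rs)
  case (Cons r rs)
  have "distinct (concat (map (\<lambda>js. map (\<lambda>j. j # js) [0..<r]) tss))" if "distinct tss" for tss :: "nat list list"
    using that by (induction tss) (auto simp: distinct_map inj_on_def)
  with Cons show ?case by simp
qed simp

text \<open>Earlier coordinates vary faster in \<open>tuples\<close>, so the tuples over
  \<open>rs\<close> run through completely for each tuple over \<open>ss\<close>, which makes
  \<open>ss\<close> the outer loop.\<close>

lemma tuples_append: "tuples (rs @ ss) = concat (map (\<lambda>ks. map (\<lambda>js. js @ ks) (tuples rs)) (tuples ss))"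
proof (induction rs)
  case (Cons r rs)
  have "concat (map f (concat (map g xs))) = concat (map (\<lambda>x. concat (map f (g x))) xs)"
    for f :: "nat list \<Rightarrow> nat list list" and g and xs :: "nat list list"
    by (induction xs) auto
  then show ?case
    by (simp add: Cons map_concat[where f = "\<lambda>js. js @ _"] comp_def)
qed (simp add: map_concat[symmetric])

text \<open>Reverse lexicographic order is strictly associative. Replacing each inner tuple by its
  position and listing the resulting outer tuples \<open>Js\<close> produces the concatenated tuples
  in their own order, so no permutation of blocks arises when operations are composed.\<close>

lemma tuples_concat:
  "tuples (concat rss) =
    map (\<lambda>Js. concat (map2 (\<lambda>rs J. tuples rs ! J) rss Js)) (tuples (map (length \<circ> tuples) rss))"
proof (induction rss)
  case (Cons rs rss)
  let ?T = "tuples (map (length \<circ> tuples) rss)"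
  let ?c = "\<lambda>Js. concat (map2 (\<lambda>rs J. tuples rs ! J) rss Js)"
  have eq: "map g (tuples rs) = map (\<lambda>J. g (tuples rs ! J)) [0..<length (tuples rs)]"
    for g :: "nat list \<Rightarrow> nat list"
    by (rule nth_equalityI) simp_all
  have "tuples (concat (rs # rss)) = concat (map (\<lambda>Js. map (\<lambda>js. js @ ?c Js) (tuples rs)) ?T)"
    by (simp only: concat.simps tuples_append Cons map_map comp_def)
  also have "\<dots> = concat (map (\<lambda>Js. map (\<lambda>J. tuples rs ! J @ ?c Js) [0..<length (tuples rs)]) ?T)"
    by (subst eq) (rule refl)
  finally show ?case
    by (simp add: map_concat comp_def)
qed simp

lemma length_multi_seq [simp]: "length (multi_seq ms) = length (indices ms)"
  by (simp add: multi_seq_def)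

lemma indices_concat:
  "indices (concat mss) =
    map (\<lambda>Js. concat (map2 (\<lambda>ms J. indices ms ! J) mss Js)) (indices (map multi_seq mss))"
proof -
  have "map2 (\<lambda>rs J. tuples rs ! J) (map (map length) mss) Js = map2 (\<lambda>ms J. indices ms ! J) mss Js" for Js
    by (simp add: zip_map1 comp_def case_prod_unfold)
  then show ?thesis
    by (simp add: map_concat tuples_concat comp_def)
qed

lemma pos_eqI: "\<lbrakk>distinct ts; q < length ts; ts ! q = x\<rbrakk> \<Longrightarrow> pos ts x = q"
  unfolding pos_def by (rule the_inv_into_f_eq) (auto simp: inj_on_nth)

lemma pos_less [simp]: "\<lbrakk>distinct ts; x \<in> set ts\<rbrakk> \<Longrightarrow> pos ts x < length ts"
  by (metis in_set_conv_nth pos_eqI)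

lemma nth_pos [simp]: "\<lbrakk>distinct ts; x \<in> set ts\<rbrakk> \<Longrightarrow> ts ! pos ts x = x"
  by (metis in_set_conv_nth pos_eqI)

lemma pos_eq_iff: "\<lbrakk>distinct ts; x \<in> set ts; y \<in> set ts\<rbrakk> \<Longrightarrow> pos ts x = pos ts y \<longleftrightarrow> x = y"
  by (metis nth_pos)

lemma length_pick [simp]: "length (pick ms js) = min (length ms) (length js)"
  by (simp add: pick_def)

lemma nth_pick [simp]: "\<lbrakk>i < length ms; i < length js\<rbrakk> \<Longrightarrow> pick ms js ! i = ms ! i ! (js ! i)"
  by (simp add: pick_def)

lemma pick_concat: "map length mss = map length jss \<Longrightarrow> pick (concat mss) (concat jss) = concat (map2 pick mss jss)"
  by (simp add: pick_def[abs_def] map2_concat)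

text \<open>By \<open>indices_concat\<close> the positions of the inner tuples form an index tuple
  of the outer list, and this tuple decodes to \<open>concat jss\<close>. It is the block half of
  \<open>en_concat\<close>.\<close>

lemma pos_indices_concat:
  assumes "length jss = length mss" "\<And>i. i < length mss \<Longrightarrow> jss ! i \<in> set (indices (mss ! i))"
  shows "pos (indices (concat mss)) (concat jss) =
    pos (indices (map multi_seq mss)) (map2 (\<lambda>ms js. pos (indices ms) js) mss jss)"
    (is "_ = pos ?I ?Js")
proof (rule pos_eqI)
  have Js: "?Js \<in> set ?I"
    using assms(1) pos_less[OF distinct_tuples assms(2)] by (simp add: mem_tuples)
  then show "pos ?I ?Js < length (indices (concat mss))"
    by (simp add: indices_concat)
  have "map2 (\<lambda>ms J. indices ms ! J) mss ?Js = jss"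
    using assms by (simp add: list_eq_iff_nth_eq)
  then show "indices (concat mss) ! pos ?I ?Js = concat jss"
    using Js by (simp add: indices_concat)
qed simp

section \<open>Lexicographic positions\<close>

lemma points_Nil [simp]: "points [] = {[]}"
  by (auto simp: points_def)

lemma points_Cons [simp]: "a # as \<in> points (p # ps) \<longleftrightarrow> a \<in> {1..p} \<and> as \<in> points ps"
  by (auto simp: points_def nth_Cons' split: if_splits)

lemma points_ConsE:
  assumes "bs \<in> points (p # ps)"
  obtains a as where "bs = a # as" "a \<in> {1..p}" "as \<in> points ps"
  using assms points_Cons by (cases bs) (auto simp: points_def)

lemma lex_pos_in: "as \<in> points ps \<Longrightarrow> lex_pos ps as \<in> {1..prod_list ps}"
proof (induction ps arbitrary: as)
  case (Cons p ps)
  obtain a bs where as: "as = a # bs" "a \<in> {1..p}" "bs \<in> points ps"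
    using Cons.prems by (rule points_ConsE)
  then have "lex_pos ps bs \<le> prod_list ps" "1 \<le> lex_pos ps bs" using Cons.IH by fastforce+
  moreover have "prod_list ps * (a - 1) + prod_list ps = prod_list ps * a"
    using as(2) by (simp add: algebra_simps)
  moreover have "prod_list ps * a \<le> prod_list ps * p" using as(2) by simp
  ultimately have "prod_list ps * (a - 1) + lex_pos ps bs \<le> prod_list ps * p" by linarith
  then show ?case using as \<open>1 \<le> lex_pos ps bs\<close> by (simp add: mult.commute)
qed simp

lemma lex_pos_inj: "inj_on (lex_pos ps) (points ps)"
proof (induction ps)
  case (Cons p ps)
  \<comment> \<open>Lowered by one, a lexicographic position is \<open>prod_list ps\<close> times
    \<open>a - 1\<close> plus \<open>lex_pos ps as - 1\<close>, and the latter is below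
    \<open>prod_list ps\<close>. Quotient and remainder therefore recover both.\<close>
  have split: "(lex_pos (p # ps) (a # as) - 1) div prod_list ps = a - 1"
    "(lex_pos (p # ps) (a # as) - 1) mod prod_list ps = lex_pos ps as - 1"
    if "as \<in> points ps" "a \<ge> 1" for a as
  proof -
    have "1 \<le> lex_pos ps as" "lex_pos ps as - 1 < prod_list ps"
      using lex_pos_in[OF that(1)] by auto
    then have "lex_pos (p # ps) (a # as) - 1 = (lex_pos ps as - 1) + (a - 1) * prod_list ps"
      by (simp add: mult.commute)
    then show "(lex_pos (p # ps) (a # as) - 1) div prod_list ps = a - 1"
      "(lex_pos (p # ps) (a # as) - 1) mod prod_list ps = lex_pos ps as - 1"
      using \<open>lex_pos ps as - 1 < prod_list ps\<close> by simp_all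
  qed
  show ?case
  proof (rule inj_onI)
    fix x y assume xy: "x \<in> points (p # ps)" "y \<in> points (p # ps)" "lex_pos (p # ps) x = lex_pos (p # ps) y"
    obtain a as where x: "x = a # as" "a \<in> {1..p}" "as \<in> points ps" using xy(1) by (rule points_ConsE)
    obtain b bs where y: "y = b # bs" "b \<in> {1..p}" "bs \<in> points ps" using xy(2) by (rule points_ConsE)
    have "a - 1 = b - 1" "lex_pos ps as - 1 = lex_pos ps bs - 1"
      using split[of as a] split[of bs b] x y xy(3) by (metis atLeastAtMost_iff)+
    moreover have "1 \<le> lex_pos ps as" "1 \<le> lex_pos ps bs"
      using lex_pos_in[OF x(3)] lex_pos_in[OF y(3)] by auto
    ultimately have "a = b" "lex_pos ps as = lex_pos ps bs" using x(2) y(2) by auto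
    with Cons x y show "x = y" by (auto dest: inj_onD)
  qed
qed simp

lemma lex_pos_surj: "c \<in> {1..prod_list ps} \<Longrightarrow> \<exists>as\<in>points ps. lex_pos ps as = c"
proof (induction ps arbitrary: c)
  case (Cons p ps)
  let ?N = "prod_list ps"
  have N: "?N > 0" using Cons.prems by (cases "?N = 0") auto
  \<comment> \<open>The preimage of \<open>c\<close> is built from the quotient and the remainder of
    \<open>c - 1\<close>, each raised by one because elements of blocks count from 1.\<close>
  then have "(c - 1) mod ?N + 1 \<in> {1..?N}" using mod_less_divisor[OF N, of "c - 1"] by simp
  then obtain as where as: "as \<in> points ps" "lex_pos ps as = (c - 1) mod ?N + 1" using Cons.IH by blast
  have "(c - 1) div ?N < p"
    using Cons.prems N by (subst div_less_iff_less_mult) auto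
  then have "(c - 1) div ?N + 1 \<in> {1..p}" by simp
  moreover have "?N * ((c - 1) div ?N) + ((c - 1) mod ?N + 1) = c"
    using Cons.prems mult_div_mod_eq[of ?N "c - 1"] by auto
  ultimately show ?case using as by (intro bexI[of _ "((c - 1) div ?N + 1) # as"]) auto
qed simp

lemma lex_inv_lex_pos [simp]: "as \<in> points ps \<Longrightarrow> lex_inv ps (lex_pos ps as) = as"
  by (simp add: lex_inv_def the_inv_into_f_f lex_pos_inj)

lemma lex_posE:
  assumes "1 \<le> c" "c \<le> prod_list ps"
  obtains as where "as \<in> points ps" "c = lex_pos ps as"
  using lex_pos_surj[of c ps] assms by auto

lemma lex_pos_append:
  "\<lbrakk>as \<in> points ps; as' \<in> points ps'\<rbrakk> \<Longrightarrow>
    lex_pos (ps @ ps') (as @ as') = prod_list ps' * (lex_pos ps as - 1) + lex_pos ps' as'"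
proof (induction ps arbitrary: as)
  case (Cons p ps)
  obtain a bs where as: "as = a # bs" "a \<in> {1..p}" "bs \<in> points ps"
    using Cons.prems(1) by (rule points_ConsE)
  have "1 \<le> lex_pos ps bs" using lex_pos_in[OF as(3)] by simp
  \<comment> \<open>Writing \<open>lex_pos ps bs\<close> as a successor removes the truncated
    subtraction from the identity.\<close>
  then obtain c where "lex_pos ps bs = Suc c" by (cases "lex_pos ps bs") auto
  with as Cons show ?case by (simp add: algebra_simps)
qed simp

lemma prod_list_concat: "prod_list (concat pss) = prod_list (map prod_list pss)"
  by (induction pss) auto

lemma points_append:
  "\<lbrakk>as \<in> points ps; as' \<in> points ps'\<rbrakk> \<Longrightarrow> as @ as' \<in> points (ps @ ps')"
  by (auto simp: points_def nth_append)

text \<open>Strict associativity of the lexicographic identification. Membership and formula are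
  proved together because the inductive step uses \<open>lex_pos_append\<close>, which applies only
  to points.\<close>

lemma lex_pos_concat:
  "\<lbrakk>length ass = length pss; \<forall>i<length pss. ass ! i \<in> points (pss ! i)\<rbrakk> \<Longrightarrow>
    concat ass \<in> points (concat pss) \<and>
    map2 lex_pos pss ass \<in> points (map prod_list pss) \<and>
    lex_pos (concat pss) (concat ass) = lex_pos (map prod_list pss) (map2 lex_pos pss ass)"
proof (induction pss arbitrary: ass)
  case (Cons ps pss)
  then obtain as bss where ass: "ass = as # bss" "length bss = length pss" by (cases ass) auto
  with Cons.prems have "as \<in> points ps" "\<forall>i<length pss. bss ! i \<in> points (pss ! i)" by force+
  with Cons.IH[of bss] ass lex_pos_in[of as ps] show ?case
    by (simp add: lex_pos_append points_append prod_list_concat)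
qed simp

lemma points_concat_iff:
  assumes "map length ass = map length pss"
  shows "concat ass \<in> points (concat pss) \<longleftrightarrow> (\<forall>i<length pss. ass ! i \<in> points (pss ! i))"
proof -
  have "(\<forall>l<length (concat pss). concat ass ! l \<in> {1..concat pss ! l}) \<longleftrightarrow>
      (\<forall>i<length pss. \<forall>j<length (pss ! i). ass ! i ! j \<in> {1..pss ! i ! j})"
    using all_concat_iff[OF assms assms assms, of "\<lambda>a _ p _. a \<in> {1..p}"] .
  then show ?thesis
    using map_length_eqD[OF assms] by (simp add: points_def)
qed

section \<open>Elements of the blocks of a product sequence\<close>

text \<open>
  \<open>en ms\<close> identifies the product of the disjoint unions of the blocks of the sequences in \<open>ms\<close>
  with the disjoint union of the blocks of \<open>multi_seq ms\<close>. Maps between blocks are compared by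
  evaluating them on elements of the form \<open>en ms us\<close>.
\<close>

definition en :: "nat list list \<Rightarrow> (nat \<times> nat) list \<Rightarrow> nat \<times> nat" where
  "en ms us = (pos (indices ms) (map fst us), lex_pos (pick ms (map fst us)) (map snd us))"

definition box :: "nat list list \<Rightarrow> (nat \<times> nat) list set" where
  "box ms = {us. length us = length ms \<and> (\<forall>i<length ms. us ! i \<in> blocks (ms ! i))}"

lemma mem_blocks: "(i, a) \<in> blocks m \<longleftrightarrow> i < length m \<and> 1 \<le> a \<and> a \<le> m ! i"
  by (auto simp: blocks_def)

lemma mem_blocks': "u \<in> blocks m \<longleftrightarrow> fst u < length m \<and> 1 \<le> snd u \<and> snd u \<le> m ! fst u"
  by (cases u) (simp add: mem_blocks)

lemma box_indices: "us \<in> box ms \<Longrightarrow> map fst us \<in> set (indices ms)"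
  by (auto simp: mem_tuples box_def mem_blocks')

lemma box_points: "us \<in> box ms \<Longrightarrow> map snd us \<in> points (pick ms (map fst us))"
  by (auto simp: points_def box_def mem_blocks')

lemma nth_multi_seq: "js \<in> set (indices ms) \<Longrightarrow> multi_seq ms ! pos (indices ms) js = prod_list (pick ms js)"
  by (simp add: multi_seq_def)

lemma en_in: "us \<in> box ms \<Longrightarrow> en ms us \<in> blocks (multi_seq ms)"
  using lex_pos_in[OF box_points] by (fastforce simp: en_def mem_blocks nth_multi_seq box_indices)

lemma fst_en_eq_iff:
  "\<lbrakk>us \<in> box ms; vs \<in> box ms\<rbrakk> \<Longrightarrow> fst (en ms us) = fst (en ms vs) \<longleftrightarrow> map fst us = map fst vs"
  by (simp add: en_def pos_eq_iff box_indices)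

lemma nth_fst_en: "us \<in> box ms \<Longrightarrow> indices ms ! fst (en ms us) = map fst us"
  by (simp add: en_def box_indices)

lemma lex_inv_en: "us \<in> box ms \<Longrightarrow> lex_inv (pick ms (map fst us)) (snd (en ms us)) = map snd us"
  by (simp add: en_def box_points)

lemma en_E:
  assumes "u \<in> blocks (multi_seq ms)"
  obtains us where "us \<in> box ms" "u = en ms us"
proof -
  obtain q a where u: "u = (q, a)" by (cases u)
  define js where "js = indices ms ! q"
  have q: "q < length (indices ms)" "1 \<le> a" "a \<le> prod_list (pick ms js)"
    using assms by (auto simp: u mem_blocks js_def multi_seq_def)
  then obtain as where as: "as \<in> points (pick ms js)" "a = lex_pos (pick ms js) as"
    by (elim lex_posE)
  have js: "js \<in> set (indices ms)" "pos (indices ms) js = q"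
    using q by (auto simp: js_def intro: pos_eqI)
  have len: "length js = length ms" "length as = length ms"
    using js(1) as(1) by (auto simp: mem_tuples points_def)
  show ?thesis
  proof
    show "zip js as \<in> box ms"
      using js(1) as(1) len by (auto simp: box_def mem_blocks points_def mem_tuples)
    show "u = en ms (zip js as)"
      using js as len by (simp add: en_def u)
  qed
qed

text \<open>\<open>multi_map\<close> decodes an element, applies the maps coordinatewise and encodes
  the result. On encoded elements the decoding cancels, so that \<open>lex_inv\<close> need not be
  considered again.\<close>

lemma multi_map_en:
  assumes "us \<in> box ms"
  shows "multi_map ms ns \<phi>s (en ms us) = en ns (tab (length ms) (\<lambda>i. (\<phi>s ! i) (us ! i)))"
proof -
  have len: "length us = length ms" using assms by (simp add: box_def)
  have "tab (length ms) (\<lambda>i. (\<phi>s ! i) (map fst us ! i, map snd us ! i)) = tab (length ms) (\<lambda>i. (\<phi>s ! i) (us ! i))"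
    using len by simp
  then show ?thesis
    using en_in[OF assms] nth_fst_en[OF assms] lex_inv_en[OF assms]
    by (simp only: multi_map_def Let_def case_prod_unfold restrict_apply' en_def[of ns])
qed

lemma box_concat_iff:
  "map length uss = map length mss \<Longrightarrow>
    concat uss \<in> box (concat mss) \<longleftrightarrow> (\<forall>i<length mss. uss ! i \<in> box (mss ! i))"
proof -
  assume *: "map length uss = map length mss"
  note len = map_length_eqD[OF *]
  have "(\<forall>l<length (concat mss). concat uss ! l \<in> blocks (concat mss ! l)) \<longleftrightarrow>
      (\<forall>i<length mss. \<forall>j<length (mss ! i). uss ! i ! j \<in> blocks (mss ! i ! j))"
    using all_concat_iff[OF * * *, of "\<lambda>u _ m _. u \<in> blocks m"] .
  then show ?thesis
    using len by (simp add: box_def)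
qed

text \<open>\<open>pos_indices_concat\<close> compares the blocks and \<open>lex_pos_concat\<close>
  the positions inside a block. Together they make the enumeration strictly associative, which is
  the reason why block maps of composites agree without a comparison isomorphism.\<close>

lemma en_concat:
  assumes "length uss = length mss" "\<And>i. i < length mss \<Longrightarrow> uss ! i \<in> box (mss ! i)"
  shows "map2 en mss uss \<in> box (map multi_seq mss)"
    and "en (concat mss) (concat uss) = en (map multi_seq mss) (map2 en mss uss)"
proof -
  let ?jss = "map (map fst) uss" and ?ass = "map (map snd) uss"
  show box: "map2 en mss uss \<in> box (map multi_seq mss)"
    using assms by (simp add: box_def en_in)
  have len: "length (uss ! i) = length (mss ! i)" if "i < length mss" for i
    using assms(2)[OF that] by (simp add: box_def)
  have ml: "map length mss = map length ?jss"
    using assms(1) len by (intro map_length_eqI) auto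
  have pts: "\<forall>i<length (map2 pick mss ?jss). ?ass ! i \<in> points (map2 pick mss ?jss ! i)"
    using assms by (simp add: box_points)
  have "map2 (\<lambda>ms js. pos (indices ms) js) mss ?jss = map fst (map2 en mss uss)"
    using assms(1) by (simp add: list_eq_iff_nth_eq en_def)
  then have "pos (indices (concat mss)) (concat ?jss) = pos (indices (map multi_seq mss)) (map fst (map2 en mss uss))"
    using assms pos_indices_concat[of ?jss mss] by (simp add: box_indices del: map_map)
  moreover have "pick (map multi_seq mss) (map fst (map2 en mss uss)) = map prod_list (map2 pick mss ?jss)"
    using assms by (simp add: list_eq_iff_nth_eq en_def nth_multi_seq box_indices)
  moreover have "map snd (map2 en mss uss) = map2 lex_pos (map2 pick mss ?jss) ?ass"
    using assms(1) by (simp add: list_eq_iff_nth_eq en_def)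
  moreover have "lex_pos (concat (map2 pick mss ?jss)) (concat ?ass) =
      lex_pos (map prod_list (map2 pick mss ?jss)) (map2 lex_pos (map2 pick mss ?jss) ?ass)"
    using lex_pos_concat[OF _ pts] assms(1) by simp
  ultimately show "en (concat mss) (concat uss) = en (map multi_seq mss) (map2 en mss uss)"
    using pick_concat[OF ml] unfolding en_def map_concat by simp
qed

section \<open>Reindexing along a linearity constraint\<close>

abbreviation sh :: "nat \<Rightarrow> nat \<times> nat \<Rightarrow> nat \<times> nat" where
  "sh d \<equiv> apfst ((+) d)"

lemma blocks_append: "u \<in> blocks (m @ m') \<longleftrightarrow> u \<in> blocks m \<or> (\<exists>v\<in>blocks m'. u = sh (length m) v)"
proof (cases u)
  case (Pair i a)
  have "\<exists>v\<in>blocks m'. u = sh (length m) v" if "i \<ge> length m" "(i - length m, a) \<in> blocks m'"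
    using that Pair by (intro bexI[of _ "(i - length m, a)"]) auto
  then show ?thesis
    using Pair by (cases "i < length m") (fastforce simp: mem_blocks mem_blocks' nth_append)+
qed

lemma sum_map_left: "u \<in> blocks m \<Longrightarrow> sum_map m n m' \<phi> \<psi> u = \<phi> u"
  by (cases u) (simp add: sum_map_def mem_blocks nth_append)

lemma sum_map_right: "v \<in> blocks m' \<Longrightarrow> sum_map m n m' \<phi> \<psi> (sh (length m) v) = sh (length n) (\<psi> v)"
  by (cases v) (auto simp: sum_map_def mem_blocks nth_append)

lemma block_swap_left: "u \<in> blocks m \<Longrightarrow> block_swap m n u = sh (length n) u"
  by (auto simp: block_swap_def mem_blocks nth_append split: prod.splits)

lemma block_swap_right: "v \<in> blocks n \<Longrightarrow> block_swap m n (sh (length m) v) = v"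
  by (cases v) (auto simp: block_swap_def mem_blocks nth_append)

text \<open>Since \<open>ms ! b\<close> is an initial segment of \<open>ms ! b @ m'\<close>, an
  index tuple into \<open>ms\<close> picks the same entries from the enlarged sequence. The tuple
  stays the same and is merely encoded with respect to a longer list.\<close>

lemma sigma_map_left:
  assumes "us \<in> box ms" "b < length ms"
  shows "us \<in> box (ms[b := ms ! b @ m'])"
    and "sigma_map ms b m' (en ms us) = en (ms[b := ms ! b @ m']) us"
proof -
  have "pick (ms[b := ms ! b @ m']) (map fst us) = pick ms (map fst us)"
    using assms by (auto simp: list_eq_iff_nth_eq nth_list_update nth_append box_def mem_blocks')
  moreover have "en ms us \<in> blocks (multi_seq ms @ x)" for x
    using en_in[OF assms(1)] by (simp add: blocks_append)
  moreover have "fst (en ms us) < length (indices ms)"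
    using en_in[OF assms(1)] by (simp add: mem_blocks')
  ultimately show "sigma_map ms b m' (en ms us) = en (ms[b := ms ! b @ m']) us"
    using nth_fst_en[OF assms(1)] by (simp add: sigma_map_def Let_def en_def)
  show "us \<in> box (ms[b := ms ! b @ m'])"
    using assms by (auto simp: box_def nth_list_update blocks_append)
qed

text \<open>The blocks of \<open>m'\<close> come behind those of \<open>ms ! b\<close>, so the
  \<open>b\<close>-th coordinate moves by \<open>length (ms ! b)\<close> blocks while its position
  inside the block is kept.\<close>

lemma sigma_map_right:
  assumes "us \<in> box (ms[b := m'])" "b < length ms"
  shows "us[b := sh (length (ms ! b)) (us ! b)] \<in> box (ms[b := ms ! b @ m'])"
    and "sigma_map ms b m' (sh (length (multi_seq ms)) (en (ms[b := m']) us)) =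
      en (ms[b := ms ! b @ m']) (us[b := sh (length (ms ! b)) (us ! b)])"
proof -
  let ?d = "length (ms ! b)" and ?v = "sh (length (multi_seq ms)) (en (ms[b := m']) us)"
  have len: "length us = length ms" using assms by (simp add: box_def)
  have "us ! b \<in> blocks m'" using assms by (force simp: box_def)
  then show "us[b := sh ?d (us ! b)] \<in> box (ms[b := ms ! b @ m'])"
    using assms by (auto simp: box_def nth_list_update blocks_append)
  have "pick (ms[b := ms ! b @ m']) (map fst (us[b := sh ?d (us ! b)])) = pick (ms[b := m']) (map fst us)"
    using assms len by (auto simp: list_eq_iff_nth_eq nth_list_update nth_append)
  moreover have "?v \<in> blocks (multi_seq ms @ multi_seq (ms[b := m']))"
    using en_in[OF assms(1)] by (auto simp: blocks_append)
  moreover have "map snd (us[b := sh ?d (us ! b)]) = map snd us"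
    using len assms(2) by (simp add: map_update)  (metis list_update_id length_map nth_map)
  moreover have "map fst (us[b := sh ?d (us ! b)]) = (map fst us)[b := ?d + map fst us ! b]"
    using len assms(2) by (simp add: map_update)
  moreover have "\<not> fst ?v < length (indices ms)" "fst ?v - length (indices ms) = fst (en (ms[b := m']) us)" "snd ?v = snd (en (ms[b := m']) us)"
    by simp_all
  ultimately show "sigma_map ms b m' ?v = en (ms[b := ms ! b @ m']) (us[b := sh ?d (us ! b)])"
    using nth_fst_en[OF assms(1)]
    by (simp add: sigma_map_def Let_def en_def case_prod_unfold)
qed

text \<open>The two cases record which part of \<open>ms ! b @ m'\<close> contains the
  \<open>b\<close>-th coordinate, and match \<open>sigma_map_left\<close> and
  \<open>sigma_map_right\<close>. This yields surjectivity of the linearity constraint on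
  elements.\<close>

lemma box_update_appendE:
  assumes "us \<in> box (ms[b := ms ! b @ m'])" "b < length ms"
  obtains "us \<in> box ms"
  | vs where "vs \<in> box (ms[b := m'])" "us = vs[b := sh (length (ms ! b)) (vs ! b)]"
proof -
  have us: "length us = length ms" "us ! b \<in> blocks (ms ! b @ m')"
    using assms by (auto simp: box_def)
  from us(2) consider "us ! b \<in> blocks (ms ! b)"
    | v where "v \<in> blocks m'" "us ! b = sh (length (ms ! b)) v" by (auto simp: blocks_append)
  then show thesis
  proof cases
    case 1
    with assms have "us \<in> box ms" by (auto simp: box_def nth_list_update split: if_splits)
    then show ?thesis by (rule that(1))
  next
    case (2 v)
    show ?thesis
    proof (rule that(2))
      show "us[b := v] \<in> box (ms[b := m'])"
        using assms 2 by (auto simp: box_def nth_list_update)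
      show "us = us[b := v, b := sh (length (ms ! b)) (us[b := v] ! b)]"
        using us(1) assms(2) 2 by (simp flip: 2(2))
    qed
  qed
qed

section \<open>Functors to the category of categories\<close>

lemma homD: "f \<in> hom C x y \<Longrightarrow> f \<in> Arr C \<and> Dom C f = x \<and> Cod C f = y"
  by (simp add: hom_def)

lemma Arr_hom: "f \<in> Arr C \<Longrightarrow> f \<in> hom C (Dom C f) (Cod C f)"
  by (simp add: hom_def)

lemma (in category) hom_Obj: "f \<in> hom C x y \<Longrightarrow> x \<in> Obj C \<and> y \<in> Obj C"
  using dom_cod by (auto simp: hom_def)

lemma prod_cat_simps [simp]:
  "xs \<in> Obj (prod_cat Cs) \<longleftrightarrow> length xs = length Cs \<and> (\<forall>i<length Cs. xs ! i \<in> Obj (Cs ! i))"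
  "fs \<in> Arr (prod_cat Cs) \<longleftrightarrow> length fs = length Cs \<and> (\<forall>i<length Cs. fs ! i \<in> Arr (Cs ! i))"
  "Dom (prod_cat Cs) fs = tab (length Cs) (\<lambda>i. Dom (Cs ! i) (fs ! i))"
  "Cod (prod_cat Cs) fs = tab (length Cs) (\<lambda>i. Cod (Cs ! i) (fs ! i))"
  "Ident (prod_cat Cs) xs = tab (length Cs) (\<lambda>i. Ident (Cs ! i) (xs ! i))"
  "Comp (prod_cat Cs) gs fs = tab (length Cs) (\<lambda>i. Comp (Cs ! i) (gs ! i) (fs ! i))"
  by (simp_all add: prod_cat_def)

lemma tab_eq_iff:
  "tab n f = xs \<longleftrightarrow> length xs = n \<and> (\<forall>i<n. xs ! i = f i)"
  "xs = tab n f \<longleftrightarrow> length xs = n \<and> (\<forall>i<n. xs ! i = f i)"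
  by (auto intro!: nth_equalityI)

lemma hom_prod_cat:
  "fs \<in> hom (prod_cat Cs) xs ys \<longleftrightarrow> length fs = length Cs \<and> length xs = length Cs \<and>
    length ys = length Cs \<and> (\<forall>i<length Cs. fs ! i \<in> hom (Cs ! i) (xs ! i) (ys ! i))"
  by (auto simp: hom_def tab_eq_iff)

lemma category_prod_cat:
  assumes "\<And>i. i < length Cs \<Longrightarrow> category (Cs ! i)"
  shows "category (prod_cat Cs)"
proof
  fix f assume "f \<in> Arr (prod_cat Cs)"
  then show "Dom (prod_cat Cs) f \<in> Obj (prod_cat Cs) \<and> Cod (prod_cat Cs) f \<in> Obj (prod_cat Cs)"
    using category.dom_cod[OF assms] by simp
next
  fix x assume "x \<in> Obj (prod_cat Cs)"
  then show "Ident (prod_cat Cs) x \<in> hom (prod_cat Cs) x x"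
    using category.ident[OF assms] by (simp add: hom_prod_cat)
next
  fix f g x y z assume "f \<in> hom (prod_cat Cs) x y" "g \<in> hom (prod_cat Cs) y z"
  then show "Comp (prod_cat Cs) g f \<in> hom (prod_cat Cs) x z"
    using category.comp[OF assms] by (fastforce simp: hom_prod_cat)
next
  fix f x y assume f: "f \<in> hom (prod_cat Cs) x y"
  then show "Comp (prod_cat Cs) f (Ident (prod_cat Cs) x) = f"
    using category.comp_ident[OF assms] by (auto simp: hom_prod_cat tab_eq_iff)
  show "Comp (prod_cat Cs) (Ident (prod_cat Cs) y) f = f"
    using f category.ident_comp[OF assms] by (auto simp: hom_prod_cat tab_eq_iff)
next
  fix f g h x y z w
  assume "f \<in> hom (prod_cat Cs) x y" "g \<in> hom (prod_cat Cs) y z" "h \<in> hom (prod_cat Cs) z w"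
  then show "Comp (prod_cat Cs) h (Comp (prod_cat Cs) g f) = Comp (prod_cat Cs) (Comp (prod_cat Cs) h g) f"
    by (simp add: hom_prod_cat tab_eq_iff) (blast intro: category.comp_assoc[OF assms])
qed

lemma (in cfunctor) FAr_in': "f \<in> Arr C \<Longrightarrow> FAr F f \<in> Arr D"
  using FAr_in[OF Arr_hom] by (simp add: hom_def)

lemma cfunctor_id: "category C \<Longrightarrow> cfunctor C C (id_ftor C)"
  by (simp add: cfunctor_def cfunctor_axioms_def id_ftor_def hom_def category_def)

lemma cfunctor_comp:
  assumes "cfunctor C D F" "cfunctor D E G"
  shows "cfunctor C E (comp_ftor C G F)"
proof -
  interpret F: cfunctor C D F by fact
  interpret G: cfunctor D E G by fact
  show ?thesis
  proof
    show "FOb (comp_ftor C G F) \<in> extensional (Obj C)" "FAr (comp_ftor C G F) \<in> extensional (Arr C)"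
      by (simp_all add: comp_ftor_def)
  next
    fix x assume x: "x \<in> Obj C"
    then show "FOb (comp_ftor C G F) x \<in> Obj E"
      by (simp add: comp_ftor_def compose_def F.FOb_in G.FOb_in)
    show "FAr (comp_ftor C G F) (Ident C x) = Ident E (FOb (comp_ftor C G F) x)"
      using x homD[OF F.C.ident[OF x]] by (simp add: comp_ftor_def compose_def F.FAr_ident G.FAr_ident F.FOb_in)
  next
    fix f x y assume f: "f \<in> hom C x y"
    then show "FAr (comp_ftor C G F) f \<in> hom E (FOb (comp_ftor C G F) x) (FOb (comp_ftor C G F) y)"
      using homD[OF f] F.C.hom_Obj[OF f] by (simp add: comp_ftor_def compose_def F.FAr_in G.FAr_in)
    fix g z assume g: "g \<in> hom C y z"
    show "FAr (comp_ftor C G F) (Comp C g f) = Comp E (FAr (comp_ftor C G F) g) (FAr (comp_ftor C G F) f)"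
      using homD[OF f] homD[OF g] homD[OF F.C.comp[OF f g]]
        F.FAr_comp[OF f g] G.FAr_comp[OF F.FAr_in[OF f] F.FAr_in[OF g]]
      by (simp add: comp_ftor_def compose_def)
  qed
qed

lemma ftor_eqI: "\<lbrakk>FOb F = FOb G; FAr F = FAr G\<rbrakk> \<Longrightarrow> F = (G :: ('a, 'b, 'c, 'd) ftor)"
  by (cases F; cases G) simp

lemma hom_CAT: "u \<in> hom CAT C D \<longleftrightarrow> (\<exists>F. u = (C, D, F) \<and> cfunctor C D F)"
  by (auto simp: hom_def CAT_def)

lemma category_CAT: "category CAT"
proof
  fix f :: "('a, 'b) cat_arr" assume "f \<in> Arr CAT"
  then show "Dom CAT f \<in> Obj CAT \<and> Cod CAT f \<in> Obj CAT"
    by (auto simp: CAT_def cfunctor_def)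
next
  fix x :: "('a, 'b) cat" assume "x \<in> Obj CAT"
  then show "Ident CAT x \<in> hom CAT x x"
    by (simp add: hom_CAT) (simp add: CAT_def cfunctor_id)
next
  fix f g :: "('a, 'b) cat_arr" and x y z assume "f \<in> hom CAT x y" "g \<in> hom CAT y z"
  then show "Comp CAT g f \<in> hom CAT x z"
    by (auto simp: hom_CAT) (simp add: CAT_def cfunctor_comp)
next
  fix f :: "('a, 'b) cat_arr" and x y assume "f \<in> hom CAT x y"
  then obtain F where f: "f = (x, y, F)" and F: "cfunctor x y F" by (auto simp: hom_CAT)
  interpret F: cfunctor x y F by fact
  \<comment> \<open>The composite functor is restricted to the objects and arrows of
    \<open>x\<close>; extensionality of \<open>F\<close> gives the equation outside of them.\<close>
  show "Comp CAT f (Ident CAT x) = f"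
    using F.FOb_ext F.FAr_ext
    by (auto simp: f CAT_def comp_ftor_def id_ftor_def compose_def extensional_def intro!: ftor_eqI)
  show "Comp CAT (Ident CAT y) f = f"
    using F.FOb_ext F.FAr_ext F.FOb_in F.FAr_in'
    by (auto simp: f CAT_def comp_ftor_def id_ftor_def compose_def extensional_def intro!: ftor_eqI)
next
  fix f g h :: "('a, 'b) cat_arr" and x y z w
  assume "f \<in> hom CAT x y" "g \<in> hom CAT y z" "h \<in> hom CAT z w"
  then obtain F G H where fgh: "f = (x, y, F)" "g = (y, z, G)" "h = (z, w, H)"
    and FGH: "cfunctor x y F" "cfunctor y z G" "cfunctor z w H" by (auto simp: hom_CAT)
  interpret F: cfunctor x y F by fact
  show "Comp CAT h (Comp CAT g f) = Comp CAT (Comp CAT h g) f"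
    using F.FOb_in F.FAr_in' by (auto simp: fgh CAT_def comp_ftor_def compose_def intro!: ftor_eqI)
qed

text \<open>Used twice: with base \<open>Fcat\<close> for a Gamma-category, and with base
  \<open>Acat\<close> for \<open>AX X\<close>, whose Grothendieck construction underlies
  \<open>Pobj X\<close>.\<close>

locale cat_valued = cfunctor B CAT G
  for B :: "('b, 'u) cat" and G :: "('b, 'u, ('o, 'm) cat, ('o, 'm) cat_arr) ftor"
begin

lemma FAr_eq: "u \<in> hom B b c \<Longrightarrow> FAr G u = (FOb G b, FOb G c, act G u)"
  using FAr_in[of u b c] by (auto simp: hom_CAT act_def)

lemma cat_FOb: "b \<in> Obj B \<Longrightarrow> category (FOb G b)"
  using FOb_in by (simp add: CAT_def)

lemma act_functor: "u \<in> hom B b c \<Longrightarrow> cfunctor (FOb G b) (FOb G c) (act G u)"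
  using FAr_in[of u b c] by (auto simp: hom_CAT act_def)

lemma act_ident: "b \<in> Obj B \<Longrightarrow> act G (Ident B b) = id_ftor (FOb G b)"
  using FAr_ident[of b] by (simp add: act_def) (simp add: CAT_def)

lemma act_comp:
  assumes "u \<in> hom B b c" "v \<in> hom B c d"
  shows "act G (Comp B v u) = comp_ftor (FOb G b) (act G v) (act G u)"
  using FAr_comp[OF assms] unfolding FAr_eq[OF assms(1)] FAr_eq[OF assms(2)]
  by (simp add: act_def) (simp add: CAT_def)

lemma act_comp_Ob:
  "\<lbrakk>u \<in> hom B b c; v \<in> hom B c d; x \<in> Obj (FOb G b)\<rbrakk>
    \<Longrightarrow> FOb (act G (Comp B v u)) x = FOb (act G v) (FOb (act G u) x)"
  by (simp add: act_comp comp_ftor_def compose_def)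

lemma act_comp_Ar:
  "\<lbrakk>u \<in> hom B b c; v \<in> hom B c d; f \<in> Arr (FOb G b)\<rbrakk>
    \<Longrightarrow> FAr (act G (Comp B v u)) f = FAr (act G v) (FAr (act G u) f)"
  by (simp add: act_comp comp_ftor_def compose_def)

lemma hom_groth:
  "h \<in> hom (groth B G) s t \<longleftrightarrow> (\<exists>u f. h = (s, t, (u, f)) \<and> u \<in> hom B (fst s) (fst t) \<and>
     snd s \<in> Obj (FOb G (fst s)) \<and> snd t \<in> Obj (FOb G (fst t)) \<and>
     f \<in> hom (FOb G (fst t)) (FOb (act G u) (snd s)) (snd t))"
  by (cases s; cases t) (auto simp: hom_def groth_def)

lemma Comp_groth:
  "Comp (groth B G) (s', t', (v, g)) (s, t, (u, f)) =
    (s, t', (Comp B v u, Comp (FOb G (fst t')) g (FAr (act G v) f)))"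
  by (cases t') (simp add: groth_def)

lemma Ident_groth: "Ident (groth B G) s = (s, s, (Ident B (fst s), Ident (FOb G (fst s)) (snd s)))"
  by (simp add: groth_def case_prod_unfold)

lemma category_groth: "category (groth B G)"
proof
  fix h assume "h \<in> Arr (groth B G)"
  then show "Dom (groth B G) h \<in> Obj (groth B G) \<and> Cod (groth B G) h \<in> Obj (groth B G)"
    by (auto simp: groth_def dest: C.hom_Obj)
next
  fix s assume s: "s \<in> Obj (groth B G)"
  then have *: "fst s \<in> Obj B" "snd s \<in> Obj (FOb G (fst s))" by (auto simp: groth_def)
  then show "Ident (groth B G) s \<in> hom (groth B G) s s"
    using C.ident[OF *(1)] category.ident[OF cat_FOb[OF *(1)] *(2)]
    by (simp add: hom_groth Ident_groth act_ident id_ftor_def)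
next
  fix h k s t r assume "h \<in> hom (groth B G) s t" "k \<in> hom (groth B G) t r"
  then obtain u f v g where h: "h = (s, t, (u, f))" "k = (t, r, (v, g))"
    and u: "u \<in> hom B (fst s) (fst t)" "v \<in> hom B (fst t) (fst r)"
    and s: "snd s \<in> Obj (FOb G (fst s))" "snd r \<in> Obj (FOb G (fst r))"
    and f: "f \<in> hom (FOb G (fst t)) (FOb (act G u) (snd s)) (snd t)"
    and g: "g \<in> hom (FOb G (fst r)) (FOb (act G v) (snd t)) (snd r)"
    by (auto simp: hom_groth)
  interpret V: cfunctor "FOb G (fst t)" "FOb G (fst r)" "act G v" using u(2) by (rule act_functor)
  have "Comp (FOb G (fst r)) g (FAr (act G v) f) \<in>
      hom (FOb G (fst r)) (FOb (act G (Comp B v u)) (snd s)) (snd r)"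
    using V.D.comp[OF V.FAr_in[OF f] g] act_comp_Ob[OF u s(1)] by simp
  then show "Comp (groth B G) k h \<in> hom (groth B G) s r"
    using C.comp[OF u] s by (simp add: hom_groth h Comp_groth)
next
  fix h s t assume "h \<in> hom (groth B G) s t"
  then obtain u f where h: "h = (s, t, (u, f))" and u: "u \<in> hom B (fst s) (fst t)"
    and s: "snd s \<in> Obj (FOb G (fst s))" "snd t \<in> Obj (FOb G (fst t))"
    and f: "f \<in> hom (FOb G (fst t)) (FOb (act G u) (snd s)) (snd t)"
    by (auto simp: hom_groth)
  interpret U: cfunctor "FOb G (fst s)" "FOb G (fst t)" "act G u" using u by (rule act_functor)
  show "Comp (groth B G) h (Ident (groth B G) s) = h"
    using C.comp_ident[OF u] U.FAr_ident[OF s(1)] U.D.comp_ident[OF f] by (simp add: h Ident_groth Comp_groth)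
  show "Comp (groth B G) (Ident (groth B G) t) h = h"
    using C.ident_comp[OF u] U.D.ident_comp[OF f] C.hom_Obj[OF u] homD[OF f]
    by (simp add: h Ident_groth Comp_groth act_ident id_ftor_def)
next
  fix h k l s t r q
  assume "h \<in> hom (groth B G) s t" "k \<in> hom (groth B G) t r" "l \<in> hom (groth B G) r q"
  then obtain u f v g w e where h: "h = (s, t, (u, f))" "k = (t, r, (v, g))" "l = (r, q, (w, e))"
    and u: "u \<in> hom B (fst s) (fst t)" "v \<in> hom B (fst t) (fst r)" "w \<in> hom B (fst r) (fst q)"
    and f: "f \<in> hom (FOb G (fst t)) (FOb (act G u) (snd s)) (snd t)"
    and g: "g \<in> hom (FOb G (fst r)) (FOb (act G v) (snd t)) (snd r)"
    and e: "e \<in> hom (FOb G (fst q)) (FOb (act G w) (snd r)) (snd q)"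
    by (auto simp: hom_groth)
  interpret V: cfunctor "FOb G (fst t)" "FOb G (fst r)" "act G v" using u(2) by (rule act_functor)
  interpret W: cfunctor "FOb G (fst r)" "FOb G (fst q)" "act G w" using u(3) by (rule act_functor)
  have f': "FAr (act G v) f \<in> hom (FOb G (fst r)) (FOb (act G v) (FOb (act G u) (snd s))) (FOb (act G v) (snd t))"
    by (rule V.FAr_in[OF f])
  show "Comp (groth B G) l (Comp (groth B G) k h) = Comp (groth B G) (Comp (groth B G) l k) h"
    using C.comp_assoc[OF u] W.FAr_comp[OF f' g] W.D.comp_assoc[OF W.FAr_in[OF f'] W.FAr_in[OF g] e]
      act_comp_Ar[OF u(2,3)] homD[OF f]
    by (simp add: h Comp_groth)
qed

end

section \<open>The category of sequences\<close>

lemma Fcat_arr: "(p, q, \<psi>) \<in> Arr Fcat \<longleftrightarrow> \<psi> \<in> {0..p} \<rightarrow>\<^sub>E {0..q} \<and> \<psi> 0 = 0"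
  by (simp add: Fcat_def)

lemma hom_Fcat: "u \<in> hom Fcat p q \<longleftrightarrow> (\<exists>\<psi>. u = (p, q, \<psi>) \<and> (p, q, \<psi>) \<in> Arr Fcat)"
  by (auto simp: hom_def Fcat_def)

text \<open>The condition on preimages becomes a condition on pairs of elements: elements sent to
  the same block come from the same block. In this form it passes to composites at once and can be
  checked on enumerated elements. Conversely, any element of a nonempty preimage names the block
  that contains it.\<close>

lemma Acat_arr:
  "(m, n, \<phi>) \<in> Arr Acat \<longleftrightarrow> (\<forall>a\<in>set m. 0 < a) \<and> (\<forall>a\<in>set n. 0 < a) \<and> \<phi> \<in> blocks m \<rightarrow>\<^sub>E blocks n \<and>
    (\<forall>u\<in>blocks m. \<forall>v\<in>blocks m. fst (\<phi> u) = fst (\<phi> v) \<longrightarrow> fst u = fst v)"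
    (is "?L \<longleftrightarrow> ?P \<and> ?Q \<and> ?E \<and> ?R")
proof
  assume L: ?L
  then have E: "?P \<and> ?Q \<and> ?E" by (simp add: Acat_def)
  moreover have "fst u = fst v" if uv: "u \<in> blocks m" "v \<in> blocks m" "fst (\<phi> u) = fst (\<phi> v)" for u v
  proof -
    let ?j = "fst (\<phi> v)"
    have "?j < length n" using E uv by (auto simp: mem_blocks' dest!: PiE_mem)
    moreover have "u \<in> preim m \<phi> ?j" "v \<in> preim m \<phi> ?j" using uv by (auto simp: preim_def)
    ultimately obtain i where sub: "preim m \<phi> ?j \<subseteq> {i} \<times> {1..m ! i}" using L unfolding Acat_def by auto
    have "u \<in> {i} \<times> {1..m ! i}" "v \<in> {i} \<times> {1..m ! i}"
      using \<open>u \<in> preim m \<phi> ?j\<close> \<open>v \<in> preim m \<phi> ?j\<close> by (simp_all only: subsetD[OF sub])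
    then show ?thesis by (simp add: mem_Times_iff)
  qed
  ultimately show "?P \<and> ?Q \<and> ?E \<and> ?R" by blast
next
  assume R: "?P \<and> ?Q \<and> ?E \<and> ?R"
  have "\<exists>i<length m. preim m \<phi> j \<subseteq> {i} \<times> {1..m ! i}" if u: "u \<in> preim m \<phi> j" for u j
  proof -
    have "w \<in> {fst u} \<times> {1..m ! fst u}" if "w \<in> preim m \<phi> j" for w
    proof -
      have "w \<in> blocks m" "fst (\<phi> w) = fst (\<phi> u)" "u \<in> blocks m"
        using u that by (simp_all add: preim_def)
      then have "fst w = fst u" using R by blast
      with \<open>w \<in> blocks m\<close> show ?thesis by (simp add: mem_Times_iff mem_blocks')
    qed
    moreover have "fst u < length m" using u by (simp add: preim_def mem_blocks')
    ultimately show ?thesis by blast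
  qed
  then have "preim m \<phi> j = {} \<or> (\<exists>i<length m. preim m \<phi> j \<subseteq> {i} \<times> {1..m ! i})" for j
    by (metis all_not_in_conv)
  with R show ?L by (simp add: Acat_def)
qed

lemma Acat_arrD:
  assumes "(m, n, \<phi>) \<in> Arr Acat"
  shows "m \<in> Obj Acat" "n \<in> Obj Acat" "u \<in> blocks m \<Longrightarrow> \<phi> u \<in> blocks n" "\<phi> \<in> extensional (blocks m)"
    "\<lbrakk>u \<in> blocks m; v \<in> blocks m; fst (\<phi> u) = fst (\<phi> v)\<rbrakk> \<Longrightarrow> fst u = fst v"
proof -
  note * = assms[unfolded Acat_arr]
  show "m \<in> Obj Acat" "n \<in> Obj Acat" using * by (simp_all add: Acat_def)
  show "u \<in> blocks m \<Longrightarrow> \<phi> u \<in> blocks n" "\<phi> \<in> extensional (blocks m)" using * by (simp_all add: PiE_iff)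
  show "\<lbrakk>u \<in> blocks m; v \<in> blocks m; fst (\<phi> u) = fst (\<phi> v)\<rbrakk> \<Longrightarrow> fst u = fst v" using * by blast
qed

lemma Acat_arrI:
  assumes "m \<in> Obj Acat" "n \<in> Obj Acat" "\<And>u. u \<in> blocks m \<Longrightarrow> \<phi> u \<in> blocks n" "\<phi> \<in> extensional (blocks m)"
    "\<And>u v. \<lbrakk>u \<in> blocks m; v \<in> blocks m; fst (\<phi> u) = fst (\<phi> v)\<rbrakk> \<Longrightarrow> fst u = fst v"
  shows "(m, n, \<phi>) \<in> Arr Acat"
proof -
  have "\<forall>a\<in>set m. 0 < a" "\<forall>a\<in>set n. 0 < a" using assms(1,2) by (simp_all add: Acat_def)
  moreover have "\<phi> \<in> blocks m \<rightarrow>\<^sub>E blocks n" using assms(3,4) by (simp add: PiE_iff)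
  ultimately show ?thesis unfolding Acat_arr using assms(5) by blast
qed

lemma Acat_Obj: "m \<in> Obj Acat \<longleftrightarrow> (\<forall>i<length m. 0 < m ! i)"
  by (auto simp: Acat_def all_set_conv_all_nth)

lemma Acat_Obj_append [simp]: "m @ m' \<in> Obj Acat \<longleftrightarrow> m \<in> Obj Acat \<and> m' \<in> Obj Acat"
  by (auto simp: Acat_def)

lemma hom_Acat: "u \<in> hom Acat m n \<longleftrightarrow> (\<exists>\<phi>. u = (m, n, \<phi>) \<and> (m, n, \<phi>) \<in> Arr Acat)"
  by (auto simp: hom_def Acat_def)

lemma Acat_simps [simp]:
  "Ident Acat m = (m, m, \<lambda>u\<in>blocks m. u)"
  "Comp Acat (m', n', \<psi>) (m, n, \<phi>) = (m, n', compose (blocks m) \<psi> \<phi>)"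
  "Dom Acat (m, n, \<phi>) = m" "Cod Acat (m, n, \<phi>) = n"
  by (simp_all add: Acat_def)

lemma Acat_ident: "m \<in> Obj Acat \<Longrightarrow> (m, m, \<lambda>u\<in>blocks m. u) \<in> Arr Acat"
  by (rule Acat_arrI) auto

lemma Acat_comp:
  assumes "(m, n, \<phi>) \<in> Arr Acat" "(n, r, \<psi>) \<in> Arr Acat"
  shows "(m, r, compose (blocks m) \<psi> \<phi>) \<in> Arr Acat"
proof (rule Acat_arrI)
  note \<phi> = Acat_arrD[OF assms(1)] and \<psi> = Acat_arrD[OF assms(2)]
  fix u assume u: "u \<in> blocks m"
  then show "compose (blocks m) \<psi> \<phi> u \<in> blocks r"
    by (simp add: compose_eq \<phi>(3) \<psi>(3))
  fix v assume v: "v \<in> blocks m" "fst (compose (blocks m) \<psi> \<phi> u) = fst (compose (blocks m) \<psi> \<phi> v)"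
  then have "fst (\<phi> u) = fst (\<phi> v)"
    using \<psi>(5)[OF \<phi>(3)[OF u] \<phi>(3)[OF v(1)]] u by (simp add: compose_eq)
  then show "fst u = fst v"
    by (rule \<phi>(5)[OF u v(1)])
qed (use assms in \<open>simp_all add: Acat_arrD(1,2)\<close>)

lemma category_Acat: "category Acat"
proof
  fix f assume "f \<in> Arr Acat"
  then show "Dom Acat f \<in> Obj Acat \<and> Cod Acat f \<in> Obj Acat"
    using Acat_arrD(1,2) by (cases f) auto
next
  fix f x y assume "f \<in> hom Acat x y"
  then obtain \<phi> where f: "f = (x, y, \<phi>)" "(x, y, \<phi>) \<in> Arr Acat" by (auto simp: hom_Acat)
  have "compose (blocks x) \<phi> (\<lambda>u\<in>blocks x. u) = \<phi>"
    by (rule compose_Id[OF _ Acat_arrD(4)[OF f(2)]]) (use Acat_arrD(3)[OF f(2)] in blast)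
  then show "Comp Acat f (Ident Acat x) = f" by (simp add: f)
  have "compose (blocks x) (\<lambda>u\<in>blocks y. u) \<phi> = \<phi>"
    by (rule Id_compose[OF _ Acat_arrD(4)[OF f(2)]]) (use Acat_arrD(3)[OF f(2)] in blast)
  then show "Comp Acat (Ident Acat y) f = f" by (simp add: f)
next
  fix f g h x y z w assume "f \<in> hom Acat x y" "g \<in> hom Acat y z" "h \<in> hom Acat z w"
  then show "Comp Acat h (Comp Acat g f) = Comp Acat (Comp Acat h g) f"
    by (auto simp: hom_Acat compose_def fun_eq_iff Acat_arrD(3))
qed (auto simp: hom_Acat Acat_ident Acat_comp)

lemma preim_empty_iff: "preim m \<phi> j = {} \<longleftrightarrow> (\<forall>u\<in>blocks m. fst (\<phi> u) \<noteq> j)"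
  by (auto simp: preim_def)

text \<open>Any element of a nonempty preimage determines the block containing it, which evaluates
  the definite description in \<open>src_block\<close>.\<close>

lemma src_block_eq:
  assumes "(m, n, \<phi>) \<in> Arr Acat" "u \<in> blocks m"
  shows "src_block m \<phi> (fst (\<phi> u)) = fst u"
  unfolding src_block_def
proof (rule the_equality)
  show "fst u < length m \<and> preim m \<phi> (fst (\<phi> u)) \<subseteq> {fst u} \<times> {1..m ! fst u}"
  proof -
    have "w \<in> {fst u} \<times> {1..m ! fst u}" if "w \<in> preim m \<phi> (fst (\<phi> u))" for w
    proof -
      have w: "w \<in> blocks m" "fst (\<phi> w) = fst (\<phi> u)" using that by (simp_all add: preim_def)
      then have "fst w = fst u" by (rule Acat_arrD(5)[OF assms(1) _ assms(2)])
      with w(1) show ?thesis by (simp add: mem_blocks' mem_Times_iff)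
    qed
    then show ?thesis using assms(2) by (simp add: subset_iff mem_blocks')
  qed
next
  fix i assume i: "i < length m \<and> preim m \<phi> (fst (\<phi> u)) \<subseteq> {i} \<times> {1..m ! i}"
  have "u \<in> preim m \<phi> (fst (\<phi> u))" using assms(2) by (simp add: preim_def)
  then have "u \<in> {i} \<times> {1..m ! i}" by (rule subsetD[OF conjunct2[OF i]])
  then show "i = fst u" by (simp add: mem_Times_iff)
qed

lemma block_map_0 [simp]: "block_map m \<phi> i j 0 = 0"
  by (simp add: block_map_def preim_def mem_blocks)

lemma block_map_eq:
  "(i, a) \<in> blocks m \<Longrightarrow> block_map m \<phi> i j a = (if fst (\<phi> (i, a)) = j then snd (\<phi> (i, a)) else 0)"
  by (simp add: block_map_def preim_def mem_blocks)

lemma block_map_Fcat: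
  assumes "(m, n, \<phi>) \<in> Arr Acat" "i < length m" "j < length n"
  shows "(m ! i, n ! j, block_map m \<phi> i j) \<in> Arr Fcat"
proof -
  have "snd (\<phi> (i, a)) \<le> n ! j" if "(i, a) \<in> blocks m" "fst (\<phi> (i, a)) = j" for a
    using Acat_arrD(3)[OF assms(1) that(1)] that(2) by (auto simp: mem_blocks')
  then show ?thesis
    by (auto simp: Fcat_arr block_map_def preim_def mem_blocks)
qed

text \<open>Because \<psi> sends different blocks to different blocks, only block
  \<open>fst w\<close> of \<open>n\<close> reaches block \<open>fst (\<psi> w)\<close> of
  \<open>r\<close>. An element whose image under \<phi> lies in another block is thus sent to 0 on
  both sides.\<close>

lemma block_map_comp:
  assumes "(m, n, \<phi>) \<in> Arr Acat" "(n, r, \<psi>) \<in> Arr Acat" "w \<in> blocks n" "i < length m"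
  shows "block_map m (compose (blocks m) \<psi> \<phi>) i (fst (\<psi> w)) =
    compose {0..m ! i} (block_map n \<psi> (fst w) (fst (\<psi> w))) (block_map m \<phi> i (fst w))"
proof
  fix a
  note \<phi> = Acat_arrD[OF assms(1)] and \<psi> = Acat_arrD[OF assms(2)]
  show "block_map m (compose (blocks m) \<psi> \<phi>) i (fst (\<psi> w)) a =
    compose {0..m ! i} (block_map n \<psi> (fst w) (fst (\<psi> w))) (block_map m \<phi> i (fst w)) a"
  proof (cases "(i, a) \<in> blocks m")
    case True
    then have a: "a \<in> {0..m ! i}" by (simp add: mem_blocks)
    obtain k b where kb: "\<phi> (i, a) = (k, b)" by (cases "\<phi> (i, a)")
    have im: "(k, b) \<in> blocks n" using \<phi>(3)[OF True] kb by simp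
    have "fst (\<psi> (k, b)) = fst (\<psi> w) \<Longrightarrow> k = fst w" using \<psi>(5)[OF im assms(3)] by simp
    then show ?thesis
      using True im a kb by (auto simp: block_map_eq compose_eq)
  next
    case False
    then show ?thesis by (auto simp: block_map_def preim_def compose_def mem_blocks)
  qed
qed

section \<open>Gamma-sets and their extension to sequences\<close>

text \<open>
  The objects and the arrows of a Gamma-category both form a pointed functor from \<open>\<F>\<close> to sets.
  Operations and modifications are natural families of maps between such functors, so the
  combinatorics of \<open>\<P>\<close> is developed once, at the level of sets.
\<close>

record 'a gset =
  GS :: "nat \<Rightarrow> 'a set"
  GB :: "nat \<Rightarrow> 'a"
  GA :: "nat \<times> nat \<times> (nat \<Rightarrow> nat) \<Rightarrow> 'a \<Rightarrow> 'a"

text \<open>\<open>GA_zero\<close> is the trace of terminality of \<open>FOb X 0\<close>: a zero map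
  factors through degree 0. It is the law needed when a composite of arrows of \<open>Acat\<close>
  misses a block that is not missed in two steps.\<close>

locale gset =
  fixes S :: "'a gset"
  assumes GB_in: "GB S p \<in> GS S p"
    and GA_in: "\<lbrakk>(p, q, \<psi>) \<in> Arr Fcat; x \<in> GS S p\<rbrakk> \<Longrightarrow> GA S (p, q, \<psi>) x \<in> GS S q"
    and GA_ident: "x \<in> GS S p \<Longrightarrow> GA S (p, p, \<lambda>a\<in>{0..p}. a) x = x"
    and GA_comp: "\<lbrakk>(p, q, \<psi>) \<in> Arr Fcat; (q, r, \<chi>) \<in> Arr Fcat; x \<in> GS S p\<rbrakk>
      \<Longrightarrow> GA S (p, r, compose {0..p} \<chi> \<psi>) x = GA S (q, r, \<chi>) (GA S (p, q, \<psi>) x)"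
    and GA_base: "(p, q, \<psi>) \<in> Arr Fcat \<Longrightarrow> GA S (p, q, \<psi>) (GB S p) = GB S q"
    and GA_zero: "x \<in> GS S p \<Longrightarrow> GA S (p, q, \<lambda>a\<in>{0..p}. 0) x = GB S q"

text \<open>For \<open>ob_gset X\<close> and \<open>ar_gset X\<close> these are the objects and the
  arrows of \<open>AXob X m\<close>.\<close>

definition axc :: "'a gset \<Rightarrow> nat list \<Rightarrow> 'a list set" where
  "axc S m = {xs. length xs = length m \<and> (\<forall>i<length m. xs ! i \<in> GS S (m ! i))}"

definition axact :: "'a gset \<Rightarrow> nat list \<Rightarrow> nat list \<Rightarrow> (nat \<times> nat \<Rightarrow> nat \<times> nat) \<Rightarrow> 'a list \<Rightarrow> 'a list" where
  "axact S m n \<phi> xs = tab (length n) (\<lambda>j. if preim m \<phi> j = {} then GB S (n ! j)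
     else GA S (m ! src_block m \<phi> j, n ! j, block_map m \<phi> (src_block m \<phi> j) j) (xs ! src_block m \<phi> j))"

lemma length_axact [simp]: "length (axact S m n \<phi> xs) = length n"
  by (simp add: axact_def)

lemma axact_empty:
  "\<lbrakk>j < length n; \<And>u. u \<in> blocks m \<Longrightarrow> fst (\<phi> u) \<noteq> j\<rbrakk> \<Longrightarrow> axact S m n \<phi> xs ! j = GB S (n ! j)"
  by (auto simp: axact_def preim_empty_iff)

text \<open>Replaces the choice made by \<open>src_block\<close> with an arbitrary element mapped
  into block \<open>j\<close>, which is what arguments on elements provide.\<close>

lemma axact_src:
  assumes "(m, n, \<phi>) \<in> Arr Acat" "u \<in> blocks m" "fst (\<phi> u) = j"
  shows "axact S m n \<phi> xs ! j = GA S (m ! fst u, n ! j, block_map m \<phi> (fst u) j) (xs ! fst u)"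
proof -
  have "j < length n" using Acat_arrD(3)[OF assms(1,2)] assms(3) by (auto simp: mem_blocks')
  moreover have "preim m \<phi> j \<noteq> {}" using assms(2,3) by (auto simp: preim_empty_iff)
  ultimately show ?thesis
    using src_block_eq[OF assms(1,2)] assms(3) by (simp add: axact_def)
qed

lemma axcI: "\<lbrakk>length xs = length m; \<And>i. i < length m \<Longrightarrow> xs ! i \<in> GS S (m ! i)\<rbrakk> \<Longrightarrow> xs \<in> axc S m"
  by (simp add: axc_def)

lemma axcD: "xs \<in> axc S m \<Longrightarrow> length xs = length m \<and> (\<forall>i<length m. xs ! i \<in> GS S (m ! i))"
  by (simp add: axc_def)

lemma axc_append: "\<lbrakk>xs \<in> axc S m; ys \<in> axc S n\<rbrakk> \<Longrightarrow> xs @ ys \<in> axc S (m @ n)"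
  by (auto simp: axc_def nth_append)

text \<open>Only target blocks are required to be identical copies of source blocks. Since arrows of
  \<open>Acat\<close> separate blocks, bijectivity follows; the inverse is constructed in
  \<open>block_iso_inverse\<close>.\<close>

definition block_iso :: "nat list \<Rightarrow> nat list \<Rightarrow> (nat \<times> nat \<Rightarrow> nat \<times> nat) \<Rightarrow> bool" where
  "block_iso m n \<phi> \<longleftrightarrow> (m, n, \<phi>) \<in> Arr Acat \<and>
    (\<forall>j<length n. \<exists>i<length m. m ! i = n ! j \<and> (\<forall>a. (i, a) \<in> blocks m \<longrightarrow> \<phi> (i, a) = (j, a)))"

context gset
begin

lemma axact_nth_cases:
  assumes "(m, n, \<phi>) \<in> Arr Acat" "j < length n"
  obtains (empty) "\<And>u. u \<in> blocks m \<Longrightarrow> fst (\<phi> u) \<noteq> j" "axact S m n \<phi> xs ! j = GB S (n ! j)"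
  | (src) u where "u \<in> blocks m" "fst (\<phi> u) = j" "fst u < length m"
      "axact S m n \<phi> xs ! j = GA S (m ! fst u, n ! j, block_map m \<phi> (fst u) j) (xs ! fst u)"
proof (cases "\<exists>u\<in>blocks m. fst (\<phi> u) = j")
  case True
  then obtain u where u: "u \<in> blocks m" "fst (\<phi> u) = j" by blast
  then have "fst u < length m" by (simp add: mem_blocks')
  then show ?thesis using src u axact_src[OF assms(1) u] by blast
next
  case False
  then show ?thesis using empty axact_empty[OF assms(2), of m \<phi>] by blast
qed

lemma axact_in:
  assumes "(m, n, \<phi>) \<in> Arr Acat" "xs \<in> axc S m"
  shows "axact S m n \<phi> xs \<in> axc S n"
proof (rule axcI)
  fix j assume j: "j < length n"
  from assms(1) j show "axact S m n \<phi> xs ! j \<in> GS S (n ! j)"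
  proof (cases rule: axact_nth_cases[where xs = xs])
    case (src u)
    then show ?thesis
      using GA_in[OF block_map_Fcat[OF assms(1) _ j]] axcD[OF assms(2)] by simp
  qed (simp add: GB_in)
qed simp

text \<open>The relevant block maps are identities, so \<open>GA_ident\<close> applies and only the
  order of the entries changes. The hypothesis on \<open>ys\<close> runs over elements because the
  permutations of blocks are known through their values on elements.\<close>

lemma axact_reindex:
  assumes "block_iso m n \<phi>" "xs \<in> axc S m" "length ys = length n"
    "\<And>i a. (i, a) \<in> blocks m \<Longrightarrow> ys ! fst (\<phi> (i, a)) = xs ! i"
  shows "axact S m n \<phi> xs = ys"
proof (rule nth_equalityI)
  note arr = assms(1)[unfolded block_iso_def, THEN conjunct1]
  fix j assume "j < length (axact S m n \<phi> xs)"
  then have j: "j < length n" by simp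
  with assms(1) obtain i where i: "i < length m" "m ! i = n ! j" "\<And>a. (i, a) \<in> blocks m \<Longrightarrow> \<phi> (i, a) = (j, a)"
    unfolding block_iso_def by blast
  \<comment> \<open>Positivity provides the element \<open>(i, 1)\<close>; hence coordinate
    \<open>j\<close> comes from block \<open>i\<close> and is not the basepoint supplied for an
    empty preimage.\<close>
  have "0 < m ! i" using Acat_arrD(1)[OF arr] i(1) by (simp add: Acat_Obj)
  then have u: "(i, 1) \<in> blocks m" using i(1) by (simp add: mem_blocks)
  have "block_map m \<phi> i j a = (\<lambda>a\<in>{0..m ! i}. a) a" for a
  proof (cases "(i, a) \<in> blocks m")
    case True
    then show ?thesis using i by (simp add: block_map_eq mem_blocks)
  next
    case False
    then have "a = 0 \<or> \<not> a \<le> m ! i" using i(1) by (auto simp: mem_blocks)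
    then show ?thesis using False by (auto simp: block_map_def preim_def)
  qed
  then have "block_map m \<phi> i j = (\<lambda>a\<in>{0..n ! j}. a)" using i(2) by (simp add: fun_eq_iff)
  then have "axact S m n \<phi> xs ! j = xs ! i"
    using axact_src[OF arr u, of j S xs] i u GA_ident[of "xs ! i" "n ! j"] axcD[OF assms(2)] by force
  then show "axact S m n \<phi> xs ! j = ys ! j" using assms(4)[OF u] i(3)[OF u] by simp
qed (use assms(3) in simp)

lemma block_iso_ident: "m \<in> Obj Acat \<Longrightarrow> block_iso m m (\<lambda>u\<in>blocks m. u)"
  by (auto simp: block_iso_def Acat_ident)

lemma axact_ident: "\<lbrakk>m \<in> Obj Acat; xs \<in> axc S m\<rbrakk> \<Longrightarrow> axact S m m (\<lambda>u\<in>blocks m. u) xs = xs"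
  using axcD[of xs S m] by (intro axact_reindex block_iso_ident) auto

text \<open>The source of block \<open>k\<close> is traced back in two stages. If no block of
  \<open>n\<close> maps to it, both sides are the basepoint; if \<phi> misses the block of
  \<open>n\<close> that does, \<open>GA_base\<close> applies; if both stages have a source, the
  block maps compose by \<open>block_map_comp\<close>.\<close>

lemma axact_comp:
  assumes "(m, n, \<phi>) \<in> Arr Acat" "(n, r, \<psi>) \<in> Arr Acat" "xs \<in> axc S m"
  shows "axact S m r (compose (blocks m) \<psi> \<phi>) xs = axact S n r \<psi> (axact S m n \<phi> xs)"
proof (rule nth_equalityI)
  note comp = Acat_comp[OF assms(1,2)]
  note \<phi> = Acat_arrD[OF assms(1)] and \<psi> = Acat_arrD[OF assms(2)]
  let ?ys = "axact S m n \<phi> xs" and ?\<chi> = "compose (blocks m) \<psi> \<phi>"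
  fix k assume "k < length (axact S m r ?\<chi> xs)"
  then have k: "k < length r" by simp
  from assms(2) k show "axact S m r ?\<chi> xs ! k = axact S n r \<psi> ?ys ! k"
  proof (cases rule: axact_nth_cases[where xs = ?ys])
    case empty
    then show ?thesis using k by (simp add: axact_empty \<phi>(3) compose_eq)
  next
    case (src w)
    note [simp] = src(4)
    have bw: "(n ! fst w, r ! k, block_map n \<psi> (fst w) k) \<in> Arr Fcat"
      by (rule block_map_Fcat[OF assms(2) src(3) k])
    from assms(1) src(3) show ?thesis
    proof (cases rule: axact_nth_cases[where xs = xs])
      case empty
      have "fst (?\<chi> v) \<noteq> k" if v: "v \<in> blocks m" for v
        using \<psi>(5)[OF \<phi>(3)[OF v] src(1)] empty(1)[OF v] v src(2) by (auto simp: compose_eq)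
      then show ?thesis using k bw by (simp add: axact_empty empty(2) GA_base)
    next
      case (src u)
      have bu: "(m ! fst u, n ! fst w, block_map m \<phi> (fst u) (fst w)) \<in> Arr Fcat"
        by (rule block_map_Fcat[OF assms(1) src(3) \<open>fst w < length n\<close>])
      have xu: "xs ! fst u \<in> GS S (m ! fst u)" using axcD[OF assms(3)] src(3) by simp
      have "axact S n r \<psi> ?ys ! k = GA S (m ! fst u, r ! k, compose {0..m ! fst u}
          (block_map n \<psi> (fst w) k) (block_map m \<phi> (fst u) (fst w))) (xs ! fst u)"
        using GA_comp[OF bu bw xu] by (simp add: src(4))
      also have "\<dots> = GA S (m ! fst u, r ! k, block_map m ?\<chi> (fst u) k) (xs ! fst u)"
        using block_map_comp[OF assms(1,2) \<open>w \<in> blocks n\<close> src(3)] \<open>fst (\<psi> w) = k\<close> by simp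
      finally have R: "axact S n r \<psi> ?ys ! k = \<dots>" .
      show ?thesis
      proof (cases "\<exists>v\<in>blocks m. fst (?\<chi> v) = k")
        case True
        then obtain v where v: "v \<in> blocks m" "fst (?\<chi> v) = k" by blast
        then have "fst (\<phi> v) = fst w"
          using \<psi>(5)[OF \<phi>(3)[OF v(1)] \<open>w \<in> blocks n\<close>] \<open>fst (\<psi> w) = k\<close> by (simp add: compose_eq)
        then have "fst v = fst u" using \<phi>(5)[OF v(1) src(1)] src(2) by simp
        then show ?thesis using axact_src[OF comp v, of S xs] R by simp
      next
        case False
        \<comment> \<open>Both stages have a source but no element survives both: the composite
          block map is zero, and \<open>GA_zero\<close> turns its action into the basepoint that
          \<open>axact\<close> prescribes for an empty preimage.\<close>
        then have "block_map m ?\<chi> (fst u) k = (\<lambda>a\<in>{0..m ! fst u}. 0)"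
          unfolding block_map_def preim_def by (intro restrict_ext) auto
        then show ?thesis using R False k axact_empty[of k r m ?\<chi> S xs] GA_zero[OF xu] by auto
      qed
    qed
  qed
qed simp

end

section \<open>Concatenation, block swaps and inverses in \<open>Acat\<close>\<close>

lemma blocks_appendE:
  assumes "u \<in> blocks (m @ m')"
  obtains (left) "u \<in> blocks m" "fst u < length m"
  | (right) v where "v \<in> blocks m'" "u = sh (length m) v" "fst v < length m'"
  using assms by (metis blocks_append mem_blocks')

lemma blocks_appendI:
  "u \<in> blocks m \<Longrightarrow> u \<in> blocks (m @ m')"
  "v \<in> blocks m' \<Longrightarrow> sh (length m) v \<in> blocks (m @ m')"
  by (auto simp: blocks_append)

lemma Acat_sum:
  assumes "(m, n, \<phi>) \<in> Arr Acat" "(m', n', \<psi>) \<in> Arr Acat"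
  shows "(m @ m', n @ n', sum_map m n m' \<phi> \<psi>) \<in> Arr Acat"
proof (rule Acat_arrI)
  note \<phi> = Acat_arrD[OF assms(1)] and \<psi> = Acat_arrD[OF assms(2)]
  have *: "(\<exists>v\<in>blocks m. u = v \<and> sum_map m n m' \<phi> \<psi> u = \<phi> v \<and> fst (\<phi> v) < length n) \<or>
    (\<exists>v\<in>blocks m'. u = sh (length m) v \<and> sum_map m n m' \<phi> \<psi> u = sh (length n) (\<psi> v))"
    if "u \<in> blocks (m @ m')" for u
    using that
  proof (cases rule: blocks_appendE)
    case left
    then show ?thesis using \<phi>(3)[of u] by (intro disjI1 bexI[of _ u]) (simp_all add: sum_map_left mem_blocks')
  next
    case (right v)
    then show ?thesis by (intro disjI2 bexI[of _ v]) (simp_all add: sum_map_right)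
  qed
  fix u assume u: "u \<in> blocks (m @ m')"
  show "sum_map m n m' \<phi> \<psi> u \<in> blocks (n @ n')"
    using *[OF u] by (elim disjE bexE conjE) (simp_all add: blocks_appendI \<phi>(3) \<psi>(3))
  fix v assume v: "v \<in> blocks (m @ m')" "fst (sum_map m n m' \<phi> \<psi> u) = fst (sum_map m n m' \<phi> \<psi> v)"
  \<comment> \<open>Images of the first summand lie in blocks below \<open>length n\<close> and
    those of the second in blocks from \<open>length n\<close> on, so the mixed cases contradict
    equality.\<close>
  show "fst u = fst v"
    using *[OF u] *[OF v(1)]
  proof (elim disjE bexE conjE)
    fix u' v' assume "u' \<in> blocks m" "u = u'" "v' \<in> blocks m" "v = v'"
      "sum_map m n m' \<phi> \<psi> u = \<phi> u'" "sum_map m n m' \<phi> \<psi> v = \<phi> v'"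
    then show ?thesis using v(2) \<phi>(5)[of u' v'] by simp
  next
    fix u' v' assume "u' \<in> blocks m'" "u = sh (length m) u'" "v' \<in> blocks m'" "v = sh (length m) v'"
      "sum_map m n m' \<phi> \<psi> u = sh (length n) (\<psi> u')" "sum_map m n m' \<phi> \<psi> v = sh (length n) (\<psi> v')"
    then show ?thesis using v(2) \<psi>(5)[of u' v'] by simp
  qed (use v(2) in simp_all)
qed (use assms in \<open>simp_all add: Acat_arrD(1,2) sum_map_def case_prod_unfold restrict_def extensional_def\<close>)

text \<open>A block of \<open>n\<close> can only be hit from \<open>m\<close>, and a block of
  \<open>n'\<close> only from \<open>m'\<close>. Preimages and block maps of the sum are therefore
  computed in one summand, up to the shift of indices.\<close>

lemma axact_sum:
  assumes "(m, n, \<phi>) \<in> Arr Acat" "(m', n', \<psi>) \<in> Arr Acat" "length xs = length m"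
  shows "axact S (m @ m') (n @ n') (sum_map m n m' \<phi> \<psi>) (xs @ ys) = axact S m n \<phi> xs @ axact S m' n' \<psi> ys"
proof (rule nth_equalityI)
  let ?\<chi> = "sum_map m n m' \<phi> \<psi>"
  note \<phi> = Acat_arrD[OF assms(1)] and \<psi> = Acat_arrD[OF assms(2)] and arr = Acat_sum[OF assms(1,2)]
  fix j assume "j < length (axact S (m @ m') (n @ n') ?\<chi> (xs @ ys))"
  then have j: "j < length n + length n'" by simp
  show "axact S (m @ m') (n @ n') ?\<chi> (xs @ ys) ! j = (axact S m n \<phi> xs @ axact S m' n' \<psi> ys) ! j"
  proof (cases "j < length n")
    case True
    show ?thesis
    proof (cases "\<exists>u\<in>blocks m. fst (\<phi> u) = j")
      case ex: True
      then obtain u where u: "u \<in> blocks m" "fst (\<phi> u) = j" by blast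
      then have lt: "fst u < length m" by (simp add: mem_blocks')
      have "block_map (m @ m') ?\<chi> (fst u) j = block_map m \<phi> (fst u) j"
      proof
        fix a
        have "(fst u, a) \<in> blocks (m @ m') \<longleftrightarrow> (fst u, a) \<in> blocks m"
          using lt by (simp add: mem_blocks nth_append)
        then show "block_map (m @ m') ?\<chi> (fst u) j a = block_map m \<phi> (fst u) j a"
          using lt by (auto simp: block_map_def preim_def nth_append sum_map_left)
      qed
      then show ?thesis
        using axact_src[OF arr, of u j S "xs @ ys"] axact_src[OF assms(1) u, of S xs] u lt True assms(3)
        by (simp add: blocks_append sum_map_left nth_append)
    next
      case False
      have "fst (?\<chi> u) \<noteq> j" if "u \<in> blocks (m @ m')" for u
        using that by (cases rule: blocks_appendE) (use False True in \<open>simp_all add: sum_map_left sum_map_right\<close>)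
      then show ?thesis using False True j by (simp add: axact_empty nth_append)
    qed
  next
    case ge: False
    then obtain l where l: "j = length n + l" "l < length n'" using j by (metis add_less_cancel_left le_Suc_ex not_less)
    have left: "fst (?\<chi> u) \<noteq> j" if "u \<in> blocks m" for u
      using \<phi>(3)[OF that] that ge by (auto simp: sum_map_left mem_blocks')
    show ?thesis
    proof (cases "\<exists>v\<in>blocks m'. fst (\<psi> v) = l")
      case ex: True
      then obtain v where v: "v \<in> blocks m'" "fst (\<psi> v) = l" by blast
      have u: "sh (length m) v \<in> blocks (m @ m')" "fst (?\<chi> (sh (length m) v)) = j"
        using v l by (auto simp: blocks_append sum_map_right)
      have "block_map (m @ m') ?\<chi> (length m + fst v) j = block_map m' \<psi> (fst v) l"
      proof
        fix a
        have "(length m + fst v, a) \<in> blocks (m @ m') \<longleftrightarrow> (fst v, a) \<in> blocks m'"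
          by (simp add: mem_blocks nth_append)
        moreover have "(fst v, a) \<in> blocks m' \<Longrightarrow> ?\<chi> (length m + fst v, a) = sh (length n) (\<psi> (fst v, a))"
          using sum_map_right[of "(fst v, a)" m' m n \<phi> \<psi>] by simp
        ultimately show "block_map (m @ m') ?\<chi> (length m + fst v) j a = block_map m' \<psi> (fst v) l a"
          using l by (auto simp: block_map_def preim_def)
      qed
      then show ?thesis
        using axact_src[OF arr u, of S "xs @ ys"] axact_src[OF assms(2) v, of S ys] l assms(3)
        by (simp add: nth_append)
    next
      case False
      have "fst (?\<chi> u) \<noteq> j" if "u \<in> blocks (m @ m')" for u
        using that by (cases rule: blocks_appendE) (use False left l in \<open>simp_all add: sum_map_right\<close>)
      then show ?thesis using False l by (simp add: axact_empty nth_append)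
    qed
  qed
qed simp

lemma block_iso_arr: "block_iso m n \<phi> \<Longrightarrow> (m, n, \<phi>) \<in> Arr Acat"
  by (simp add: block_iso_def)

lemma block_iso_swap:
  assumes "m \<in> Obj Acat" "n \<in> Obj Acat"
  shows "block_iso (m @ n) (n @ m) (block_swap m n)"
proof -
  have *: "(\<exists>v\<in>blocks m. u = v \<and> fst v < length m \<and> block_swap m n u = sh (length n) v) \<or>
    (\<exists>v\<in>blocks n. u = sh (length m) v \<and> fst v < length n \<and> block_swap m n u = v)" if "u \<in> blocks (m @ n)" for u
    using that
  proof (cases rule: blocks_appendE)
    case left
    then show ?thesis by (intro disjI1 bexI[of _ u]) (simp_all add: block_swap_left)
  next
    case (right v)
    then show ?thesis by (intro disjI2 bexI[of _ v]) (simp_all add: block_swap_right)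
  qed
  have "(m @ n, n @ m, block_swap m n) \<in> Arr Acat"
  proof (rule Acat_arrI)
    fix u assume u: "u \<in> blocks (m @ n)"
    show "block_swap m n u \<in> blocks (n @ m)"
      using *[OF u] by (auto simp: blocks_append)
    fix v assume v: "v \<in> blocks (m @ n)" "fst (block_swap m n u) = fst (block_swap m n v)"
    then show "fst u = fst v"
      using *[OF u] *[OF v(1)] by (elim disjE bexE conjE) simp_all
  qed (use assms in \<open>simp_all add: block_swap_def case_prod_unfold restrict_def extensional_def\<close>)
  moreover have "\<exists>i<length (m @ n). (m @ n) ! i = (n @ m) ! j \<and>
      (\<forall>a. (i, a) \<in> blocks (m @ n) \<longrightarrow> block_swap m n (i, a) = (j, a))" if "j < length (n @ m)" for j
  proof (cases "j < length n")
    case True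
    have "block_swap m n (length m + j, a) = (j, a)" if "(length m + j, a) \<in> blocks (m @ n)" for a
      using block_swap_right[of "(j, a)" n m] that True by (simp add: mem_blocks nth_append)
    then show ?thesis using True by (intro exI[of _ "length m + j"]) (simp add: nth_append)
  next
    case False
    have "block_swap m n (j - length n, a) = (j, a)" if "(j - length n, a) \<in> blocks (m @ n)" for a
    proof -
      have "(j - length n, a) \<in> blocks m"
        using that False \<open>j < length (n @ m)\<close> less_diff_conv2[of "length n" j "length m"]
        by (simp add: mem_blocks nth_append split: if_splits)
      then show ?thesis using block_swap_left[of "(j - length n, a)" m n] False by simp
    qed
    then show ?thesis using False that by (intro exI[of _ "j - length n"]) (auto simp: nth_append)
  qed
  ultimately show ?thesis by (simp add: block_iso_def)
qed

text \<open>The inverse sends \<open>(j, a)\<close> to \<open>(i, a)\<close>, where \<open>j\<close> is the image of the block \<open>i\<close>.\<close>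

lemma block_iso_inverse:
  assumes "block_iso m n \<phi>"
  obtains \<psi> where "(n, m, \<psi>) \<in> Arr Acat"
    "compose (blocks m) \<psi> \<phi> = (\<lambda>u\<in>blocks m. u)" "compose (blocks n) \<phi> \<psi> = (\<lambda>u\<in>blocks n. u)"
proof -
  note arr = block_iso_arr[OF assms] note \<phi> = Acat_arrD[OF arr]
  obtain s where s: "\<And>j. j < length n \<Longrightarrow> s j < length m \<and> m ! s j = n ! j \<and>
      (\<forall>a. (s j, a) \<in> blocks m \<longrightarrow> \<phi> (s j, a) = (j, a))"
    using assms unfolding block_iso_def by metis
  let ?\<psi> = "\<lambda>u\<in>blocks n. (s (fst u), snd u)"
  have \<psi>_in: "(s (fst u), snd u) \<in> blocks m" if "u \<in> blocks n" for u
    using s[of "fst u"] that by (simp add: mem_blocks')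
  have \<phi>\<psi>: "\<phi> (?\<psi> u) = u" if "u \<in> blocks n" for u
    using s[of "fst u"] \<psi>_in[OF that] that by (simp add: mem_blocks')
  have \<psi>\<phi>: "?\<psi> (\<phi> u) = u" if u: "u \<in> blocks m" for u
  proof -
    note v = \<phi>(3)[OF u]
    have "\<phi> (?\<psi> (\<phi> u)) = \<phi> u" by (rule \<phi>\<psi>[OF v])
    then have "fst (?\<psi> (\<phi> u)) = fst u" using \<phi>(5)[OF _ u, of "?\<psi> (\<phi> u)"] \<psi>_in[OF v] v by simp
    then have "s (fst (\<phi> u)) = fst u" using v by simp
    moreover from this have "\<phi> u = (fst (\<phi> u), snd u)"
      using s[of "fst (\<phi> u)"] v u by (metis mem_blocks' surjective_pairing)
    ultimately show ?thesis using v by (metis prod.collapse restrict_apply' snd_conv)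
  qed
  show thesis
  proof
    show "(n, m, ?\<psi>) \<in> Arr Acat"
    proof (rule Acat_arrI)
      fix u v assume uv: "u \<in> blocks n" "v \<in> blocks n" "fst (?\<psi> u) = fst (?\<psi> v)"
      then have "s (fst u) = s (fst v)" by simp
      then show "fst u = fst v"
        using s[of "fst u"] s[of "fst v"] uv(1,2) \<psi>_in[OF uv(1)] by (metis mem_blocks' prod.sel(1))
    qed (use \<phi>(1,2) \<psi>_in in simp_all)
    show "compose (blocks m) ?\<psi> \<phi> = (\<lambda>u\<in>blocks m. u)"
      using \<psi>\<phi> by (simp add: compose_def cong: restrict_cong)
    show "compose (blocks n) \<phi> ?\<psi> = (\<lambda>u\<in>blocks n. u)"
      using \<phi>\<psi> by (simp add: compose_def cong: restrict_cong)
  qed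
qed

section \<open>Smash products of pointed maps\<close>

lemma smash_map_lex_pos:
  assumes "as \<in> points ps"
  shows "smash_map ps qs \<psi>s (lex_pos ps as) =
    (let bs = tab (length ps) (\<lambda>i. (\<psi>s ! i) (as ! i)) in if 0 \<in> set bs then 0 else lex_pos qs bs)"
  using lex_pos_in[OF assms] assms by (simp add: smash_map_def)

lemma smash_map_0 [simp]: "smash_map ps qs \<psi>s 0 = 0"
  by (simp add: smash_map_def)

lemma smash_map_eqI:
  assumes "\<And>as. as \<in> points ps \<Longrightarrow> smash_map ps qs \<psi>s (lex_pos ps as) = f (lex_pos ps as)"
    "f 0 = 0" "f \<in> extensional {0..prod_list ps}"
  shows "smash_map ps qs \<psi>s = f"
proof
  fix a
  consider "a = 0" | "1 \<le> a" "a \<le> prod_list ps" | "\<not> a \<le> prod_list ps" by linarith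
  then show "smash_map ps qs \<psi>s a = f a"
  proof cases
    case 2
    then obtain as where "as \<in> points ps" "a = lex_pos ps as" by (rule lex_posE)
    then show ?thesis by (simp only: assms(1))
  next
    case 3
    then show ?thesis using extensional_arb[OF assms(3), of a] by (simp add: smash_map_def)
  qed (simp add: assms(2))
qed

lemma Fcat_tuple_points:
  assumes "Fcat_tuple ps qs \<psi>s" "as \<in> points ps" "0 \<notin> set (tab (length ps) (\<lambda>i. (\<psi>s ! i) (as ! i)))"
  shows "tab (length ps) (\<lambda>i. (\<psi>s ! i) (as ! i)) \<in> points qs"
proof -
  have "(\<psi>s ! i) (as ! i) \<in> {1..qs ! i}" if i: "i < length ps" for i
  proof -
    have "\<psi>s ! i \<in> {0..ps ! i} \<rightarrow>\<^sub>E {0..qs ! i}" using assms(1) i by (simp add: Fcat_tuple_def Fcat_arr)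
    moreover have "as ! i \<in> {0..ps ! i}" using assms(2) i by (simp add: points_def)
    ultimately have "(\<psi>s ! i) (as ! i) \<in> {0..qs ! i}" by (rule PiE_mem)
    moreover have "(\<psi>s ! i) (as ! i) \<noteq> 0" using assms(3) i by (auto simp: image_iff)
    ultimately show ?thesis by simp
  qed
  then show ?thesis using assms(1) by (simp add: points_def Fcat_tuple_def)
qed

lemma smash_arr:
  assumes "Fcat_tuple ps qs \<psi>s"
  shows "smash_arr ps qs \<psi>s \<in> Arr Fcat"
proof -
  have "smash_map ps qs \<psi>s a \<le> prod_list qs" if "a \<le> prod_list ps" for a
  proof (cases "a = 0")
    case False
    with that obtain as where as: "as \<in> points ps" "a = lex_pos ps as" by (elim lex_posE[rotated]) auto
    show ?thesis
      using Fcat_tuple_points[OF assms as(1), THEN lex_pos_in]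
      by (simp add: as smash_map_lex_pos Let_def)
  qed simp
  then show ?thesis by (auto simp: Fcat_arr smash_map_def)
qed

text \<open>The smash product of maps is strictly associative. A flat tuple of values contains 0
  exactly if one of its pieces does; otherwise the positions agree by
  \<open>lex_pos_concat\<close>.\<close>

lemma smash_map_concat:
  assumes "map length \<psi>ss = map length pss" "map length qss = map length pss"
    "\<And>i. i < length pss \<Longrightarrow> Fcat_tuple (pss ! i) (qss ! i) (\<psi>ss ! i)"
  shows "smash_map (concat pss) (concat qss) (concat \<psi>ss) =
    smash_map (map prod_list pss) (map prod_list qss) (tab (length pss) (\<lambda>i. smash_map (pss ! i) (qss ! i) (\<psi>ss ! i)))"
    (is "_ = smash_map ?P ?Q ?\<Psi>")
proof (rule smash_map_eqI)
  note [simp] = map_length_eqD(1)[OF assms(1)] map_length_eqD(1)[OF assms(2)]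
    map_length_eqD(2)[OF assms(1)] map_length_eqD(2)[OF assms(2)]
  fix as assume as: "as \<in> points (concat pss)"
  then have "length as = length (concat pss)" by (simp add: points_def)
  then obtain ass where ass: "as = concat ass" "map length ass = map length pss" by (rule concatE)
  note [simp] = map_length_eqD(1)[OF ass(2)] map_length_eqD(2)[OF ass(2)]
  have pts: "\<forall>i<length pss. ass ! i \<in> points (pss ! i)"
    using as points_concat_iff[OF ass(2)] ass(1) by simp
  define bs where "bs i = tab (length (pss ! i)) (\<lambda>j. (\<psi>ss ! i ! j) (ass ! i ! j))" for i
  have lex: "lex_pos (concat pss) as = lex_pos ?P (map2 lex_pos pss ass)" "map2 lex_pos pss ass \<in> points ?P"
    using lex_pos_concat[of ass pss] pts ass by simp_all
  have conc: "tab (length (concat pss)) (\<lambda>l. (concat \<psi>ss ! l) (as ! l)) = concat (tab (length pss) bs)"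
  proof -
    have "map2 (\<lambda>\<psi> a. \<psi> a) (concat \<psi>ss) (concat ass) = concat (map2 (map2 (\<lambda>\<psi> a. \<psi> a)) \<psi>ss ass)"
      by (rule map2_concat) (use assms(1) ass(2) in simp)
    moreover have "map2 (map2 (\<lambda>\<psi> a. \<psi> a)) \<psi>ss ass = tab (length pss) bs"
      by (rule nth_equalityI) (auto simp: bs_def intro: nth_equalityI)
    moreover have "map2 (\<lambda>\<psi> a. \<psi> a) (concat \<psi>ss) (concat ass) = tab (length (concat pss)) (\<lambda>l. (concat \<psi>ss ! l) (as ! l))"
      using map_length_eqD(3)[OF ass(2)] map_length_eqD(3)[OF assms(1)]
      by (auto simp: ass(1) intro: nth_equalityI)
    ultimately show ?thesis by simp
  qed
  have inner: "smash_map (pss ! i) (qss ! i) (\<psi>ss ! i) (lex_pos (pss ! i) (ass ! i)) =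
      (if 0 \<in> set (bs i) then 0 else lex_pos (qss ! i) (bs i))" if "i < length pss" for i
    using pts that by (simp add: smash_map_lex_pos bs_def Let_def)
  have bs_pts: "bs i \<in> points (qss ! i)" if "i < length pss" "0 \<notin> set (bs i)" for i
    using Fcat_tuple_points[OF assms(3)[OF that(1)], of "ass ! i"] pts that by (simp add: bs_def)
  have tab: "tab (length ?P) (\<lambda>i. (?\<Psi> ! i) (map2 lex_pos pss ass ! i)) =
      tab (length pss) (\<lambda>i. if 0 \<in> set (bs i) then 0 else lex_pos (qss ! i) (bs i))"
    by (rule nth_equalityI) (simp_all add: inner)
  show "smash_map (concat pss) (concat qss) (concat \<psi>ss) (lex_pos (concat pss) as) =
      smash_map ?P ?Q ?\<Psi> (lex_pos (concat pss) as)"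
  proof (cases "\<exists>i<length pss. 0 \<in> set (bs i)")
    case True
    then have "0 \<in> set (concat (tab (length pss) bs))" by auto
    moreover have "0 \<in> set (tab (length ?P) (\<lambda>i. (?\<Psi> ! i) (map2 lex_pos pss ass ! i)))"
      unfolding tab using True by force
    ultimately show ?thesis
      unfolding smash_map_lex_pos[OF as] Let_def conc
      unfolding lex(1) smash_map_lex_pos[OF lex(2)] Let_def by simp
  next
    case False
    have pos: "lex_pos (qss ! i) (bs i) \<ge> 1" if "i < length pss" for i
      using lex_pos_in[OF bs_pts[OF that]] False that by simp
    have "0 \<notin> set (concat (tab (length pss) bs))" using False by auto
    moreover have tab': "tab (length ?P) (\<lambda>i. (?\<Psi> ! i) (map2 lex_pos pss ass ! i)) = map2 lex_pos qss (tab (length pss) bs)"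
      unfolding tab by (rule nth_equalityI) (use False in auto)
    moreover have "0 \<notin> set (map2 lex_pos qss (tab (length pss) bs))"
      using pos by (fastforce simp: in_set_conv_nth)
    moreover have "lex_pos (concat qss) (concat (tab (length pss) bs)) = lex_pos ?Q (map2 lex_pos qss (tab (length pss) bs))"
      using lex_pos_concat[of "tab (length pss) bs" qss] bs_pts False by simp
    ultimately show ?thesis
      unfolding smash_map_lex_pos[OF as] Let_def conc
      unfolding lex(1) smash_map_lex_pos[OF lex(2)] Let_def by simp
  qed
qed (simp_all add: smash_map_def prod_list_concat)

lemma Fcat_tuple_concat:
  assumes "map length \<psi>ss = map length pss" "map length qss = map length pss"
  shows "Fcat_tuple (concat pss) (concat qss) (concat \<psi>ss) \<longleftrightarrow>
    (\<forall>i<length pss. Fcat_tuple (pss ! i) (qss ! i) (\<psi>ss ! i))"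
proof -
  have "(\<forall>l<length (concat pss). (concat pss ! l, concat qss ! l, concat \<psi>ss ! l) \<in> Arr Fcat) \<longleftrightarrow>
    (\<forall>i<length pss. \<forall>j<length (pss ! i). (pss ! i ! j, qss ! i ! j, \<psi>ss ! i ! j) \<in> Arr Fcat)"
    using all_concat_iff[OF assms(2,2,1), of "\<lambda>q _ p \<psi>. (p, q, \<psi>) \<in> Arr Fcat"] .
  then show ?thesis
    using map_length_eqD[OF assms(1)] map_length_eqD[OF assms(2)] by (simp add: Fcat_tuple_def)
qed

lemma Fcat_tuple_smash:
  assumes "length qss = length pss" "\<And>i. i < length pss \<Longrightarrow> Fcat_tuple (pss ! i) (qss ! i) (\<psi>ss ! i)"
  shows "Fcat_tuple (map prod_list pss) (map prod_list qss)
    (tab (length pss) (\<lambda>i. smash_map (pss ! i) (qss ! i) (\<psi>ss ! i)))"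
  using assms smash_arr by (simp add: Fcat_tuple_def)

section \<open>Operations of Gamma-sets\<close>

definition gtup :: "'a gset list \<Rightarrow> nat list \<Rightarrow> 'a list set" where
  "gtup Ss ps = {xs. length xs = length Ss \<and> (\<forall>i<length Ss. xs ! i \<in> GS (Ss ! i) (ps ! i))}"

text \<open>Source and target elements may have different types since three instances are intended:
  object maps and arrow maps of an operation, and modifications, which send tuples of objects to
  arrows.\<close>

locale gset_op =
  fixes Ss :: "'a gset list" and T :: "'b gset" and H :: "nat list \<Rightarrow> 'a list \<Rightarrow> 'b"
  assumes gset_Ss: "S \<in> set Ss \<Longrightarrow> gset S"
    and H_in: "\<lbrakk>length ps = length Ss; xs \<in> gtup Ss ps\<rbrakk> \<Longrightarrow> H ps xs \<in> GS T (prod_list ps)"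
    and H_base: "\<lbrakk>length ps = length Ss; xs \<in> gtup Ss ps; i < length Ss; xs ! i = GB (Ss ! i) (ps ! i)\<rbrakk>
      \<Longrightarrow> H ps xs = GB T (prod_list ps)"
    and H_nat: "\<lbrakk>Fcat_tuple ps qs \<psi>s; length ps = length Ss; xs \<in> gtup Ss ps\<rbrakk>
      \<Longrightarrow> GA T (smash_arr ps qs \<psi>s) (H ps xs) =
        H qs (tab (length Ss) (\<lambda>i. GA (Ss ! i) (ps ! i, qs ! i, \<psi>s ! i) (xs ! i)))"

lemma gtup_concatE:
  assumes "xs \<in> gtup (concat Sss) (concat pss)" "map length pss = map length Sss"
  obtains xss where "xs = concat xss" "map length xss = map length Sss"
    "\<And>i. i < length Sss \<Longrightarrow> xss ! i \<in> gtup (Sss ! i) (pss ! i)"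
proof -
  have "length xs = length (concat Sss)" using assms(1) by (simp add: gtup_def)
  then obtain xss where xss: "xs = concat xss" "map length xss = map length Sss" by (rule concatE)
  have "\<forall>i<length Sss. \<forall>j<length (Sss ! i). xss ! i ! j \<in> GS (Sss ! i ! j) (pss ! i ! j)"
    using all_concat_iff[OF xss(2,2) assms(2), of "\<lambda>x _ S p. x \<in> GS S p"] assms(1)
    by (simp add: gtup_def xss(1))
  then show thesis
    using that[OF xss] map_length_eqD[OF xss(2)] by (simp add: gtup_def)
qed

lemma gtup_concat:
  assumes "map length pss = map length Sss" "length xss = length Sss"
    "\<And>i. i < length Sss \<Longrightarrow> xss ! i \<in> gtup (Sss ! i) (pss ! i)"
  shows "concat xss \<in> gtup (concat Sss) (concat pss)"
proof -
  have len: "map length xss = map length Sss"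
    using assms(2,3) by (intro map_length_eqI) (auto simp: gtup_def)
  have "\<forall>l<length (concat Sss). concat xss ! l \<in> GS (concat Sss ! l) (concat pss ! l)"
    using all_concat_iff[OF len len assms(1), of "\<lambda>x _ S p. x \<in> GS S p"] assms(3)
    by (simp add: gtup_def)
  then show ?thesis using map_length_eqD[OF len] by (simp add: gtup_def)
qed

text \<open>\<open>K\<close> is prescribed only by its values on concatenated arguments. One proof
  then covers the composite on objects, the composite on arrows, and both factors of a horizontal
  composite of modifications.\<close>

lemma gset_op_comp:
  assumes H: "gset_op Ts U H" and len: "length Sss = length Ts"
    and Hs: "\<And>i. i < length Ts \<Longrightarrow> gset_op (Sss ! i) (Ts ! i) (Hs i)"
    and K: "\<And>pss xss. \<lbrakk>map length pss = map length Sss; length xss = length Sss;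
        \<And>i. i < length Ts \<Longrightarrow> xss ! i \<in> gtup (Sss ! i) (pss ! i)\<rbrakk>
      \<Longrightarrow> K (concat pss) (concat xss) = H (map prod_list pss) (tab (length Ts) (\<lambda>i. Hs i (pss ! i) (xss ! i)))"
  shows "gset_op (concat Sss) U K"
proof -
  interpret H: gset_op Ts U H by fact
  have inn: "tab (length Ts) (\<lambda>i. Hs i (pss ! i) (xss ! i)) \<in> gtup Ts (map prod_list pss)"
    if "map length pss = map length Sss" "\<And>i. i < length Sss \<Longrightarrow> xss ! i \<in> gtup (Sss ! i) (pss ! i)"
    for pss xss
    using that len gset_op.H_in[OF Hs] map_length_eqD[OF that(1)] by (simp add: gtup_def)
  show ?thesis
  proof (rule gset_op.intro)
    fix S assume "S \<in> set (concat Sss)"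
    then obtain i where "i < length Sss" "S \<in> set (Sss ! i)" by (auto simp: in_set_conv_nth[of _ Sss])
    then show "gset S" using gset_op.gset_Ss[OF Hs, of i S] len by simp
  next
    fix ps xs assume ps: "length ps = length (concat Sss)" and xs: "xs \<in> gtup (concat Sss) ps"
    obtain pss where pss: "ps = concat pss" "map length pss = map length Sss" using ps by (rule concatE)
    obtain xss where xss: "xs = concat xss" "map length xss = map length Sss"
      "\<And>i. i < length Sss \<Longrightarrow> xss ! i \<in> gtup (Sss ! i) (pss ! i)"
      using gtup_concatE[OF xs[unfolded pss(1)] pss(2)] by metis
    note lens = map_length_eqD[OF pss(2)] map_length_eqD[OF xss(2)]
    have K': "K ps xs = H (map prod_list pss) (tab (length Ts) (\<lambda>i. Hs i (pss ! i) (xss ! i)))"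
      unfolding pss xss(1) by (rule K) (use pss xss lens len in auto)
    show "K ps xs \<in> GS U (prod_list ps)"
      unfolding K' using H.H_in[OF _ inn[OF pss(2) xss(3)]] lens len by (simp add: pss(1) prod_list_concat)
    {
      fix l assume l: "l < length (concat Sss)" "xs ! l = GB (concat Sss ! l) (ps ! l)"
      obtain i j where ij: "locate (map length Sss) l = (i, j)" by fastforce
      note * = concat_cong_locate[OF pss(2) l(1) ij] concat_cong_locate[OF refl l(1) ij]
        concat_cong_locate[OF xss(2) l(1) ij]
      have i: "i < length Ts" "j < length (Sss ! i)" using * len by simp_all
      \<comment> \<open>A basepoint among the inputs makes the value of one inner operation a
        basepoint, which in turn makes the outer value a basepoint.\<close>
      have "Hs i (pss ! i) (xss ! i) = GB (Ts ! i) (prod_list (pss ! i))"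
        by (rule gset_op.H_base[OF Hs[OF i(1)] _ xss(3) i(2)]) (use i len lens l(2) * in \<open>simp_all add: pss xss\<close>)
      then show "K ps xs = GB U (prod_list ps)"
        unfolding K' using i len lens
        by (subst H.H_base[OF _ inn[OF pss(2) xss(3)] i(1)]) (simp_all add: pss(1) prod_list_concat)
    }
    fix qs \<psi>s assume F: "Fcat_tuple ps qs \<psi>s"
    then have lq: "length qs = length (concat Sss)" and l\<psi>: "length \<psi>s = length (concat Sss)"
      using ps by (simp_all add: Fcat_tuple_def)
    obtain qss where qss: "qs = concat qss" "map length qss = map length Sss" using lq by (rule concatE)
    obtain \<psi>ss where \<psi>ss: "\<psi>s = concat \<psi>ss" "map length \<psi>ss = map length Sss" using l\<psi> by (rule concatE)
    have F': "Fcat_tuple (pss ! i) (qss ! i) (\<psi>ss ! i)" if "i < length Ts" for i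
      using F that pss qss \<psi>ss lens len Fcat_tuple_concat[of \<psi>ss pss qss] by simp
    have len': "length qss = length Ts" "length \<psi>ss = length Ts" "length pss = length Ts" "length xss = length Ts"
      using map_length_eqD(1)[OF qss(2)] map_length_eqD(1)[OF \<psi>ss(2)] lens len by simp_all
    define yss where "yss = tab (length Ts) (\<lambda>i. tab (length (Sss ! i)) (\<lambda>j. GA (Sss ! i ! j) (pss ! i ! j, qss ! i ! j, \<psi>ss ! i ! j) (xss ! i ! j)))"
    have ylen: "map length yss = map length Sss"
      by (rule map_length_eqI) (simp_all add: yss_def len)
    have "\<forall>l<length (concat Sss). concat yss ! l = GA (concat Sss ! l) (ps ! l, qs ! l, \<psi>s ! l) (xs ! l)"
    proof (intro allI impI)
      fix l assume l: "l < length (concat Sss)"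
      obtain i j where ij: "locate (map length Sss) l = (i, j)" by fastforce
      have "i < length Ts" "j < length (Sss ! i)"
        using concat_cong_locate(1,2)[OF refl l ij] len by simp_all
      then show "concat yss ! l = GA (concat Sss ! l) (ps ! l, qs ! l, \<psi>s ! l) (xs ! l)"
        unfolding concat_cong_locate(3)[OF ylen l ij] concat_cong_locate(3)[OF refl l ij]
          pss(1) concat_cong_locate(3)[OF pss(2) l ij] qss(1) concat_cong_locate(3)[OF qss(2) l ij]
          \<psi>ss(1) concat_cong_locate(3)[OF \<psi>ss(2) l ij] xss(1) concat_cong_locate(3)[OF xss(2) l ij]
        by (simp add: yss_def)
    qed
    then have y: "tab (length (concat Sss)) (\<lambda>l. GA (concat Sss ! l) (ps ! l, qs ! l, \<psi>s ! l) (xs ! l)) = concat yss"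
      using map_length_eqD(3)[OF ylen] by (simp add: tab_eq_iff)
    have nat: "GA (Ts ! i) (smash_arr (pss ! i) (qss ! i) (\<psi>ss ! i)) (Hs i (pss ! i) (xss ! i)) = Hs i (qss ! i) (yss ! i)"
      if i: "i < length Ts" for i
      using gset_op.H_nat[OF Hs[OF i] F'[OF i] _ xss(3)] i lens len by (simp add: yss_def)
    have yin: "yss ! i \<in> gtup (Sss ! i) (qss ! i)" if i: "i < length Ts" for i
    proof -
      have "gset (Sss ! i ! j)" if "j < length (Sss ! i)" for j
        using gset_op.gset_Ss[OF Hs[OF i], of "Sss ! i ! j"] that by simp
      then show ?thesis
        using F'[OF i] xss(3)[of i] i len lens
        by (simp add: yss_def gtup_def Fcat_tuple_def) (blast intro: gset.GA_in)
    qed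
    \<comment> \<open>Outer naturality is used along the smash products of the inner maps; by
      \<open>smash_map_concat\<close> their smash product is that of the whole list. Inner
      naturality then identifies each argument.\<close>
    have "GA U (smash_arr ps qs \<psi>s) (K ps xs) = GA U (smash_arr (map prod_list pss) (map prod_list qss)
        (tab (length pss) (\<lambda>i. smash_map (pss ! i) (qss ! i) (\<psi>ss ! i))))
        (H (map prod_list pss) (tab (length Ts) (\<lambda>i. Hs i (pss ! i) (xss ! i))))"
      unfolding K' using smash_map_concat[of \<psi>ss pss qss] F' len' pss(2) qss(2) \<psi>ss(2)
      by (simp add: pss(1) qss(1) \<psi>ss(1) prod_list_concat)
    also have "\<dots> = H (map prod_list qss) (tab (length Ts) (\<lambda>i. Hs i (qss ! i) (yss ! i)))"
      by (subst H.H_nat[OF Fcat_tuple_smash _ inn[OF pss(2) xss(3)]])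
        (use len' F' len nat in \<open>auto intro!: arg_cong[where f = "H _"] nth_equalityI\<close>)
    also have "\<dots> = K qs (concat yss)"
      unfolding qss(1) by (rule K[symmetric]) (use qss(2) yin len in \<open>auto simp: yss_def\<close>)
    finally show "GA U (smash_arr ps qs \<psi>s) (K ps xs) =
        K qs (tab (length (concat Sss)) (\<lambda>l. GA (concat Sss ! l) (ps ! l, qs ! l, \<psi>s ! l) (xs ! l)))"
      unfolding y .
  qed
qed

section \<open>Operations on sequences\<close>

definition multi :: "(nat list \<Rightarrow> 'a list \<Rightarrow> 'b) \<Rightarrow> nat list list \<Rightarrow> 'a list list \<Rightarrow> 'b list" where
  "multi H ms xs = map (\<lambda>js. H (pick ms js) (pick xs js)) (indices ms)"

definition fam :: "'a gset list \<Rightarrow> nat list list \<Rightarrow> 'a list list \<Rightarrow> bool" where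
  "fam Ss ms xs \<longleftrightarrow> length ms = length Ss \<and> length xs = length Ss \<and>
    (\<forall>i<length Ss. ms ! i \<in> Obj Acat \<and> xs ! i \<in> axc (Ss ! i) (ms ! i))"

definition Acat_tuple :: "nat list list \<Rightarrow> nat list list \<Rightarrow> (nat \<times> nat \<Rightarrow> nat \<times> nat) list \<Rightarrow> bool" where
  "Acat_tuple ms ns \<phi>s \<longleftrightarrow> length ns = length ms \<and> length \<phi>s = length ms \<and>
    (\<forall>i<length ms. (ms ! i, ns ! i, \<phi>s ! i) \<in> Arr Acat)"

lemma length_multi [simp]: "length (multi H ms xs) = length (indices ms)"
  by (simp add: multi_def)

lemma nth_multi:
  "js \<in> set (indices ms) \<Longrightarrow> multi H ms xs ! pos (indices ms) js = H (pick ms js) (pick xs js)"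
  by (simp add: multi_def)

lemma multi_nth_cases:
  assumes "l < length (indices ms)"
  obtains js where "js \<in> set (indices ms)" "l = pos (indices ms) js" "length js = length ms"
    "\<forall>i<length ms. js ! i < length (ms ! i)"
proof
  show "indices ms ! l \<in> set (indices ms)" using assms by simp
  then show "length (indices ms ! l) = length ms" "\<forall>i<length ms. indices ms ! l ! i < length (ms ! i)"
    by (auto simp: mem_tuples)
  show "l = pos (indices ms) (indices ms ! l)" using assms by (simp add: pos_eqI)
qed

lemma pick_gtup:
  assumes "fam Ss ms xs" "js \<in> set (indices ms)"
  shows "pick xs js \<in> gtup Ss (pick ms js)" "length (pick ms js) = length Ss"
proof -
  have "length js = length Ss" "\<forall>i<length Ss. js ! i < length (ms ! i)"
    using assms by (auto simp: mem_tuples fam_def)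
  moreover have "\<forall>i<length Ss. \<forall>j<length (ms ! i). xs ! i ! j \<in> GS (Ss ! i) (ms ! i ! j)"
    using assms(1) by (auto simp: fam_def axc_def)
  ultimately show "pick xs js \<in> gtup Ss (pick ms js)" "length (pick ms js) = length Ss"
    using assms(1) by (auto simp: gtup_def fam_def)
qed

lemma (in gset_op) multi_in:
  assumes "fam Ss ms xs"
  shows "multi H ms xs \<in> axc T (multi_seq ms)"
proof (rule axcI)
  fix l assume "l < length (multi_seq ms)"
  then have "l < length (indices ms)" by simp
  then obtain js where js: "js \<in> set (indices ms)" "l = pos (indices ms) js" by (rule multi_nth_cases)
  show "multi H ms xs ! l \<in> GS T (multi_seq ms ! l)"
    using H_in[OF pick_gtup(2,1)[OF assms js(1)]] js by (simp add: nth_multi nth_multi_seq)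
qed simp

lemma multi_seq_Obj: "(\<And>i. i < length ms \<Longrightarrow> ms ! i \<in> Obj Acat) \<Longrightarrow> multi_seq ms \<in> Obj Acat"
proof -
  assume *: "\<And>i. i < length ms \<Longrightarrow> ms ! i \<in> Obj Acat"
  have "0 < prod_list (pick ms js)" if js: "js \<in> set (indices ms)" for js
  proof -
    have "length js = length ms" "\<forall>i<length ms. js ! i < length (ms ! i)" using js by (auto simp: mem_tuples)
    then have "\<forall>i<length (pick ms js). 0 < pick ms js ! i"
      using * by (simp add: Acat_Obj)
    then have "0 \<notin> set (pick ms js)" unfolding all_set_conv_all_nth[symmetric] by auto
    then show ?thesis by (simp add: prod_list_zero_iff zero_less_iff_neq_zero)
  qed
  then show ?thesis by (simp add: Acat_def multi_seq_def)
qed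

lemma Acat_tuple_box:
  "\<lbrakk>Acat_tuple ms ns \<phi>s; us \<in> box ms\<rbrakk> \<Longrightarrow> tab (length ms) (\<lambda>i. (\<phi>s ! i) (us ! i)) \<in> box ns"
  by (simp add: Acat_tuple_def box_def) (blast intro: Acat_arrD(3))

text \<open>The block of an enumerated element is determined by the blocks of its coordinates
  (\<open>fst_en_eq_iff\<close>), so separation of blocks can be checked one coordinate at a
  time.\<close>

lemma multi_map_arr:
  assumes "Acat_tuple ms ns \<phi>s"
  shows "(multi_seq ms, multi_seq ns, multi_map ms ns \<phi>s) \<in> Arr Acat"
proof (rule Acat_arrI)
  have arr: "(ms ! i, ns ! i, \<phi>s ! i) \<in> Arr Acat" if "i < length ms" for i
    using assms that by (simp add: Acat_tuple_def)
  have len: "length ns = length ms" using assms by (simp add: Acat_tuple_def)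
  show "multi_seq ms \<in> Obj Acat" "multi_seq ns \<in> Obj Acat"
    using Acat_arrD(1,2)[OF arr] len by (auto intro!: multi_seq_Obj)
  show "multi_map ms ns \<phi>s \<in> extensional (blocks (multi_seq ms))"
    by (simp add: multi_map_def)
  fix u assume "u \<in> blocks (multi_seq ms)"
  then obtain us where us: "us \<in> box ms" "u = en ms us" by (rule en_E)
  note us' = Acat_tuple_box[OF assms us(1)]
  show "multi_map ms ns \<phi>s u \<in> blocks (multi_seq ns)"
    using en_in[OF us'] by (simp add: us multi_map_en)
  fix v assume "v \<in> blocks (multi_seq ms)" and eq: "fst (multi_map ms ns \<phi>s u) = fst (multi_map ms ns \<phi>s v)"
  then obtain vs where vs: "vs \<in> box ms" "v = en ms vs" by (elim en_E)
  note vs' = Acat_tuple_box[OF assms vs(1)]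
  have "map fst (tab (length ms) (\<lambda>i. (\<phi>s ! i) (us ! i))) = map fst (tab (length ms) (\<lambda>i. (\<phi>s ! i) (vs ! i)))"
    using eq by (simp only: us vs multi_map_en fst_en_eq_iff[OF us' vs'])
  then have "fst ((\<phi>s ! i) (us ! i)) = fst ((\<phi>s ! i) (vs ! i))" if "i < length ms" for i
    using that by simp
  then have "fst (us ! i) = fst (vs ! i)" if "i < length ms" for i
    using that us(1) vs(1) Acat_arrD(5)[OF arr[OF that], of "us ! i" "vs ! i"] by (simp add: box_def)
  then have "map fst us = map fst vs"
    using us(1) vs(1) by (intro nth_equalityI) (simp_all add: box_def)
  then show "fst u = fst v" by (simp add: us vs en_def)
qed

text \<open>A tuple lands in block \<open>ls\<close> exactly if each coordinate lands in block
  \<open>ls ! i\<close>. Then all values are at least 1 and are encoded by \<open>lex_pos\<close>;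
  otherwise some coordinate block map gives 0, and a smash product with a zero coordinate is
  0.\<close>

lemma block_map_multi:
  assumes "Acat_tuple ms ns \<phi>s" "js \<in> set (indices ms)" "ls \<in> set (indices ns)"
  shows "block_map (multi_seq ms) (multi_map ms ns \<phi>s) (pos (indices ms) js) (pos (indices ns) ls) =
    smash_map (pick ms js) (pick ns ls)
      (tab (length ms) (\<lambda>i. block_map (ms ! i) (\<phi>s ! i) (js ! i) (ls ! i)))" (is "?f = smash_map _ _ ?\<psi>s")
proof (rule smash_map_eqI[symmetric])
  have js: "length js = length ms" "\<And>i. i < length ms \<Longrightarrow> js ! i < length (ms ! i)"
    using assms(2) by (auto simp: mem_tuples)
  have ls: "length ls = length ms" using assms(1,3) by (auto simp: mem_tuples Acat_tuple_def)
  fix as assume as: "as \<in> points (pick ms js)"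
  then have las: "length as = length ms" using js by (simp add: points_def)
  define us where "us = zip js as"
  have us: "us \<in> box ms" "map fst us = js" "map snd us = as"
    using as js las by (auto simp: us_def box_def mem_blocks points_def)
  have nth_us: "us ! i = (js ! i, as ! i)" if "i < length ms" for i
    using that js las by (simp add: us_def)
  let ?vs = "tab (length ms) (\<lambda>i. (\<phi>s ! i) (us ! i))"
  have vs: "?vs \<in> box ns" by (rule Acat_tuple_box[OF assms(1) us(1)])
  have en: "en ms us = (pos (indices ms) js, lex_pos (pick ms js) as)"
    by (simp add: en_def us)
  have b: "block_map (ms ! i) (\<phi>s ! i) (js ! i) (ls ! i) (as ! i) =
      (if fst (?vs ! i) = ls ! i then snd (?vs ! i) else 0)" if "i < length ms" for i
    using us(1) that nth_us by (simp add: block_map_eq box_def)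
  have f: "?f (lex_pos (pick ms js) as) = (if fst (en ns ?vs) = pos (indices ns) ls then snd (en ns ?vs) else 0)"
    using block_map_eq[of "pos (indices ms) js" "lex_pos (pick ms js) as" "multi_seq ms"] en_in[OF us(1)]
      multi_map_en[OF us(1)] by (simp add: en)
  have g: "smash_map (pick ms js) (pick ns ls) ?\<psi>s (lex_pos (pick ms js) as) =
    (let bs = tab (length ms) (\<lambda>i. if fst (?vs ! i) = ls ! i then snd (?vs ! i) else 0)
     in if 0 \<in> set bs then 0 else lex_pos (pick ns ls) bs)"
  proof -
    have "tab (length (pick ms js)) (\<lambda>i. (?\<psi>s ! i) (as ! i)) =
        tab (length ms) (\<lambda>i. if fst (?vs ! i) = ls ! i then snd (?vs ! i) else 0)"
      using b js by (intro nth_equalityI) simp_all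
    then show ?thesis unfolding smash_map_lex_pos[OF as] by (simp only:)
  qed
  show "smash_map (pick ms js) (pick ns ls) ?\<psi>s (lex_pos (pick ms js) as) = ?f (lex_pos (pick ms js) as)"
  proof (cases "map fst ?vs = ls")
    case True
    then have eq: "fst (?vs ! i) = ls ! i" if "i < length ms" for i
      using that by (metis length_map length_upt minus_nat.diff_0 nth_map)
    have "snd (?vs ! i) \<ge> 1" if "i < length ms" for i
    proof -
      have "i < length ns" using vs that by (simp add: box_def)
      then have "?vs ! i \<in> blocks (ns ! i)" using vs unfolding box_def by blast
      then show ?thesis unfolding mem_blocks' by blast
    qed
    then have "0 \<notin> set (map snd ?vs)" by fastforce
    moreover have "tab (length ms) (\<lambda>i. if fst (?vs ! i) = ls ! i then snd (?vs ! i) else 0) = map snd ?vs"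
      using eq by (intro nth_equalityI) simp_all
    ultimately show ?thesis unfolding f g Let_def by (simp only: en_def True fst_conv snd_conv if_False refl if_True)
  next
    case False
    then obtain i where i: "i < length ms" "fst (?vs ! i) \<noteq> ls ! i"
      using ls nth_equalityI[of "map fst ?vs" ls] by auto
    then have "0 \<in> set (tab (length ms) (\<lambda>i. if fst (?vs ! i) = ls ! i then snd (?vs ! i) else 0))"
      by force
    moreover have "fst (en ns ?vs) \<noteq> pos (indices ns) ls"
      using False pos_eq_iff[OF distinct_tuples box_indices[OF vs] assms(3)] by (simp only: en_def fst_conv) blast
    ultimately show ?thesis unfolding f g Let_def by (simp only: if_True if_False)
  qed
next
  show "?f \<in> extensional {0..prod_list (pick ms js)}"
    using assms(2) by (simp add: block_map_def nth_multi_seq)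
qed simp

text \<open>At the entry \<open>ls\<close> there are two cases. If every coordinate block is hit,
  the block map is a smash product by \<open>block_map_multi\<close> and \<open>H_nat\<close>
  applies. If some coordinate is missed, the product block is missed too, and on the other side that
  input is a basepoint, so \<open>H_base\<close> applies.\<close>

lemma (in gset_op) multi_natural:
  assumes "Acat_tuple ms ns \<phi>s" "fam Ss ms xs"
  shows "axact T (multi_seq ms) (multi_seq ns) (multi_map ms ns \<phi>s) (multi H ms xs) =
    multi H ns (tab (length Ss) (\<lambda>i. axact (Ss ! i) (ms ! i) (ns ! i) (\<phi>s ! i) (xs ! i)))"
    (is "_ = multi H ns ?ys")
proof (rule nth_equalityI)
  let ?\<phi> = "multi_map ms ns \<phi>s" and ?a = "axact T (multi_seq ms) (multi_seq ns) (multi_map ms ns \<phi>s) (multi H ms xs)"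
  have len: "length ms = length Ss" "length ns = length Ss" "length xs = length Ss"
    using assms by (simp_all add: Acat_tuple_def fam_def)
  have arr: "(ms ! i, ns ! i, \<phi>s ! i) \<in> Arr Acat" if "i < length Ss" for i
    using assms that by (simp add: Acat_tuple_def fam_def)
  fix l assume "l < length ?a"
  then have "l < length (indices ns)" by simp
  then obtain ls where ls: "ls \<in> set (indices ns)" "l = pos (indices ns) ls" "length ls = length ns"
    "\<forall>i<length ns. ls ! i < length (ns ! i)" by (rule multi_nth_cases)
  have gs: "gset (Ss ! i)" if "i < length Ss" for i using gset_Ss that by simp
  have fam': "fam Ss ns ?ys"
    using arr assms(2) gset.axact_in[OF gs] Acat_arrD(2)[OF arr] len by (auto simp: fam_def)
  show "?a ! l = multi H ns ?ys ! l"
  proof (cases "\<forall>i<length Ss. \<exists>u\<in>blocks (ms ! i). fst ((\<phi>s ! i) u) = ls ! i")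
    case True
    then obtain f where f: "\<And>i. i < length Ss \<Longrightarrow> f i \<in> blocks (ms ! i) \<and> fst ((\<phi>s ! i) (f i)) = ls ! i"
      by metis
    \<comment> \<open>One chosen element per coordinate assembles to an element of the product that
      maps into block \<open>ls\<close>; its blocks \<open>js\<close> give the source of this
      entry.\<close>
    define us where "us = tab (length Ss) f"
    have us: "us \<in> box ms" using f len by (simp add: us_def box_def)
    have "map fst (tab (length ms) (\<lambda>i. (\<phi>s ! i) (us ! i))) = ls"
      using f ls(3) len by (intro nth_equalityI) (simp_all add: us_def)
    then have fl: "fst (?\<phi> (en ms us)) = l"
      by (simp only: multi_map_en[OF us]) (simp only: en_def fst_conv ls(2))
    define js where "js = map fst us"
    have js: "js \<in> set (indices ms)" "fst (en ms us) = pos (indices ms) js"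
      using box_indices[OF us] by (simp_all add: js_def en_def)
    have ljs: "length js = length Ss" "\<And>i. i < length Ss \<Longrightarrow> js ! i < length (ms ! i)"
      using js(1) len by (auto simp: mem_tuples)
    let ?\<psi>s = "tab (length ms) (\<lambda>i. block_map (ms ! i) (\<phi>s ! i) (js ! i) (ls ! i))"
    have F: "Fcat_tuple (pick ms js) (pick ns ls) ?\<psi>s"
      using ljs ls len block_map_Fcat[OF arr] by (simp add: Fcat_tuple_def)
    have "?a ! l = GA T (smash_arr (pick ms js) (pick ns ls) ?\<psi>s) (H (pick ms js) (pick xs js))"
      using axact_src[OF multi_map_arr[OF assms(1)] en_in[OF us] fl, of T "multi H ms xs"]
        block_map_multi[OF assms(1) js(1) ls(1)] js ls(1)
      by (simp add: js(2) ls(2) nth_multi nth_multi_seq)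
    also have "\<dots> = H (pick ns ls) (tab (length Ss) (\<lambda>i. GA (Ss ! i) (pick ms js ! i, pick ns ls ! i, ?\<psi>s ! i) (pick xs js ! i)))"
      by (rule H_nat[OF F pick_gtup(2,1)[OF assms(2) js(1)]])
    also have "tab (length Ss) (\<lambda>i. GA (Ss ! i) (pick ms js ! i, pick ns ls ! i, ?\<psi>s ! i) (pick xs js ! i)) = pick ?ys ls"
    proof (rule nth_equalityI)
      fix i assume "i < length (tab (length Ss) (\<lambda>i. GA (Ss ! i) (pick ms js ! i, pick ns ls ! i, ?\<psi>s ! i) (pick xs js ! i)))"
      then have i: "i < length Ss" by simp
      have "js ! i = fst (f i)" using i by (simp add: js_def us_def)
      with i show "tab (length Ss) (\<lambda>i. GA (Ss ! i) (pick ms js ! i, pick ns ls ! i, ?\<psi>s ! i) (pick xs js ! i)) ! i = pick ?ys ls ! i"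
        using axact_src[OF arr[OF i], of "f i" "ls ! i" "Ss ! i" "xs ! i"] f[OF i] len ljs ls by simp
    qed (use ls(3) len in simp)
    finally show ?thesis using ls by (simp add: nth_multi)
  next
    case False
    then obtain i where i: "i < length Ss" "\<And>u. u \<in> blocks (ms ! i) \<Longrightarrow> fst ((\<phi>s ! i) u) \<noteq> ls ! i" by blast
    have "fst (?\<phi> u) \<noteq> l" if u: "u \<in> blocks (multi_seq ms)" for u
    proof
      assume eq: "fst (?\<phi> u) = l"
      obtain us where us: "us \<in> box ms" "u = en ms us" using u by (rule en_E)
      let ?vs = "tab (length ms) (\<lambda>i. (\<phi>s ! i) (us ! i))"
      have "map fst ?vs = ls"
        using eq pos_eq_iff[OF distinct_tuples box_indices[OF Acat_tuple_box[OF assms(1) us(1)]] ls(1)]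
        by (simp only: us(2) multi_map_en[OF us(1)] ls(2)) (simp only: en_def fst_conv)
      then have "fst ((\<phi>s ! i) (us ! i)) = ls ! i" using i(1) len by auto
      then show False using i us(1) len by (simp add: box_def)
    qed
    then have "?a ! l = GB T (prod_list (pick ns ls))"
      using axact_empty[of l "multi_seq ns" "multi_seq ms" ?\<phi> T "multi H ms xs"] ls(1)
      by (simp add: ls(2) nth_multi_seq)
    moreover have "pick ?ys ls ! i = GB (Ss ! i) (pick ns ls ! i)"
      using axact_empty[of "ls ! i" "ns ! i" "ms ! i" "\<phi>s ! i" "Ss ! i" "xs ! i"] i ls len by simp
    ultimately show ?thesis
      using H_base[OF pick_gtup(2,1)[OF fam' ls(1)] i(1)] ls by (simp add: nth_multi)
  qed
qed simp

section \<open>The linearity constraints on blocks\<close>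

text \<open>A criterion on elements. Since target blocks are nonempty, surjectivity on elements
  provides a source block for each of them, and preservation of positions makes the map identical on
  it.\<close>

lemma block_isoI:
  assumes "(m, n, \<phi>) \<in> Arr Acat"
    "\<And>u. u \<in> blocks m \<Longrightarrow> snd (\<phi> u) = snd u \<and> n ! fst (\<phi> u) = m ! fst u"
    "\<And>u v. \<lbrakk>u \<in> blocks m; v \<in> blocks m; fst u = fst v\<rbrakk> \<Longrightarrow> fst (\<phi> u) = fst (\<phi> v)"
    "\<And>v. v \<in> blocks n \<Longrightarrow> \<exists>u\<in>blocks m. \<phi> u = v"
  shows "block_iso m n \<phi>"
proof -
  have "\<exists>i<length m. m ! i = n ! j \<and> (\<forall>a. (i, a) \<in> blocks m \<longrightarrow> \<phi> (i, a) = (j, a))" if j: "j < length n" for j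
  proof -
    have "(j, 1) \<in> blocks n" using Acat_arrD(2)[OF assms(1)] j by (simp add: Acat_Obj mem_blocks Suc_le_eq)
    then obtain u where u: "u \<in> blocks m" "fst (\<phi> u) = j" using assms(4) by force
    have "\<phi> (fst u, a) = (j, a)" if "(fst u, a) \<in> blocks m" for a
      using assms(2)[OF that] assms(3)[OF that u(1)] u(2) by (simp add: prod_eq_iff)
    then show ?thesis using assms(2)[OF u(1)] u by (intro exI[of _ "fst u"]) (simp add: mem_blocks')
  qed
  then show ?thesis using assms(1) by (simp add: block_iso_def)
qed

lemma pick_append_left:
  "\<lbrakk>b < length xs; js ! b < length (xs ! b)\<rbrakk> \<Longrightarrow> pick (xs[b := xs ! b @ x']) js = pick xs js"
  by (auto simp: nth_list_update nth_append intro!: nth_equalityI)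

lemma pick_append_right:
  "\<lbrakk>b < length xs; length js = length xs\<rbrakk>
    \<Longrightarrow> pick (xs[b := xs ! b @ x']) (js[b := length (xs ! b) + js ! b]) = pick (xs[b := x']) js"
  by (auto simp: nth_list_update nth_append intro!: nth_equalityI)

lemma map_fst_sh: "b < length us \<Longrightarrow> map fst (us[b := sh d (us ! b)]) = (map fst us)[b := d + map fst us ! b]"
  by (simp add: map_update)

lemma sigma_blocksE:
  assumes "u \<in> blocks (multi_seq ms @ multi_seq (ms[b := m']))"
  obtains (left) us where "us \<in> box ms" "u = en ms us" "fst u < length (multi_seq ms)"
  | (right) us where "us \<in> box (ms[b := m'])" "u = sh (length (multi_seq ms)) (en (ms[b := m']) us)"
  using assms
proof (cases rule: blocks_appendE)
  case left
  then show ?thesis using that(1) en_E by metis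
next
  case (right v)
  then show ?thesis using that(2) en_E by metis
qed

lemma multi_en: "us \<in> box ms \<Longrightarrow> multi H ms xs ! fst (en ms us) = H (pick ms (map fst us)) (pick xs (map fst us))"
  by (simp add: en_def nth_multi box_indices)

text \<open>By \<open>pick_append_left\<close> and \<open>pick_append_right\<close> the tuples of
  entries before and after the reindexing coincide. Hence an arbitrary \<open>H\<close> takes the
  same values, be it an operation, a modification or a product of sizes.\<close>

lemma multi_sigma:
  assumes "b < length ms" "length xs = length ms" "length (xs ! b) = length (ms ! b)"
    "u \<in> blocks (multi_seq ms @ multi_seq (ms[b := m']))"
  shows "multi H (ms[b := ms ! b @ m']) (xs[b := xs ! b @ x']) ! fst (sigma_map ms b m' u) =
    (multi H ms xs @ multi H (ms[b := m']) (xs[b := x'])) ! fst u"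
  using assms(4)
proof (cases rule: sigma_blocksE)
  case (left us)
  have "map fst us ! b < length (ms ! b)" using left(1) assms(1) by (simp add: box_def mem_blocks')
  then show ?thesis
    using assms left sigma_map_left[OF left(1) assms(1), of m']
    by (simp add: multi_en nth_append pick_append_left)
next
  case (right us)
  then have len: "length us = length ms" by (simp add: box_def)
  show ?thesis
    using assms right sigma_map_right[OF right(1) assms(1)] len pick_append_right[of b ms "map fst us" m']
      pick_append_right[of b xs "map fst us" x']
    by (simp add: multi_en nth_append map_fst_sh)
qed

text \<open>Presenting the sizes of the blocks as values of \<open>multi\<close> lets
  \<open>multi_sigma\<close> and \<open>multi_concat\<close> be applied to them as well.\<close>

lemma multi_seq_eq: "multi_seq ms = multi (\<lambda>ps xs. prod_list ps) ms ms"
  by (simp add: multi_def multi_seq_def)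

lemma sigma_block_iso:
  assumes "b < length ms" "\<And>i. i < length ms \<Longrightarrow> ms ! i \<in> Obj Acat" "m' \<in> Obj Acat"
  shows "block_iso (multi_seq ms @ multi_seq (ms[b := m'])) (multi_seq (ms[b := ms ! b @ m'])) (sigma_map ms b m')"
    (is "block_iso ?m ?n ?\<sigma>")
proof (rule block_isoI)
  have ext: "?\<sigma> \<in> extensional (blocks ?m)" by (simp add: sigma_map_def Let_def)
  show "(?m, ?n, ?\<sigma>) \<in> Arr Acat"
  proof (rule Acat_arrI)
    show "?m \<in> Obj Acat" "?n \<in> Obj Acat"
      using assms by (auto intro!: multi_seq_Obj simp: nth_list_update)
    fix u assume u: "u \<in> blocks ?m"
    then show "?\<sigma> u \<in> blocks ?n"
    proof (cases rule: sigma_blocksE)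
      case (left us)
      then show ?thesis using sigma_map_left[OF left(1) assms(1), of m'] en_in by simp
    next
      case (right us)
      then show ?thesis using sigma_map_right[OF right(1) assms(1)] en_in by simp
    qed
    fix v assume v: "v \<in> blocks ?m" "fst (?\<sigma> u) = fst (?\<sigma> v)"
    have lt: "map fst us ! b < length (ms ! b)" if "us \<in> box ms" for us
      using that assms(1) by (simp add: box_def mem_blocks')
    show "fst u = fst v"
      using u
    proof (cases rule: sigma_blocksE)
      case us: (left us)
      note U = sigma_map_left[OF us(1) assms(1), of m']
      from v(1) show ?thesis
      proof (cases rule: sigma_blocksE)
        case vs: (left vs)
        note V = sigma_map_left[OF vs(1) assms(1), of m']
        show ?thesis
          using v(2) fst_en_eq_iff[OF U(1) V(1)] fst_en_eq_iff[OF us(1) vs(1)] by (simp add: us vs U V)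
      next
        case vs: (right vs)
        note V = sigma_map_right[OF vs(1) assms(1), unfolded length_multi_seq]
        \<comment> \<open>This mixed case is contradictory: the \<open>b\<close>-th index is below
          \<open>length (ms ! b)\<close> for \<open>us\<close> and at least that for the shifted
          tuple.\<close>
        have "map fst us = map fst (vs[b := sh (length (ms ! b)) (vs ! b)])"
          using v(2) fst_en_eq_iff[OF U(1) V(1)] by (simp add: us vs U V)
        then show ?thesis using lt[OF us(1)] vs(1) assms(1) by (simp add: box_def)
      qed
    next
      case us: (right us)
      note U = sigma_map_right[OF us(1) assms(1), unfolded length_multi_seq]
      from v(1) show ?thesis
      proof (cases rule: sigma_blocksE)
        case vs: (left vs)
        note V = sigma_map_left[OF vs(1) assms(1), of m']
        have "map fst (us[b := sh (length (ms ! b)) (us ! b)]) = map fst vs"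
          using v(2) fst_en_eq_iff[OF U(1) V(1)] by (simp add: us vs U V)
        from this[symmetric] show ?thesis using lt[OF vs(1)] us(1) assms(1) by (simp add: box_def)
      next
        case vs: (right vs)
        note V = sigma_map_right[OF vs(1) assms(1), unfolded length_multi_seq]
        have l: "length us = length ms" "length vs = length ms" using us(1) vs(1) by (simp_all add: box_def)
        have "(map fst us)[b := length (ms ! b) + map fst us ! b] = (map fst vs)[b := length (ms ! b) + map fst vs ! b]"
          using v(2) fst_en_eq_iff[OF U(1) V(1)] assms(1) l by (simp add: us vs U V map_fst_sh)
        moreover from arg_cong[OF this, of "\<lambda>xs. xs ! b"] have "map fst us ! b = map fst vs ! b"
          using assms(1) l by simp
        ultimately have "map fst us = map fst vs" by (metis list_update_id list_update_overwrite)
        then show ?thesis using fst_en_eq_iff[OF us(1) vs(1)] by (simp add: us vs)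
      qed
    qed
  qed (rule ext)
next
  fix u assume u: "u \<in> blocks ?m"
  then show "snd (?\<sigma> u) = snd u \<and> ?n ! fst (?\<sigma> u) = ?m ! fst u"
    unfolding multi_seq_eq using multi_sigma[OF assms(1) refl refl u, of "\<lambda>ps xs. prod_list ps" m']
    by (auto simp: multi_seq_eq sigma_map_def Let_def case_prod_unfold)
next
  fix u v assume "u \<in> blocks ?m" "v \<in> blocks ?m" "fst u = fst v"
  then show "fst (?\<sigma> u) = fst (?\<sigma> v)"
    by (simp add: sigma_map_def Let_def case_prod_unfold)
next
  fix v assume "v \<in> blocks ?n"
  then obtain vs where vs: "vs \<in> box (ms[b := ms ! b @ m'])" "v = en (ms[b := ms ! b @ m']) vs" by (rule en_E)
  from vs(1) assms(1) show "\<exists>u\<in>blocks ?m. ?\<sigma> u = v"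
  proof (cases rule: box_update_appendE)
    case 1
    then show ?thesis using sigma_map_left(2)[OF 1 assms(1), of m'] blocks_appendI(1)[OF en_in[OF 1]] vs(2) by metis
  next
    case (2 us)
    then show ?thesis using sigma_map_right(2)[OF 2(1) assms(1)] blocks_appendI(2)[OF en_in[OF 2(1)]] vs(2) by metis
  qed
qed

text \<open>The constraint merely permutes entries, so pushing forward along it gives exactly the
  values at the appended sequences. For objects this makes an identity a legitimate second
  component; for arrows and for modifications it gives compatibility with the constraint.\<close>

lemma axact_sigma:
  assumes "gset T" "b < length ms" "\<And>i. i < length ms \<Longrightarrow> ms ! i \<in> Obj Acat" "m' \<in> Obj Acat"
    "length xs = length ms" "length (xs ! b) = length (ms ! b)"
    "multi H ms xs \<in> axc T (multi_seq ms)" "multi H (ms[b := m']) (xs[b := x']) \<in> axc T (multi_seq (ms[b := m']))"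
  shows "axact T (multi_seq ms @ multi_seq (ms[b := m'])) (multi_seq (ms[b := ms ! b @ m'])) (sigma_map ms b m')
      (multi H ms xs @ multi H (ms[b := m']) (xs[b := x'])) = multi H (ms[b := ms ! b @ m']) (xs[b := xs ! b @ x'])"
proof (rule gset.axact_reindex[OF assms(1) sigma_block_iso axc_append])
  fix i a assume "(i, a) \<in> blocks (multi_seq ms @ multi_seq (ms[b := m']))"
  from multi_sigma[OF assms(2,5,6) this, of H x']
  show "multi H (ms[b := ms ! b @ m']) (xs[b := xs ! b @ x']) ! fst (sigma_map ms b m' (i, a)) =
      (multi H ms xs @ multi H (ms[b := m']) (xs[b := x'])) ! i"
    by simp
qed (use assms in simp_all)

section \<open>Composite operations on sequences\<close>

text \<open>By \<open>indices_concat\<close> both lists are indexed in the same order, so it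
  suffices to compare the entries at a concatenated index tuple.\<close>

lemma multi_concat:
  assumes "length xss = length mss" "k = length mss"
    "\<And>i. i < k \<Longrightarrow> length (xss ! i) = length (mss ! i)"
    "\<And>jss. \<lbrakk>length jss = k; \<And>i. i < k \<Longrightarrow> jss ! i \<in> set (indices (mss ! i))\<rbrakk> \<Longrightarrow>
      K (concat (map2 pick mss jss)) (concat (map2 pick xss jss)) =
      H (map prod_list (map2 pick mss jss)) (tab k (\<lambda>i. Hs i (pick (mss ! i) (jss ! i)) (pick (xss ! i) (jss ! i))))"
  shows "multi K (concat mss) (concat xss) =
    multi H (map multi_seq mss) (tab k (\<lambda>i. multi (Hs i) (mss ! i) (xss ! i)))"
proof -
  have "K (pick (concat mss) (concat jss)) (pick (concat xss) (concat jss)) =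
      H (pick (map multi_seq mss) Js) (pick (tab k (\<lambda>i. multi (Hs i) (mss ! i) (xss ! i))) Js)"
    if Js: "Js \<in> set (indices (map multi_seq mss))" and jss: "jss = map2 (\<lambda>ms J. indices ms ! J) mss Js" for Js jss
  proof -
    have len: "length Js = k" "\<And>i. i < k \<Longrightarrow> Js ! i < length (indices (mss ! i))"
      using Js by (auto simp: mem_tuples assms(2))
    have jss': "length jss = k" "\<And>i. i < k \<Longrightarrow> jss ! i = indices (mss ! i) ! (Js ! i)"
      using len(1) by (simp_all add: jss assms(2))
    then have mem: "jss ! i \<in> set (indices (mss ! i))" if "i < k" for i
      using len(2)[OF that] that by simp
    then have l: "map length mss = map length jss" "map length xss = map length jss"
      using jss'(1) assms(1,2,3) by (auto intro!: map_length_eqI simp: mem_tuples)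
    have "pick (map multi_seq mss) Js = map prod_list (map2 pick mss jss)"
      using len jss' assms(2) by (intro nth_equalityI) (simp_all add: multi_seq_def)
    moreover have "pick (tab k (\<lambda>i. multi (Hs i) (mss ! i) (xss ! i))) Js =
        tab k (\<lambda>i. Hs i (pick (mss ! i) (jss ! i)) (pick (xss ! i) (jss ! i)))"
      using len jss' assms(2) by (intro nth_equalityI) (simp_all add: multi_def)
    ultimately show ?thesis
      using assms(4)[OF jss'(1) mem] by (simp only: pick_concat[OF l(1)] pick_concat[OF l(2)])
  qed
  then show ?thesis
    by (simp add: multi_def indices_concat)
qed

section \<open>Gamma-categories as pairs of Gamma-sets\<close>

definition ob_gset :: "('o, 'm) gcat \<Rightarrow> 'o gset" where
  "ob_gset X = \<lparr>GS = \<lambda>n. Obj (FOb X n), GB = basept X, GA = \<lambda>u. FOb (act X u)\<rparr>"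

definition ar_gset :: "('o, 'm) gcat \<Rightarrow> 'm gset" where
  "ar_gset X = \<lparr>GS = \<lambda>n. Arr (FOb X n), GB = \<lambda>n. Ident (FOb X n) (basept X n), GA = \<lambda>u. FAr (act X u)\<rparr>"

lemma gset_simps [simp]:
  "GS (ob_gset X) n = Obj (FOb X n)" "GB (ob_gset X) n = basept X n" "GA (ob_gset X) u = FOb (act X u)"
  "GS (ar_gset X) n = Arr (FOb X n)" "GB (ar_gset X) n = Ident (FOb X n) (basept X n)"
  "GA (ar_gset X) u = FAr (act X u)"
  by (simp_all add: ob_gset_def ar_gset_def)

lemma zero_Fcat: "(p, q, \<lambda>a\<in>{0..p}. 0) \<in> Arr Fcat"
  by (simp add: Fcat_arr)

text \<open>Basepoints are the images of the only element in degree 0. Precomposing a pointed map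
  with the map out of degree 0 gives again such a map, and a zero map factors through degree 0;
  \<open>GA_base\<close> and \<open>GA_zero\<close> follow by functoriality.\<close>

lemma gset_pointedI:
  assumes GA_in: "\<And>p q \<psi> x. \<lbrakk>(p, q, \<psi>) \<in> Arr Fcat; x \<in> GS S p\<rbrakk> \<Longrightarrow> GA S (p, q, \<psi>) x \<in> GS S q"
    and GA_ident: "\<And>p x. x \<in> GS S p \<Longrightarrow> GA S (p, p, \<lambda>a\<in>{0..p}. a) x = x"
    and GA_comp: "\<And>p q r \<psi> \<chi> x. \<lbrakk>(p, q, \<psi>) \<in> Arr Fcat; (q, r, \<chi>) \<in> Arr Fcat; x \<in> GS S p\<rbrakk>
      \<Longrightarrow> GA S (p, r, compose {0..p} \<chi> \<psi>) x = GA S (q, r, \<chi>) (GA S (p, q, \<psi>) x)"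
    and b: "GS S 0 = {b}" "\<And>n. GB S n = GA S (0, n, \<lambda>a\<in>{0..0}. 0) b"
  shows "gset S"
proof
  show "GB S p \<in> GS S p" for p
    using GA_in[OF zero_Fcat, of b 0 p] b by simp
  show "GA S (p, q, \<psi>) (GB S p) = GB S q" if \<psi>: "(p, q, \<psi>) \<in> Arr Fcat" for p q \<psi>
  proof -
    have "compose {0..0} \<psi> (\<lambda>a\<in>{0..0::nat}. 0) = (\<lambda>a\<in>{0..0}. 0)"
      using \<psi> by (simp add: compose_def Fcat_arr cong: restrict_cong)
    moreover have "GA S (0, q, compose {0..0} \<psi> (\<lambda>a\<in>{0..0}. 0)) b = GA S (p, q, \<psi>) (GA S (0, p, \<lambda>a\<in>{0..0}. 0) b)"
      by (rule GA_comp[OF zero_Fcat \<psi>]) (simp add: b)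
    ultimately show ?thesis by (simp only: b(2))
  qed
  show "GA S (p, q, \<lambda>a\<in>{0..p}. 0) x = GB S q" if x: "x \<in> GS S p" for p q x
  proof -
    have "compose {0..p} (\<lambda>a\<in>{0..0::nat}. 0) (\<lambda>a\<in>{0..p}. 0) = (\<lambda>a\<in>{0..p}. 0 :: nat)"
      by (simp add: compose_def cong: restrict_cong)
    moreover have "GA S (p, 0, \<lambda>a\<in>{0..p}. 0) x = b"
      using GA_in[OF zero_Fcat x, of 0] b(1) by simp
    ultimately show ?thesis
      using GA_comp[OF zero_Fcat[of p 0] zero_Fcat[of 0 q] x] by (simp only: b(2))
  qed
qed (use assms in blast)+

locale gamma_cat =
  fixes X :: "('o, 'm) gcat"
  assumes gamma: "gamma_category X"

sublocale gamma_cat \<subseteq> cat_valued Fcat X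
  using gamma by (simp add: gamma_category_def cat_valued_def)

context gamma_cat
begin

abbreviation "ob \<equiv> ob_gset X"
abbreviation "ar \<equiv> ar_gset X"

lemma cat_X: "category (FOb X n)"
  by (rule cat_FOb) (simp add: Fcat_def)

lemma act_cfunctor: "(p, q, \<psi>) \<in> Arr Fcat \<Longrightarrow> cfunctor (FOb X p) (FOb X q) (act X (p, q, \<psi>))"
  by (rule act_functor) (simp add: hom_Fcat)

lemma act_X_ident: "act X (p, p, \<lambda>a\<in>{0..p}. a) = id_ftor (FOb X p)"
  using act_ident[of p] by (simp add: Fcat_def)

lemma act_X_comp:
  "\<lbrakk>(p, q, \<psi>) \<in> Arr Fcat; (q, r, \<chi>) \<in> Arr Fcat\<rbrakk>
    \<Longrightarrow> act X (p, r, compose {0..p} \<chi> \<psi>) = comp_ftor (FOb X p) (act X (q, r, \<chi>)) (act X (p, q, \<psi>))"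
  using act_comp[of "(p, q, \<psi>)" p q "(q, r, \<chi>)" r] by (simp add: hom_Fcat) (simp add: Fcat_def)

lemma act_X_comp':
  assumes "(p, q, \<psi>) \<in> Arr Fcat" "(q, r, \<chi>) \<in> Arr Fcat"
  shows "x \<in> Obj (FOb X p) \<Longrightarrow> FOb (act X (p, r, compose {0..p} \<chi> \<psi>)) x = FOb (act X (q, r, \<chi>)) (FOb (act X (p, q, \<psi>)) x)"
    and "f \<in> Arr (FOb X p) \<Longrightarrow> FAr (act X (p, r, compose {0..p} \<chi> \<psi>)) f = FAr (act X (q, r, \<chi>)) (FAr (act X (p, q, \<psi>)) f)"
  unfolding act_X_comp[OF assms] by (simp_all add: comp_ftor_def compose_eq)

lemma terminal: "terminal_cat (FOb X 0)"
  using gamma by (simp add: gamma_category_def)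

lemma zero_cat:
  obtains b where "Obj (FOb X 0) = {b}" "Arr (FOb X 0) = {Ident (FOb X 0) b}"
    "\<And>n. basept X n = FOb (act X (0, n, \<lambda>a\<in>{0..0}. 0)) b"
proof -
  obtain b f where bf: "Obj (FOb X 0) = {b}" "Arr (FOb X 0) = {f}"
    using terminal by (auto simp: terminal_cat_def)
  then have "Ident (FOb X 0) b = f"
    using category.ident[OF cat_X, of b 0] by (simp add: hom_def)
  with bf that show thesis by (simp add: basept_def)
qed

lemma gset_ob: "gset ob"
proof -
  obtain b where b: "Obj (FOb X 0) = {b}" "\<And>n. basept X n = FOb (act X (0, n, \<lambda>a\<in>{0..0}. 0)) b"
    using zero_cat by metis
  show ?thesis
    by (rule gset_pointedI[where b = b])
      (use b in \<open>simp_all add: cfunctor.FOb_in[OF act_cfunctor] act_X_ident act_X_comp' id_ftor_def\<close>)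
qed

lemma gset_ar: "gset ar"
proof -
  obtain b where b: "Obj (FOb X 0) = {b}" "Arr (FOb X 0) = {Ident (FOb X 0) b}"
    "\<And>n. basept X n = FOb (act X (0, n, \<lambda>a\<in>{0..0}. 0)) b" using zero_cat by metis
  have "Ident (FOb X n) (basept X n) = FAr (act X (0, n, \<lambda>a\<in>{0..0}. 0)) (Ident (FOb X 0) b)" for n
    using cfunctor.FAr_ident[OF act_cfunctor[OF zero_Fcat, of 0 n], of b] b by simp
  with b show ?thesis
    by (intro gset_pointedI[where b = "Ident (FOb X 0) b"])
      (simp_all add: cfunctor.FAr_in'[OF act_cfunctor] act_X_ident act_X_comp' id_ftor_def)
qed

end

sublocale gamma_cat \<subseteq> ob: gset "ob_gset X" by (rule gset_ob)
sublocale gamma_cat \<subseteq> ar: gset "ar_gset X" by (rule gset_ar)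

section \<open>The functor on sequences\<close>

lemma AXob_Obj [simp]: "Obj (AXob X m) = axc (ob_gset X) m"
  by (auto simp: AXob_def axc_def)

lemma AXob_Arr [simp]: "Arr (AXob X m) = axc (ar_gset X) m"
  by (auto simp: AXob_def axc_def)

lemma AXob_simps [simp]:
  "Ident (AXob X m) xs = tab (length m) (\<lambda>i. Ident (FOb X (m ! i)) (xs ! i))"
  "Comp (AXob X m) gs fs = tab (length m) (\<lambda>i. Comp (FOb X (m ! i)) (gs ! i) (fs ! i))"
  by (simp_all add: AXob_def cong: map_cong)

lemma hom_AXob:
  "f \<in> hom (AXob X m) x y \<longleftrightarrow> length f = length m \<and> length x = length m \<and> length y = length m \<and>
    (\<forall>i<length m. f ! i \<in> hom (FOb X (m ! i)) (x ! i) (y ! i))"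
  by (auto simp: AXob_def hom_prod_cat)

text \<open>Both parts of \<open>AXact\<close> are one construction on Gamma-sets, applied to
  objects and to arrows. Functoriality of \<open>AX X\<close> can therefore be read off from
  \<open>axact_ident\<close> and \<open>axact_comp\<close>.\<close>

lemma AXact_eq:
  "AXact X (m, n, \<phi>) = \<lparr>FOb = \<lambda>xs\<in>axc (ob_gset X) m. axact (ob_gset X) m n \<phi> xs,
     FAr = \<lambda>fs\<in>axc (ar_gset X) m. axact (ar_gset X) m n \<phi> fs\<rparr>"
  by (simp add: AXact_def axact_def Let_def cong: if_cong)

lemma src_block_Fcat:
  assumes "(m, n, \<phi>) \<in> Arr Acat" "j < length n" "preim m \<phi> j \<noteq> {}"
  shows "src_block m \<phi> j < length m"
    and "(m ! src_block m \<phi> j, n ! j, block_map m \<phi> (src_block m \<phi> j) j) \<in> Arr Fcat"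
proof -
  obtain u where u: "u \<in> blocks m" "fst (\<phi> u) = j" using assms(3) by (auto simp: preim_empty_iff)
  then show "src_block m \<phi> j < length m" using src_block_eq[OF assms(1) u(1)] by (simp add: mem_blocks')
  then show "(m ! src_block m \<phi> j, n ! j, block_map m \<phi> (src_block m \<phi> j) j) \<in> Arr Fcat"
    by (rule block_map_Fcat[OF assms(1) _ assms(2)])
qed

context gamma_cat
begin

lemma cat_AXob: "category (AXob X m)"
  unfolding AXob_def by (rule category_prod_cat) (simp add: cat_X)

lemma basept_in: "basept X n \<in> Obj (FOb X n)"
  using ob.GB_in by simp

lemma axact_hom:
  assumes "(m, n, \<phi>) \<in> Arr Acat" "f \<in> hom (AXob X m) x y"
  shows "axact ar m n \<phi> f \<in> hom (AXob X n) (axact ob m n \<phi> x) (axact ob m n \<phi> y)"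
  using assms(2) category.ident[OF cat_X basept_in] src_block_Fcat(1)[OF assms(1)]
    cfunctor.FAr_in[OF act_cfunctor[OF src_block_Fcat(2)[OF assms(1)]]]
  by (simp add: hom_AXob axact_def)

lemma axact_Ident:
  assumes "(m, n, \<phi>) \<in> Arr Acat" "x \<in> axc ob m"
  shows "axact ar m n \<phi> (Ident (AXob X m) x) = Ident (AXob X n) (axact ob m n \<phi> x)"
  using axcD[OF assms(2)] src_block_Fcat(1)[OF assms(1)]
    cfunctor.FAr_ident[OF act_cfunctor[OF src_block_Fcat(2)[OF assms(1)]]]
  by (simp add: axact_def)

lemma axact_Comp:
  assumes "(m, n, \<phi>) \<in> Arr Acat" "f \<in> hom (AXob X m) x y" "g \<in> hom (AXob X m) y z"
  shows "axact ar m n \<phi> (Comp (AXob X m) g f) = Comp (AXob X n) (axact ar m n \<phi> g) (axact ar m n \<phi> f)"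
proof -
  have "axact ar m n \<phi> (Comp (AXob X m) g f) ! j = Comp (FOb X (n ! j)) (axact ar m n \<phi> g ! j) (axact ar m n \<phi> f ! j)"
    if j: "j < length n" for j
  proof (cases "preim m \<phi> j = {}")
    case True
    then show ?thesis
      using category.ident_comp[OF cat_X category.ident[OF cat_X basept_in]] j by (simp add: axact_def)
  next
    case False
    let ?s = "src_block m \<phi> j"
    note s = src_block_Fcat[OF assms(1) j False]
    show ?thesis
      using cfunctor.FAr_comp[OF act_cfunctor[OF s(2)], of "f ! ?s" "x ! ?s" "y ! ?s" "g ! ?s" "z ! ?s"]
        assms(2,3) s(1) j False by (simp add: axact_def hom_AXob)
  qed
  then show ?thesis by (intro nth_equalityI) simp_all
qed

lemma AXact_cfunctor:
  assumes "(m, n, \<phi>) \<in> Arr Acat"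
  shows "cfunctor (AXob X m) (AXob X n) (AXact X (m, n, \<phi>))"
proof -
  interpret M: category "AXob X m" by (rule cat_AXob)
  interpret N: category "AXob X n" by (rule cat_AXob)
  show ?thesis
  proof
    fix f x y assume f: "f \<in> hom (AXob X m) x y"
    then show "FAr (AXact X (m, n, \<phi>)) f \<in> hom (AXob X n) (FOb (AXact X (m, n, \<phi>)) x) (FOb (AXact X (m, n, \<phi>)) y)"
      using axact_hom[OF assms f] M.hom_Obj[OF f] homD[OF f] by (simp add: AXact_eq)
    fix g z assume g: "g \<in> hom (AXob X m) y z"
    show "FAr (AXact X (m, n, \<phi>)) (Comp (AXob X m) g f) =
      Comp (AXob X n) (FAr (AXact X (m, n, \<phi>)) g) (FAr (AXact X (m, n, \<phi>)) f)"
      using axact_Comp[OF assms f g] homD[OF M.comp[OF f g]] homD[OF f] homD[OF g]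
      by (simp add: AXact_eq del: AXob_simps)
  next
    fix x assume "x \<in> Obj (AXob X m)"
    then show "FOb (AXact X (m, n, \<phi>)) x \<in> Obj (AXob X n)"
      "FAr (AXact X (m, n, \<phi>)) (Ident (AXob X m) x) = Ident (AXob X n) (FOb (AXact X (m, n, \<phi>)) x)"
      using ob.axact_in[OF assms] axact_Ident[OF assms] homD[OF M.ident] by (simp_all add: AXact_eq del: AXob_simps)
  qed (simp_all add: AXact_eq)
qed

lemma AX_simps:
  "m \<in> Obj Acat \<Longrightarrow> FOb (AX X) m = AXob X m"
  "(m, n, \<phi>) \<in> Arr Acat \<Longrightarrow> act (AX X) (m, n, \<phi>) = AXact X (m, n, \<phi>)"
  "(m, n, \<phi>) \<in> Arr Acat \<Longrightarrow> FAr (AX X) (m, n, \<phi>) = (AXob X m, AXob X n, AXact X (m, n, \<phi>))"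
  by (simp_all add: AX_def act_def)

lemma AX_functor: "cfunctor Acat CAT (AX X)"
proof (intro cfunctor.intro category_Acat category_CAT cfunctor_axioms.intro)
  fix u m n assume "u \<in> hom Acat m n"
  then obtain \<phi> where u: "u = (m, n, \<phi>)" "(m, n, \<phi>) \<in> Arr Acat" by (auto simp: hom_Acat)
  note m = Acat_arrD(1,2)[OF u(2)]
  show "FAr (AX X) u \<in> hom CAT (FOb (AX X) m) (FOb (AX X) n)"
    using AXact_cfunctor[OF u(2)] by (simp add: u AX_simps m hom_CAT)
  fix v r assume "v \<in> hom Acat n r"
  then obtain \<psi> where v: "v = (n, r, \<psi>)" "(n, r, \<psi>) \<in> Arr Acat" by (auto simp: hom_Acat)
  have "AXact X (m, r, compose (blocks m) \<psi> \<phi>) = comp_ftor (AXob X m) (AXact X (n, r, \<psi>)) (AXact X (m, n, \<phi>))"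
    using ob.axact_comp[OF u(2) v(2)] ar.axact_comp[OF u(2) v(2)] ob.axact_in[OF u(2)] ar.axact_in[OF u(2)]
    by (auto simp: AXact_eq comp_ftor_def compose_def intro!: restrict_ext)
  then show "FAr (AX X) (Comp Acat v u) = Comp CAT (FAr (AX X) v) (FAr (AX X) u)"
    using Acat_comp[OF u(2) v(2)] by (simp add: u v AX_simps CAT_def)
next
  fix m assume m: "m \<in> Obj Acat"
  then show "FOb (AX X) m \<in> Obj CAT" by (simp add: AX_simps CAT_def cat_AXob)
  have "AXact X (m, m, \<lambda>u\<in>blocks m. u) = id_ftor (AXob X m)"
    using ob.axact_ident[OF m] ar.axact_ident[OF m]
    by (auto simp: AXact_eq id_ftor_def intro!: restrict_ext)
  then show "FAr (AX X) (Ident Acat m) = Ident CAT (FOb (AX X) m)"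
    using Acat_ident[OF m] m by (simp add: AX_simps CAT_def)
qed (simp_all add: AX_def)

end

sublocale gamma_cat \<subseteq> A: cat_valued Acat "AX X"
  using AX_functor by (simp add: cat_valued_def)

section \<open>Arrows of the inverse K-theory category\<close>

definition pmap :: "('o, 'm) par \<Rightarrow> nat \<times> nat \<Rightarrow> nat \<times> nat" where
  "pmap h = snd (snd (fst (snd (snd h))))"

definition pval :: "('o, 'm) par \<Rightarrow> 'm list" where
  "pval h = snd (snd (snd h))"

lemma pmap_pval [simp]: "pmap (s, t, ((m, n, \<phi>), f)) = \<phi>" "pval (s, t, (u, f)) = f"
  by (simp_all add: pmap_def pval_def)

lemma Pobj_groth:
  "Obj (Pobj X) = Obj (groth Acat (AX X))" "Arr (Pobj X) = Arr (groth Acat (AX X))"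
  "Dom (Pobj X) = Dom (groth Acat (AX X))" "Cod (Pobj X) = Cod (groth Acat (AX X))"
  "Ident (Pobj X) = Ident (groth Acat (AX X))" "Comp (Pobj X) = Comp (groth Acat (AX X))"
  by (simp_all add: Pobj_def Let_def)

lemma Pobj_simps [simp]:
  "TOb (Pobj X) s t = (fst s @ fst t, snd s @ snd t)" "TUnit (Pobj X) = ([], [])"
  by (simp_all add: Pobj_def Let_def case_prod_unfold)

text \<open>The identity is taken at the target \<open>t\<close>, because the component of an arrow
  lives over the target sequence. Purity thus forces the pushforward of the source to equal the
  target, see \<open>pure_cod\<close>.\<close>

definition pure :: "('o, 'm) gcat \<Rightarrow> 'o pob \<Rightarrow> ('o, 'm) par \<Rightarrow> bool" where
  "pure X t h \<longleftrightarrow> pval h = Ident (AXob X (fst t)) (snd t)"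

context gamma_cat
begin

abbreviation "P \<equiv> Pobj X"

lemma Obj_P: "s \<in> Obj P \<longleftrightarrow> fst s \<in> Obj Acat \<and> snd s \<in> axc ob (fst s)"
  by (cases s) (auto simp: Pobj_groth groth_def AX_simps)

lemma hom_P_groth: "hom P s t = hom (groth Acat (AX X)) s t"
  by (simp add: hom_def Pobj_groth)

lemma hom_PE:
  assumes "h \<in> hom P s t"
  shows "h = (s, t, ((fst s, fst t, pmap h), pval h))" "(fst s, fst t, pmap h) \<in> Arr Acat"
    "snd s \<in> axc ob (fst s)" "snd t \<in> axc ob (fst t)"
    "pval h \<in> hom (AXob X (fst t)) (axact ob (fst s) (fst t) (pmap h) (snd s)) (snd t)"
  using assms unfolding hom_P_groth A.hom_groth
  by (auto simp: hom_Acat AX_simps Acat_arrD(1,2) AXact_eq)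

lemma hom_PI:
  assumes "(m, n, \<phi>) \<in> Arr Acat" "x \<in> axc ob m" "y \<in> axc ob n"
    "f \<in> hom (AXob X n) (axact ob m n \<phi> x) y"
  shows "((m, x), (n, y), ((m, n, \<phi>), f)) \<in> hom P (m, x) (n, y)"
  using assms unfolding hom_P_groth A.hom_groth
  by (auto simp: hom_Acat AX_simps Acat_arrD(1,2) AXact_eq)

lemma pure_hom_PI:
  assumes "(m, n, \<phi>) \<in> Arr Acat" "x \<in> axc ob m" "axact ob m n \<phi> x = y"
  shows "((m, x), (n, y), ((m, n, \<phi>), Ident (AXob X n) y)) \<in> hom P (m, x) (n, y)"
proof (rule hom_PI)
  show y: "y \<in> axc ob n" using ob.axact_in[OF assms(1,2)] assms(3) by simp
  show "Ident (AXob X n) y \<in> hom (AXob X n) (axact ob m n \<phi> x) y"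
    using category.ident[OF cat_AXob, of y n] y unfolding assms(3) by simp
qed fact+

text \<open>Block maps are extensional, so agreement on elements is equality; everything else in the
  triple is determined by source and target.\<close>

lemma P_eqI:
  assumes "g \<in> hom P s t" "h \<in> hom P s t" "\<And>u. u \<in> blocks (fst s) \<Longrightarrow> pmap g u = pmap h u" "pval g = pval h"
  shows "g = h"
proof -
  have "pmap g = pmap h"
    using Acat_arrD(4)[OF hom_PE(2)[OF assms(1)]] Acat_arrD(4)[OF hom_PE(2)[OF assms(2)]] assms(3)
    by (rule extensionalityI)
  then show ?thesis
    using hom_PE(1)[OF assms(1)] hom_PE(1)[OF assms(2)] assms(4) by metis
qed

lemma pure_eqI:
  assumes "g \<in> hom P s t" "h \<in> hom P s t" "pure X t g" "pure X t h"
    "\<And>u. u \<in> blocks (fst s) \<Longrightarrow> pmap g u = pmap h u"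
  shows "g = h"
  using assms(3,4) by (intro P_eqI[OF assms(1,2,5)]) (simp_all add: pure_def)

lemma cat_P: "category P"
  using A.category_groth by (simp add: category_def hom_def Pobj_groth)

lemma Comp_P:
  assumes "f \<in> hom P s t" "g \<in> hom P t r"
  shows "u \<in> blocks (fst s) \<Longrightarrow> pmap (Comp P g f) u = pmap g (pmap f u)"
    and "pval (Comp P g f) = Comp (AXob X (fst r)) (pval g) (axact ar (fst t) (fst r) (pmap g) (pval f))"
proof -
  have "Comp P (t, r, ((fst t, fst r, pmap g), pval g)) (s, t, ((fst s, fst t, pmap f), pval f)) =
    (s, r, ((fst s, fst r, compose (blocks (fst s)) (pmap g) (pmap f)),
     Comp (AXob X (fst r)) (pval g) (axact ar (fst t) (fst r) (pmap g) (pval f))))"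
    using hom_PE(2)[OF assms(2)] homD[OF hom_PE(5)[OF assms(1)]]
    by (simp add: Pobj_groth A.Comp_groth AX_simps Acat_arrD(2) AXact_eq del: AXob_simps)
  then have *: "Comp P g f = \<dots>"
    using hom_PE(1)[OF assms(1)] hom_PE(1)[OF assms(2)] by simp
  show "u \<in> blocks (fst s) \<Longrightarrow> pmap (Comp P g f) u = pmap g (pmap f u)"
    "pval (Comp P g f) = Comp (AXob X (fst r)) (pval g) (axact ar (fst t) (fst r) (pmap g) (pval f))"
    by (simp_all only: * pmap_pval compose_eq)
qed

lemma pure_Comp:
  assumes "f \<in> hom P s t" "g \<in> hom P t r" "pure X t f" "pure X r g"
  shows "pure X r (Comp P g f)"
proof -
  \<comment> \<open>The typing of an identity forces its source to be \<open>snd r\<close>, so both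
    factors are the same identity.\<close>
  have "Comp (AXob X (fst r)) (Ident (AXob X (fst r)) (snd r)) (Ident (AXob X (fst r)) z) = Ident (AXob X (fst r)) (snd r)"
    if "Ident (AXob X (fst r)) (snd r) \<in> hom (AXob X (fst r)) z (snd r)" for z
  proof -
    have "z = snd r" using that category.ident[OF cat_AXob, of "snd r" "fst r"] hom_PE(4)[OF assms(2)]
      by (simp add: hom_def)
    then show ?thesis using category.comp_ident[OF cat_AXob that] by simp
  qed
  then show ?thesis
    using hom_PE(5)[OF assms(2)] assms(3,4) axact_Ident[OF hom_PE(2)[OF assms(2)] hom_PE(4)[OF assms(1)]]
    by (simp add: pure_def Comp_P(2)[OF assms(1,2)] del: AXob_simps)
qed

lemma Ident_P:
  assumes "s \<in> Obj P"
  shows "Ident P s \<in> hom P s s" "pmap (Ident P s) = (\<lambda>u\<in>blocks (fst s). u)" "pure X s (Ident P s)"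
    "pval (Ident P s) = Ident (AXob X (fst s)) (snd s)"
  using assms category.ident[OF cat_P assms]
  by (simp_all add: Pobj_groth[of X] A.Ident_groth pure_def AX_simps Obj_P[unfolded Pobj_groth])

lemma TAr_P_eq:
  assumes "f \<in> hom P s t" "g \<in> hom P s' t'"
  shows "TAr P f g = ((fst s @ fst s', snd s @ snd s'), (fst t @ fst t', snd t @ snd t'),
    ((fst s @ fst s', fst t @ fst t', sum_map (fst s) (fst t) (fst s') (pmap f) (pmap g)), pval f @ pval g))"
proof -
  have "TAr P (s, t, ((m, n, \<phi>), x)) (s', t', ((m', n', \<psi>), y)) =
    ((fst s @ fst s', snd s @ snd s'), (fst t @ fst t', snd t @ snd t'),
    ((fst s @ fst s', fst t @ fst t', sum_map (fst s) (fst t) (fst s') \<phi> \<psi>), x @ y))" for m n \<phi> x m' n' \<psi> y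
    by (cases s; cases t; cases s'; cases t') (simp add: Pobj_def Let_def)
  then show ?thesis using hom_PE(1)[OF assms(1)] hom_PE(1)[OF assms(2)] by metis
qed

lemma hom_AXob_append:
  "\<lbrakk>f \<in> hom (AXob X m) x y; g \<in> hom (AXob X n) z w\<rbrakk> \<Longrightarrow> f @ g \<in> hom (AXob X (m @ n)) (x @ z) (y @ w)"
  by (auto simp: hom_AXob nth_append)

lemma Ident_AXob_append:
  "\<lbrakk>length x = length m\<rbrakk> \<Longrightarrow> Ident (AXob X (m @ n)) (x @ y) = Ident (AXob X m) x @ Ident (AXob X n) y"
  by (auto simp: nth_append intro!: nth_equalityI)

lemma Comp_AXob_append:
  "\<lbrakk>length f = length m; length g = length m\<rbrakk>
    \<Longrightarrow> Comp (AXob X (m @ n)) (g @ g') (f @ f') = Comp (AXob X m) g f @ Comp (AXob X n) g' f'"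
  by (auto simp: nth_append intro!: nth_equalityI)

lemma TAr_P:
  assumes "f \<in> hom P s t" "g \<in> hom P s' t'"
  shows "TAr P f g \<in> hom P (fst s @ fst s', snd s @ snd s') (fst t @ fst t', snd t @ snd t')"
    and "u \<in> blocks (fst s) \<Longrightarrow> pmap (TAr P f g) u = pmap f u"
    and "v \<in> blocks (fst s') \<Longrightarrow> pmap (TAr P f g) (sh (length (fst s)) v) = sh (length (fst t)) (pmap g v)"
    and "pval (TAr P f g) = pval f @ pval g"
    and "\<lbrakk>pure X t f; pure X t' g\<rbrakk> \<Longrightarrow> pure X (fst t @ fst t', snd t @ snd t') (TAr P f g)"
proof -
  note f = hom_PE[OF assms(1)] and g = hom_PE[OF assms(2)]
  have len: "length (snd s) = length (fst s)" "length (snd t) = length (fst t)"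
    using axcD[OF f(3)] axcD[OF f(4)] by simp_all
  show "TAr P f g \<in> hom P (fst s @ fst s', snd s @ snd s') (fst t @ fst t', snd t @ snd t')"
    unfolding TAr_P_eq[OF assms]
    using hom_AXob_append[OF f(5) g(5)] axact_sum[OF f(2) g(2) len(1)]
    by (intro hom_PI Acat_sum f(2) g(2) axc_append f(3,4) g(3,4)) simp
  show "u \<in> blocks (fst s) \<Longrightarrow> pmap (TAr P f g) u = pmap f u"
    "v \<in> blocks (fst s') \<Longrightarrow> pmap (TAr P f g) (sh (length (fst s)) v) = sh (length (fst t)) (pmap g v)"
    "pval (TAr P f g) = pval f @ pval g"
    by (simp_all add: TAr_P_eq[OF assms] sum_map_left sum_map_right)
  then show "\<lbrakk>pure X t f; pure X t' g\<rbrakk> \<Longrightarrow> pure X (fst t @ fst t', snd t @ snd t') (TAr P f g)"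
    using len by (simp add: pure_def Ident_AXob_append del: AXob_simps)
qed

text \<open>The inverse is the pure arrow on the inverse block map: functoriality of
  \<open>axact\<close> carries \<open>y\<close> back to \<open>x\<close>, and both composites are
  pure with identity block map.\<close>

lemma block_iso_is_iso:
  assumes "block_iso m n \<phi>" "x \<in> axc ob m" "axact ob m n \<phi> x = y"
  shows "is_iso P ((m, x), (n, y), ((m, n, \<phi>), Ident (AXob X n) y))" (is "is_iso P ?h")
proof -
  note arr = block_iso_arr[OF assms(1)]
  obtain \<psi> where \<psi>: "(n, m, \<psi>) \<in> Arr Acat" "compose (blocks m) \<psi> \<phi> = (\<lambda>u\<in>blocks m. u)"
    "compose (blocks n) \<phi> \<psi> = (\<lambda>u\<in>blocks n. u)" by (rule block_iso_inverse[OF assms(1)])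
  have inv: "u \<in> blocks m \<Longrightarrow> \<psi> (\<phi> u) = u" "v \<in> blocks n \<Longrightarrow> \<phi> (\<psi> v) = v" for u v
    using fun_cong[OF \<psi>(2), of u] fun_cong[OF \<psi>(3), of v] by (simp_all add: compose_eq)
  have y: "axact ob n m \<psi> y = x"
    using ob.axact_comp[OF arr \<psi>(1) assms(2)] ob.axact_ident[OF Acat_arrD(1)[OF arr] assms(2)]
    by (simp add: \<psi> assms(3))
  let ?k = "((n, y), (m, x), ((n, m, \<psi>), Ident (AXob X m) x))"
  have h: "?h \<in> hom P (m, x) (n, y)" by (rule pure_hom_PI[OF arr assms(2,3)])
  have k: "?k \<in> hom P (n, y) (m, x)"
    using pure_hom_PI[OF \<psi>(1) _ y] ob.axact_in[OF arr assms(2)] assms(3) by simp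
  have O: "(m, x) \<in> Obj P" "(n, y) \<in> Obj P" using category.hom_Obj[OF cat_P h] by simp_all
  have pure: "pure X (m, x) ?k" "pure X (n, y) ?h" by (simp_all add: pure_def)
  have "Comp P ?k ?h = Ident P (m, x)"
    by (rule pure_eqI[OF category.comp[OF cat_P h k] Ident_P(1)[OF O(1)] pure_Comp[OF h k pure(2,1)] Ident_P(3)[OF O(1)]])
      (simp add: Comp_P(1)[OF h k] Ident_P(2)[OF O(1)] inv del: AXob_simps)
  moreover have "Comp P ?h ?k = Ident P (n, y)"
    by (rule pure_eqI[OF category.comp[OF cat_P k h] Ident_P(1)[OF O(2)] pure_Comp[OF k h pure] Ident_P(3)[OF O(2)]])
      (simp add: Comp_P(1)[OF k h] Ident_P(2)[OF O(2)] inv del: AXob_simps)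
  ultimately show ?thesis
    using homD[OF h] k unfolding is_iso_def by (auto simp del: AXob_simps)
qed

lemma axact_swap:
  assumes "gset T" "m \<in> Obj Acat" "n \<in> Obj Acat" "x \<in> axc T m" "y \<in> axc T n"
  shows "axact T (m @ n) (n @ m) (block_swap m n) (x @ y) = y @ x"
proof (rule gset.axact_reindex[OF assms(1) block_iso_swap[OF assms(2,3)] axc_append[OF assms(4,5)]])
  note len = axcD[OF assms(4)] axcD[OF assms(5)]
  show "length (y @ x) = length (n @ m)" using len by simp
  fix i a assume "(i, a) \<in> blocks (m @ n)"
  then show "(y @ x) ! fst (block_swap m n (i, a)) = (x @ y) ! i"
  proof (cases rule: blocks_appendE)
    case left
    then show ?thesis using len by (simp add: block_swap_left nth_append)
  next
    case (right v)
    from right(2) have "i = length m + fst v" by (cases v) simp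
    moreover have "block_swap m n (i, a) = v" using block_swap_right[OF right(1), of m] right(2) by simp
    ultimately show ?thesis using len right(3) by (simp add: nth_append)
  qed
qed

lemma Braid_P:
  assumes "s \<in> Obj P" "t \<in> Obj P"
  shows "Braid P s t \<in> hom P (fst s @ fst t, snd s @ snd t) (fst t @ fst s, snd t @ snd s)"
    and "pmap (Braid P s t) = block_swap (fst s) (fst t)"
    and "pure X (fst t @ fst s, snd t @ snd s) (Braid P s t)"
proof -
  have Braid: "Braid P s t = ((fst s @ fst t, snd s @ snd t), (fst t @ fst s, snd t @ snd s),
    ((fst s @ fst t, fst t @ fst s, block_swap (fst s) (fst t)), Ident (AXob X (fst t @ fst s)) (snd t @ snd s)))"
    by (simp add: Pobj_def Let_def case_prod_unfold)
  have s: "fst s \<in> Obj Acat" "snd s \<in> axc ob (fst s)" "fst t \<in> Obj Acat" "snd t \<in> axc ob (fst t)"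
    using assms by (simp_all add: Obj_P)
  show "Braid P s t \<in> hom P (fst s @ fst t, snd s @ snd t) (fst t @ fst s, snd t @ snd s)"
    unfolding Braid by (rule pure_hom_PI[OF block_iso_arr[OF block_iso_swap[OF s(1,3)]] axc_append[OF s(2,4)] axact_swap[OF gset_ob s(1,3,2,4)]])
  show "pmap (Braid P s t) = block_swap (fst s) (fst t)"
    "pure X (fst t @ fst s, snd t @ snd s) (Braid P s t)"
    by (simp_all only: Braid pure_def pmap_pval fst_conv snd_conv)
qed

end

section \<open>The permutative structure on \<open>Pobj X\<close>\<close>

context gamma_cat
begin

lemma TAr_P_assoc:
  assumes f: "f \<in> hom P s t" and g: "g \<in> hom P s' t'" and h: "h \<in> hom P s'' t''"
  shows "TAr P (TAr P f g) h = TAr P f (TAr P g h)"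
proof (rule P_eqI)
  note fg = TAr_P[OF f g] and gh = TAr_P[OF g h]
  note L = TAr_P[OF fg(1) h] and R = TAr_P[OF f gh(1)]
  show "TAr P (TAr P f g) h \<in> hom P (fst s @ fst s' @ fst s'', snd s @ snd s' @ snd s'')
      (fst t @ fst t' @ fst t'', snd t @ snd t' @ snd t'')"
    using L(1) by simp
  show "TAr P f (TAr P g h) \<in> hom P (fst s @ fst s' @ fst s'', snd s @ snd s' @ snd s'')
      (fst t @ fst t' @ fst t'', snd t @ snd t' @ snd t'')"
    using R(1) by simp
  show "pval (TAr P (TAr P f g) h) = pval (TAr P f (TAr P g h))"
    by (simp add: L(4) R(4) fg(4) gh(4))
  fix u assume "u \<in> blocks (fst (fst s @ fst s' @ fst s'', snd s @ snd s' @ snd s''))"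
  then have "u \<in> blocks (fst s @ fst s' @ fst s'')" by simp
  then show "pmap (TAr P (TAr P f g) h) u = pmap (TAr P f (TAr P g h)) u"
  proof (cases rule: blocks_appendE)
    case left
    then show ?thesis by (simp add: L(2) R(2) fg(2) blocks_appendI)
  next
    case (right v)
    from right(1) show ?thesis
    proof (cases rule: blocks_appendE)
      case left
      have "sh (length (fst s)) v \<in> blocks (fst s @ fst s')" using left(1) by (rule blocks_appendI)
      then show ?thesis using left right by (simp add: L(2) R(3) fg(3) gh(2))
    next
      case (right w)
      have eq: "sh a (sh b x) = sh (a + b) x" for a b and x :: "nat \<times> nat" by (cases x) simp
      have "v \<in> blocks (fst (fst s' @ fst s'', snd s' @ snd s''))"
        unfolding right(2) fst_conv by (rule blocks_appendI(2)[OF right(1)])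
      from R(3)[OF this] show ?thesis using L(3)[OF right(1)] gh(3)[OF right(1)]
          \<open>u = sh (length (fst s)) v\<close> right(2) by (simp add: eq)
    qed
  qed
qed

lemma Ident_TUnit: "Ident P ([], []) \<in> hom P ([], []) ([], [])" "pval (Ident P ([], [])) = []"
  "([], []) \<in> Obj P"
proof -
  show "([], []) \<in> Obj P" by (simp add: Obj_P Acat_Obj axc_def)
  then show "Ident P ([], []) \<in> hom P ([], []) ([], [])" "pval (Ident P ([], [])) = []"
    using Ident_P[of "([], [])"] by (simp_all add: pure_def)
qed

lemma blocks_Nil [simp]: "blocks [] = {}"
  by (simp add: blocks_def)

lemma sh_0 [simp]: "sh 0 v = v"
  by (cases v) simp

lemma TAr_P_unit:
  assumes "f \<in> hom P s t"
  shows "TAr P (Ident P ([], [])) f = f" "TAr P f (Ident P ([], [])) = f"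
proof -
  note I = Ident_TUnit(1)
  show "TAr P (Ident P ([], [])) f = f"
  proof (rule P_eqI[OF _ assms])
    show "TAr P (Ident P ([], [])) f \<in> hom P s t" using TAr_P(1)[OF I assms] by simp
    show "pmap (TAr P (Ident P ([], [])) f) u = pmap f u" if "u \<in> blocks (fst s)" for u
      using TAr_P(3)[OF I assms that] by simp
    show "pval (TAr P (Ident P ([], [])) f) = pval f"
      using TAr_P(4)[OF I assms] Ident_TUnit(2) by simp
  qed
  show "TAr P f (Ident P ([], [])) = f"
  proof (rule P_eqI[OF _ assms])
    show "TAr P f (Ident P ([], [])) \<in> hom P s t" using TAr_P(1)[OF assms I] by simp
    show "pmap (TAr P f (Ident P ([], []))) u = pmap f u" if "u \<in> blocks (fst s)" for u
      using TAr_P(2)[OF assms I that] by simp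
    show "pval (TAr P f (Ident P ([], []))) = pval f"
      using TAr_P(4)[OF assms I] Ident_TUnit(2) by simp
  qed
qed

lemma TAr_P_Ident:
  assumes "s \<in> Obj P" "t \<in> Obj P"
  shows "TAr P (Ident P s) (Ident P t) = Ident P (TOb P s t)"
proof -
  note s = Ident_P[OF assms(1)] and t = Ident_P[OF assms(2)]
  have O: "(fst s @ fst t, snd s @ snd t) \<in> Obj P"
    using assms by (simp add: Obj_P axc_append)
  note st = Ident_P[OF O] and T = TAr_P[OF s(1) t(1)]
  have "TAr P (Ident P s) (Ident P t) = Ident P (fst s @ fst t, snd s @ snd t)"
  proof (rule pure_eqI[OF T(1) st(1) T(5)[OF s(3) t(3)] st(3)])
    fix u assume "u \<in> blocks (fst (fst s @ fst t, snd s @ snd t))"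
    then have u: "u \<in> blocks (fst s @ fst t)" by simp
    then show "pmap (TAr P (Ident P s) (Ident P t)) u = pmap (Ident P (fst s @ fst t, snd s @ snd t)) u"
    proof (cases rule: blocks_appendE)
      case left
      then show ?thesis using u by (simp add: T(2) s(2) st(2))
    next
      case (right v)
      then show ?thesis using u T(3)[OF right(1)] by (simp add: t(2) st(2))
    qed
  qed
  then show ?thesis by simp
qed

lemma TAr_P_Comp:
  assumes "f \<in> hom P s t" "g \<in> hom P t r" "f' \<in> hom P s' t'" "g' \<in> hom P t' r'"
  shows "TAr P (Comp P g f) (Comp P g' f') = Comp P (TAr P g g') (TAr P f f')"
proof (rule P_eqI)
  note gf = category.comp[OF cat_P assms(1,2)] and gf' = category.comp[OF cat_P assms(3,4)]
  note L = TAr_P[OF gf gf'] and G = TAr_P[OF assms(2,4)] and F = TAr_P[OF assms(1,3)]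
  note R = category.comp[OF cat_P F(1) G(1)] Comp_P[OF F(1) G(1)]
  note c = Comp_P[OF assms(1,2)] and c' = Comp_P[OF assms(3,4)]
  note f = hom_PE[OF assms(1)] and g = hom_PE[OF assms(2)] and f' = hom_PE[OF assms(3)] and g' = hom_PE[OF assms(4)]
  show "TAr P (Comp P g f) (Comp P g' f') \<in> hom P (fst s @ fst s', snd s @ snd s') (fst r @ fst r', snd r @ snd r')"
    by (rule L(1))
  show "Comp P (TAr P g g') (TAr P f f') \<in> hom P (fst s @ fst s', snd s @ snd s') (fst r @ fst r', snd r @ snd r')"
    by (rule R(1))
  have len: "length (pval f) = length (fst t)" "length (pval g) = length (fst r)"
    using f(5) g(5) by (simp_all add: hom_AXob)
  have "axact ar (fst t @ fst t') (fst r @ fst r') (pmap (TAr P g g')) (pval f @ pval f') =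
      axact ar (fst t) (fst r) (pmap g) (pval f) @ axact ar (fst t') (fst r') (pmap g') (pval f')"
    using axact_sum[OF g(2) g'(2) len(1)] by (simp add: TAr_P_eq[OF assms(2,4)])
  then show "pval (TAr P (Comp P g f) (Comp P g' f')) = pval (Comp P (TAr P g g') (TAr P f f'))"
    using len by (simp add: L(4) R(3) c(2) c'(2) F(4) G(4) Comp_AXob_append del: AXob_simps)
  fix u assume "u \<in> blocks (fst (fst s @ fst s', snd s @ snd s'))"
  then have u: "u \<in> blocks (fst s @ fst s')" by simp
  then show "pmap (TAr P (Comp P g f) (Comp P g' f')) u = pmap (Comp P (TAr P g g') (TAr P f f')) u"
  proof (cases rule: blocks_appendE)
    case left
    then show ?thesis using u Acat_arrD(3)[OF f(2) left(1)]
      by (simp add: L(2) R(2) c(1) F(2) G(2))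
  next
    case (right v)
    then show ?thesis using u Acat_arrD(3)[OF f'(2) right(1)]
      by (simp add: L(3) R(2) c'(1) F(3) G(3))
  qed
qed

text \<open>The symmetry, hexagon and unit axioms of the braiding involve only pure arrows and
  reduce to block maps. Naturality of the braiding involves arbitrary arrows and needs a comparison
  of components as well.\<close>

lemma permutative_P: "permutative P"
proof -
  have "permutative_axioms P"
  proof
    fix x y assume x: "x \<in> Obj P" "y \<in> Obj P"
    then show "TOb P x y \<in> Obj P" by (simp add: Obj_P axc_append)
    show "TAr P (Ident P x) (Ident P y) = Ident P (TOb P x y)" by (rule TAr_P_Ident[OF x])
    note B = Braid_P[OF x] and B' = Braid_P[OF x(2,1)]
    show "Braid P x y \<in> hom P (TOb P x y) (TOb P y x)" using B(1) by simp
    have O: "(fst x @ fst y, snd x @ snd y) \<in> Obj P"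
      using x by (simp add: Obj_P axc_append)
    note I = Ident_P[OF O]
    have "Comp P (Braid P y x) (Braid P x y) = Ident P (fst x @ fst y, snd x @ snd y)"
    proof (rule pure_eqI[OF category.comp[OF cat_P B(1) B'(1)] I(1) pure_Comp[OF B(1) B'(1) B(3) B'(3)] I(3)])
      fix u assume u: "u \<in> blocks (fst (fst x @ fst y, snd x @ snd y))"
      then have "u \<in> blocks (fst x @ fst y)" by simp
      then show "pmap (Comp P (Braid P y x) (Braid P x y)) u = pmap (Ident P (fst x @ fst y, snd x @ snd y)) u"
        by (cases rule: blocks_appendE)
          (use u in \<open>simp_all add: Comp_P(1)[OF B(1) B'(1)] B(2) B'(2) I(2) block_swap_left block_swap_right\<close>)
    qed
    then show "Comp P (Braid P y x) (Braid P x y) = Ident P (TOb P x y)" by simp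
    fix z assume z: "z \<in> Obj P"
    show "TOb P (TOb P x y) z = TOb P x (TOb P y z)" by simp
    have yz: "(fst y @ fst z, snd y @ snd z) \<in> Obj P"
      using x z by (simp add: Obj_P axc_append)
    note Iy = Ident_P[OF x(2)] and Iz = Ident_P[OF z] and Bxz = Braid_P[OF x(1) z] and Bx = Braid_P[OF x(1) yz]
    note T1 = TAr_P[OF Iy(1) Bxz(1)] and T2 = TAr_P[OF B(1) Iz(1)]
    have h1: "TAr P (Braid P x y) (Ident P z) \<in> hom P (fst x @ fst y @ fst z, snd x @ snd y @ snd z)
        (fst y @ fst x @ fst z, snd y @ snd x @ snd z)" and p1: "pure X (fst y @ fst x @ fst z, snd y @ snd x @ snd z) (TAr P (Braid P x y) (Ident P z))"
      using T2(1) T2(5)[OF B(3) Iz(3)] by simp_all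
    have h2: "TAr P (Ident P y) (Braid P x z) \<in> hom P (fst y @ fst x @ fst z, snd y @ snd x @ snd z)
        (fst y @ fst z @ fst x, snd y @ snd z @ snd x)" and p2: "pure X (fst y @ fst z @ fst x, snd y @ snd z @ snd x) (TAr P (Ident P y) (Braid P x z))"
      using T1(1) T1(5)[OF Iy(3) Bxz(3)] by simp_all
    have h3: "Braid P x (TOb P y z) \<in> hom P (fst x @ fst y @ fst z, snd x @ snd y @ snd z)
        (fst y @ fst z @ fst x, snd y @ snd z @ snd x)" and p3: "pure X (fst y @ fst z @ fst x, snd y @ snd z @ snd x) (Braid P x (TOb P y z))"
      using Bx(1,3) by simp_all
    show "Braid P x (TOb P y z) = Comp P (TAr P (Ident P y) (Braid P x z)) (TAr P (Braid P x y) (Ident P z))"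
    proof (rule pure_eqI[OF h3 category.comp[OF cat_P h1 h2] p3 pure_Comp[OF h1 h2 p1 p2]])
      fix u assume "u \<in> blocks (fst (fst x @ fst y @ fst z, snd x @ snd y @ snd z))"
      then have u: "u \<in> blocks (fst x @ fst y @ fst z)" by simp
      have eq: "sh a (sh b w) = sh (a + b) w" for a b and w :: "nat \<times> nat" by (cases w) simp
      from u have C: "pmap (Comp P (TAr P (Ident P y) (Braid P x z)) (TAr P (Braid P x y) (Ident P z))) u =
        pmap (TAr P (Ident P y) (Braid P x z)) (pmap (TAr P (Braid P x y) (Ident P z)) u)"
        using Comp_P(1)[OF h1 h2] by simp
      show "pmap (Braid P x (TOb P y z)) u =
        pmap (Comp P (TAr P (Ident P y) (Braid P x z)) (TAr P (Braid P x y) (Ident P z))) u"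
        unfolding C using u
      proof (cases rule: blocks_appendE)
        case left
        have "pmap (TAr P (Braid P x y) (Ident P z)) u = sh (length (fst y)) u"
          using T2(2)[of u] left by (simp add: B(2) blocks_appendI block_swap_left)
        moreover have "pmap (TAr P (Ident P y) (Braid P x z)) (sh (length (fst y)) u) = sh (length (fst y)) (sh (length (fst z)) u)"
          using T1(3)[of u] left by (simp add: Bxz(2) blocks_appendI block_swap_left)
        ultimately show "pmap (Braid P x (TOb P y z)) u =
            pmap (TAr P (Ident P y) (Braid P x z)) (pmap (TAr P (Braid P x y) (Ident P z)) u)"
          using left Bx(2) by (simp add: block_swap_left eq)
      next
        case (right v)
        have L: "pmap (Braid P x (TOb P y z)) u = v"
          using Bx(2) block_swap_right[OF right(1)] right(2) by simp
        from right(1) show "pmap (Braid P x (TOb P y z)) u =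
            pmap (TAr P (Ident P y) (Braid P x z)) (pmap (TAr P (Braid P x y) (Ident P z)) u)"
          unfolding L
        proof (cases rule: blocks_appendE)
          case left
          have "pmap (TAr P (Braid P x y) (Ident P z)) u = v"
            using T2(2)[of u] left right(2) by (simp add: B(2) blocks_appendI block_swap_right)
          then show "v = pmap (TAr P (Ident P y) (Braid P x z)) (pmap (TAr P (Braid P x y) (Ident P z)) u)"
            using T1(2)[of v] left by (simp add: Iy(2))
        next
          case (right w)
          have "pmap (TAr P (Braid P x y) (Ident P z)) u = sh (length (fst y)) (sh (length (fst x)) w)"
            using T2(3)[OF right(1)] right(1,2) \<open>u = sh (length (fst x)) v\<close> by (simp add: Iz(2) eq add.commute)
          moreover have "sh (length (fst x)) w \<in> blocks (fst x @ fst z)" using right(1) by (rule blocks_appendI)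
          ultimately show "v = pmap (TAr P (Ident P y) (Braid P x z)) (pmap (TAr P (Braid P x y) (Ident P z)) u)"
            using T1(3) right by (simp add: Bxz(2) block_swap_right)
        qed
      qed
    qed
  next
    fix f x y f' x' y' assume f: "f \<in> hom P x y" and f': "f' \<in> hom P x' y'"
    show "TAr P f f' \<in> hom P (TOb P x x') (TOb P y y')" using TAr_P(1)[OF f f'] by simp
    note x = category.hom_Obj[OF cat_P f] and x' = category.hom_Obj[OF cat_P f']
    note F = hom_PE[OF f] and F' = hom_PE[OF f']
    note B = Braid_P[OF conjunct2[OF x] conjunct2[OF x']] and B' = Braid_P[OF conjunct1[OF x] conjunct1[OF x']]
    note T = TAr_P[OF f f'] and T' = TAr_P[OF f' f]
    show "Comp P (Braid P y y') (TAr P f f') = Comp P (TAr P f' f) (Braid P x x')"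
    proof (rule P_eqI[OF category.comp[OF cat_P T(1) B(1)] category.comp[OF cat_P B'(1) T'(1)]])
      have O: "fst y \<in> Obj Acat" "fst y' \<in> Obj Acat" using x x' by (simp_all add: Obj_P)
      have hf: "pval f \<in> axc ar (fst y)" "pval f' \<in> axc ar (fst y')"
        using homD[OF F(5)] homD[OF F'(5)] by (simp_all del: AXob_simps)
      \<comment> \<open>Both composites have the component \<open>pval f' @ pval f\<close>: on the
        left the swap permutes the entries of \<open>pval f @ pval f'\<close>, on the right the
        first factor contributes only identities.\<close>
      have "pval (Comp P (Braid P y y') (TAr P f f')) =
          Comp (AXob X (fst y' @ fst y)) (Ident (AXob X (fst y' @ fst y)) (snd y' @ snd y)) (pval f' @ pval f)"
        using axact_swap[OF gset_ar O hf] B(3)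
        by (simp add: Comp_P(2)[OF T(1) B(1)] T(4) B(2) pure_def del: AXob_simps)
      also have "\<dots> = pval f' @ pval f"
        by (rule category.ident_comp[OF cat_AXob hom_AXob_append[OF F'(5) F(5)]])
      also have "\<dots> = Comp (AXob X (fst y' @ fst y)) (pval f' @ pval f)
          (Ident (AXob X (fst y' @ fst y)) (axact ob (fst x') (fst y') (pmap f') (snd x') @ axact ob (fst x) (fst y) (pmap f) (snd x)))"
        by (rule category.comp_ident[OF cat_AXob hom_AXob_append[OF F'(5) F(5)], symmetric])
      also have "Ident (AXob X (fst y' @ fst y)) (axact ob (fst x') (fst y') (pmap f') (snd x') @ axact ob (fst x) (fst y) (pmap f) (snd x))
          = axact ar (fst x' @ fst x) (fst y' @ fst y) (pmap (TAr P f' f)) (Ident (AXob X (fst x' @ fst x)) (snd x' @ snd x))"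
        using axcD[OF F'(3)]
        by (subst axact_Ident[OF hom_PE(2)[OF T'(1), unfolded fst_conv] axc_append[OF F'(3) F(3)]])
          (simp add: TAr_P_eq[OF f' f] axact_sum[OF F'(2) F(2)] del: AXob_simps)
      also have "Comp (AXob X (fst y' @ fst y)) (pval f' @ pval f) \<dots> = pval (Comp P (TAr P f' f) (Braid P x x'))"
        using B'(3) by (simp add: Comp_P(2)[OF B'(1) T'(1)] T'(4) pure_def del: AXob_simps)
      finally show "pval (Comp P (Braid P y y') (TAr P f f')) = pval (Comp P (TAr P f' f) (Braid P x x'))" .
      fix u assume "u \<in> blocks (fst (fst x @ fst x', snd x @ snd x'))"
      then have u: "u \<in> blocks (fst x @ fst x')" by simp
      then show "pmap (Comp P (Braid P y y') (TAr P f f')) u = pmap (Comp P (TAr P f' f) (Braid P x x')) u"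
      proof (cases rule: blocks_appendE)
        case left
        then show ?thesis using u Acat_arrD(3)[OF F(2) left(1)] T'(3)[OF left(1)]
          by (simp add: Comp_P(1)[OF T(1) B(1)] Comp_P(1)[OF B'(1) T'(1)] T(2) B(2) B'(2) block_swap_left)
      next
        case (right v)
        then show ?thesis using u Acat_arrD(3)[OF F'(2) right(1)] T(3)[OF right(1)] T'(2)[OF right(1)]
          by (simp add: Comp_P(1)[OF T(1) B(1)] Comp_P(1)[OF B'(1) T'(1)] B(2) B'(2) block_swap_right)
      qed
    qed
  next
    fix f x y g z f' x' y' g' z'
    assume "f \<in> hom P x y" "g \<in> hom P y z" "f' \<in> hom P x' y'" "g' \<in> hom P y' z'"
    then show "TAr P (Comp P g f) (Comp P g' f') = Comp P (TAr P g g') (TAr P f f')"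
      by (rule TAr_P_Comp)
  next
    fix f g h assume "f \<in> Arr P" "g \<in> Arr P" "h \<in> Arr P"
    then show "TAr P (TAr P f g) h = TAr P f (TAr P g h)"
      by (intro TAr_P_assoc) (erule Arr_hom)+
  next
    show "TUnit P \<in> Obj P" using Ident_TUnit(3) by simp
    show "TOb P (TUnit P) x = x \<and> TOb P x (TUnit P) = x" for x by simp
    show "TAr P (Ident P (TUnit P)) f = f \<and> TAr P f (Ident P (TUnit P)) = f" if "f \<in> Arr P" for f
      using TAr_P_unit[OF Arr_hom[OF that]] by simp
    fix x assume x: "x \<in> Obj P"
    note B = Braid_P[OF x Ident_TUnit(3)] and I = Ident_P[OF x]
    have "Braid P x ([], []) = Ident P x"
    proof (rule pure_eqI)
      show "Braid P x ([], []) \<in> hom P x x" "pure X x (Braid P x ([], []))" using B by simp_all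
      show "pmap (Braid P x ([], [])) u = pmap (Ident P x) u" if "u \<in> blocks (fst x)" for u
        using that B(2) block_swap_left[OF that, of "[]"] by (simp add: I(2))
    qed (rule I)+
    then show "Braid P x (TUnit P) = Ident P x" by simp
  qed
  then show ?thesis by (simp add: permutative_def cat_P)
qed

end

section \<open>Categories of operations\<close>

lemma nat_trans_hom: "\<lbrakk>nat_trans C D F G \<alpha>; x \<in> Obj C\<rbrakk> \<Longrightarrow> \<alpha> x \<in> hom D (FOb F x) (FOb G x)"
  by (simp add: nat_trans_def)

lemma nat_trans_nat:
  "\<lbrakk>nat_trans C D F G \<alpha>; f \<in> hom C x y\<rbrakk> \<Longrightarrow> Comp D (\<alpha> y) (FAr F f) = Comp D (FAr G f) (\<alpha> x)"
  by (auto simp: nat_trans_def hom_def)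

lemma nat_trans_ident:
  assumes "cfunctor C D F"
  shows "nat_trans C D F F (\<lambda>x\<in>Obj C. Ident D (FOb F x))"
proof -
  interpret cfunctor C D F by fact
  show ?thesis
    using C.dom_cod FOb_in D.ident D.ident_comp[OF FAr_in[OF Arr_hom]] D.comp_ident[OF FAr_in[OF Arr_hom]]
    by (simp add: nat_trans_def)
qed

lemma nat_trans_comp:
  assumes "cfunctor C D F" "cfunctor C D G" "cfunctor C D H" "nat_trans C D F G \<alpha>" "nat_trans C D G H \<beta>"
  shows "nat_trans C D F H (\<lambda>x\<in>Obj C. Comp D (\<beta> x) (\<alpha> x))"
proof -
  interpret F: cfunctor C D F by fact
  interpret G: cfunctor C D G by fact
  interpret H: cfunctor C D H by fact
  note \<alpha> = nat_trans_hom[OF assms(4)] and \<beta> = nat_trans_hom[OF assms(5)]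
  have "Comp D (Comp D (\<beta> y) (\<alpha> y)) (FAr F f) = Comp D (FAr H f) (Comp D (\<beta> x) (\<alpha> x))"
    if f: "f \<in> hom C x y" for f x y
  proof -
    note xy = F.C.hom_Obj[OF f]
    have "Comp D (Comp D (\<beta> y) (\<alpha> y)) (FAr F f) = Comp D (\<beta> y) (Comp D (\<alpha> y) (FAr F f))"
      using F.D.comp_assoc[OF F.FAr_in[OF f] \<alpha> \<beta>] xy by simp
    also have "\<dots> = Comp D (\<beta> y) (Comp D (FAr G f) (\<alpha> x))"
      by (simp add: nat_trans_nat[OF assms(4) f])
    also have "\<dots> = Comp D (Comp D (\<beta> y) (FAr G f)) (\<alpha> x)"
      using F.D.comp_assoc[OF \<alpha> G.FAr_in[OF f] \<beta>] xy by simp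
    also have "\<dots> = Comp D (FAr H f) (Comp D (\<beta> x) (\<alpha> x))"
      using F.D.comp_assoc[OF \<alpha> \<beta> H.FAr_in[OF f]] xy by (simp add: nat_trans_nat[OF assms(5) f])
    finally show ?thesis .
  qed
  from this[OF Arr_hom] show ?thesis
    using F.C.dom_cod F.D.comp[OF \<alpha> \<beta>] by (simp add: nat_trans_def)
qed

section \<open>Categories of operations between Gamma-categories\<close>

lemma gprod_Obj [simp]: "Obj (gprod Xs ps) = gtup (map ob_gset Xs) ps"
  by (auto simp: gprod_def gtup_def)

lemma gprod_Arr [simp]: "Arr (gprod Xs ps) = gtup (map ar_gset Xs) ps"
  by (auto simp: gprod_def gtup_def)

lemma hom_gprod: "f \<in> hom (gprod Xs ps) x y \<longleftrightarrow> length f = length Xs \<and> length x = length Xs \<and>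
    length y = length Xs \<and> (\<forall>i<length Xs. f ! i \<in> hom (FOb (Xs ! i) (ps ! i)) (x ! i) (y ! i))"
  by (auto simp: gprod_def hom_prod_cat)

lemma gprod_Ident: "Ident (gprod Xs ps) x = tab (length Xs) (\<lambda>i. Ident (FOb (Xs ! i) (ps ! i)) (x ! i))"
  by (simp add: gprod_def cong: map_cong)

lemma gprod_Comp: "Comp (gprod Xs ps) g f = tab (length Xs) (\<lambda>i. Comp (FOb (Xs ! i) (ps ! i)) (g ! i) (f ! i))"
  by (simp add: gprod_def cong: map_cong)

lemma gacts_Ob:
  assumes "xs \<in> gtup (map ob_gset Xs) ps"
  shows "FOb (gacts Xs ps qs \<psi>s) xs =
    tab (length (map ob_gset Xs)) (\<lambda>i. GA (map ob_gset Xs ! i) (ps ! i, qs ! i, \<psi>s ! i) (xs ! i))"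
proof -
  have "xs \<in> Obj (prod_cat (gcats Xs ps))" using assms by (simp only: gprod_def[symmetric] gprod_Obj)
  then show ?thesis by (simp add: gacts_def prod_ftor_def del: prod_cat_simps)
qed

lemma gacts_Ar:
  assumes "fs \<in> gtup (map ar_gset Xs) ps"
  shows "FAr (gacts Xs ps qs \<psi>s) fs =
    tab (length (map ar_gset Xs)) (\<lambda>i. GA (map ar_gset Xs ! i) (ps ! i, qs ! i, \<psi>s ! i) (fs ! i))"
proof -
  have "fs \<in> Arr (prod_cat (gcats Xs ps))" using assms by (simp only: gprod_def[symmetric] gprod_Arr)
  then show ?thesis by (simp add: gacts_def prod_ftor_def del: prod_cat_simps)
qed

lemma gtup_act:
  assumes "\<And>S. S \<in> set Ss \<Longrightarrow> gset S" "Fcat_tuple ps qs \<psi>s" "length ps = length Ss" "xs \<in> gtup Ss ps"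
  shows "tab (length Ss) (\<lambda>i. GA (Ss ! i) (ps ! i, qs ! i, \<psi>s ! i) (xs ! i)) \<in> gtup Ss qs"
proof -
  have "GA (Ss ! i) (ps ! i, qs ! i, \<psi>s ! i) (xs ! i) \<in> GS (Ss ! i) (qs ! i)" if "i < length Ss" for i
    using assms that by (intro gset.GA_in) (simp_all add: Fcat_tuple_def gtup_def)
  then show ?thesis by (simp add: gtup_def)
qed

lemma gamma_catI: "gamma_category X \<Longrightarrow> gamma_cat X"
  by (rule gamma_cat.intro)

locale gamma_cats =
  fixes Xs :: "('o, 'm) gcat list" and Z :: "('o, 'm) gcat"
  assumes gamma_Xs: "X \<in> set Xs \<Longrightarrow> gamma_category X" and gamma_Z: "gamma_category Z"

sublocale gamma_cats \<subseteq> Z: gamma_cat Z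
  using gamma_Z by (rule gamma_catI)

context gamma_cats
begin

abbreviation "obs \<equiv> map ob_gset Xs"
abbreviation "ars \<equiv> map ar_gset Xs"

lemma gamma_cat_nth: "i < length Xs \<Longrightarrow> gamma_cat (Xs ! i)"
  using gamma_Xs by (simp add: gamma_catI)

lemma gset_obs: "S \<in> set obs \<Longrightarrow> gset S"
  using gamma_Xs gamma_cat.gset_ob[OF gamma_catI] by auto

lemma gset_ars: "S \<in> set ars \<Longrightarrow> gset S"
  using gamma_Xs gamma_cat.gset_ar[OF gamma_catI] by auto

lemma cat_gprod: "category (gprod Xs ps)"
  unfolding gprod_def by (rule category_prod_cat) (simp add: gamma_cat.cat_X[OF gamma_cat_nth])

text \<open>Naturality of an operation is an equation between functors, and functors are pairs of
  extensional maps. It splits into the naturality of two families of maps of Gamma-sets, on objects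
  and on arrows; the two basepoint conditions split in the same way.\<close>

lemma gamma_op_iff:
  "gamma_op Xs Z F \<longleftrightarrow> F \<in> extensional {ps. length ps = length Xs} \<and>
    (\<forall>ps. length ps = length Xs \<longrightarrow> cfunctor (gprod Xs ps) (FOb Z (prod_list ps)) (F ps)) \<and>
    gset_op obs (ob_gset Z) (\<lambda>ps. FOb (F ps)) \<and> gset_op ars (ar_gset Z) (\<lambda>ps. FAr (F ps))"
proof (intro iffI conjI)
  assume F: "gamma_op Xs Z F"
  then show "F \<in> extensional {ps. length ps = length Xs}"
    and Fun: "\<forall>ps. length ps = length Xs \<longrightarrow> cfunctor (gprod Xs ps) (FOb Z (prod_list ps)) (F ps)"
    by (simp_all add: gamma_op_def)
  have nat: "comp_ftor (gprod Xs ps) (act Z (smash_arr ps qs \<psi>s)) (F ps) =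
      comp_ftor (gprod Xs ps) (F qs) (gacts Xs ps qs \<psi>s)"
    if "length ps = length Xs" "Fcat_tuple ps qs \<psi>s" for ps qs \<psi>s
    using F that by (simp add: gamma_op_def)
  have base: "FAr (F ps) fs = Ident (FOb Z (prod_list ps)) (basept Z (prod_list ps))"
    if "length ps = length Xs" "fs \<in> Arr (gprod Xs ps)" "i < length Xs"
      "fs ! i = Ident (FOb (Xs ! i) (ps ! i)) (basept (Xs ! i) (ps ! i))" for ps fs i
    using F that unfolding gamma_op_def by blast
  show "gset_op obs (ob_gset Z) (\<lambda>ps. FOb (F ps))"
  proof (rule gset_op.intro)
    fix ps xs assume ps: "length ps = length obs" and xs: "xs \<in> gtup obs ps"
    show "FOb (F ps) xs \<in> GS (ob_gset Z) (prod_list ps)"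
      using cfunctor.FOb_in[OF Fun[rule_format]] ps xs by simp
    show "FOb (F ps) xs = GB (ob_gset Z) (prod_list ps)"
      if "i < length obs" "xs ! i = GB (obs ! i) (ps ! i)" for i
      using F ps xs that by (auto simp: gamma_op_def)
    fix qs \<psi>s assume "Fcat_tuple ps qs \<psi>s"
    then have "FOb (comp_ftor (gprod Xs ps) (act Z (smash_arr ps qs \<psi>s)) (F ps)) xs =
        FOb (comp_ftor (gprod Xs ps) (F qs) (gacts Xs ps qs \<psi>s)) xs"
      using nat[of ps qs \<psi>s] ps by simp
    then show "GA (ob_gset Z) (smash_arr ps qs \<psi>s) (FOb (F ps) xs) =
        FOb (F qs) (tab (length obs) (\<lambda>i. GA (obs ! i) (ps ! i, qs ! i, \<psi>s ! i) (xs ! i)))"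
      using xs by (simp add: comp_ftor_def compose_eq gacts_Ob)
  qed (rule gset_obs)
  show "gset_op ars (ar_gset Z) (\<lambda>ps. FAr (F ps))"
  proof (rule gset_op.intro)
    fix ps xs assume ps: "length ps = length ars" and xs: "xs \<in> gtup ars ps"
    show "FAr (F ps) xs \<in> GS (ar_gset Z) (prod_list ps)"
      using cfunctor.FAr_in'[OF Fun[rule_format]] ps xs by simp
    show "FAr (F ps) xs = GB (ar_gset Z) (prod_list ps)"
      if "i < length ars" "xs ! i = GB (ars ! i) (ps ! i)" for i
      using base[of ps xs i] ps xs that by simp
    fix qs \<psi>s assume "Fcat_tuple ps qs \<psi>s"
    then have "FAr (comp_ftor (gprod Xs ps) (act Z (smash_arr ps qs \<psi>s)) (F ps)) xs =
        FAr (comp_ftor (gprod Xs ps) (F qs) (gacts Xs ps qs \<psi>s)) xs"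
      using nat[of ps qs \<psi>s] ps by simp
    then show "GA (ar_gset Z) (smash_arr ps qs \<psi>s) (FAr (F ps) xs) =
        FAr (F qs) (tab (length ars) (\<lambda>i. GA (ars ! i) (ps ! i, qs ! i, \<psi>s ! i) (xs ! i)))"
      using xs by (simp add: comp_ftor_def compose_eq gacts_Ar)
  qed (rule gset_ars)
next
  assume *: "F \<in> extensional {ps. length ps = length Xs} \<and>
    (\<forall>ps. length ps = length Xs \<longrightarrow> cfunctor (gprod Xs ps) (FOb Z (prod_list ps)) (F ps)) \<and>
    gset_op obs (ob_gset Z) (\<lambda>ps. FOb (F ps)) \<and> gset_op ars (ar_gset Z) (\<lambda>ps. FAr (F ps))"
  then interpret Ob: gset_op obs "ob_gset Z" "\<lambda>ps. FOb (F ps)" by simp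
  from * interpret Ar: gset_op ars "ar_gset Z" "\<lambda>ps. FAr (F ps)" by simp
  have "comp_ftor (gprod Xs ps) (act Z (smash_arr ps qs \<psi>s)) (F ps) =
      comp_ftor (gprod Xs ps) (F qs) (gacts Xs ps qs \<psi>s)"
    if "length ps = length Xs" "Fcat_tuple ps qs \<psi>s" for ps qs \<psi>s
    using Ob.H_nat[OF that(2)] Ar.H_nat[OF that(2)] that(1)
    by (auto simp: comp_ftor_def compose_def gacts_Ob gacts_Ar intro!: restrict_ext)
  with * show "gamma_op Xs Z F"
    using Ob.H_base Ar.H_base by (auto simp: gamma_op_def)
qed

text \<open>Compatibility with the maps of \<open>Fcat\<close> and the basepoint condition make a
  modification a family of maps from the object Gamma-sets of the inputs to the arrow Gamma-set of
  \<open>Z\<close>.\<close>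

lemma gamma_mod_iff:
  assumes "gamma_op Xs Z F" "gamma_op Xs Z G"
  shows "gamma_mod Xs Z F G \<theta> \<longleftrightarrow> \<theta> \<in> extensional {ps. length ps = length Xs} \<and>
    (\<forall>ps. length ps = length Xs \<longrightarrow> nat_trans (gprod Xs ps) (FOb Z (prod_list ps)) (F ps) (G ps) (\<theta> ps)) \<and>
    gset_op obs (ar_gset Z) \<theta>"
proof (intro iffI conjI)
  assume \<theta>: "gamma_mod Xs Z F G \<theta>"
  then show "\<theta> \<in> extensional {ps. length ps = length Xs}"
    and nt: "\<forall>ps. length ps = length Xs \<longrightarrow> nat_trans (gprod Xs ps) (FOb Z (prod_list ps)) (F ps) (G ps) (\<theta> ps)"
    by (simp_all add: gamma_mod_def)
  show "gset_op obs (ar_gset Z) \<theta>"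
  proof (rule gset_op.intro)
    fix ps xs assume ps: "length ps = length obs" and xs: "xs \<in> gtup obs ps"
    show "\<theta> ps xs \<in> GS (ar_gset Z) (prod_list ps)"
      using homD[OF nat_trans_hom[OF nt[rule_format]]] ps xs by simp
    show "\<theta> ps xs = GB (ar_gset Z) (prod_list ps)"
      if "i < length obs" "xs ! i = GB (obs ! i) (ps ! i)" for i
      using \<theta> ps xs that by (auto simp: gamma_mod_def)
    fix qs \<psi>s assume "Fcat_tuple ps qs \<psi>s"
    then show "GA (ar_gset Z) (smash_arr ps qs \<psi>s) (\<theta> ps xs) =
        \<theta> qs (tab (length obs) (\<lambda>i. GA (obs ! i) (ps ! i, qs ! i, \<psi>s ! i) (xs ! i)))"
      using \<theta> ps xs by (simp add: gamma_mod_def gacts_Ob)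
  qed (rule gset_obs)
next
  assume *: "\<theta> \<in> extensional {ps. length ps = length Xs} \<and>
    (\<forall>ps. length ps = length Xs \<longrightarrow> nat_trans (gprod Xs ps) (FOb Z (prod_list ps)) (F ps) (G ps) (\<theta> ps)) \<and>
    gset_op obs (ar_gset Z) \<theta>"
  then interpret gset_op obs "ar_gset Z" \<theta> by simp
  have "FAr (act Z (smash_arr ps qs \<psi>s)) (\<theta> ps xs) = \<theta> qs (FOb (gacts Xs ps qs \<psi>s) xs)"
    if "length ps = length Xs" "Fcat_tuple ps qs \<psi>s" "xs \<in> gtup obs ps" for ps qs \<psi>s xs
    using H_nat[OF that(2)] that(1,3) by (simp add: gacts_Ob)
  then show "gamma_mod Xs Z F G \<theta>"
    using * H_base by (auto simp: gamma_mod_def)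
qed

lemma gamma_opD:
  assumes "gamma_op Xs Z F"
  shows "F \<in> extensional {ps. length ps = length Xs}"
    "length ps = length Xs \<Longrightarrow> cfunctor (gprod Xs ps) (FOb Z (prod_list ps)) (F ps)"
    "gset_op obs (ob_gset Z) (\<lambda>ps. FOb (F ps))" "gset_op ars (ar_gset Z) (\<lambda>ps. FAr (F ps))"
  using assms by (simp_all add: gamma_op_iff)

lemma gamma_modD:
  assumes "gamma_op Xs Z F" "gamma_op Xs Z G" "gamma_mod Xs Z F G \<theta>"
  shows "\<theta> \<in> extensional {ps. length ps = length Xs}"
    "length ps = length Xs \<Longrightarrow> nat_trans (gprod Xs ps) (FOb Z (prod_list ps)) (F ps) (G ps) (\<theta> ps)"
    "gset_op obs (ar_gset Z) \<theta>"
  using assms by (simp_all add: gamma_mod_iff)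

lemma gamma_mod_eqI:
  assumes "gamma_mod Xs Z F G \<theta>" "gamma_mod Xs Z F G \<eta>"
    "\<And>ps xs. \<lbrakk>length ps = length Xs; xs \<in> gtup obs ps\<rbrakk> \<Longrightarrow> \<theta> ps xs = \<eta> ps xs"
  shows "\<theta> = \<eta>"
proof (rule extensionalityI)
  show "\<theta> \<in> extensional {ps. length ps = length Xs}" "\<eta> \<in> extensional {ps. length ps = length Xs}"
    using assms(1,2) by (simp_all add: gamma_mod_def)
  fix ps :: "nat list" assume "ps \<in> {ps. length ps = length Xs}"
  then have ps: "length ps = length Xs" by simp
  then have "\<theta> ps \<in> extensional (gtup obs ps)" "\<eta> ps \<in> extensional (gtup obs ps)"
    using assms(1,2) by (simp_all add: gamma_mod_def nat_trans_def)
  then show "\<theta> ps = \<eta> ps" using assms(3)[OF ps] by (rule extensionalityI)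
qed

lemma gamma_mod_ident:
  assumes F: "gamma_op Xs Z F"
  shows "gamma_mod Xs Z F F (\<lambda>ps\<in>{ps. length ps = length Xs}. \<lambda>xs\<in>Obj (gprod Xs ps).
    Ident (FOb Z (prod_list ps)) (FOb (F ps) xs))" (is "gamma_mod _ _ _ _ ?I")
proof -
  interpret Ob: gset_op obs "ob_gset Z" "\<lambda>ps. FOb (F ps)" by (rule gamma_opD[OF F])
  have "gset_op obs (ar_gset Z) ?I"
  proof (rule gset_op.intro)
    fix ps xs assume ps: "length ps = length obs" and xs: "xs \<in> gtup obs ps"
    note in_Z = Ob.H_in[OF ps xs]
    show "?I ps xs \<in> GS (ar_gset Z) (prod_list ps)"
      using homD[OF category.ident[OF Z.cat_X]] in_Z ps xs by simp
    show "?I ps xs = GB (ar_gset Z) (prod_list ps)"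
      if "i < length obs" "xs ! i = GB (obs ! i) (ps ! i)" for i
      using Ob.H_base[OF ps xs that] ps xs by simp
    fix qs \<psi>s assume \<psi>: "Fcat_tuple ps qs \<psi>s"
    then have qs: "length qs = length Xs" using ps by (simp add: Fcat_tuple_def)
    show "GA (ar_gset Z) (smash_arr ps qs \<psi>s) (?I ps xs) =
        ?I qs (tab (length obs) (\<lambda>i. GA (obs ! i) (ps ! i, qs ! i, \<psi>s ! i) (xs ! i)))"
      using cfunctor.FAr_ident[OF Z.act_cfunctor[OF smash_arr[OF \<psi>]]] in_Z ps xs qs
        Ob.H_nat[OF \<psi> ps xs] gtup_act[OF gset_obs \<psi> ps xs] by simp
  qed (rule gset_obs)
  then show ?thesis
    using nat_trans_ident[OF gamma_opD(2)[OF F]] by (simp add: gamma_mod_iff[OF F F])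
qed

text \<open>Each \<open>act Z u\<close> is a functor, so pointwise composites of natural families
  are natural. This serves for vertical composites of modifications and for putting together the two
  factors of a horizontal composite.\<close>

lemma gset_op_Comp:
  assumes "gset_op Ss (ar_gset Z) K" "gset_op Ss (ar_gset Z) L"
    "\<And>ps xs. \<lbrakk>length ps = length Ss; xs \<in> gtup Ss ps\<rbrakk> \<Longrightarrow> Dom (FOb Z (prod_list ps)) (L ps xs) = Cod (FOb Z (prod_list ps)) (K ps xs)"
    "\<And>ps xs. \<lbrakk>length ps = length Ss; xs \<in> gtup Ss ps\<rbrakk> \<Longrightarrow> M ps xs = Comp (FOb Z (prod_list ps)) (L ps xs) (K ps xs)"
  shows "gset_op Ss (ar_gset Z) M"
proof -
  interpret K: gset_op Ss "ar_gset Z" K by fact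
  interpret L: gset_op Ss "ar_gset Z" L by fact
  have homs: "K ps xs \<in> hom (FOb Z (prod_list ps)) (Dom (FOb Z (prod_list ps)) (K ps xs)) (Cod (FOb Z (prod_list ps)) (K ps xs))"
    "L ps xs \<in> hom (FOb Z (prod_list ps)) (Cod (FOb Z (prod_list ps)) (K ps xs)) (Cod (FOb Z (prod_list ps)) (L ps xs))"
    if "length ps = length Ss" "xs \<in> gtup Ss ps" for ps xs
    using K.H_in[OF that] L.H_in[OF that] assms(3)[OF that] by (simp_all add: hom_def)
  show ?thesis
  proof (rule gset_op.intro)
    fix ps xs assume ps: "length ps = length Ss" and xs: "xs \<in> gtup Ss ps"
    note hs = homs[OF ps xs]
    show "M ps xs \<in> GS (ar_gset Z) (prod_list ps)"
      using homD[OF category.comp[OF Z.cat_X hs]] by (simp add: assms(4)[OF ps xs])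
    show "M ps xs = GB (ar_gset Z) (prod_list ps)"
      if "i < length Ss" "xs ! i = GB (Ss ! i) (ps ! i)" for i
      using K.H_base[OF ps xs that] L.H_base[OF ps xs that]
        category.ident_comp[OF Z.cat_X category.ident[OF Z.cat_X Z.basept_in]]
      by (simp add: assms(4)[OF ps xs])
    fix qs \<psi>s assume \<psi>: "Fcat_tuple ps qs \<psi>s"
    then have qs: "length qs = length Ss" using ps by (simp add: Fcat_tuple_def)
    show "GA (ar_gset Z) (smash_arr ps qs \<psi>s) (M ps xs) =
        M qs (tab (length Ss) (\<lambda>i. GA (Ss ! i) (ps ! i, qs ! i, \<psi>s ! i) (xs ! i)))"
      using cfunctor.FAr_comp[OF Z.act_cfunctor[OF smash_arr[OF \<psi>]] hs]
        K.H_nat[OF \<psi> ps xs] L.H_nat[OF \<psi> ps xs]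
      by (simp add: assms(4)[OF ps xs] assms(4)[OF qs gtup_act[OF K.gset_Ss \<psi> ps xs]])
  qed (rule K.gset_Ss)
qed

lemma gamma_mod_comp:
  assumes F: "gamma_op Xs Z F" and G: "gamma_op Xs Z G" and H: "gamma_op Xs Z H"
    and \<theta>: "gamma_mod Xs Z F G \<theta>" and \<eta>: "gamma_mod Xs Z G H \<eta>"
  shows "gamma_mod Xs Z F H (\<lambda>ps\<in>{ps. length ps = length Xs}. \<lambda>xs\<in>Obj (gprod Xs ps).
    Comp (FOb Z (prod_list ps)) (\<eta> ps xs) (\<theta> ps xs))" (is "gamma_mod _ _ _ _ ?C")
proof -
  note \<theta>' = gamma_modD[OF F G \<theta>] and \<eta>' = gamma_modD[OF G H \<eta>]
  have "gset_op obs (ar_gset Z) ?C"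
  proof (rule gset_op_Comp[OF \<theta>'(3) \<eta>'(3)])
    fix ps xs assume "length ps = length obs" "xs \<in> gtup obs ps"
    then have ps: "length ps = length Xs" "xs \<in> Obj (gprod Xs ps)" by simp_all
    then show "Dom (FOb Z (prod_list ps)) (\<eta> ps xs) = Cod (FOb Z (prod_list ps)) (\<theta> ps xs)"
      using homD[OF nat_trans_hom[OF \<theta>'(2)]] homD[OF nat_trans_hom[OF \<eta>'(2)]] by metis
    show "?C ps xs = Comp (FOb Z (prod_list ps)) (\<eta> ps xs) (\<theta> ps xs)" using ps by simp
  qed
  then show ?thesis
    using nat_trans_comp[OF gamma_opD(2)[OF F] gamma_opD(2)[OF G] gamma_opD(2)[OF H] \<theta>'(2) \<eta>'(2)]
    by (simp add: gamma_mod_iff[OF F H])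
qed

lemma hom_gamma_ops: "t \<in> hom (gamma_ops Xs Z) F G \<longleftrightarrow>
    (\<exists>\<theta>. t = (F, G, \<theta>) \<and> gamma_op Xs Z F \<and> gamma_op Xs Z G \<and> gamma_mod Xs Z F G \<theta>)"
  by (auto simp: hom_def gamma_ops_def)

lemma category_gamma_ops: "category (gamma_ops Xs Z)"
proof
  fix t assume "t \<in> Arr (gamma_ops Xs Z)"
  then show "Dom (gamma_ops Xs Z) t \<in> Obj (gamma_ops Xs Z) \<and> Cod (gamma_ops Xs Z) t \<in> Obj (gamma_ops Xs Z)"
    by (auto simp: gamma_ops_def)
next
  fix F assume "F \<in> Obj (gamma_ops Xs Z)"
  then have "gamma_op Xs Z F" by (simp add: gamma_ops_def)
  from gamma_mod_ident[OF this] this show "Ident (gamma_ops Xs Z) F \<in> hom (gamma_ops Xs Z) F F"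
    unfolding hom_gamma_ops by (simp add: gamma_ops_def)
next
  fix t u F G H assume "t \<in> hom (gamma_ops Xs Z) F G" "u \<in> hom (gamma_ops Xs Z) G H"
  then obtain \<theta> \<eta> where t: "t = (F, G, \<theta>)" "u = (G, H, \<eta>)" and F: "gamma_op Xs Z F"
    and G: "gamma_op Xs Z G" and H: "gamma_op Xs Z H"
    and \<theta>: "gamma_mod Xs Z F G \<theta>" and \<eta>: "gamma_mod Xs Z G H \<eta>" by (auto simp: hom_gamma_ops)
  show "Comp (gamma_ops Xs Z) u t \<in> hom (gamma_ops Xs Z) F H"
    using gamma_mod_comp[OF F G H \<theta> \<eta>] F H unfolding hom_gamma_ops by (simp add: gamma_ops_def t)
next
  fix t F G assume "t \<in> hom (gamma_ops Xs Z) F G"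
  then obtain \<theta> where t: "t = (F, G, \<theta>)" and F: "gamma_op Xs Z F"
    and G: "gamma_op Xs Z G" and \<theta>: "gamma_mod Xs Z F G \<theta>" by (auto simp: hom_gamma_ops)
  have h: "\<theta> ps xs \<in> hom (FOb Z (prod_list ps)) (FOb (F ps) xs) (FOb (G ps) xs)"
    if "length ps = length Xs" "xs \<in> gtup obs ps" for ps xs
    using nat_trans_hom[OF gamma_modD(2)[OF F G \<theta>]] that by simp
  show "Comp (gamma_ops Xs Z) t (Ident (gamma_ops Xs Z) F) = t"
    using gamma_mod_eqI[OF gamma_mod_comp[OF F F G gamma_mod_ident[OF F] \<theta>] \<theta>]
      category.comp_ident[OF Z.cat_X h] by (simp add: gamma_ops_def t)
  show "Comp (gamma_ops Xs Z) (Ident (gamma_ops Xs Z) G) t = t"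
    using gamma_mod_eqI[OF gamma_mod_comp[OF F G G \<theta> gamma_mod_ident[OF G]] \<theta>]
      category.ident_comp[OF Z.cat_X h] by (simp add: gamma_ops_def t)
next
  fix t u v F G H K
  assume "t \<in> hom (gamma_ops Xs Z) F G" "u \<in> hom (gamma_ops Xs Z) G H" "v \<in> hom (gamma_ops Xs Z) H K"
  then obtain \<theta> \<eta> \<zeta> where t: "t = (F, G, \<theta>)" "u = (G, H, \<eta>)" "v = (H, K, \<zeta>)"
    and ops: "gamma_op Xs Z F" "gamma_op Xs Z G" "gamma_op Xs Z H" "gamma_op Xs Z K"
    and \<theta>: "gamma_mod Xs Z F G \<theta>" and \<eta>: "gamma_mod Xs Z G H \<eta>" and \<zeta>: "gamma_mod Xs Z H K \<zeta>"
    by (auto simp: hom_gamma_ops)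
  have "Comp (FOb Z (prod_list ps)) (\<zeta> ps xs) (Comp (FOb Z (prod_list ps)) (\<eta> ps xs) (\<theta> ps xs)) =
      Comp (FOb Z (prod_list ps)) (Comp (FOb Z (prod_list ps)) (\<zeta> ps xs) (\<eta> ps xs)) (\<theta> ps xs)"
    if ps: "length ps = length Xs" and xs: "xs \<in> Obj (gprod Xs ps)" for ps xs
    by (rule category.comp_assoc[OF Z.cat_X nat_trans_hom[OF gamma_modD(2)[OF ops(1,2) \<theta> ps] xs]
          nat_trans_hom[OF gamma_modD(2)[OF ops(2,3) \<eta> ps] xs] nat_trans_hom[OF gamma_modD(2)[OF ops(3,4) \<zeta> ps] xs]])
  then show "Comp (gamma_ops Xs Z) v (Comp (gamma_ops Xs Z) u t) =
      Comp (gamma_ops Xs Z) (Comp (gamma_ops Xs Z) v u) t"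
    by (auto simp: gamma_ops_def t intro!: restrict_ext)
qed

end

section \<open>Categories of multilinear functors and transformations\<close>

lemma (in linear_functor) update_Obj:
  assumes "constraint_dom Cs i xs y"
  shows "xs \<in> Obj (prod_cat Cs)" "xs[i := y] \<in> Obj (prod_cat Cs)" "xs[i := TOb (Cs ! i) (xs ! i) y] \<in> Obj (prod_cat Cs)"
  using assms permutative.TOb_in[OF permutative_Cs, of "Cs ! i" "xs ! i" y]
  by (auto simp: constraint_dom_def nth_list_update)

lemma linear_trans_ident:
  assumes "linear_functor Cs D F"
  shows "linear_trans Cs D F F (\<lambda>xs\<in>Obj (prod_cat Cs). Ident D (FOb (LF F) xs))"
proof -
  interpret linear_functor Cs D F by fact
  have "Comp D (Ident D (FOb (LF F) (xs[i := TOb (Cs ! i) (xs ! i) y]))) (LC F i xs y) =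
      Comp D (LC F i xs y) (TAr D (Ident D (FOb (LF F) xs)) (Ident D (FOb (LF F) (xs[i := y]))))"
    if "constraint_dom Cs i xs y" for i xs y
    using D.ident_comp[OF LC_in[OF that]] D.comp_ident[OF LC_in[OF that]] D.TAr_ident update_Obj[OF that] FOb_in
    by simp
  then show ?thesis
    using nat_trans_ident[OF cfunctor_axioms] update_Obj by (simp add: linear_trans_def del: prod_cat_simps)
qed

lemma linear_trans_comp:
  assumes "linear_functor Cs D F" "linear_functor Cs D G" "linear_functor Cs D H"
    "linear_trans Cs D F G \<alpha>" "linear_trans Cs D G H \<beta>"
  shows "linear_trans Cs D F H (\<lambda>xs\<in>Obj (prod_cat Cs). Comp D (\<beta> xs) (\<alpha> xs))"
proof -
  interpret F: linear_functor Cs D F by fact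
  interpret G: linear_functor Cs D G by fact
  interpret H: linear_functor Cs D H by fact
  have nt: "nat_trans (prod_cat Cs) D (LF F) (LF G) \<alpha>" "nat_trans (prod_cat Cs) D (LF G) (LF H) \<beta>"
    using assms(4,5) by (simp_all add: linear_trans_def)
  note \<alpha> = nat_trans_hom[OF nt(1)] and \<beta> = nat_trans_hom[OF nt(2)]
  have "Comp D (Comp D (\<beta> (xs[i := TOb (Cs ! i) (xs ! i) y])) (\<alpha> (xs[i := TOb (Cs ! i) (xs ! i) y]))) (LC F i xs y) =
      Comp D (LC H i xs y) (TAr D (Comp D (\<beta> xs) (\<alpha> xs)) (Comp D (\<beta> (xs[i := y])) (\<alpha> (xs[i := y]))))"
    if c: "constraint_dom Cs i xs y" for i xs y
  proof -
    let ?xy = "xs[i := TOb (Cs ! i) (xs ! i) y]"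
    note O = F.update_Obj[OF c]
    have Ta: "TAr D (\<alpha> xs) (\<alpha> (xs[i := y])) \<in> hom D (TOb D (FOb (LF F) xs) (FOb (LF F) (xs[i := y]))) (TOb D (FOb (LF G) xs) (FOb (LF G) (xs[i := y])))"
      and Tb: "TAr D (\<beta> xs) (\<beta> (xs[i := y])) \<in> hom D (TOb D (FOb (LF G) xs) (FOb (LF G) (xs[i := y]))) (TOb D (FOb (LF H) xs) (FOb (LF H) (xs[i := y])))"
      by (rule F.D.TAr_in[OF \<alpha>[OF O(1)] \<alpha>[OF O(2)]], rule F.D.TAr_in[OF \<beta>[OF O(1)] \<beta>[OF O(2)]])
    have "Comp D (Comp D (\<beta> ?xy) (\<alpha> ?xy)) (LC F i xs y) = Comp D (\<beta> ?xy) (Comp D (\<alpha> ?xy) (LC F i xs y))"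
      by (rule F.D.comp_assoc[OF F.LC_in[OF c] \<alpha>[OF O(3)] \<beta>[OF O(3)], symmetric])
    also have "\<dots> = Comp D (\<beta> ?xy) (Comp D (LC G i xs y) (TAr D (\<alpha> xs) (\<alpha> (xs[i := y]))))"
      using assms(4) c by (simp add: linear_trans_def)
    also have "\<dots> = Comp D (Comp D (\<beta> ?xy) (LC G i xs y)) (TAr D (\<alpha> xs) (\<alpha> (xs[i := y])))"
      by (rule F.D.comp_assoc[OF Ta G.LC_in[OF c] \<beta>[OF O(3)]])
    also have "\<dots> = Comp D (Comp D (LC H i xs y) (TAr D (\<beta> xs) (\<beta> (xs[i := y])))) (TAr D (\<alpha> xs) (\<alpha> (xs[i := y])))"
      using assms(5) c by (simp add: linear_trans_def)
    also have "\<dots> = Comp D (LC H i xs y) (Comp D (TAr D (\<beta> xs) (\<beta> (xs[i := y]))) (TAr D (\<alpha> xs) (\<alpha> (xs[i := y]))))"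
      by (rule F.D.comp_assoc[OF Ta Tb H.LC_in[OF c], symmetric])
    finally show ?thesis
      by (simp add: F.D.TAr_comp[OF \<alpha>[OF O(1)] \<beta>[OF O(1)] \<alpha>[OF O(2)] \<beta>[OF O(2)]])
  qed
  moreover have "Comp D (\<beta> xs) (\<alpha> xs) = Ident D (FOb (LF F) xs)"
    if "xs \<in> Obj (prod_cat Cs)" "\<exists>i<length Cs. xs ! i = TUnit (Cs ! i)" for xs
  proof -
    have "\<alpha> xs = Ident D (FOb (LF F) xs)" "\<beta> xs = Ident D (FOb (LF G) xs)"
      using assms(4,5) that unfolding linear_trans_def by blast+
    then show ?thesis using F.D.comp_ident[OF \<beta>[OF that(1)]] \<alpha>[OF that(1)] F.D.ident[OF F.FOb_in[OF that(1)]]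
      by (simp add: hom_def)
  qed
  ultimately show ?thesis
    using nat_trans_comp[OF F.cfunctor_axioms G.cfunctor_axioms H.cfunctor_axioms nt] F.update_Obj
    by (simp add: linear_trans_def del: prod_cat_simps)
qed

lemma linear_trans_hom:
  "\<lbrakk>linear_trans Cs D F G \<alpha>; xs \<in> Obj (prod_cat Cs)\<rbrakk> \<Longrightarrow> \<alpha> xs \<in> hom D (FOb (LF F) xs) (FOb (LF G) xs)"
  by (simp add: linear_trans_def nat_trans_def)

lemma linear_trans_ext: "linear_trans Cs D F G \<alpha> \<Longrightarrow> \<alpha> \<in> extensional (Obj (prod_cat Cs))"
  by (simp add: linear_trans_def nat_trans_def)

lemma hom_perm_ops: "t \<in> hom (perm_ops Cs D) F G \<longleftrightarrow>
    (\<exists>\<alpha>. t = (F, G, \<alpha>) \<and> strong_linear Cs D F \<and> strong_linear Cs D G \<and> linear_trans Cs D F G \<alpha>)"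
  by (auto simp: hom_def perm_ops_def)

lemma strong_linear_functor: "strong_linear Cs D F \<Longrightarrow> linear_functor Cs D F"
  by (simp add: strong_linear_def)

lemma category_perm_ops: "category (perm_ops Cs D)"
proof
  fix t assume "t \<in> Arr (perm_ops Cs D)"
  then show "Dom (perm_ops Cs D) t \<in> Obj (perm_ops Cs D) \<and> Cod (perm_ops Cs D) t \<in> Obj (perm_ops Cs D)"
    by (auto simp: perm_ops_def)
next
  fix F assume "F \<in> Obj (perm_ops Cs D)"
  then have "strong_linear Cs D F" by (simp add: perm_ops_def)
  from linear_trans_ident[OF strong_linear_functor[OF this]] this show "Ident (perm_ops Cs D) F \<in> hom (perm_ops Cs D) F F"
    unfolding hom_perm_ops by (simp add: perm_ops_def)
next
  fix t u F G H assume "t \<in> hom (perm_ops Cs D) F G" "u \<in> hom (perm_ops Cs D) G H"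
  then obtain \<alpha> \<beta> where t: "t = (F, G, \<alpha>)" "u = (G, H, \<beta>)" and sl: "strong_linear Cs D F"
    "strong_linear Cs D G" "strong_linear Cs D H"
    and lt: "linear_trans Cs D F G \<alpha>" "linear_trans Cs D G H \<beta>" by (auto simp: hom_perm_ops)
  show "Comp (perm_ops Cs D) u t \<in> hom (perm_ops Cs D) F H"
    using linear_trans_comp[OF sl[THEN strong_linear_functor] lt] sl unfolding hom_perm_ops
    by (simp add: perm_ops_def t)
next
  fix t F G assume "t \<in> hom (perm_ops Cs D) F G"
  then obtain \<alpha> where t: "t = (F, G, \<alpha>)" and sl: "strong_linear Cs D F" and lt: "linear_trans Cs D F G \<alpha>"
    by (auto simp: hom_perm_ops)
  interpret linear_functor Cs D F using sl by (rule strong_linear_functor)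
  \<comment> \<open>The composite transformation is restricted to objects by definition;
    extensionality of \<alpha> makes the unit laws equations of HOL functions.\<close>
  have "(\<lambda>xs\<in>Obj (prod_cat Cs). \<alpha> xs) = \<alpha>"
    by (rule extensional_restrict[OF linear_trans_ext[OF lt]])
  then show "Comp (perm_ops Cs D) t (Ident (perm_ops Cs D) F) = t"
    "Comp (perm_ops Cs D) (Ident (perm_ops Cs D) G) t = t"
    using D.comp_ident[OF linear_trans_hom[OF lt]] D.ident_comp[OF linear_trans_hom[OF lt]]
    by (simp_all add: perm_ops_def t del: prod_cat_simps cong: restrict_cong)
next
  fix t u v F G H K
  assume "t \<in> hom (perm_ops Cs D) F G" "u \<in> hom (perm_ops Cs D) G H" "v \<in> hom (perm_ops Cs D) H K"
  then obtain \<alpha> \<beta> \<gamma> where t: "t = (F, G, \<alpha>)" "u = (G, H, \<beta>)" "v = (H, K, \<gamma>)" and sl: "strong_linear Cs D F"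
    and lt: "linear_trans Cs D F G \<alpha>" "linear_trans Cs D G H \<beta>" "linear_trans Cs D H K \<gamma>"
    by (auto simp: hom_perm_ops)
  interpret linear_functor Cs D F using sl by (rule strong_linear_functor)
  show "Comp (perm_ops Cs D) v (Comp (perm_ops Cs D) u t) =
      Comp (perm_ops Cs D) (Comp (perm_ops Cs D) v u) t"
    using D.comp_assoc[OF linear_trans_hom[OF lt(1)] linear_trans_hom[OF lt(2)] linear_trans_hom[OF lt(3)]]
    by (simp add: perm_ops_def t del: prod_cat_simps cong: restrict_cong)
qed

section \<open>Operations induce strong multilinear functors\<close>

text \<open>The form to which \<open>Pobj_simps\<close> rewrites the tensor product of
  objects.\<close>

abbreviation oplus :: "'o pob \<Rightarrow> 'o pob \<Rightarrow> 'o pob" where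
  "oplus s t \<equiv> (fst s @ fst t, snd s @ snd t)"

text \<open>With \<open>boxp\<close>, the enumeration of the blocks of \<open>PopOb F ss\<close> in
  terms of the tuple \<open>ss\<close>; it is the same for every \<open>F\<close>.\<close>

definition enp :: "'o pob list \<Rightarrow> (nat \<times> nat) list \<Rightarrow> nat \<times> nat" where
  "enp ss = en (map fst ss)"

definition boxp :: "'o pob list \<Rightarrow> (nat \<times> nat) list set" where
  "boxp ss = box (map fst ss)"

lemma boxpD: "us \<in> boxp ss \<Longrightarrow> length us = length ss \<and> (\<forall>i<length ss. us ! i \<in> blocks (fst (ss ! i)))"
  by (simp add: boxp_def box_def)

lemma PopOb_eq: "PopOb F ss = (multi_seq (map fst ss), multi (\<lambda>ps. FOb (F ps)) (map fst ss) (map snd ss))"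
  by (simp add: PopOb_def multi_val_def multi_def)

lemma enp_in: "us \<in> boxp ss \<Longrightarrow> enp ss us \<in> blocks (fst (PopOb F ss))"
  by (simp add: PopOb_eq enp_def boxp_def en_in)

lemma enp_E:
  assumes "u \<in> blocks (fst (PopOb F ss))"
  obtains us where "us \<in> boxp ss" "u = enp ss us"
  using assms en_E unfolding PopOb_eq enp_def boxp_def fst_conv by metis

lemma indices_Nil: "\<lbrakk>[] \<in> set ms\<rbrakk> \<Longrightarrow> indices ms = []"
  by (induction ms) auto

text \<open>One empty range leaves no index tuples at all, so a unit argument makes the whole
  sequence empty.\<close>

lemma PopOb_unit:
  assumes "j < length ss" "ss ! j = ([], [])"
  shows "PopOb F ss = ([], [])"
proof -
  have "[] \<in> set (map fst ss)" using assms by (metis fst_conv length_map nth_map nth_mem)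
  then show ?thesis by (simp add: PopOb_eq multi_def multi_seq_def indices_Nil del: map_map)
qed

lemma PopC_eq:
  assumes "b < length ss"
  shows "PopC Z F b ss t = (oplus (PopOb F ss) (PopOb F (ss[b := t])), PopOb F (ss[b := oplus (ss ! b) t]),
    ((fst (PopOb F ss) @ fst (PopOb F (ss[b := t])), fst (PopOb F (ss[b := oplus (ss ! b) t])),
      sigma_map (map fst ss) b (fst t)),
     Ident (AXob Z (fst (PopOb F (ss[b := oplus (ss ! b) t])))) (snd (PopOb F (ss[b := oplus (ss ! b) t])))))"
  by (simp add: PopC_def PopOb_def Let_def del: AXob_simps)

lemma PopC_left:
  assumes "b < length ss" "us \<in> boxp ss"
  shows "us \<in> boxp (ss[b := oplus (ss ! b) t])"
    "pmap (PopC Z F b ss t) (enp ss us) = enp (ss[b := oplus (ss ! b) t]) us"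
  using sigma_map_left[of us "map fst ss" b "fst t"] assms
  by (simp_all add: boxp_def enp_def PopC_eq map_update del: AXob_simps)

lemma PopC_right:
  assumes "b < length ss" "us \<in> boxp (ss[b := t])"
  shows "us[b := sh (length (fst (ss ! b))) (us ! b)] \<in> boxp (ss[b := oplus (ss ! b) t])"
    "pmap (PopC Z F b ss t) (sh (length (fst (PopOb F ss))) (enp (ss[b := t]) us)) =
      enp (ss[b := oplus (ss ! b) t]) (us[b := sh (length (fst (ss ! b))) (us ! b)])"
  using sigma_map_right[of us "map fst ss" b "fst t"] assms
  by (simp_all add: boxp_def enp_def PopC_eq PopOb_eq map_update del: AXob_simps)

lemma PopC_blocksE:
  assumes "u \<in> blocks (fst (PopOb F ss) @ m)"
  obtains (left) us where "us \<in> boxp ss" "u = enp ss us" "u \<in> blocks (fst (PopOb F ss))"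
  | (right) v where "v \<in> blocks m" "u = sh (length (fst (PopOb F ss))) v"
  using assms by (metis blocks_appendE enp_E)

context gamma_cats
begin

abbreviation "Ps \<equiv> map Pobj Xs"
abbreviation "D \<equiv> Pobj Z"

lemma Obj_Ps:
  "ss \<in> Obj (prod_cat Ps) \<longleftrightarrow> length ss = length Xs \<and> fam obs (map fst ss) (map snd ss)"
  using gamma_cat.Obj_P[OF gamma_cat_nth] by (auto simp: fam_def)

lemma category_Ps: "category (prod_cat Ps)"
  by (rule category_prod_cat) (simp add: gamma_cat.cat_P[OF gamma_cat_nth])

lemma permutative_Ps: "C \<in> set Ps \<Longrightarrow> permutative C"
  using gamma_Xs gamma_cat.permutative_P[OF gamma_catI] by auto

lemma hom_Ps_nth: "\<lbrakk>hs \<in> hom (prod_cat Ps) ss ts; i < length Xs\<rbrakk> \<Longrightarrow> hs ! i \<in> hom (Pobj (Xs ! i)) (ss ! i) (ts ! i)"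
  by (simp add: hom_prod_cat)

lemma hom_Ps_length:
  "hs \<in> hom (prod_cat Ps) ss ts \<Longrightarrow> length hs = length Xs \<and> length ss = length Xs \<and> length ts = length Xs"
  by (simp add: hom_prod_cat)

lemma hom_Ps_arr:
  assumes "hs \<in> hom (prod_cat Ps) ss ts"
  shows "Acat_tuple (map fst ss) (map fst ts) (map pmap hs)"
    "fam ars (map fst ts) (map pval hs)"
    "fam obs (map fst ss) (map snd ss)" "fam obs (map fst ts) (map snd ts)"
proof -
  note len = hom_Ps_length[OF assms]
  note h = gamma_cat.hom_PE[OF gamma_cat_nth hom_Ps_nth[OF assms]]
  show "Acat_tuple (map fst ss) (map fst ts) (map pmap hs)"
    using h(2) len by (simp add: Acat_tuple_def)
  show "fam obs (map fst ss) (map snd ss)" "fam obs (map fst ts) (map snd ts)"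
    using h(3,4) Acat_arrD(1,2)[OF h(2)] len by (simp_all add: fam_def)
  show "fam ars (map fst ts) (map pval hs)"
    using homD[OF h(5)] Acat_arrD(2)[OF h(2)] len by (simp add: fam_def)
qed

definition famhom :: "nat list list \<Rightarrow> 'm list list \<Rightarrow> 'o list list \<Rightarrow> 'o list list \<Rightarrow> bool" where
  "famhom ns fs xs ys \<longleftrightarrow> length ns = length Xs \<and> length fs = length Xs \<and> length xs = length Xs \<and>
    length ys = length Xs \<and> (\<forall>i<length Xs. fs ! i \<in> hom (AXob (Xs ! i) (ns ! i)) (xs ! i) (ys ! i))"

lemma pick_hom:
  assumes "famhom ns fs xs ys" "ls \<in> set (indices ns)"
  shows "pick fs ls \<in> hom (gprod Xs (pick ns ls)) (pick xs ls) (pick ys ls)"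
proof -
  have "length ls = length Xs" "\<forall>i<length Xs. ls ! i < length (ns ! i)"
    using assms by (auto simp: mem_tuples famhom_def)
  moreover have "\<forall>i<length Xs. \<forall>j<length (ns ! i). fs ! i ! j \<in> hom (FOb (Xs ! i) (ns ! i ! j)) (xs ! i ! j) (ys ! i ! j)"
    using assms(1) by (simp add: famhom_def hom_AXob)
  ultimately show ?thesis using assms(1) by (simp add: hom_gprod famhom_def)
qed

lemma multi_seq_hom:
  assumes "\<And>ls. ls \<in> set (indices ns) \<Longrightarrow> a ls \<in> hom (FOb Z (prod_list (pick ns ls))) (b ls) (c ls)"
  shows "map a (indices ns) \<in> hom (AXob Z (multi_seq ns)) (map b (indices ns)) (map c (indices ns))"
  using assms by (simp add: hom_AXob multi_seq_def)

lemma Comp_multi_seq: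
  "Comp (AXob Z (multi_seq ns)) (map b (indices ns)) (map a (indices ns)) =
    map (\<lambda>ls. Comp (FOb Z (prod_list (pick ns ls))) (b ls) (a ls)) (indices ns)"
  by (intro nth_equalityI) (simp_all add: multi_seq_def)

lemma Ident_multi_seq:
  "Ident (AXob Z (multi_seq ns)) (map a (indices ns)) =
    map (\<lambda>ls. Ident (FOb Z (prod_list (pick ns ls))) (a ls)) (indices ns)"
  by (intro nth_equalityI) (simp_all add: multi_seq_def)

end

section \<open>The functor underlying \<open>Pop\<close>\<close>

locale gamma_oper = gamma_cats Xs Z for Xs :: "('o, 'm) gcat list" and Z +
  fixes F :: "('o, 'm) gop"
  assumes op: "gamma_op Xs Z F"
begin

abbreviation "FO \<equiv> \<lambda>ps. FOb (F ps)"
abbreviation "FA \<equiv> \<lambda>ps. FAr (F ps)"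

sublocale Ob: gset_op obs "ob_gset Z" FO by (rule gamma_opD[OF op])
sublocale Ar: gset_op ars "ar_gset Z" FA by (rule gamma_opD[OF op])

lemma F_cfunctor: "length ps = length Xs \<Longrightarrow> cfunctor (gprod Xs ps) (FOb Z (prod_list ps)) (F ps)"
  by (rule gamma_opD[OF op])

lemma F_pick:
  "\<lbrakk>length ns = length Xs; ls \<in> set (indices ns)\<rbrakk>
    \<Longrightarrow> cfunctor (gprod Xs (pick ns ls)) (FOb Z (prod_list (pick ns ls))) (F (pick ns ls))"
  by (rule F_cfunctor) (simp add: mem_tuples)

lemma multi_hom:
  assumes "famhom ns fs xs ys"
  shows "multi FA ns fs \<in> hom (AXob Z (multi_seq ns)) (multi FO ns xs) (multi FO ns ys)"
  unfolding multi_def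
  by (rule multi_seq_hom, rule cfunctor.FAr_in[OF F_pick pick_hom[OF assms]])
    (use assms in \<open>simp_all add: famhom_def\<close>)

lemma multi_Ident:
  assumes "fam obs ns xs"
  shows "multi FA ns (tab (length Xs) (\<lambda>i. Ident (AXob (Xs ! i) (ns ! i)) (xs ! i))) =
    Ident (AXob Z (multi_seq ns)) (multi FO ns xs)"
proof -
  have "FA (pick ns ls) (pick (tab (length Xs) (\<lambda>i. Ident (AXob (Xs ! i) (ns ! i)) (xs ! i))) ls) =
      Ident (FOb Z (prod_list (pick ns ls))) (FO (pick ns ls) (pick xs ls))"
    if ls: "ls \<in> set (indices ns)" for ls
  proof -
    have len: "length ns = length Xs" "length xs = length Xs" "length ls = length Xs" "\<forall>i<length Xs. ls ! i < length (ns ! i)"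
      using assms ls by (auto simp: mem_tuples fam_def)
    have "pick (tab (length Xs) (\<lambda>i. Ident (AXob (Xs ! i) (ns ! i)) (xs ! i))) ls = Ident (gprod Xs (pick ns ls)) (pick xs ls)"
      using len by (intro nth_equalityI) (simp_all add: gprod_Ident)
    then show ?thesis
      using cfunctor.FAr_ident[OF F_pick[OF len(1) ls], of "pick xs ls"] pick_gtup(1)[OF assms ls] by simp
  qed
  then show ?thesis by (simp add: multi_def Ident_multi_seq del: AXob_simps)
qed

lemma multi_Comp:
  assumes "famhom ns fs xs ys" "famhom ns gs ys zs"
  shows "multi FA ns (tab (length Xs) (\<lambda>i. Comp (AXob (Xs ! i) (ns ! i)) (gs ! i) (fs ! i))) =
    Comp (AXob Z (multi_seq ns)) (multi FA ns gs) (multi FA ns fs)"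
proof -
  have "FA (pick ns ls) (pick (tab (length Xs) (\<lambda>i. Comp (AXob (Xs ! i) (ns ! i)) (gs ! i) (fs ! i))) ls) =
      Comp (FOb Z (prod_list (pick ns ls))) (FA (pick ns ls) (pick gs ls)) (FA (pick ns ls) (pick fs ls))"
    if ls: "ls \<in> set (indices ns)" for ls
  proof -
    have len: "length ns = length Xs" "length fs = length Xs" "length gs = length Xs" "length ls = length Xs" "\<forall>i<length Xs. ls ! i < length (ns ! i)"
      using assms ls by (auto simp: mem_tuples famhom_def)
    have "pick (tab (length Xs) (\<lambda>i. Comp (AXob (Xs ! i) (ns ! i)) (gs ! i) (fs ! i))) ls =
        Comp (gprod Xs (pick ns ls)) (pick gs ls) (pick fs ls)"
      using len by (intro nth_equalityI) (simp_all add: gprod_Comp)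
    then show ?thesis
      using cfunctor.FAr_comp[OF F_pick[OF len(1) ls] pick_hom[OF assms(1) ls] pick_hom[OF assms(2) ls]] by simp
  qed
  then show ?thesis by (simp add: multi_def Comp_multi_seq del: AXob_simps)
qed

lemma PopOb_in: "ss \<in> Obj (prod_cat Ps) \<Longrightarrow> PopOb F ss \<in> Obj D"
  using Ob.multi_in multi_seq_Obj[of "map fst ss"]
  by (auto simp: Obj_Ps Z.Obj_P PopOb_eq fam_def simp del: prod_cat_simps)

lemma PopAr_eq:
  assumes "hs \<in> hom (prod_cat Ps) ss ts"
  shows "PopAr F hs = (PopOb F ss, PopOb F ts, ((fst (PopOb F ss), fst (PopOb F ts),
    multi_map (map fst ss) (map fst ts) (map pmap hs)), multi FA (map fst ts) (map pval hs)))"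
proof -
  note len = hom_Ps_length[OF assms]
  have "hs ! i = (ss ! i, ts ! i, (fst (ss ! i), fst (ts ! i), pmap (hs ! i)), pval (hs ! i))" if "i < length Xs" for i
    by (rule gamma_cat.hom_PE(1)[OF gamma_cat_nth[OF that] hom_Ps_nth[OF assms that]])
  then have "fst (hs ! i) = ss ! i" "fst (snd (hs ! i)) = ts ! i" if "i < length Xs" for i
    using that by (metis fst_conv, metis fst_conv snd_conv)
  then have "map fst hs = ss" "map (fst \<circ> snd) hs = ts"
    using len by (simp_all add: list_eq_iff_nth_eq[of "map _ _"])
  moreover have "map (\<lambda>(s, t, ((m, n, \<phi>), f)). \<phi>) hs = map pmap hs" "map (\<lambda>(s, t, (u, f)). f) hs = map pval hs"
    by (simp_all add: pmap_def pval_def case_prod_unfold)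
  ultimately show ?thesis
    by (simp only: PopAr_def Let_def PopOb_eq fst_conv multi_def)
qed

lemma famhom_pval:
  assumes "hs \<in> hom (prod_cat Ps) ss ts"
  shows "famhom (map fst ts) (map pval hs)
    (tab (length Xs) (\<lambda>i. axact (ob_gset (Xs ! i)) (fst (ss ! i)) (fst (ts ! i)) (pmap (hs ! i)) (snd (ss ! i)))) (map snd ts)"
  using hom_Ps_length[OF assms] gamma_cat.hom_PE(5)[OF gamma_cat_nth hom_Ps_nth[OF assms]]
  by (simp add: famhom_def)

text \<open>The component of an arrow starts at the pushforward of its source. Naturality of
  \<open>F\<close> on objects identifies this pushforward with the values of \<open>F\<close> at the
  pushed-forward inputs, where the family \<open>multi FA\<close> starts.\<close>

lemma multi_nat_Ob:
  assumes "hs \<in> hom (prod_cat Ps) ss ts"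
  shows "axact (ob_gset Z) (fst (PopOb F ss)) (fst (PopOb F ts)) (multi_map (map fst ss) (map fst ts) (map pmap hs)) (snd (PopOb F ss)) =
    multi FO (map fst ts) (tab (length Xs) (\<lambda>i. axact (ob_gset (Xs ! i)) (fst (ss ! i)) (fst (ts ! i)) (pmap (hs ! i)) (snd (ss ! i))))"
proof -
  note h = hom_Ps_arr[OF assms] and len = hom_Ps_length[OF assms]
  have "tab (length obs) (\<lambda>i. axact (obs ! i) (map fst ss ! i) (map fst ts ! i) (map pmap hs ! i) (map snd ss ! i)) =
      tab (length Xs) (\<lambda>i. axact (ob_gset (Xs ! i)) (fst (ss ! i)) (fst (ts ! i)) (pmap (hs ! i)) (snd (ss ! i)))"
    using len by (intro nth_equalityI) simp_all
  with Ob.multi_natural[OF h(1,3)] show ?thesis by (simp only: PopOb_eq fst_conv snd_conv)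
qed

lemma PopAr_hom:
  assumes "hs \<in> hom (prod_cat Ps) ss ts"
  shows "PopAr F hs \<in> hom D (PopOb F ss) (PopOb F ts)"
proof -
  note h = hom_Ps_arr[OF assms]
  have "((fst (PopOb F ss), snd (PopOb F ss)), (fst (PopOb F ts), snd (PopOb F ts)), ((fst (PopOb F ss), fst (PopOb F ts),
    multi_map (map fst ss) (map fst ts) (map pmap hs)), multi FA (map fst ts) (map pval hs))) \<in>
      hom D (fst (PopOb F ss), snd (PopOb F ss)) (fst (PopOb F ts), snd (PopOb F ts))"
    using multi_map_arr[OF h(1)] Ob.multi_in[OF h(3)] Ob.multi_in[OF h(4)] multi_hom[OF famhom_pval[OF assms]]
    by (intro Z.hom_PI) (unfold multi_nat_Ob[OF assms], simp_all add: PopOb_eq)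
  then show ?thesis by (simp add: PopAr_eq[OF assms])
qed

lemma PopAr_enp:
  assumes "hs \<in> hom (prod_cat Ps) ss ts" "us \<in> boxp ss"
  shows "tab (length Xs) (\<lambda>i. pmap (hs ! i) (us ! i)) \<in> boxp ts"
    "pmap (PopAr F hs) (enp ss us) = enp ts (tab (length Xs) (\<lambda>i. pmap (hs ! i) (us ! i)))"
proof -
  note h = hom_Ps_arr[OF assms(1)] and len = hom_Ps_length[OF assms(1)]
  have us: "us \<in> box (map fst ss)" using assms(2) by (simp add: boxp_def)
  have eq: "tab (length (map fst ss)) (\<lambda>i. (map pmap hs ! i) (us ! i)) = tab (length Xs) (\<lambda>i. pmap (hs ! i) (us ! i))"
    using len by (intro nth_equalityI) simp_all
  show "tab (length Xs) (\<lambda>i. pmap (hs ! i) (us ! i)) \<in> boxp ts"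
    using Acat_tuple_box[OF h(1) us] unfolding eq boxp_def .
  show "pmap (PopAr F hs) (enp ss us) = enp ts (tab (length Xs) (\<lambda>i. pmap (hs ! i) (us ! i)))"
    by (simp only: PopAr_eq[OF assms(1)] enp_def pmap_pval multi_map_en[OF us] eq)
qed

lemma PopAr_pval: "hs \<in> hom (prod_cat Ps) ss ts \<Longrightarrow> pval (PopAr F hs) = multi FA (map fst ts) (map pval hs)"
  by (simp add: PopAr_eq)

text \<open>The functors \<open>F ps\<close> preserve identities, so identity components are sent to
  identity components (\<open>multi_Ident\<close>).\<close>

lemma PopAr_pure:
  assumes "hs \<in> hom (prod_cat Ps) ss ts" "\<And>i. i < length Xs \<Longrightarrow> pure (Xs ! i) (ts ! i) (hs ! i)"
  shows "pure Z (PopOb F ts) (PopAr F hs)"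
proof -
  note len = hom_Ps_length[OF assms(1)]
  have "map pval hs = tab (length Xs) (\<lambda>i. Ident (AXob (Xs ! i) (map fst ts ! i)) (map snd ts ! i))"
    using assms(2) len by (intro nth_equalityI) (simp_all add: pure_def)
  then show ?thesis
    using multi_Ident[OF hom_Ps_arr(4)[OF assms(1)]]
    by (simp only: pure_def PopAr_pval[OF assms(1)] PopOb_eq fst_conv snd_conv)
qed

lemma Ident_Ps:
  assumes "ss \<in> Obj (prod_cat Ps)"
  shows "Ident (prod_cat Ps) ss \<in> hom (prod_cat Ps) ss ss"
    "i < length Xs \<Longrightarrow> pmap (Ident (prod_cat Ps) ss ! i) = (\<lambda>u\<in>blocks (fst (ss ! i)). u)"
    "i < length Xs \<Longrightarrow> pure (Xs ! i) (ss ! i) (Ident (prod_cat Ps) ss ! i)"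
    "i < length Xs \<Longrightarrow> Ident (prod_cat Ps) ss ! i = Ident (Pobj (Xs ! i)) (ss ! i)"
  using category.ident[OF category_Ps assms] gamma_cat.Ident_P[OF gamma_cat_nth, of i "ss ! i"] assms by simp_all

lemma PopAr_Ident:
  assumes "ss \<in> Obj (prod_cat Ps)"
  shows "PopAr F (Ident (prod_cat Ps) ss) = Ident D (PopOb F ss)"
proof -
  note I = Ident_Ps[OF assms] and J = Z.Ident_P[OF PopOb_in[OF assms]]
  show ?thesis
  proof (rule Z.pure_eqI[OF PopAr_hom[OF I(1)] J(1) PopAr_pure[OF I(1,3)] J(3)])
    fix u assume u: "u \<in> blocks (fst (PopOb F ss))"
    then obtain us where us: "us \<in> boxp ss" "u = enp ss us" by (rule enp_E)
    have "tab (length Xs) (\<lambda>i. pmap (Ident (prod_cat Ps) ss ! i) (us ! i)) = us"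
      using boxpD[OF us(1)] assms I(2) by (intro nth_equalityI) simp_all
    then show "pmap (PopAr F (Ident (prod_cat Ps) ss)) u = pmap (Ident D (PopOb F ss)) u"
      using u by (simp only: us(2) PopAr_enp(2)[OF I(1) us(1)] J(2) restrict_apply')
  qed
qed

text \<open>On components two properties of \<open>F\<close> are used in turn: naturality on arrows
  moves \<open>F\<close> past the pushforward along \<open>ks\<close>, and functoriality of each
  \<open>F ps\<close> then combines the entries.\<close>

lemma PopAr_Comp:
  assumes hs: "hs \<in> hom (prod_cat Ps) ss ts" and ks: "ks \<in> hom (prod_cat Ps) ts rs"
  shows "PopAr F (Comp (prod_cat Ps) ks hs) = Comp D (PopAr F ks) (PopAr F hs)"
proof -
  note c = category.comp[OF category_Ps hs ks]
  note len = hom_Ps_length[OF hs] hom_Ps_length[OF ks]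
  note P = Z.Comp_P[OF PopAr_hom[OF hs] PopAr_hom[OF ks]]
  note Ci = gamma_cat.Comp_P[OF gamma_cat_nth hom_Ps_nth[OF hs] hom_Ps_nth[OF ks]]
  have nth: "Comp (prod_cat Ps) ks hs ! i = Comp (Pobj (Xs ! i)) (ks ! i) (hs ! i)" if "i < length Xs" for i
    using that by simp
  show ?thesis
  proof (rule Z.P_eqI[OF PopAr_hom[OF c] category.comp[OF Z.cat_P PopAr_hom[OF hs] PopAr_hom[OF ks]]])
    fix u assume u: "u \<in> blocks (fst (PopOb F ss))"
    then obtain us where us: "us \<in> boxp ss" "u = enp ss us" by (rule enp_E)
    note v = PopAr_enp[OF hs us(1)]
    have "tab (length Xs) (\<lambda>i. pmap (Comp (prod_cat Ps) ks hs ! i) (us ! i)) =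
        tab (length Xs) (\<lambda>i. pmap (ks ! i) (tab (length Xs) (\<lambda>i. pmap (hs ! i) (us ! i)) ! i))"
      using boxpD[OF us(1)] len by (intro nth_equalityI) (simp_all add: Ci(1))
    then show "pmap (PopAr F (Comp (prod_cat Ps) ks hs)) u = pmap (Comp D (PopAr F ks) (PopAr F hs)) u"
      using u by (simp only: us(2) PopAr_enp(2)[OF c us(1)] P(1) v(2) PopAr_enp(2)[OF ks v(1)])
  next
    let ?ax = "tab (length Xs) (\<lambda>i. axact (ar_gset (Xs ! i)) (fst (ts ! i)) (fst (rs ! i)) (pmap (ks ! i)) (pval (hs ! i)))"
    let ?ox = "tab (length Xs) (\<lambda>i. axact (ob_gset (Xs ! i)) (fst (ts ! i)) (fst (rs ! i)) (pmap (ks ! i))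
      (axact (ob_gset (Xs ! i)) (fst (ss ! i)) (fst (ts ! i)) (pmap (hs ! i)) (snd (ss ! i))))"
    let ?oy = "tab (length Xs) (\<lambda>i. axact (ob_gset (Xs ! i)) (fst (ts ! i)) (fst (rs ! i)) (pmap (ks ! i)) (snd (ts ! i)))"
    have "tab (length ars) (\<lambda>i. axact (ars ! i) (map fst ts ! i) (map fst rs ! i) (map pmap ks ! i) (map pval hs ! i)) = ?ax"
      using len by (intro nth_equalityI) simp_all
    with Ar.multi_natural[OF hom_Ps_arr(1)[OF ks] hom_Ps_arr(2)[OF hs]]
    have nat: "axact (ar_gset Z) (fst (PopOb F ts)) (fst (PopOb F rs)) (pmap (PopAr F ks)) (pval (PopAr F hs)) =
        multi FA (map fst rs) ?ax"
      by (simp only: PopAr_eq[OF ks] PopAr_eq[OF hs] PopOb_eq fst_conv pmap_pval)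
    have ax: "famhom (map fst rs) ?ax ?ox ?oy"
      using len gamma_cat.axact_hom[OF gamma_cat_nth] gamma_cat.hom_PE(2)[OF gamma_cat_nth hom_Ps_nth[OF ks]]
        gamma_cat.hom_PE(5)[OF gamma_cat_nth hom_Ps_nth[OF hs]]
      by (simp add: famhom_def)
    have "map pval (Comp (prod_cat Ps) ks hs) =
        tab (length Xs) (\<lambda>i. Comp (AXob (Xs ! i) (map fst rs ! i)) (map pval ks ! i) (?ax ! i))"
      using len by (intro nth_equalityI) (simp_all add: Ci(2) del: AXob_simps)
    then have "multi FA (map fst rs) (map pval (Comp (prod_cat Ps) ks hs)) =
        Comp (AXob Z (multi_seq (map fst rs))) (multi FA (map fst rs) (map pval ks)) (multi FA (map fst rs) ?ax)"
      using multi_Comp[OF ax famhom_pval[OF ks]] by (simp only:)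
    then show "pval (PopAr F (Comp (prod_cat Ps) ks hs)) = pval (Comp D (PopAr F ks) (PopAr F hs))"
      unfolding PopAr_pval[OF c] P(2) nat PopAr_pval[OF ks] by (simp only: PopOb_eq fst_conv)
  qed
qed

lemma Pop_LF:
  "FOb (LF (Pop Xs Z F)) = (\<lambda>ss\<in>Obj (prod_cat Ps). PopOb F ss)"
  "FAr (LF (Pop Xs Z F)) = (\<lambda>hs\<in>Arr (prod_cat Ps). PopAr F hs)"
  by (simp_all add: Pop_def)

lemma Pop_cfunctor: "cfunctor (prod_cat Ps) D (LF (Pop Xs Z F))"
proof -
  interpret C: category "prod_cat Ps" by (rule category_Ps)
  interpret DD: category D by (rule Z.cat_P)
  show ?thesis
  proof
    fix x assume x: "x \<in> Obj (prod_cat Ps)"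
    then show "FOb (LF (Pop Xs Z F)) x \<in> Obj D"
      by (simp add: Pop_LF PopOb_in del: prod_cat_simps)
    show "FAr (LF (Pop Xs Z F)) (Ident (prod_cat Ps) x) = Ident D (FOb (LF (Pop Xs Z F)) x)"
      using x homD[OF C.ident[OF x]] by (simp add: Pop_LF PopAr_Ident del: prod_cat_simps)
  next
    fix f x y assume f: "f \<in> hom (prod_cat Ps) x y"
    show "FAr (LF (Pop Xs Z F)) f \<in> hom D (FOb (LF (Pop Xs Z F)) x) (FOb (LF (Pop Xs Z F)) y)"
      using homD[OF f] C.hom_Obj[OF f] PopAr_hom[OF f] by (simp add: Pop_LF del: prod_cat_simps)
    fix g z assume g: "g \<in> hom (prod_cat Ps) y z"
    show "FAr (LF (Pop Xs Z F)) (Comp (prod_cat Ps) g f) =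
        Comp D (FAr (LF (Pop Xs Z F)) g) (FAr (LF (Pop Xs Z F)) f)"
      using homD[OF f] homD[OF g] homD[OF C.comp[OF f g]] PopAr_Comp[OF f g]
      by (simp add: Pop_LF del: prod_cat_simps)
  qed (simp_all add: Pop_LF)
qed

section \<open>Linearity constraints as arrows of \<open>Pobj Z\<close>\<close>

lemma update_Ps:
  assumes "ss \<in> Obj (prod_cat Ps)" "t \<in> Obj (Pobj (Xs ! b))"
  shows "ss[b := t] \<in> Obj (prod_cat Ps)"
  using assms by (cases "b < length Xs") (auto simp: nth_list_update)

lemma oplus_in:
  assumes "b < length Xs" "s \<in> Obj (Pobj (Xs ! b))" "t \<in> Obj (Pobj (Xs ! b))"
  shows "oplus s t \<in> Obj (Pobj (Xs ! b))"
  using assms by (simp add: gamma_cat.Obj_P[OF gamma_cat_nth] axc_append)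

lemma sigma_Ps:
  assumes "b < length Xs" "ss \<in> Obj (prod_cat Ps)" "t \<in> Obj (Pobj (Xs ! b))"
  shows "block_iso (fst (oplus (PopOb F ss) (PopOb F (ss[b := t])))) (fst (PopOb F (ss[b := oplus (ss ! b) t])))
    (sigma_map (map fst ss) b (fst t))"
proof -
  have fam: "fam obs (map fst ss) (map snd ss)" and len: "length ss = length Xs" using assms(2) by (simp_all only: Obj_Ps)
  have "fst t \<in> Obj Acat" using assms(1,3) by (simp add: gamma_cat.Obj_P[OF gamma_cat_nth])
  with fam len assms(1) show ?thesis
    using sigma_block_iso[of b "map fst ss" "fst t"] by (simp add: PopOb_eq map_update fam_def)
qed

lemma sigma_Ob:
  assumes "b < length Xs" "ss \<in> Obj (prod_cat Ps)" "t \<in> Obj (Pobj (Xs ! b))"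
  shows "axact (ob_gset Z) (fst (oplus (PopOb F ss) (PopOb F (ss[b := t])))) (fst (PopOb F (ss[b := oplus (ss ! b) t])))
    (sigma_map (map fst ss) b (fst t)) (snd (oplus (PopOb F ss) (PopOb F (ss[b := t])))) = snd (PopOb F (ss[b := oplus (ss ! b) t]))"
proof -
  have fam: "fam obs (map fst ss) (map snd ss)" and len: "length ss = length Xs" using assms(2) by (simp_all only: Obj_Ps)
  have fam': "fam obs (map fst (ss[b := t])) (map snd (ss[b := t]))"
    using update_Ps[OF assms(2,3)] by (simp only: Obj_Ps)
  have t: "fst t \<in> Obj Acat" using assms(1,3) by (simp add: gamma_cat.Obj_P[OF gamma_cat_nth])
  have "length (snd (ss ! b)) = length (fst (ss ! b))"
    using fam len assms(1) by (simp add: fam_def axc_def)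
  then show ?thesis
    using axact_sigma[OF Z.gset_ob, of b "map fst ss" "fst t" "map snd ss" FO "snd t"] fam t len assms(1)
      Ob.multi_in[OF fam] Ob.multi_in[OF fam']
    by (simp add: PopOb_eq map_update fam_def)
qed

text \<open>By \<open>sigma_Ob\<close> the block permutation carries the concatenated values exactly
  to the target values, so the identity component is well typed. Invertibility comes from
  \<open>block_iso_is_iso\<close>.\<close>

lemma PopC_hom:
  assumes "b < length Xs" "ss \<in> Obj (prod_cat Ps)" "t \<in> Obj (Pobj (Xs ! b))"
  shows "PopC Z F b ss t \<in> hom D (oplus (PopOb F ss) (PopOb F (ss[b := t]))) (PopOb F (ss[b := oplus (ss ! b) t]))"
    and "is_iso D (PopC Z F b ss t)"
    and "pure Z (PopOb F (ss[b := oplus (ss ! b) t])) (PopC Z F b ss t)"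
proof -
  have len: "b < length ss" using assms(1,2) by simp
  have "snd (oplus (PopOb F ss) (PopOb F (ss[b := t]))) \<in> axc Z.ob (fst (oplus (PopOb F ss) (PopOb F (ss[b := t]))))"
    using PopOb_in[OF assms(2)] PopOb_in[OF update_Ps[OF assms(2,3)]] by (simp add: Z.Obj_P axc_append)
  note * = sigma_Ps[OF assms] this sigma_Ob[OF assms]
  show "PopC Z F b ss t \<in> hom D (oplus (PopOb F ss) (PopOb F (ss[b := t]))) (PopOb F (ss[b := oplus (ss ! b) t]))"
    using Z.pure_hom_PI[OF block_iso_arr[OF *(1)] *(2,3)] by (simp add: PopC_eq[OF len] del: AXob_simps)
  show "is_iso D (PopC Z F b ss t)"
    using Z.block_iso_is_iso[OF *] by (simp add: PopC_eq[OF len] del: AXob_simps)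
  show "pure Z (PopOb F (ss[b := oplus (ss ! b) t])) (PopC Z F b ss t)"
    by (simp add: PopC_eq[OF len] pure_def del: AXob_simps)
qed

end

section \<open>Components of composites with a pure factor\<close>

context gamma_cat
begin

lemma pure_cod:
  assumes "g \<in> hom P t r" "pure X r g"
  shows "axact ob (fst t) (fst r) (pmap g) (snd t) = snd r"
  using hom_PE(5)[OF assms(1)] assms(2) category.ident[OF cat_AXob, of "snd r" "fst r"] hom_PE(4)[OF assms(1)]
  by (simp add: pure_def hom_def del: AXob_simps)

text \<open>Pushing forward an identity gives an identity by \<open>axact_Ident\<close>, so the
  component of the second factor remains.\<close>

lemma Comp_pure_right:
  assumes "f \<in> hom P s t" "g \<in> hom P t r" "pure X t f"
  shows "pval (Comp P g f) = pval g"
  using category.comp_ident[OF cat_AXob hom_PE(5)[OF assms(2)]]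
    axact_Ident[OF hom_PE(2)[OF assms(2)] hom_PE(4)[OF assms(1)]] assms(3)
  by (simp add: Comp_P(2)[OF assms(1,2)] pure_def del: AXob_simps)

lemma Comp_pure_left:
  assumes "f \<in> hom P s t" "g \<in> hom P t r" "pure X r g"
  shows "pval (Comp P g f) = axact ar (fst t) (fst r) (pmap g) (pval f)"
  using category.ident_comp[OF cat_AXob axact_hom[OF hom_PE(2)[OF assms(2)] hom_PE(5)[OF assms(1)]]]
    pure_cod[OF assms(2,3)] assms(3)
  by (simp add: Comp_P(2)[OF assms(1,2)] pure_def del: AXob_simps)

end

lemma sh_sh: "sh a (sh b x) = sh (a + b) x"
  by (cases x) simp

lemma oplus_assoc: "oplus (oplus s t) r = oplus s (oplus t r)"
  by simp

section \<open>Naturality and coherence of the linearity constraints\<close>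

context gamma_oper
begin

lemma popl:
  assumes "b < length ss" "us \<in> boxp ss"
  shows "us \<in> boxp (ss[b := oplus (ss ! b) t])"
    "pmap (PopC Z F b ss t) (enp ss us) = enp (ss[b := oplus (ss ! b) t]) us"
  by (rule PopC_left[OF assms])+

lemma popr:
  assumes "b < length ss" "us \<in> boxp (ss[b := t])"
  shows "us[b := sh (length (fst (ss ! b))) (us ! b)] \<in> boxp (ss[b := oplus (ss ! b) t])"
    "pmap (PopC Z F b ss t) (sh (length (fst (PopOb F ss))) (enp (ss[b := t]) us)) =
      enp (ss[b := oplus (ss ! b) t]) (us[b := sh (length (fst (ss ! b))) (us ! b)])"
  by (rule PopC_right[OF assms])+

lemma hom_Ps_update:
  assumes "hs \<in> hom (prod_cat Ps) ss ts" "g \<in> hom (Pobj (Xs ! b)) s t"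
  shows "hs[b := g] \<in> hom (prod_cat Ps) (ss[b := s]) (ts[b := t])"
  using assms by (cases "b < length Xs") (auto simp: hom_prod_cat nth_list_update)

lemma PopC_pmap: "b < length ss \<Longrightarrow> pmap (PopC Z F b ss t) = sigma_map (map fst ss) b (fst t)"
  by (simp add: PopC_eq del: AXob_simps)

text \<open>Since the constraints are pure, both components become the values of \<open>F\<close> on
  the appended components, by \<open>axact_sigma\<close> for arrows. On elements, the shift of the
  \<open>b\<close>-th coordinate commutes with the block maps because a sum of arrows respects its
  second summand.\<close>

lemma PopC_natural:
  assumes hs: "hs \<in> hom (prod_cat Ps) ss ts" and b: "b < length Xs" and g: "g \<in> hom (Pobj (Xs ! b)) s t"
  shows "Comp D (PopC Z F b ts t) (TAr D (PopAr F hs) (PopAr F (hs[b := g]))) =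
    Comp D (PopAr F (hs[b := TAr (Pobj (Xs ! b)) (hs ! b) g])) (PopC Z F b ss s)"
proof -
  note X = gamma_cat_nth[OF b]
  note len = hom_Ps_length[OF hs] and hb = hom_Ps_nth[OF hs b]
  note O = category.hom_Obj[OF category_Ps hs] and Og = category.hom_Obj[OF gamma_cat.cat_P[OF X] g]
  note hs1 = hom_Ps_update[OF hs g] and Tg = gamma_cat.TAr_P[OF X hb g]
  note hs2 = hom_Ps_update[OF hs Tg(1)]
  note T = Z.TAr_P[OF PopAr_hom[OF hs] PopAr_hom[OF hs1]]
  note Ct = PopC_hom[OF b conjunct2[OF O] conjunct2[OF Og]] and Cs = PopC_hom[OF b conjunct1[OF O] conjunct1[OF Og]]
  note L = category.comp[OF Z.cat_P T(1) Ct(1)] and R = category.comp[OF Z.cat_P Cs(1) PopAr_hom[OF hs2]]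
  have bs: "b < length ss" "b < length ts" using b len by simp_all
  \<comment> \<open>On elements from the first copy the \<open>b\<close>-th coordinate lies in
    \<open>ss ! b\<close>, where the sum acts as \<open>hs ! b\<close>.\<close>
  have tabeq: "tab (length Xs) (\<lambda>i. pmap (hs[b := TAr (Pobj (Xs ! b)) (hs ! b) g] ! i) (us ! i)) =
      tab (length Xs) (\<lambda>i. pmap (hs ! i) (us ! i))" if "us \<in> boxp ss" for us
    using boxpD[OF that] len b by (intro nth_equalityI) (auto simp: nth_list_update Tg(2))
  show ?thesis
  proof (rule Z.P_eqI[OF L R])
    have l: "length (pval (hs ! b)) = length (fst (ts ! b))"
      using gamma_cat.hom_PE(5)[OF X hb] by (simp add: hom_AXob)
    have fam: "fam ars (map fst ts) (map pval hs)" "fam ars ((map fst ts)[b := fst t]) ((map pval hs)[b := pval g])"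
      using hom_Ps_arr(2)[OF hs] hom_Ps_arr(2)[OF hs1] by (simp_all add: map_update)
    have "pval (Comp D (PopC Z F b ts t) (TAr D (PopAr F hs) (PopAr F (hs[b := g])))) =
        axact (ar_gset Z) (multi_seq (map fst ts) @ multi_seq ((map fst ts)[b := fst t])) (multi_seq ((map fst ts)[b := map fst ts ! b @ fst t]))
          (sigma_map (map fst ts) b (fst t)) (multi FA (map fst ts) (map pval hs) @ multi FA ((map fst ts)[b := fst t]) ((map pval hs)[b := pval g]))"
      unfolding Z.Comp_pure_left[OF T(1) Ct(1,3)] PopC_pmap[OF bs(2)] T(4) PopAr_pval[OF hs] PopAr_pval[OF hs1]
      using bs by (simp add: PopOb_eq map_update)
    also have "\<dots> = multi FA ((map fst ts)[b := map fst ts ! b @ fst t]) ((map pval hs)[b := map pval hs ! b @ pval g])"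
      using len b l fam Ar.multi_in[OF fam(1)] Ar.multi_in[OF fam(2)] Acat_arrD(2)[OF gamma_cat.hom_PE(2)[OF X g]]
      by (intro axact_sigma Z.gset_ar) (auto simp: fam_def)
    also have "\<dots> = pval (Comp D (PopAr F (hs[b := TAr (Pobj (Xs ! b)) (hs ! b) g])) (PopC Z F b ss s))"
      unfolding Z.Comp_pure_right[OF Cs(1) PopAr_hom[OF hs2] Cs(3)] PopAr_pval[OF hs2]
      using bs len by (simp add: map_update Tg(4))
    finally show "pval (Comp D (PopC Z F b ts t) (TAr D (PopAr F hs) (PopAr F (hs[b := g])))) =
      pval (Comp D (PopAr F (hs[b := TAr (Pobj (Xs ! b)) (hs ! b) g])) (PopC Z F b ss s))" .
    fix u assume u: "u \<in> blocks (fst (oplus (PopOb F ss) (PopOb F (ss[b := s]))))"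
    then have "u \<in> blocks (fst (PopOb F ss) @ fst (PopOb F (ss[b := s])))" by simp
    then show "pmap (Comp D (PopC Z F b ts t) (TAr D (PopAr F hs) (PopAr F (hs[b := g])))) u =
      pmap (Comp D (PopAr F (hs[b := TAr (Pobj (Xs ! b)) (hs ! b) g])) (PopC Z F b ss s)) u"
      unfolding Z.Comp_P(1)[OF T(1) Ct(1) u] Z.Comp_P(1)[OF Cs(1) PopAr_hom[OF hs2] u]
    proof (cases rule: PopC_blocksE)
      case (left us)
      note v = PopAr_enp[OF hs left(1)]
      show "pmap (PopC Z F b ts t) (pmap (TAr D (PopAr F hs) (PopAr F (hs[b := g]))) u) =
        pmap (PopAr F (hs[b := TAr (Pobj (Xs ! b)) (hs ! b) g])) (pmap (PopC Z F b ss s) u)"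
        unfolding T(2)[OF left(3)]
        unfolding left(2) v(2) popl(2)[OF bs(2) v(1)] popl(2)[OF bs(1) left(1)]
          PopAr_enp(2)[OF hs2 popl(1)[OF bs(1) left(1)]] tabeq[OF left(1)]
        ..
    next
      case (right w)
      obtain us where us: "us \<in> boxp (ss[b := s])" "w = enp (ss[b := s]) us"
        using right(1) by (rule enp_E)
      note v = PopAr_enp[OF hs1 us(1)] and sr = popr[OF bs(1) us(1)]
      have lus: "length us = length Xs" "us ! b \<in> blocks (fst s)"
        using boxpD[OF us(1)] len b by (auto simp: nth_list_update)
      have eq: "tab (length Xs) (\<lambda>i. pmap (hs[b := TAr (Pobj (Xs ! b)) (hs ! b) g] ! i) (us[b := sh (length (fst (ss ! b))) (us ! b)] ! i)) =
          (tab (length Xs) (\<lambda>i. pmap (hs[b := g] ! i) (us ! i)))[b := sh (length (fst (ts ! b))) (tab (length Xs) (\<lambda>i. pmap (hs[b := g] ! i) (us ! i)) ! b)]"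
        using lus len b Tg(3)[OF lus(2)] by (intro nth_equalityI) (auto simp: nth_list_update)
      show "pmap (PopC Z F b ts t) (pmap (TAr D (PopAr F hs) (PopAr F (hs[b := g]))) u) =
        pmap (PopAr F (hs[b := TAr (Pobj (Xs ! b)) (hs ! b) g])) (pmap (PopC Z F b ss s) u)"
        unfolding right(2) T(3)[OF right(1)]
        unfolding us(2) v(2) popr(2)[OF bs(2) v(1)] sr(2) PopAr_enp(2)[OF hs2 sr(1)] eq
        ..
    qed
  qed
qed

text \<open>Both composites are pure. Elements of the three summands have their \<open>b\<close>-th
  coordinate shifted by nothing, by the length of \<open>ss ! b\<close>, or by that length plus the
  length of \<open>y\<close>, whichever way the sum is bracketed.\<close>

lemma PopC_associative:
  assumes b: "b < length Xs" and ss: "ss \<in> Obj (prod_cat Ps)" and y: "y \<in> Obj (Pobj (Xs ! b))" and z: "z \<in> Obj (Pobj (Xs ! b))"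
  shows "Comp D (PopC Z F b (ss[b := oplus (ss ! b) y]) z) (TAr D (PopC Z F b ss y) (Ident D (PopOb F (ss[b := z])))) =
    Comp D (PopC Z F b ss (oplus y z)) (TAr D (Ident D (PopOb F ss)) (PopC Z F b (ss[b := y]) z))"
proof -
  have bs: "b < length ss" and sb: "ss ! b \<in> Obj (Pobj (Xs ! b))" using b ss by simp_all
  have b2: "b < length (ss[b := x])" for x using bs by simp
  note yz = oplus_in[OF b y z] and sy = oplus_in[OF b sb y]
  note ssy = update_Ps[OF ss y] and ssz = update_Ps[OF ss z] and sssy = update_Ps[OF ss sy]
  note Iz = Z.Ident_P[OF PopOb_in[OF ssz]] and I = Z.Ident_P[OF PopOb_in[OF ss]]
  note C1 = PopC_hom[OF b ss y] and C2 = PopC_hom[OF b sssy z, unfolded list_update_overwrite nth_list_update_eq[OF bs]]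
  note C3 = PopC_hom[OF b ss yz] and C4 = PopC_hom[OF b ssy z, unfolded list_update_overwrite nth_list_update_eq[OF bs]]
  note T1 = Z.TAr_P[OF C1(1) Iz(1)] and T2 = Z.TAr_P[OF I(1) C4(1)]
  note L = category.comp[OF Z.cat_P T1(1) C2(1)] and R = category.comp[OF Z.cat_P T2(1) C3(1)]
  note pL = Z.pure_Comp[OF T1(1) C2(1) T1(5)[OF C1(3) Iz(3)] C2(3)] and pR = Z.pure_Comp[OF T2(1) C3(1) T2(5)[OF I(3) C4(3)] C3(3)]
  let ?A = "fst (PopOb F ss)" and ?B = "fst (PopOb F (ss[b := y]))" and ?C = "fst (PopOb F (ss[b := z]))"
  show ?thesis
  proof (rule Z.pure_eqI[OF L _ pL])
    \<comment> \<open>The two composites are typed with differently bracketed sums; concatenation of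
      lists is associative, so rewriting with \<open>oplus_assoc\<close> identifies the
      types.\<close>
    show "Comp D (PopC Z F b ss (oplus y z)) (TAr D (Ident D (PopOb F ss)) (PopC Z F b (ss[b := y]) z)) \<in>
      hom D (oplus (oplus (PopOb F ss) (PopOb F (ss[b := y]))) (PopOb F (ss[b := z]))) (PopOb F (ss[b := oplus (oplus (ss ! b) y) z]))"
      using R unfolding oplus_assoc .
    show "pure Z (PopOb F (ss[b := oplus (oplus (ss ! b) y) z])) (Comp D (PopC Z F b ss (oplus y z)) (TAr D (Ident D (PopOb F ss)) (PopC Z F b (ss[b := y]) z)))"
      using pR unfolding oplus_assoc .
    fix u assume u: "u \<in> blocks (fst (oplus (oplus (PopOb F ss) (PopOb F (ss[b := y]))) (PopOb F (ss[b := z]))))"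
    have u': "u \<in> blocks (fst (oplus (PopOb F ss) (oplus (PopOb F (ss[b := y])) (PopOb F (ss[b := z])))))"
      using u unfolding oplus_assoc .
    then have "u \<in> blocks (?A @ (?B @ ?C))" by simp
    then show "pmap (Comp D (PopC Z F b (ss[b := oplus (ss ! b) y]) z) (TAr D (PopC Z F b ss y) (Ident D (PopOb F (ss[b := z]))))) u =
      pmap (Comp D (PopC Z F b ss (oplus y z)) (TAr D (Ident D (PopOb F ss)) (PopC Z F b (ss[b := y]) z))) u"
      unfolding Z.Comp_P(1)[OF T1(1) C2(1) u] Z.Comp_P(1)[OF T2(1) C3(1) u']
    proof (cases rule: PopC_blocksE)
      case (left us)
      have "pmap (TAr D (PopC Z F b ss y) (Ident D (PopOb F (ss[b := z])))) u = enp (ss[b := oplus (ss ! b) y]) us"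
        using T1(2)[of u] left(3) popl(2)[OF bs left(1)] by (simp add: blocks_appendI left(2))
      moreover have "pmap (TAr D (Ident D (PopOb F ss)) (PopC Z F b (ss[b := y]) z)) u = enp ss us"
        using T2(2)[OF left(3)] left(3) by (simp add: I(2) left(2))
      ultimately show "pmap (PopC Z F b (ss[b := oplus (ss ! b) y]) z) (pmap (TAr D (PopC Z F b ss y) (Ident D (PopOb F (ss[b := z])))) u) =
        pmap (PopC Z F b ss (oplus y z)) (pmap (TAr D (Ident D (PopOb F ss)) (PopC Z F b (ss[b := y]) z)) u)"
        using popl(2)[OF b2 popl(1)[OF bs left(1), where t = y], where t = z] popl(2)[OF bs left(1), where t = "oplus y z"] bs by simp
    next
      case (right v)
      from right(1) show "pmap (PopC Z F b (ss[b := oplus (ss ! b) y]) z) (pmap (TAr D (PopC Z F b ss y) (Ident D (PopOb F (ss[b := z])))) u) =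
        pmap (PopC Z F b ss (oplus y z)) (pmap (TAr D (Ident D (PopOb F ss)) (PopC Z F b (ss[b := y]) z)) u)"
      proof (cases rule: PopC_blocksE)
        case (left us)
        note r = popr[OF bs left(1)]
        have "u \<in> blocks (fst (oplus (PopOb F ss) (PopOb F (ss[b := y]))))"
          using left(3) right(2) by (simp add: blocks_appendI)
        then have "pmap (TAr D (PopC Z F b ss y) (Ident D (PopOb F (ss[b := z])))) u =
            enp (ss[b := oplus (ss ! b) y]) (us[b := sh (length (fst (ss ! b))) (us ! b)])"
          using T1(2)[of u] r(2) by (simp add: right(2) left(2))
        moreover have l: "us \<in> boxp (ss[b := oplus y z])" "pmap (PopC Z F b (ss[b := y]) z) v = enp (ss[b := oplus y z]) us"
          using popl[OF b2 left(1)] bs left(2) by simp_all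
        moreover have "pmap (TAr D (Ident D (PopOb F ss)) (PopC Z F b (ss[b := y]) z)) u = sh (length ?A) (enp (ss[b := oplus y z]) us)"
          using T2(3)[of v] right l(2) by simp
        ultimately show ?thesis
          using popl(2)[OF b2 r(1), where t = z] popr(2)[OF bs l(1)] bs by simp
      next
        case (right w)
        obtain us where us: "us \<in> boxp (ss[b := z])" "w = enp (ss[b := z]) us" using right(1) by (rule enp_E)
        have us': "us \<in> boxp ((ss[b := oplus (ss ! b) y])[b := z])" "us \<in> boxp ((ss[b := y])[b := z])" using us(1) by simp_all
        have lus: "b < length us" using boxpD[OF us(1)] bs by simp
        have uw: "u = sh (length (?A @ ?B)) w" using right(2) \<open>u = sh (length ?A) v\<close> by (simp add: sh_sh)
        have "pmap (TAr D (PopC Z F b ss y) (Ident D (PopOb F (ss[b := z])))) u =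
            sh (length (fst (PopOb F (ss[b := oplus (ss ! b) y])))) w"
          using T1(3)[OF right(1)] right(1) by (simp add: uw Iz(2))
        moreover note popr(2)[OF b2 us'(1)]
        moreover have "v \<in> blocks (fst (oplus (PopOb F (ss[b := y])) (PopOb F (ss[b := z]))))"
          using right by (simp add: blocks_appendI)
        then have "pmap (TAr D (Ident D (PopOb F ss)) (PopC Z F b (ss[b := y]) z)) u = sh (length ?A) (pmap (PopC Z F b (ss[b := y]) z) v)"
          using T2(3)[of v] \<open>u = sh (length ?A) v\<close> by simp
        moreover have r: "us[b := sh (length (fst y)) (us ! b)] \<in> boxp (ss[b := oplus y z])"
          "pmap (PopC Z F b (ss[b := y]) z) v = enp (ss[b := oplus y z]) (us[b := sh (length (fst y)) (us ! b)])"
          using popr[OF b2 us'(2)] bs right(2) us(2) by simp_all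
        ultimately show ?thesis
          using popr(2)[OF bs r(1)] bs lus by (simp add: us(2) sh_sh)
      qed
    qed
  qed
qed

text \<open>The braiding in variable \<open>b\<close> changes only the \<open>b\<close>-th
  coordinate of a tuple, whereas the braiding of the target exchanges the two copies. Elements of
  the first copy end up shifted by the length of \<open>y\<close>, those of the second unshifted,
  along both routes.\<close>

lemma PopC_symmetric:
  assumes b: "b < length Xs" and ss: "ss \<in> Obj (prod_cat Ps)" and y: "y \<in> Obj (Pobj (Xs ! b))"
  shows "Comp D (PopAr F ((Ident (prod_cat Ps) ss)[b := Braid (Pobj (Xs ! b)) (ss ! b) y])) (PopC Z F b ss y) =
    Comp D (PopC Z F b (ss[b := y]) (ss ! b)) (Braid D (PopOb F ss) (PopOb F (ss[b := y])))"
proof -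
  have bs: "b < length ss" and sb: "ss ! b \<in> Obj (Pobj (Xs ! b))" and lss: "length ss = length Xs" using b ss by simp_all
  have b2: "b < length (ss[b := x])" for x using bs by simp
  note X = gamma_cat_nth[OF b]
  note ssy = update_Ps[OF ss y]
  note B = gamma_cat.Braid_P[OF X sb y] and BD = Z.Braid_P[OF PopOb_in[OF ss] PopOb_in[OF ssy]]
  note I = Ident_Ps[OF ss]
  let ?hs = "(Ident (prod_cat Ps) ss)[b := Braid (Pobj (Xs ! b)) (ss ! b) y]"
  note hs = hom_Ps_update[OF I(1) B(1)]
  note C1 = PopC_hom[OF b ss y] and C2 = PopC_hom[OF b ssy sb, unfolded list_update_overwrite nth_list_update_eq[OF bs] list_update_id]
  have lI: "length (Ident (prod_cat Ps) ss) = length Xs" by simp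
  have pure_hs: "pure Z (PopOb F (ss[b := oplus y (ss ! b)])) (PopAr F ?hs)"
    using I(3) B(3) b lss lI by (intro PopAr_pure[OF hs]) (auto simp: nth_list_update simp del: prod_cat_simps)
  note L = category.comp[OF Z.cat_P C1(1) PopAr_hom[OF hs]] and R = category.comp[OF Z.cat_P BD(1) C2(1)]
  note pL = Z.pure_Comp[OF C1(1) PopAr_hom[OF hs] C1(3) pure_hs] and pR = Z.pure_Comp[OF BD(1) C2(1) BD(3) C2(3)]
  show ?thesis
  proof (rule Z.pure_eqI[OF L R pL pR])
    fix u assume u: "u \<in> blocks (fst (oplus (PopOb F ss) (PopOb F (ss[b := y]))))"
    then have "u \<in> blocks (fst (PopOb F ss) @ fst (PopOb F (ss[b := y])))" by simp
    then show "pmap (Comp D (PopAr F ?hs) (PopC Z F b ss y)) u =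
      pmap (Comp D (PopC Z F b (ss[b := y]) (ss ! b)) (Braid D (PopOb F ss) (PopOb F (ss[b := y])))) u"
      unfolding Z.Comp_P(1)[OF C1(1) PopAr_hom[OF hs] u] Z.Comp_P(1)[OF BD(1) C2(1) u] BD(2)
    proof (cases rule: PopC_blocksE)
      case (left us)
      note l = popl[OF bs left(1)] and us = boxpD[OF left(1)]
      have us': "us \<in> boxp ((ss[b := y])[b := ss ! b])" using left(1) by simp
      have "tab (length Xs) (\<lambda>i. pmap (?hs ! i) (us ! i)) = us[b := sh (length (fst y)) (us ! b)]"
        using us lss b B(2) I(2) lI by (intro nth_equalityI) (auto simp: nth_list_update block_swap_left simp del: prod_cat_simps)
      then have "pmap (PopAr F ?hs) (pmap (PopC Z F b ss y) u) = enp (ss[b := oplus y (ss ! b)]) (us[b := sh (length (fst y)) (us ! b)])"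
        unfolding left(2) l(2) PopAr_enp(2)[OF hs l(1)] by (simp only:)
      moreover have "block_swap (fst (PopOb F ss)) (fst (PopOb F (ss[b := y]))) u = sh (length (fst (PopOb F (ss[b := y])))) (enp ss us)"
        using block_swap_left[OF left(3)] left(2) by simp
      ultimately show "pmap (PopAr F ?hs) (pmap (PopC Z F b ss y) u) =
        pmap (PopC Z F b (ss[b := y]) (ss ! b)) (block_swap (fst (PopOb F ss)) (fst (PopOb F (ss[b := y]))) u)"
        using popr(2)[OF b2 us'] bs by simp
    next
      case (right w)
      obtain us where us: "us \<in> boxp (ss[b := y])" "w = enp (ss[b := y]) us" using right(1) by (rule enp_E)
      note r = popr[OF bs us(1)]
      have lus: "length us = length Xs" "\<forall>i<length Xs. i \<noteq> b \<longrightarrow> us ! i \<in> blocks (fst (ss ! i))" "us ! b \<in> blocks (fst y)"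
        using boxpD[OF us(1)] lss bs by (auto simp: nth_list_update split: if_splits)
      have "tab (length Xs) (\<lambda>i. pmap (?hs ! i) (us[b := sh (length (fst (ss ! b))) (us ! b)] ! i)) = us"
        using lus lss b B(2) I(2) lI block_swap_right[OF lus(3)]
        by (intro nth_equalityI) (auto simp: nth_list_update simp del: prod_cat_simps)
      then have "pmap (PopAr F ?hs) (pmap (PopC Z F b ss y) u) = enp (ss[b := oplus y (ss ! b)]) us"
        unfolding right(2) us(2) r(2) PopAr_enp(2)[OF hs r(1)] by (simp only:)
      moreover have "block_swap (fst (PopOb F ss)) (fst (PopOb F (ss[b := y]))) u = enp (ss[b := y]) us"
        using block_swap_right[OF right(1)] right(2) us(2) by simp
      ultimately show "pmap (PopAr F ?hs) (pmap (PopC Z F b ss y) u) =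
        pmap (PopC Z F b (ss[b := y]) (ss ! b)) (block_swap (fst (PopOb F ss)) (fst (PopOb F (ss[b := y]))) u)"
        using popl(2)[OF b2 us(1)] bs by simp
    qed
  qed
qed

text \<open>Both sides are pure, and the four summands behave as follows: on the first no coordinate
  is shifted, on the second only \<open>i\<close>, on the third only \<open>k\<close>, on the fourth
  both. The middle braiding exchanges the second and third summands, and the shifts in
  \<open>i\<close> and \<open>k\<close> commute.\<close>

lemma PopC_two_by_two:
  assumes i: "i < length Xs" and k: "k < length Xs" and ik: "i \<noteq> k" and ss: "ss \<in> Obj (prod_cat Ps)"
    and y: "y \<in> Obj (Pobj (Xs ! i))" and z: "z \<in> Obj (Pobj (Xs ! k))"
  shows "Comp D (PopC Z F k (ss[i := oplus (ss ! i) y]) z) (TAr D (PopC Z F i ss y) (PopC Z F i (ss[k := z]) y)) =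
    Comp D (PopC Z F i (ss[k := oplus (ss ! k) z]) y)
      (Comp D (TAr D (PopC Z F k ss z) (PopC Z F k (ss[i := y]) z))
        (TAr D (Ident D (PopOb F ss)) (TAr D (Braid D (PopOb F (ss[i := y])) (PopOb F (ss[k := z])))
          (Ident D (PopOb F (ss[i := y, k := z]))))))"
proof -
  have lss: "length ss = length Xs" using ss by simp
  have il: "i < length ss" "i < length (ss[x := x'])" and kl: "k < length ss" "k < length (ss[x := x'])" for x x'
    using i k lss by simp_all
  have si: "ss ! i \<in> Obj (Pobj (Xs ! i))" and sk: "ss ! k \<in> Obj (Pobj (Xs ! k))" using ss i k by simp_all
  let ?iy = "oplus (ss ! i) y" and ?kz = "oplus (ss ! k) z"
  note oi = oplus_in[OF i si y] and ok = oplus_in[OF k sk z]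
  note ssi = update_Ps[OF ss y] and ssk = update_Ps[OF ss z] and ssik = update_Ps[OF ssi z]
    and sso = update_Ps[OF ss oi] and ssok = update_Ps[OF ss ok]
  \<comment> \<open>Updates at \<open>i\<close> and \<open>k\<close> commute; all tuples are brought
    into the form with the update at \<open>i\<close> first, so that sources and targets match
    literally.\<close>
  have swap: "ss[k := a, i := c] = ss[i := c, k := a]" for a c using ik by (simp add: list_update_swap)
  have nk: "ss[k := a] ! i = ss ! i" "ss[i := a] ! k = ss ! k" for a using ik by simp_all
  note C1 = PopC_hom[OF i ss y] and C2 = PopC_hom[OF i ssk y, unfolded nk swap]
    and C3 = PopC_hom[OF k sso z, unfolded nk] and C4 = PopC_hom[OF k ss z] and C5 = PopC_hom[OF k ssi z, unfolded nk]
    and C6 = PopC_hom[OF i ssok y, unfolded nk swap]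
  note I = Z.Ident_P[OF PopOb_in[OF ss]] and J = Z.Ident_P[OF PopOb_in[OF ssik]]
  note B = Z.Braid_P[OF PopOb_in[OF ssi] PopOb_in[OF ssk]]
  note T1 = Z.TAr_P[OF C1(1) C2(1)] and T2 = Z.TAr_P[OF C4(1) C5(1)] and T3 = Z.TAr_P[OF B(1) J(1)]
  note T4 = Z.TAr_P[OF I(1) T3(1)]
  let ?A = "PopOb F ss" and ?B = "PopOb F (ss[i := y])" and ?C = "PopOb F (ss[k := z])" and ?E = "PopOb F (ss[i := y, k := z])"
  let ?S = "oplus ?A (oplus (oplus ?B ?C) ?E)"
  let ?l1 = "TAr D (PopC Z F i ss y) (PopC Z F i (ss[k := z]) y)"
  let ?r1 = "TAr D (Ident D ?A) (TAr D (Braid D ?B ?C) (Ident D ?E))"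
  let ?r2 = "TAr D (PopC Z F k ss z) (PopC Z F k (ss[i := y]) z)"
  have l1: "?l1 \<in> hom D ?S (oplus (PopOb F (ss[i := ?iy])) (PopOb F (ss[i := ?iy, k := z])))"
    using T1(1) by simp
  have r1: "?r1 \<in> hom D ?S (oplus ?A (oplus (oplus ?C ?B) ?E))" using T4(1) by simp
  have r2: "?r2 \<in> hom D (oplus ?A (oplus (oplus ?C ?B) ?E)) (oplus (PopOb F (ss[k := ?kz])) (PopOb F (ss[i := y, k := ?kz])))"
    using T2(1) by simp
  note R12 = category.comp[OF Z.cat_P r1 r2]
  note L = category.comp[OF Z.cat_P l1 C3(1)] and R = category.comp[OF Z.cat_P R12 C6(1)]
  have pl1: "pure Z (oplus (PopOb F (ss[i := ?iy])) (PopOb F (ss[i := ?iy, k := z]))) ?l1" using T1(5)[OF C1(3) C2(3)] .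
  have pr1: "pure Z (oplus ?A (oplus (oplus ?C ?B) ?E)) ?r1" using T4(5)[OF I(3) T3(5)[OF B(3) J(3)]] by simp
  have pr2: "pure Z (oplus (PopOb F (ss[k := ?kz])) (PopOb F (ss[i := y, k := ?kz]))) ?r2" using T2(5)[OF C4(3) C5(3)] .
  note pL = Z.pure_Comp[OF l1 C3(1) pl1 C3(3)] and pR = Z.pure_Comp[OF R12 C6(1) Z.pure_Comp[OF r1 r2 pr1 pr2] C6(3)]
  let ?shi = "\<lambda>us. us[i := sh (length (fst (ss ! i))) (us ! i)]" and ?shk = "\<lambda>us. us[k := sh (length (fst (ss ! k))) (us ! k)]"
  show ?thesis
  proof (rule Z.pure_eqI[OF L R pL pR])
    fix u assume u: "u \<in> blocks (fst ?S)"
    then have u': "u \<in> blocks (fst ?A @ (fst ?B @ (fst ?C @ fst ?E)))" by simp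
    let ?a = "length (fst ?A)" and ?b = "length (fst ?B)" and ?c = "length (fst ?C)"
    have goal: "pmap (Comp D (PopC Z F k (ss[i := ?iy]) z) ?l1) u = pmap (PopC Z F k (ss[i := ?iy]) z) (pmap ?l1 u)"
      "pmap (Comp D (PopC Z F i (ss[k := ?kz]) y) (Comp D ?r2 ?r1)) u = pmap (PopC Z F i (ss[k := ?kz]) y) (pmap ?r2 (pmap ?r1 u))"
      by (rule Z.Comp_P(1)[OF l1 C3(1) u]) (simp only: Z.Comp_P(1)[OF R12 C6(1) u] Z.Comp_P(1)[OF r1 r2 u])
    from u' show "pmap (Comp D (PopC Z F k (ss[i := ?iy]) z) ?l1) u = pmap (Comp D (PopC Z F i (ss[k := ?kz]) y) (Comp D ?r2 ?r1)) u"
      unfolding goal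
    proof (cases rule: PopC_blocksE)
      case (left us)
      note li = popl[OF il(1) left(1), where t = y] and lk = popl[OF kl(1) left(1), where t = z]
      have "pmap ?l1 u = enp (ss[i := ?iy]) us"
        using T1(2)[of u] left(3) by (simp add: blocks_appendI left(2) li(2))
      moreover have "pmap ?r1 u = u" using T4(2)[OF left(3)] left(3) by (simp add: I(2))
      moreover have "pmap ?r2 u = enp (ss[k := ?kz]) us"
        using T2(2)[of u] left(3) by (simp add: blocks_appendI left(2) lk(2))
      ultimately show "pmap (PopC Z F k (ss[i := ?iy]) z) (pmap ?l1 u) = pmap (PopC Z F i (ss[k := ?kz]) y) (pmap ?r2 (pmap ?r1 u))"
        using popl(2)[OF kl(2) li(1)] popl(2)[OF il(2) lk(1)] ik by (simp add: swap)
    next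
      case (right v)
      note uv = right(2)
      from right(1) show "pmap (PopC Z F k (ss[i := ?iy]) z) (pmap ?l1 u) = pmap (PopC Z F i (ss[k := ?kz]) y) (pmap ?r2 (pmap ?r1 u))"
      proof (cases rule: PopC_blocksE)
        case (left us)
        have us': "us \<in> boxp (ss[k := ?kz, i := y])" using popl(1)[OF kl(2) left(1), where t = z] ik by (simp add: swap)
        note ri = popr[OF il(1) left(1)] and rk = popr[OF il(2) us']
        have "pmap ?l1 u = enp (ss[i := ?iy]) (?shi us)"
          using T1(2)[of u] left(3) uv ri(2) left(2) by (simp add: blocks_appendI)
        moreover have "pmap ?r1 u = sh (?a + ?c) v"
        proof -
          have "pmap (TAr D (Braid D ?B ?C) (Ident D ?E)) v = sh ?c v"
            using T3(2)[of v] left(3) by (simp add: blocks_appendI B(2) block_swap_left)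
          then show ?thesis using T4(3)[of v] left(3) by (simp add: blocks_appendI uv sh_sh)
        qed
        moreover have "pmap ?r2 (sh (?a + ?c) v) = sh (length (fst (PopOb F (ss[k := ?kz])))) (enp (ss[k := ?kz, i := y]) us)"
          using T2(3)[of v] left(3) popl(2)[OF kl(2) left(1)] ik by (simp add: blocks_appendI left(2) swap)
        ultimately show ?thesis
          using popl(2)[OF kl(2) ri(1), where t = z] rk(2) ik by (simp add: swap)
      next
        case (right w)
        note vw = right(2)
        from right(1) show ?thesis
        proof (cases rule: PopC_blocksE)
          case (left us)
          have us': "us \<in> boxp (ss[i := ?iy, k := z])" using popl(1)[OF il(2) left(1), where t = y] ik by (simp add: swap)
          note ri = popr[OF kl(1) left(1)] and rk = popr[OF kl(2) us']
          have "pmap ?l1 u = sh (length (fst (PopOb F (ss[i := ?iy])))) (enp (ss[i := ?iy, k := z]) us)"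
            using T1(3)[of w] left(3) popl(2)[OF il(2) left(1), where t = y] ik uv vw by (simp add: blocks_appendI left(2) swap sh_sh)
          moreover have "pmap ?r1 u = sh ?a w"
          proof -
            have "pmap (TAr D (Braid D ?B ?C) (Ident D ?E)) v = w"
              using T3(2)[of v] left(3) by (simp add: vw blocks_appendI B(2) block_swap_right)
            then show ?thesis using T4(3)[of v] left(3) by (simp add: blocks_appendI vw uv)
          qed
          moreover have "pmap ?r2 (sh ?a w) = enp (ss[k := ?kz]) (?shk us)"
            using T2(2)[of "sh ?a w"] left(3) ri(2) left(2) by (simp add: blocks_appendI)
          ultimately show ?thesis
            using popl(2)[OF il(2) ri(1), where t = y] rk(2) ik by (simp add: swap)
        next
          case (right x)
          obtain us where us: "us \<in> boxp (ss[i := y, k := z])" "x = enp (ss[i := y, k := z]) us" using right(1) by (rule enp_E)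
          have uswap: "us[k := a, i := c] = us[i := c, k := a]" for a c using ik by (simp add: list_update_swap)
          have usi: "us \<in> boxp (ss[k := z, i := y])" using us(1) by (simp add: swap)
          note ri = popr[OF il(2) usi] and rk = popr[OF kl(2) us(1)]
          have ri': "?shi us \<in> boxp (ss[i := ?iy, k := z])" and rk': "?shk us \<in> boxp (ss[k := ?kz, i := y])"
            using ri(1) rk(1) ik by (simp_all add: swap)
          have "pmap ?l1 u = sh (length (fst (PopOb F (ss[i := ?iy])))) (pmap (PopC Z F i (ss[k := z]) y) (sh ?c x))"
            using T1(3)[of "sh ?c x"] right(1) uv vw right(2) by (simp add: blocks_appendI sh_sh add.assoc)
          moreover have "pmap (PopC Z F i (ss[k := z]) y) (sh ?c x) = enp (ss[i := ?iy, k := z]) (?shi us)"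
            using ri(2) ik by (simp add: us(2) swap)
          moreover have "pmap ?r1 u = u"
          proof -
            have "pmap (TAr D (Braid D ?B ?C) (Ident D ?E)) v = v"
              using T3(3)[of x] right(1) by (simp add: J(2) vw right(2) sh_sh add.commute)
            then show ?thesis using T4(3)[of v] right by (simp add: blocks_appendI uv vw)
          qed
          moreover have "pmap ?r2 u = sh (length (fst (PopOb F (ss[k := ?kz])))) (pmap (PopC Z F k (ss[i := y]) z) (sh ?b x))"
            using T2(3)[of "sh ?b x"] right(1) uv vw right(2) by (simp add: blocks_appendI sh_sh ac_simps)
          moreover have "pmap (PopC Z F k (ss[i := y]) z) (sh ?b x) = enp (ss[k := ?kz, i := y]) (?shk us)"
            using rk(2) ik by (simp add: us(2) swap)
          ultimately show ?thesis
            using popr(2)[OF kl(2) ri'] popr(2)[OF il(2) rk'] ik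
            by (simp add: swap uswap)
        qed
      qed
    qed
  qed
qed

end

text \<open>The unit is the empty sequence: it has no elements to map and no entries for a
  component. The unity axioms reduce to this wherever a value is the unit.\<close>

lemma (in gamma_cat) hom_unit_unique:
  assumes "g \<in> hom P ([], []) ([], [])"
  shows "g = Ident P ([], [])"
  by (rule P_eqI[OF assms Ident_TUnit(1)])
    (use hom_PE(5)[OF assms] Ident_TUnit(2) in \<open>simp_all add: hom_AXob\<close>)

lemma (in gamma_cats) constraint_dom_Ps:
  "constraint_dom Ps b ss t \<longleftrightarrow> b < length Xs \<and> ss \<in> Obj (prod_cat Ps) \<and> t \<in> Obj (Pobj (Xs ! b))"
  by (auto simp: constraint_dom_def simp del: prod_cat_simps)

section \<open>The unity axioms, and \<open>Pop\<close> as a strong multilinear functor\<close>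

context gamma_oper
begin

lemma LC_Pop: "constraint_dom Ps b ss t \<Longrightarrow> LC (Pop Xs Z F) b ss t = PopC Z F b ss t"
  by (simp add: Pop_def)

text \<open>The identity of the unit in one variable makes source and target of the value empty, so
  that \<open>hom_unit_unique\<close> applies.\<close>

lemma PopAr_unit:
  assumes fs: "fs \<in> Arr (prod_cat Ps)" and j: "j < length Xs" and u: "fs ! j = Ident (Pobj (Xs ! j)) ([], [])"
  shows "PopAr F fs = Ident D ([], [])"
proof -
  note fs' = Arr_hom[OF fs] and len = hom_Ps_length[OF Arr_hom[OF fs]]
  note I = gamma_cat.Ident_TUnit(1)[OF gamma_cat_nth[OF j]]
  have "Dom (prod_cat Ps) fs ! j = ([], [])" "Cod (prod_cat Ps) fs ! j = ([], [])"
    using homD[OF I] u j by simp_all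
  then have "PopOb F (Dom (prod_cat Ps) fs) = ([], [])" "PopOb F (Cod (prod_cat Ps) fs) = ([], [])"
    using len j by (intro PopOb_unit[of j]; simp)+
  then show ?thesis using PopAr_hom[OF fs'] by (intro Z.hom_unit_unique) simp
qed

text \<open>A unit in a variable other than \<open>b\<close> makes source and target of the
  constraint empty. If \<open>ss ! b\<close> or \<open>y\<close> is the unit, one of the two
  summands is empty and the constraint fixes every element of the other.\<close>

lemma PopC_unity:
  assumes b: "b < length Xs" and ss: "ss \<in> Obj (prod_cat Ps)" and y: "y \<in> Obj (Pobj (Xs ! b))"
    and u: "(\<exists>j<length Xs. ss ! j = ([], [])) \<or> y = ([], [])"
  shows "PopC Z F b ss y = Ident D (oplus (PopOb F ss) (PopOb F (ss[b := y])))"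
proof -
  have len: "length ss = length Xs" using ss by simp
  then have bs: "b < length ss" using b by simp
  note C = PopC_hom[OF b ss y]
  consider (other) j where "j < length Xs" "j \<noteq> b" "ss ! j = ([], [])" | (left) "ss ! b = ([], [])" | (right) "y = ([], [])"
    using u by metis
  then show ?thesis
  proof cases
    case other
    then have Q: "PopOb F ss = ([], [])" "PopOb F (ss[b := x]) = ([], [])" for x
      using len by (auto intro!: PopOb_unit[of j])
    have "PopC Z F b ss y \<in> hom D ([], []) ([], [])" using C(1) by (simp add: Q)
    from Z.hom_unit_unique[OF this] show ?thesis by (simp add: Q)
  next
    case left
    let ?Q = "PopOb F (ss[b := y])"
    have Q: "PopOb F ss = ([], [])" using PopOb_unit[OF bs left] .
    note I = Z.Ident_P[OF PopOb_in[OF update_Ps[OF ss y]]]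
    have "PopC Z F b ss y = Ident D ?Q"
    proof (rule Z.pure_eqI[OF _ I(1) _ I(3)])
      show "PopC Z F b ss y \<in> hom D ?Q ?Q" "pure Z ?Q (PopC Z F b ss y)"
        using C(1,3) by (simp_all add: Q left)
      fix v assume v: "v \<in> blocks (fst ?Q)"
      then obtain us where us: "us \<in> boxp (ss[b := y])" "v = enp (ss[b := y]) us" by (rule enp_E)
      show "pmap (PopC Z F b ss y) v = pmap (Ident D ?Q) v"
        using popr(2)[OF bs us(1)] v by (simp add: Q left us(2) I(2))
    qed
    then show ?thesis by (simp add: Q)
  next
    case right
    let ?Q = "PopOb F ss"
    have Q: "PopOb F (ss[b := y]) = ([], [])" using PopOb_unit[of b "ss[b := y]"] bs right by simp
    note I = Z.Ident_P[OF PopOb_in[OF ss]]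
    have "PopC Z F b ss y = Ident D ?Q"
    proof (rule Z.pure_eqI[OF _ I(1) _ I(3)])
      show "PopC Z F b ss y \<in> hom D ?Q ?Q" "pure Z ?Q (PopC Z F b ss y)"
        using C(1,3) unfolding Q by (simp_all add: right)
      fix v assume v: "v \<in> blocks (fst ?Q)"
      then obtain us where us: "us \<in> boxp ss" "v = enp ss us" by (rule enp_E)
      show "pmap (PopC Z F b ss y) v = pmap (Ident D ?Q) v"
        using popl(2)[OF bs us(1), where t = y] v by (simp add: right us(2) I(2))
    qed
    then show ?thesis by (simp add: Q)
  qed
qed

lemma Pop_linear: "linear_functor Ps D (Pop Xs Z F)"
proof (rule linear_functor.intro[OF Pop_cfunctor Z.permutative_P], rule linear_functor_axioms.intro)
  note [simp del] = prod_cat_simps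
  show "permutative C" if "C \<in> set Ps" for C using that by (rule permutative_Ps)
  show "LC (Pop Xs Z F) i xs y = undefined" if "\<not> constraint_dom Ps i xs y" for i xs y
    using that by (simp add: Pop_def)
  show "FOb (LF (Pop Xs Z F)) xs = TUnit D"
    if "xs \<in> Obj (prod_cat Ps)" "j < length Ps" "xs ! j = TUnit (Ps ! j)" for xs j
    using that PopOb_unit[of j xs F] Obj_Ps by (simp add: Pop_LF)
  show "FAr (LF (Pop Xs Z F)) fs = Ident D (TUnit D)"
    if "fs \<in> Arr (prod_cat Ps)" "j < length Ps" "fs ! j = Ident (Ps ! j) (TUnit (Ps ! j))" for fs j
    using that PopAr_unit[of fs j] by (simp add: Pop_LF)
  show "Comp D (LC (Pop Xs Z F) i (Cod (prod_cat Ps) fs) (Cod (Ps ! i) g))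
        (TAr D (FAr (LF (Pop Xs Z F)) fs) (FAr (LF (Pop Xs Z F)) (fs[i := g]))) =
      Comp D (FAr (LF (Pop Xs Z F)) (fs[i := TAr (Ps ! i) (fs ! i) g]))
        (LC (Pop Xs Z F) i (Dom (prod_cat Ps) fs) (Dom (Ps ! i) g))"
    if i: "i < length Ps" and fs: "fs \<in> Arr (prod_cat Ps)" and g: "g \<in> Arr (Ps ! i)" for i fs g
  proof -
    have i': "i < length Xs" using i by simp
    have g': "g \<in> hom (Pobj (Xs ! i)) (Dom (Pobj (Xs ! i)) g) (Cod (Pobj (Xs ! i)) g)"
      using Arr_hom[OF g] i' by simp
    note f' = Arr_hom[OF fs]
    note T = gamma_cat.TAr_P(1)[OF gamma_cat_nth[OF i'] hom_Ps_nth[OF f' i'] g']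
    note O = category.hom_Obj[OF category_Ps f'] category.hom_Obj[OF gamma_cat.cat_P[OF gamma_cat_nth[OF i']] g']
    show ?thesis
      using PopC_natural[OF f' i' g'] O i' fs homD[OF hom_Ps_update[OF f' g']] homD[OF hom_Ps_update[OF f' T]]
      by (simp add: LC_Pop Pop_LF constraint_dom_Ps)
  qed
next
  note [simp del] = prod_cat_simps
  fix i xs y assume c: "constraint_dom Ps i xs y"
  then have i: "i < length Xs" and xs: "xs \<in> Obj (prod_cat Ps)" and y: "y \<in> Obj (Pobj (Xs ! i))"
    by (simp_all add: constraint_dom_Ps)
  have il: "i < length xs" using i xs by (simp add: prod_cat_simps)
  have xi: "xs ! i \<in> Obj (Pobj (Xs ! i))" using i xs by (simp add: prod_cat_simps)
  note xy = update_Ps[OF xs y] and xo = update_Ps[OF xs oplus_in[OF i xi y]]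
  note B = gamma_cat.Braid_P(1)[OF gamma_cat_nth[OF i] xi y]
  show "LC (Pop Xs Z F) i xs y \<in> hom D (TOb D (FOb (LF (Pop Xs Z F)) xs) (FOb (LF (Pop Xs Z F)) (xs[i := y])))
      (FOb (LF (Pop Xs Z F)) (xs[i := TOb (Ps ! i) (xs ! i) y]))"
    using PopC_hom(1)[OF i xs y] i by (simp add: LC_Pop[OF c] Pop_LF xs xy xo)
  show "Comp D (FAr (LF (Pop Xs Z F)) ((Ident (prod_cat Ps) xs)[i := Braid (Ps ! i) (xs ! i) y])) (LC (Pop Xs Z F) i xs y) =
      Comp D (LC (Pop Xs Z F) i (xs[i := y]) (xs ! i)) (Braid D (FOb (LF (Pop Xs Z F)) xs) (FOb (LF (Pop Xs Z F)) (xs[i := y])))"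
    using PopC_symmetric[OF i xs y] homD[OF hom_Ps_update[OF Ident_Ps(1)[OF xs] B]] i
    by (simp add: LC_Pop[OF c] LC_Pop constraint_dom_Ps Pop_LF xs xy xi)
  show "LC (Pop Xs Z F) i xs y = Ident D (TOb D (FOb (LF (Pop Xs Z F)) xs) (FOb (LF (Pop Xs Z F)) (xs[i := y])))"
    if "(\<exists>j<length Ps. xs ! j = TUnit (Ps ! j)) \<or> y = TUnit (Ps ! i)"
  proof -
    have "(\<exists>j<length Xs. xs ! j = ([], [])) \<or> y = ([], [])" using that i by auto
    from PopC_unity[OF i xs y this] show ?thesis by (simp add: LC_Pop[OF c] Pop_LF xs xy)
  qed
  show "Comp D (LC (Pop Xs Z F) i (xs[i := TOb (Ps ! i) (xs ! i) y]) z)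
        (TAr D (LC (Pop Xs Z F) i xs y) (Ident D (FOb (LF (Pop Xs Z F)) (xs[i := z])))) =
      Comp D (LC (Pop Xs Z F) i xs (TOb (Ps ! i) y z))
        (TAr D (Ident D (FOb (LF (Pop Xs Z F)) xs)) (LC (Pop Xs Z F) i (xs[i := y]) z))"
    if "z \<in> Obj (Ps ! i)" for z
  proof -
    have z: "z \<in> Obj (Pobj (Xs ! i))" using that i by simp
    show ?thesis
      using PopC_associative[OF i xs y z] update_Ps[OF xs z] oplus_in[OF i y z] i y z
      by (simp add: LC_Pop constraint_dom_Ps Pop_LF xs xy xo)
  qed
  show "Comp D (LC (Pop Xs Z F) k (xs[i := TOb (Ps ! i) (xs ! i) y]) z)
        (TAr D (LC (Pop Xs Z F) i xs y) (LC (Pop Xs Z F) i (xs[k := z]) y)) =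
      Comp D (LC (Pop Xs Z F) i (xs[k := TOb (Ps ! k) (xs ! k) z]) y)
        (Comp D (TAr D (LC (Pop Xs Z F) k xs z) (LC (Pop Xs Z F) k (xs[i := y]) z))
          (TAr D (Ident D (FOb (LF (Pop Xs Z F)) xs))
            (TAr D (Braid D (FOb (LF (Pop Xs Z F)) (xs[i := y])) (FOb (LF (Pop Xs Z F)) (xs[k := z])))
              (Ident D (FOb (LF (Pop Xs Z F)) (xs[i := y, k := z]))))))"
    if "constraint_dom Ps k xs z" "i \<noteq> k" for k z
  proof -
    have k: "k < length Xs" and z: "z \<in> Obj (Pobj (Xs ! k))" using that(1) by (simp_all add: constraint_dom_Ps)
    have xk: "xs ! k \<in> Obj (Pobj (Xs ! k))" using k xs by (simp add: prod_cat_simps)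
    show ?thesis
      using PopC_two_by_two[OF i k that(2) xs y z] update_Ps[OF xs z] update_Ps[OF xs oplus_in[OF k xk z]]
        update_Ps[OF xy z] i k y z
      by (simp add: LC_Pop constraint_dom_Ps Pop_LF xs xy xo)
  qed
qed

lemma Pop_strong: "strong_linear Ps D (Pop Xs Z F)"
  using Pop_linear PopC_hom(2) by (simp add: strong_linear_def LC_Pop constraint_dom_Ps del: prod_cat_simps)

end

section \<open>Modifications induce multilinear transformations\<close>

locale gamma_modif = gamma_cats Xs Z + F: gamma_oper Xs Z F + G: gamma_oper Xs Z G
  for Xs :: "('o, 'm) gcat list" and Z F G +
  fixes \<theta> :: "nat list \<Rightarrow> 'o list \<Rightarrow> 'm"
  assumes modif: "gamma_mod Xs Z F G \<theta>"
begin

sublocale T: gset_op obs "ar_gset Z" \<theta>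
  by (rule gamma_modD[OF F.op G.op modif])

abbreviation al :: "'o pob list \<Rightarrow> ('o, 'm) par" where
  "al ss \<equiv> (PopOb F ss, PopOb G ss, (Ident Acat (multi_seq (map fst ss)), multi \<theta> (map fst ss) (map snd ss)))"

lemma Pmod_eq: "Pmod Xs Z (F, G, \<theta>) = (Pop Xs Z F, Pop Xs Z G, \<lambda>ss\<in>Obj (prod_cat Ps). al ss)"
  by (simp add: Pmod_def multi_def Let_def del: prod_cat_simps)

lemma multi_seq_in: "ss \<in> Obj (prod_cat Ps) \<Longrightarrow> multi_seq (map fst ss) \<in> Obj Acat"
  using F.PopOb_in by (simp add: PopOb_eq Z.Obj_P del: prod_cat_simps)

lemma al_hom:
  assumes "ss \<in> Obj (prod_cat Ps)"
  shows "al ss \<in> hom D (PopOb F ss) (PopOb G ss)"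
proof -
  have fam: "fam obs (map fst ss) (map snd ss)" using assms by (simp only: Obj_Ps)
  have nt: "\<theta> (pick (map fst ss) ls) (pick (map snd ss) ls) \<in> hom (FOb Z (prod_list (pick (map fst ss) ls)))
      (F.FO (pick (map fst ss) ls) (pick (map snd ss) ls)) (G.FO (pick (map fst ss) ls) (pick (map snd ss) ls))"
    if "ls \<in> set (indices (map fst ss))" for ls
    using nat_trans_hom[OF gamma_modD(2)[OF F.op G.op modif]] pick_gtup[OF fam that] by simp
  have "multi \<theta> (map fst ss) (map snd ss) \<in> hom (AXob Z (multi_seq (map fst ss)))
      (multi F.FO (map fst ss) (map snd ss)) (multi G.FO (map fst ss) (map snd ss))"
    unfolding multi_def by (rule multi_seq_hom) (rule nt)
  then show ?thesis
    using Z.hom_PI[OF Acat_ident[OF multi_seq_in[OF assms]] F.Ob.multi_in[OF fam] G.Ob.multi_in[OF fam]]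
      Z.ob.axact_ident[OF multi_seq_in[OF assms] F.Ob.multi_in[OF fam]]
    by (simp add: PopOb_eq)
qed

lemma al_pmap: "u \<in> blocks (fst (PopOb F ss)) \<Longrightarrow> pmap (al ss) u = u"
  by (simp add: PopOb_eq)

lemma fst_PopOb: "fst (PopOb G ss) = fst (PopOb F ss)"
  by (simp add: PopOb_eq)

lemma axact_al:
  assumes "ss \<in> Obj (prod_cat Ps)" "f \<in> hom (AXob Z (fst (PopOb F ss))) x y"
  shows "axact (ar_gset Z) (fst (PopOb F ss)) (fst (PopOb F ss)) (pmap (al ss)) f = f"
  using Z.ar.axact_ident[OF multi_seq_in[OF assms(1)], of f] homD[OF assms(2)] by (simp add: PopOb_eq)

text \<open>The transformation has identity block maps, so only components matter. Naturality of
  \<theta> in the variables of \<open>Fcat\<close> moves it past the pushforward along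
  \<open>hs\<close>; what remains holds entry by entry, since each \<open>\<theta> ps\<close> is a
  natural transformation.\<close>

lemma al_natural:
  assumes hs: "hs \<in> hom (prod_cat Ps) ss ts"
  shows "Comp D (al ts) (PopAr F hs) = Comp D (PopAr G hs) (al ss)"
proof -
  note O = category.hom_Obj[OF category_Ps hs]
  note A = al_hom[OF conjunct1[OF O]] and B = al_hom[OF conjunct2[OF O]]
  note f = F.PopAr_hom[OF hs] and g = G.PopAr_hom[OF hs]
  let ?ms = "map fst ss" and ?ns = "map fst ts"
  let ?ax = "tab (length Xs) (\<lambda>i. axact (ob_gset (Xs ! i)) (fst (ss ! i)) (fst (ts ! i)) (pmap (hs ! i)) (snd (ss ! i)))"
  have len: "length hs = length Xs" "length ss = length Xs" "length ts = length Xs"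
    using hom_Ps_length[OF hs] by simp_all
  show ?thesis
  proof (rule Z.P_eqI[OF category.comp[OF Z.cat_P f B] category.comp[OF Z.cat_P A g]])
    fix u assume u: "u \<in> blocks (fst (PopOb F ss))"
    then have "pmap (PopAr F hs) u \<in> blocks (fst (PopOb F ts))"
      using Acat_arrD(3)[OF Z.hom_PE(2)[OF f]] by blast
    then show "pmap (Comp D (al ts) (PopAr F hs)) u = pmap (Comp D (PopAr G hs) (al ss)) u"
      unfolding Z.Comp_P(1)[OF f B u] Z.Comp_P(1)[OF A g u] al_pmap[OF u] al_pmap
      by (simp add: al_pmap F.PopAr_eq[OF hs] G.PopAr_eq[OF hs] del: Acat_simps)
  next
    have "tab (length obs) (\<lambda>i. axact (obs ! i) (?ms ! i) (?ns ! i) (map pmap hs ! i) (map snd ss ! i)) = ?ax"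
      using len by (intro nth_equalityI) simp_all
    with T.multi_natural[OF hom_Ps_arr(1,3)[OF hs]]
    have nat: "axact (ar_gset Z) (fst (PopOb G ss)) (fst (PopOb G ts)) (pmap (PopAr G hs)) (pval (al ss)) = multi \<theta> ?ns ?ax"
      by (simp only: G.PopAr_eq[OF hs] PopOb_eq fst_conv pmap_pval)
    have "Comp (FOb Z (prod_list (pick ?ns ls))) (\<theta> (pick ?ns ls) (pick (map snd ts) ls)) (F.FA (pick ?ns ls) (pick (map pval hs) ls)) =
        Comp (FOb Z (prod_list (pick ?ns ls))) (G.FA (pick ?ns ls) (pick (map pval hs) ls)) (\<theta> (pick ?ns ls) (pick ?ax ls))"
      if ls: "ls \<in> set (indices ?ns)" for ls
      using nat_trans_nat[OF gamma_modD(2)[OF F.op G.op modif] pick_hom[OF F.famhom_pval[OF hs] ls]] ls len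
      by (simp add: mem_tuples)
    then have pw: "Comp (AXob Z (multi_seq ?ns)) (multi \<theta> ?ns (map snd ts)) (multi F.FA ?ns (map pval hs)) =
        Comp (AXob Z (multi_seq ?ns)) (multi G.FA ?ns (map pval hs)) (multi \<theta> ?ns ?ax)"
      unfolding multi_def Comp_multi_seq by (simp del: map_map)
    have "pval (Comp D (al ts) (PopAr F hs)) = Comp (AXob Z (multi_seq ?ns)) (multi \<theta> ?ns (map snd ts)) (multi F.FA ?ns (map pval hs))"
      unfolding Z.Comp_P(2)[OF f B] fst_PopOb axact_al[OF conjunct2[OF O] Z.hom_PE(5)[OF f]]
      unfolding F.PopAr_pval[OF hs] by (simp only: pmap_pval PopOb_eq fst_conv)
    also have "\<dots> = pval (Comp D (PopAr G hs) (al ss))"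
      unfolding Z.Comp_P(2)[OF A g] nat G.PopAr_pval[OF hs] pw by (simp only: PopOb_eq fst_conv)
    finally show "pval (Comp D (al ts) (PopAr F hs)) = pval (Comp D (PopAr G hs) (al ss))" .
  qed
qed

text \<open>\<open>axact_sigma\<close> applies to the family \<theta> as it does to an operation:
  the constraint permutes the components of the two copies into those at the appended
  objects.\<close>

lemma al_PopC:
  assumes b: "b < length Xs" and ss: "ss \<in> Obj (prod_cat Ps)" and y: "y \<in> Obj (Pobj (Xs ! b))"
  shows "Comp D (al (ss[b := oplus (ss ! b) y])) (PopC Z F b ss y) = Comp D (PopC Z G b ss y) (TAr D (al ss) (al (ss[b := y])))"
proof -
  have len: "length ss = length Xs" and sb: "ss ! b \<in> Obj (Pobj (Xs ! b))" using ss b by simp_all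
  note ssy = F.update_Ps[OF ss y] and sso = F.update_Ps[OF ss F.oplus_in[OF b sb y]]
  note A = al_hom[OF ss] and B = al_hom[OF ssy] and C = al_hom[OF sso]
  note f = F.PopC_hom[OF b ss y] and g = G.PopC_hom[OF b ss y] and T = Z.TAr_P[OF A B]
  have fam: "fam obs (map fst ss) (map snd ss)" "fam obs ((map fst ss)[b := fst y]) ((map snd ss)[b := snd y])"
    using ss ssy by (simp_all only: Obj_Ps map_update)
  have yA: "fst y \<in> Obj Acat" using b y by (simp add: gamma_cat.Obj_P[OF gamma_cat_nth])
  have lb: "length (snd (ss ! b)) = length (fst (ss ! b))" using fam len b by (simp add: fam_def axc_def)
  show ?thesis
  proof (rule Z.P_eqI[OF category.comp[OF Z.cat_P f(1) C] category.comp[OF Z.cat_P T(1) g(1)]])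
    have "pval (Comp D (al (ss[b := oplus (ss ! b) y])) (PopC Z F b ss y)) =
        multi \<theta> ((map fst ss)[b := fst (ss ! b) @ fst y]) ((map snd ss)[b := snd (ss ! b) @ snd y])"
      unfolding Z.Comp_pure_right[OF f(1) C f(3)] by (simp add: map_update)
    also have "\<dots> = axact (ar_gset Z) (multi_seq (map fst ss) @ multi_seq ((map fst ss)[b := fst y])) (multi_seq ((map fst ss)[b := map fst ss ! b @ fst y]))
        (sigma_map (map fst ss) b (fst y)) (multi \<theta> (map fst ss) (map snd ss) @ multi \<theta> ((map fst ss)[b := fst y]) ((map snd ss)[b := snd y]))"
      using axact_sigma[OF Z.gset_ar, of b "map fst ss" "fst y" "map snd ss" \<theta> "snd y"] fam yA lb len b
        T.multi_in[OF fam(1)] T.multi_in[OF fam(2)]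
      by (simp add: fam_def)
    also have "\<dots> = pval (Comp D (PopC Z G b ss y) (TAr D (al ss) (al (ss[b := y]))))"
      unfolding Z.Comp_pure_left[OF T(1) g(1,3)] T(4) using len b
      by (simp add: G.PopC_pmap PopOb_eq map_update)
    finally show "pval (Comp D (al (ss[b := oplus (ss ! b) y])) (PopC Z F b ss y)) =
      pval (Comp D (PopC Z G b ss y) (TAr D (al ss) (al (ss[b := y]))))" .
    fix u assume u: "u \<in> blocks (fst (oplus (PopOb F ss) (PopOb F (ss[b := y]))))"
    then have u': "u \<in> blocks (fst (PopOb F ss) @ fst (PopOb F (ss[b := y])))" by simp
    have "pmap (PopC Z F b ss y) u \<in> blocks (fst (PopOb F (ss[b := oplus (ss ! b) y])))"
      using Acat_arrD(3)[OF Z.hom_PE(2)[OF f(1)] u] .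
    then have L: "pmap (Comp D (al (ss[b := oplus (ss ! b) y])) (PopC Z F b ss y)) u = pmap (PopC Z F b ss y) u"
      unfolding Z.Comp_P(1)[OF f(1) C u] by (rule al_pmap)
    have "pmap (TAr D (al ss) (al (ss[b := y]))) u = u"
      using u'
    proof (cases rule: blocks_appendE)
      case left
      then show ?thesis by (simp only: T(2)[OF left(1)] al_pmap)
    next
      case (right v)
      show ?thesis unfolding right(2) T(3)[OF right(1)] al_pmap[OF right(1)] fst_PopOb ..
    qed
    then show "pmap (Comp D (al (ss[b := oplus (ss ! b) y])) (PopC Z F b ss y)) u =
      pmap (Comp D (PopC Z G b ss y) (TAr D (al ss) (al (ss[b := y])))) u"
      unfolding L Z.Comp_P(1)[OF T(1) g(1) u] using len b by (simp add: F.PopC_pmap G.PopC_pmap)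
  qed
qed

lemma al_unit:
  assumes "ss \<in> Obj (prod_cat Ps)" "j < length Xs" "ss ! j = ([], [])"
  shows "al ss = Ident D (PopOb F ss)"
proof -
  have "length ss = length Xs" using assms(1) by simp
  then have "PopOb F ss = ([], [])" "PopOb G ss = ([], [])"
    using assms(2,3) by (intro PopOb_unit[of j]; simp)+
  then show ?thesis using al_hom[OF assms(1)] Z.hom_unit_unique[of "al ss"] by simp
qed

lemma Pmod_linear: "linear_trans Ps D (Pop Xs Z F) (Pop Xs Z G) (\<lambda>ss\<in>Obj (prod_cat Ps). al ss)"
proof -
  note [simp del] = prod_cat_simps
  have "nat_trans (prod_cat Ps) D (LF (Pop Xs Z F)) (LF (Pop Xs Z G)) (\<lambda>ss\<in>Obj (prod_cat Ps). al ss)"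
    using al_hom al_natural[OF Arr_hom] category.dom_cod[OF category_Ps]
    by (simp add: nat_trans_def F.Pop_LF G.Pop_LF del: Acat_simps)
  moreover have "Comp D ((\<lambda>ss\<in>Obj (prod_cat Ps). al ss) (xs[i := TOb (Ps ! i) (xs ! i) y])) (LC (Pop Xs Z F) i xs y) =
      Comp D (LC (Pop Xs Z G) i xs y) (TAr D ((\<lambda>ss\<in>Obj (prod_cat Ps). al ss) xs) ((\<lambda>ss\<in>Obj (prod_cat Ps). al ss) (xs[i := y])))"
    if c: "constraint_dom Ps i xs y" for i xs y
  proof -
    have c': "i < length Xs" "xs \<in> Obj (prod_cat Ps)" "y \<in> Obj (Pobj (Xs ! i))"
      using c by (simp_all add: constraint_dom_Ps)
    have "xs ! i \<in> Obj (Pobj (Xs ! i))" using c'(1,2) by (simp add: prod_cat_simps)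
    then show ?thesis
      using al_PopC[OF c'] F.update_Ps[OF c'(2,3)] F.update_Ps[OF c'(2) F.oplus_in[OF c'(1) _ c'(3)]] c'
      by (simp add: F.LC_Pop[OF c] G.LC_Pop[OF c] del: Acat_simps)
  qed
  ultimately show ?thesis
    using al_unit by (auto simp: linear_trans_def F.Pop_LF simp del: Acat_simps)
qed

end

section \<open>Functoriality on categories of operations\<close>

context gamma_cats
begin

lemma gamma_modifI:
  "\<lbrakk>gamma_op Xs Z F; gamma_op Xs Z G; gamma_mod Xs Z F G \<theta>\<rbrakk> \<Longrightarrow> gamma_modif Xs Z F G \<theta>"
  by (simp add: gamma_modif_def gamma_modif_axioms_def gamma_oper_def gamma_oper_axioms_def gamma_cats_axioms)

lemma gamma_operI: "gamma_op Xs Z F \<Longrightarrow> gamma_oper Xs Z F"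
  by (simp add: gamma_oper_def gamma_oper_axioms_def gamma_cats_axioms)

lemma Pmod_ident:
  assumes op: "gamma_op Xs Z F"
  shows "Pmod Xs Z (Ident (gamma_ops Xs Z) F) = Ident (perm_ops Ps D) (Pop Xs Z F)"
proof -
  let ?I = "\<lambda>ps\<in>{ps. length ps = length Xs}. \<lambda>xs\<in>Obj (gprod Xs ps). Ident (FOb Z (prod_list ps)) (FOb (F ps) xs)"
  interpret gamma_modif Xs Z F F ?I by (rule gamma_modifI[OF op op gamma_mod_ident[OF op]])
  have "al ss = Ident D (PopOb F ss)" if ss: "ss \<in> Obj (prod_cat Ps)" for ss
  proof -
    note I = Z.Ident_P[OF F.PopOb_in[OF ss]]
    have fam: "fam obs (map fst ss) (map snd ss)" using ss by (simp only: Obj_Ps)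
    have "multi ?I (map fst ss) (map snd ss) = Ident (AXob Z (multi_seq (map fst ss))) (multi F.FO (map fst ss) (map snd ss))"
      unfolding multi_def Ident_multi_seq using pick_gtup[OF fam] by (simp del: map_map length_pick)
    then have pv: "pval (al ss) = pval (Ident D (PopOb F ss))"
      unfolding I(4) by (simp only: pmap_pval PopOb_eq fst_conv snd_conv)
    show ?thesis
      by (rule Z.P_eqI[OF al_hom[OF ss] I(1) _ pv]) (simp only: al_pmap I(2) restrict_apply')
  qed
  then have "(\<lambda>ss\<in>Obj (prod_cat Ps). al ss) = (\<lambda>ss\<in>Obj (prod_cat Ps). Ident D (PopOb F ss))"
    by (rule restrict_ext)
  moreover have "Ident (gamma_ops Xs Z) F = (F, F, ?I)" by (simp add: gamma_ops_def)
  moreover have "Ident (perm_ops Ps D) (Pop Xs Z F) = (Pop Xs Z F, Pop Xs Z F, \<lambda>ss\<in>Obj (prod_cat Ps). Ident D (PopOb F ss))"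
    by (simp add: perm_ops_def F.Pop_LF del: prod_cat_simps cong: restrict_cong)
  ultimately show ?thesis by (simp only: Pmod_eq)
qed

lemma Pmod_comp:
  assumes F: "gamma_op Xs Z F" and G: "gamma_op Xs Z G" and H: "gamma_op Xs Z H"
    and \<theta>: "gamma_mod Xs Z F G \<theta>" and \<eta>: "gamma_mod Xs Z G H \<eta>"
  shows "Pmod Xs Z (Comp (gamma_ops Xs Z) (G, H, \<eta>) (F, G, \<theta>)) =
    Comp (perm_ops Ps D) (Pmod Xs Z (G, H, \<eta>)) (Pmod Xs Z (F, G, \<theta>))"
proof -
  let ?C = "\<lambda>ps\<in>{ps. length ps = length Xs}. \<lambda>xs\<in>Obj (gprod Xs ps). Comp (FOb Z (prod_list ps)) (\<eta> ps xs) (\<theta> ps xs)"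
  interpret a: gamma_modif Xs Z F G \<theta> by (rule gamma_modifI[OF F G \<theta>])
  interpret b: gamma_modif Xs Z G H \<eta> by (rule gamma_modifI[OF G H \<eta>])
  interpret c: gamma_modif Xs Z F H ?C by (rule gamma_modifI[OF F H gamma_mod_comp[OF F G H \<theta> \<eta>]])
  have "c.al ss = Comp D (b.al ss) (a.al ss)" if ss: "ss \<in> Obj (prod_cat Ps)" for ss
  proof -
    note A = a.al_hom[OF ss] and B = b.al_hom[OF ss]
    have fam: "fam obs (map fst ss) (map snd ss)" using ss by (simp only: Obj_Ps)
    have "multi ?C (map fst ss) (map snd ss) = Comp (AXob Z (multi_seq (map fst ss)))
        (multi \<eta> (map fst ss) (map snd ss)) (multi \<theta> (map fst ss) (map snd ss))"
      unfolding multi_def Comp_multi_seq using pick_gtup[OF fam] by (simp del: map_map length_pick)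
    \<comment> \<open>The block map of \<open>b.al\<close> is an identity, so the pushforward in the
      composite changes nothing.\<close>
    moreover have "axact (ar_gset Z) (fst (PopOb G ss)) (fst (PopOb H ss)) (pmap (b.al ss)) (pval (a.al ss)) = pval (a.al ss)"
      unfolding b.fst_PopOb using b.axact_al[OF ss Z.hom_PE(5)[OF A]] .
    ultimately have pv: "pval (c.al ss) = pval (Comp D (b.al ss) (a.al ss))"
      unfolding Z.Comp_P(2)[OF A B] by (simp only: pmap_pval PopOb_eq fst_conv)
    show ?thesis
    proof (rule Z.P_eqI[OF c.al_hom[OF ss] category.comp[OF Z.cat_P A B] _ pv])
      fix u assume u: "u \<in> blocks (fst (PopOb F ss))"
      then have "u \<in> blocks (fst (PopOb G ss))" by (simp add: PopOb_eq)
      then show "pmap (c.al ss) u = pmap (Comp D (b.al ss) (a.al ss)) u"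
        unfolding Z.Comp_P(1)[OF A B u] a.al_pmap[OF u] c.al_pmap[OF u] by (rule b.al_pmap[symmetric])
    qed
  qed
  then have "(\<lambda>ss\<in>Obj (prod_cat Ps). c.al ss) = (\<lambda>ss\<in>Obj (prod_cat Ps). Comp D (b.al ss) (a.al ss))"
    by (rule restrict_ext)
  moreover have "Comp (gamma_ops Xs Z) (G, H, \<eta>) (F, G, \<theta>) = (F, H, ?C)" by (simp add: gamma_ops_def)
  moreover have "Comp (perm_ops Ps D) (Pop Xs Z G, Pop Xs Z H, \<lambda>ss\<in>Obj (prod_cat Ps). b.al ss) (Pop Xs Z F, Pop Xs Z G, \<lambda>ss\<in>Obj (prod_cat Ps). a.al ss) =
      (Pop Xs Z F, Pop Xs Z H, \<lambda>ss\<in>Obj (prod_cat Ps). Comp D (b.al ss) (a.al ss))"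
    by (simp add: perm_ops_def del: prod_cat_simps Acat_simps cong: restrict_cong)
  ultimately show ?thesis by (simp only: a.Pmod_eq b.Pmod_eq c.Pmod_eq)
qed

lemma Pop_functor:
  "cfunctor (gamma_ops Xs Z) (perm_ops Ps D)
    \<lparr>FOb = (\<lambda>F\<in>Obj (gamma_ops Xs Z). Pop Xs Z F), FAr = (\<lambda>t\<in>Arr (gamma_ops Xs Z). Pmod Xs Z t)\<rparr>"
proof (intro cfunctor.intro cfunctor_axioms.intro category_gamma_ops category_perm_ops)
  interpret C: category "gamma_ops Xs Z" by (rule category_gamma_ops)
  let ?P = "\<lparr>FOb = (\<lambda>F\<in>Obj (gamma_ops Xs Z). Pop Xs Z F), FAr = (\<lambda>t\<in>Arr (gamma_ops Xs Z). Pmod Xs Z t)\<rparr>"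
  have Obj: "F \<in> Obj (gamma_ops Xs Z) \<longleftrightarrow> gamma_op Xs Z F" for F by (simp add: gamma_ops_def)
  fix F assume F: "F \<in> Obj (gamma_ops Xs Z)"
  then have op: "gamma_op Xs Z F" by (simp add: Obj)
  show "FOb ?P F \<in> Obj (perm_ops Ps D)"
    using gamma_oper.Pop_strong[OF gamma_operI[OF op]] F by (simp add: perm_ops_def)
  show "FAr ?P (Ident (gamma_ops Xs Z) F) = Ident (perm_ops Ps D) (FOb ?P F)"
    using Pmod_ident[OF op] homD[OF C.ident[OF F]] F by simp
next
  interpret C: category "gamma_ops Xs Z" by (rule category_gamma_ops)
  let ?P = "\<lparr>FOb = (\<lambda>F\<in>Obj (gamma_ops Xs Z). Pop Xs Z F), FAr = (\<lambda>t\<in>Arr (gamma_ops Xs Z). Pmod Xs Z t)\<rparr>"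
  fix t F G assume t: "t \<in> hom (gamma_ops Xs Z) F G"
  then obtain \<theta> where t': "t = (F, G, \<theta>)" "gamma_op Xs Z F" "gamma_op Xs Z G" "gamma_mod Xs Z F G \<theta>"
    by (auto simp: hom_gamma_ops)
  interpret gamma_modif Xs Z F G \<theta> by (rule gamma_modifI[OF t'(2-4)])
  show "FAr ?P t \<in> hom (perm_ops Ps D) (FOb ?P F) (FOb ?P G)"
    using homD[OF t] C.hom_Obj[OF t] Pmod_linear F.Pop_strong G.Pop_strong
    by (simp add: t'(1) Pmod_eq hom_perm_ops del: prod_cat_simps Acat_simps)
  fix u H assume u: "u \<in> hom (gamma_ops Xs Z) G H"
  then obtain \<eta> where u': "u = (G, H, \<eta>)" "gamma_op Xs Z H" "gamma_mod Xs Z G H \<eta>"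
    by (auto simp: hom_gamma_ops)
  show "FAr ?P (Comp (gamma_ops Xs Z) u t) = Comp (perm_ops Ps D) (FAr ?P u) (FAr ?P t)"
    using Pmod_comp[OF t'(2,3) u'(2) t'(4) u'(3)] homD[OF t] homD[OF u] homD[OF C.comp[OF t u]]
    by (simp add: t'(1) u'(1))
qed simp_all

end

section \<open>Units\<close>

lemma points_single: "as \<in> points [p] \<longleftrightarrow> (\<exists>a. as = [a] \<and> 1 \<le> a \<and> a \<le> p)"
  by (cases as) (auto simp: points_def length_Suc_conv)

lemma smash_map_single:
  assumes "(p, q, \<psi>) \<in> Arr Fcat"
  shows "smash_map [p] [q] [\<psi>] = \<psi>"
proof (rule smash_map_eqI)
  fix as assume as: "as \<in> points [p]"
  then obtain a where "as = [a]" "1 \<le> a" "a \<le> p" by (auto simp: points_single)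
  then show "smash_map [p] [q] [\<psi>] (lex_pos [p] as) = \<psi> (lex_pos [p] as)"
    using smash_map_lex_pos[OF as, of "[q]" "[\<psi>]"] by (simp add: Let_def)
qed (use assms in \<open>auto simp: Fcat_arr PiE_iff\<close>)

lemma gset_op_unit:
  assumes "gset S" "\<And>p x. x \<in> GS S p \<Longrightarrow> H [p] [x] = x"
  shows "gset_op [S] S H"
proof (rule gset_op.intro)
  have one: "\<exists>p x. ps = [p] \<and> xs = [x] \<and> x \<in> GS S p" if "length ps = length [S]" "xs \<in> gtup [S] ps" for ps xs
    using that by (auto simp: gtup_def length_Suc_conv)
  fix ps xs assume *: "length ps = length [S]" "xs \<in> gtup [S] ps"
  then obtain p x where px: "ps = [p]" "xs = [x]" "x \<in> GS S p" using one by blast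
  show "H ps xs \<in> GS S (prod_list ps)" using px assms(2) by simp
  show "H ps xs = GB S (prod_list ps)" if "i < length [S]" "xs ! i = GB ([S] ! i) (ps ! i)" for i
    using px assms(2) that by simp
  fix qs \<psi>s assume F: "Fcat_tuple ps qs \<psi>s"
  then obtain q \<psi> where q: "qs = [q]" "\<psi>s = [\<psi>]" "(p, q, \<psi>) \<in> Arr Fcat"
    using px by (auto simp: Fcat_tuple_def length_Suc_conv)
  show "GA S (smash_arr ps qs \<psi>s) (H ps xs) = H qs (tab (length [S]) (\<lambda>i. GA ([S] ! i) (ps ! i, qs ! i, \<psi>s ! i) (xs ! i)))"
    using px q assms gset.GA_in[OF assms(1) q(3) px(3)] by (simp add: smash_map_single)
qed (use assms(1) in simp)

lemma multi_seq_single [simp]: "multi_seq [m] = m"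
  by (rule nth_equalityI) (simp_all add: multi_seq_def pick_def)

lemma multi_single:
  assumes "length x = length m" "\<And>j. j < length m \<Longrightarrow> H [m ! j] [x ! j] = x ! j"
  shows "multi H [m] [x] = x"
  using assms by (intro nth_equalityI) (simp_all add: multi_def pick_def)

lemma en_single:
  assumes "u \<in> blocks m"
  shows "en [m] [u] = u"
proof -
  have u: "fst u < length m" "1 \<le> snd u" using assms by (simp_all add: mem_blocks')
  have "pos (indices [m]) [fst u] = fst u"
    using u by (intro pos_eqI) (simp_all del: distinct_tuples add: distinct_map inj_on_def)
  then show ?thesis using u by (simp add: en_def pick_def prod_eq_iff)
qed

lemma lin_eqI: "\<lbrakk>FOb (LF F) = FOb (LF G); FAr (LF F) = FAr (LF G); LC F = LC G\<rbrakk> \<Longrightarrow> F = (G :: ('o, 'm) lin)"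
  by (cases F; cases G) (auto intro: ftor_eqI)

context gamma_cat
begin

lemma gamma_cats_single: "gamma_cats [X] X"
  using gamma by (simp add: gamma_cats_def)

lemma gamma_unit_op: "gamma_op [X] X (gamma_unit X)"
proof -
  interpret S: gamma_cats "[X]" X by (rule gamma_cats_single)
  have "cfunctor (gprod [X] ps) (FOb X (prod_list ps)) (gamma_unit X ps)" if l: "length ps = length [X]" for ps
  proof -
    obtain p where p: "ps = [p]" using l by (auto simp: length_Suc_conv)
    interpret C: category "gprod [X] ps" by (rule S.cat_gprod)
    interpret D: category "FOb X (prod_list ps)" by (rule cat_X)
    have hd: "f \<in> hom (gprod [X] ps) x y \<Longrightarrow> hd f \<in> hom (FOb X p) (hd x) (hd y)" for f x y
      by (auto simp: hom_gprod p length_Suc_conv)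
    have U: "FOb (gamma_unit X ps) = (\<lambda>xs\<in>Obj (gprod [X] ps). hd xs)" "FAr (gamma_unit X ps) = (\<lambda>xs\<in>Arr (gprod [X] ps). hd xs)"
      by (simp_all add: gamma_unit_def p)
    show ?thesis
    proof
      fix x assume x: "x \<in> Obj (gprod [X] ps)"
      have h: "Ident (gprod [X] ps) x \<in> Arr (gprod [X] ps)" using homD[OF C.ident[OF x]] by simp
      show "FOb (gamma_unit X ps) x \<in> Obj (FOb X (prod_list ps))"
        using x unfolding U by (auto simp: gtup_def p length_Suc_conv)
      show "FAr (gamma_unit X ps) (Ident (gprod [X] ps) x) = Ident (FOb X (prod_list ps)) (FOb (gamma_unit X ps) x)"
        using x h unfolding U by (auto simp: gprod_Ident gtup_def p length_Suc_conv)
    next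
      fix f x y assume f: "f \<in> hom (gprod [X] ps) x y"
      show "FAr (gamma_unit X ps) f \<in> hom (FOb X (prod_list ps)) (FOb (gamma_unit X ps) x) (FOb (gamma_unit X ps) y)"
        using hd[OF f] homD[OF f] C.hom_Obj[OF f] unfolding U by (simp add: p)
      fix g z assume g: "g \<in> hom (gprod [X] ps) y z"
      show "FAr (gamma_unit X ps) (Comp (gprod [X] ps) g f) =
          Comp (FOb X (prod_list ps)) (FAr (gamma_unit X ps) g) (FAr (gamma_unit X ps) f)"
        using homD[OF f] homD[OF g] homD[OF C.comp[OF f g]] unfolding U
        by (auto simp: gprod_Comp p gtup_def length_Suc_conv)
    qed (simp_all add: U)
  qed
  moreover have "gset_op [ob] ob (\<lambda>ps. FOb (gamma_unit X ps))"
    by (rule gset_op_unit[OF gset_ob]) (simp add: gamma_unit_def gtup_def)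
  moreover have "gset_op [ar] ar (\<lambda>ps. FAr (gamma_unit X ps))"
    by (rule gset_op_unit[OF gset_ar]) (simp add: gamma_unit_def gtup_def)
  ultimately show ?thesis
    by (simp add: S.gamma_op_iff) (simp add: gamma_unit_def)
qed

text \<open>With a single variable the index tuples are singletons in their usual order and
  \<open>en\<close> is the identification of \<open>[u]\<close> with \<open>u\<close>, so objects
  and arrows are unchanged. The constraint becomes a pure endomorphism that fixes every element of
  both summands.\<close>

lemma Pop_unit: "Pop [X] X (gamma_unit X) = perm_unit P"
proof -
  interpret gamma_oper "[X]" X "gamma_unit X"
    using gamma_cats.gamma_operI[OF gamma_cats_single gamma_unit_op] .
  have U: "FO [p] [x] = x" if "x \<in> Obj (FOb X p)" for p x
    using that by (simp add: gamma_unit_def gtup_def)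
  have V: "FA [p] [f] = f" if "f \<in> Arr (FOb X p)" for p f
    using that by (simp add: gamma_unit_def gtup_def)
  have Ob1: "PopOb (gamma_unit X) [s] = s" if "s \<in> Obj P" for s
  proof -
    have "length (snd s) = length (fst s)" "\<forall>j<length (fst s). snd s ! j \<in> Obj (FOb X (fst s ! j))"
      using that axcD[of "snd s" "ob" "fst s"] by (simp_all add: Obj_P)
    then show ?thesis using multi_single[of "snd s" "fst s" FO] U by (simp add: PopOb_eq)
  qed
  have enp1: "enp [s] [u] = u" "[u] \<in> boxp [s]" if "u \<in> blocks (fst s)" for s :: "'o pob" and u
    using that by (simp_all add: enp_def en_single boxp_def box_def)
  have Ar1: "PopAr (gamma_unit X) [h] = h" if h: "h \<in> hom P s t" for h s t
  proof -
    note O = category.hom_Obj[OF cat_P h]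
    have h': "[h] \<in> hom (prod_cat Ps) [s] [t]" using h by (simp add: hom_prod_cat)
    have hom: "PopAr (gamma_unit X) [h] \<in> hom P s t" using PopAr_hom[OF h'] O by (simp add: Ob1)
    show ?thesis
    proof (rule P_eqI[OF hom h])
      fix u assume u: "u \<in> blocks (fst s)"
      have "pmap h u \<in> blocks (fst t)" using Acat_arrD(3)[OF hom_PE(2)[OF h] u] .
      then show "pmap (PopAr (gamma_unit X) [h]) u = pmap h u"
        using PopAr_enp(2)[OF h' enp1(2)[OF u]] by (simp add: enp1(1) u)
    next
      show "pval (PopAr (gamma_unit X) [h]) = pval h"
        using axcD[of "pval h" ar "fst t"] homD[OF hom_PE(5)[OF h]] V
        by (simp add: PopAr_pval[OF h'] multi_single)
    qed
  qed
  show ?thesis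
  proof (rule lin_eqI)
    have "PopOb (gamma_unit X) ss = hd ss" if "ss \<in> Obj (prod_cat Ps)" for ss
      using that Ob1 by (auto simp: length_Suc_conv)
    then show "FOb (LF (Pop [X] X (gamma_unit X))) = FOb (LF (perm_unit P))"
      unfolding Pop_LF by (simp add: perm_unit_def cong: restrict_cong del: prod_cat_simps)
    have "PopAr (gamma_unit X) hs = hd hs" if "hs \<in> Arr (prod_cat Ps)" for hs
      using that Ar1[OF Arr_hom] by (auto simp: length_Suc_conv)
    then show "FAr (LF (Pop [X] X (gamma_unit X))) = FAr (LF (perm_unit P))"
      unfolding Pop_LF by (simp add: perm_unit_def cong: restrict_cong del: prod_cat_simps)
    have "PopC X (gamma_unit X) b ss t = Ident P (TOb P (hd ss) t)" if c: "constraint_dom Ps b ss t" for b ss t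
    proof -
      have cd: "b < length [X]" "ss \<in> Obj (prod_cat Ps)" "t \<in> Obj (Pobj ([X] ! b))"
        using c unfolding constraint_dom_Ps by blast+
      then have "b = 0" and ss: "length ss = 1" "ss ! 0 \<in> Obj P" by auto
      moreover from this cd(3) have "t \<in> Obj P" by simp
      ultimately obtain s where s: "b = 0" "ss = [s]" "s \<in> Obj P" "t \<in> Obj P" by (auto simp: length_Suc_conv)
      have st: "oplus s t \<in> Obj P" using s by (simp add: Obj_P axc_append)
      note I = Ident_P[OF st]
      note C = PopC_hom[of b ss t]
      have C1: "PopC X (gamma_unit X) 0 [s] t \<in> hom P (oplus s t) (oplus s t)" "pure X (oplus s t) (PopC X (gamma_unit X) 0 [s] t)"
        using C s st by (simp_all add: Ob1)
      have "PopC X (gamma_unit X) 0 [s] t = Ident P (oplus s t)"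
      proof (rule pure_eqI[OF C1(1) I(1) C1(2) I(3)])
        fix u assume u: "u \<in> blocks (fst (oplus s t))"
        then have "u \<in> blocks (fst s @ fst t)" by simp
        then show "pmap (PopC X (gamma_unit X) 0 [s] t) u = pmap (Ident P (oplus s t)) u"
        proof (cases rule: blocks_appendE)
          case left
          show ?thesis using popl(2)[of 0 "[s]" "[u]", where t = t] u left by (simp add: enp1 I(2))
        next
          case (right v)
          show ?thesis using popr(2)[of 0 "[s]" "[v]" t] u right
            by (simp add: enp1 I(2) Ob1 s(3) sh_sh)
        qed
      qed
      then show ?thesis by (simp add: s)
    qed
    then show "LC (Pop [X] X (gamma_unit X)) = LC (perm_unit P)"
      by (simp add: fun_eq_iff Pop_def perm_unit_def)
  qed
qed

end

section \<open>Composition of operations\<close>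

text \<open>The counterpart of \<open>all_concat_iff\<close> for tabulated lists, likewise with four
  lists of one shape.\<close>

lemma tab_concat:
  assumes "map length vss = map length yss" "map length wss = map length yss" "map length xss = map length yss"
  shows "tab (length (concat yss)) (\<lambda>l. f (concat vss ! l) (concat wss ! l) (concat xss ! l) (concat yss ! l)) =
    concat (tab (length yss) (\<lambda>i. tab (length (yss ! i)) (\<lambda>j. f (vss ! i ! j) (wss ! i ! j) (xss ! i ! j) (yss ! i ! j))))"
    (is "_ = concat ?zss")
proof (rule nth_equalityI)
  have z: "map length ?zss = map length yss" by (rule map_length_eqI) simp_all
  then show "length (tab (length (concat yss)) (\<lambda>l. f (concat vss ! l) (concat wss ! l) (concat xss ! l) (concat yss ! l))) = length (concat ?zss)"
    using map_length_eqD(3)[OF z] by simp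
  fix l assume "l < length (tab (length (concat yss)) (\<lambda>l. f (concat vss ! l) (concat wss ! l) (concat xss ! l) (concat yss ! l)))"
  then have l: "l < length (concat yss)" by simp
  obtain i j where ij: "locate (map length yss) l = (i, j)" by fastforce
  note y = concat_cong_locate[OF refl l ij]
  have "concat ?zss ! l = f (vss ! i ! j) (wss ! i ! j) (xss ! i ! j) (yss ! i ! j)"
    using concat_cong_locate(3)[OF z l ij] y(1,2) by simp
  then show "tab (length (concat yss)) (\<lambda>l. f (concat vss ! l) (concat wss ! l) (concat xss ! l) (concat yss ! l)) ! l = concat ?zss ! l"
    using l concat_cong_locate(3)[OF assms(1) l ij] concat_cong_locate(3)[OF assms(2) l ij]
      concat_cong_locate(3)[OF assms(3) l ij] y(3) by simp
qed

text \<open>\<open>multi_concat\<close> in the form suited to composites: it is enough to know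
  \<open>K\<close> on concatenated arguments of the right types, since the entries picked from
  sequences are of this kind.\<close>

lemma multi_comp:
  assumes "length mss = k" "length xss = k" "length Sss = k" "\<And>i. i < k \<Longrightarrow> fam (Sss ! i) (mss ! i) (xss ! i)"
    and K: "\<And>pss xss. \<lbrakk>map length pss = map length Sss; length xss = length Sss;
        \<And>i. i < k \<Longrightarrow> xss ! i \<in> gtup (Sss ! i) (pss ! i)\<rbrakk>
      \<Longrightarrow> K (concat pss) (concat xss) = H (map prod_list pss) (tab k (\<lambda>i. Hs i (pss ! i) (xss ! i)))"
  shows "multi K (concat mss) (concat xss) =
    multi H (map multi_seq mss) (tab k (\<lambda>i. multi (Hs i) (mss ! i) (xss ! i)))"
proof (rule multi_concat)
  fix jss assume jss: "length jss = k" "\<And>i. i < k \<Longrightarrow> jss ! i \<in> set (indices (mss ! i))"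
  note p = pick_gtup[OF assms(4) jss(2)]
  have "map length (map2 pick mss jss) = map length Sss"
    using assms(1,3) jss(1) p(2) by (intro map_length_eqI) simp_all
  then have "K (concat (map2 pick mss jss)) (concat (map2 pick xss jss)) =
      H (map prod_list (map2 pick mss jss)) (tab k (\<lambda>i. Hs i (map2 pick mss jss ! i) (map2 pick xss jss ! i)))"
    by (rule K) (use assms(1-3) jss(1) p(1) in simp_all)
  moreover have "tab k (\<lambda>i. Hs i (map2 pick mss jss ! i) (map2 pick xss jss ! i)) =
      tab k (\<lambda>i. Hs i (pick (mss ! i) (jss ! i)) (pick (xss ! i) (jss ! i)))"
    using assms(1,2) jss(1) by simp
  ultimately show "K (concat (map2 pick mss jss)) (concat (map2 pick xss jss)) =
      H (map prod_list (map2 pick mss jss)) (tab k (\<lambda>i. Hs i (pick (mss ! i) (jss ! i)) (pick (xss ! i) (jss ! i))))"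
    by simp
qed (use assms in \<open>auto simp: fam_def\<close>)

text \<open>The object and arrow maps of \<open>gamma_compOb\<close> and both factors in \<open>gamma_compAr\<close> are of this form.\<close>

definition comp_fun :: "'x list list \<Rightarrow> nat \<Rightarrow> (nat list \<Rightarrow> 'b list \<Rightarrow> 'c) \<Rightarrow> (nat \<Rightarrow> nat list \<Rightarrow> 'a list \<Rightarrow> 'b)
    \<Rightarrow> nat list \<Rightarrow> 'a list \<Rightarrow> 'c" where
  "comp_fun Xss k H Hs ps xs = H (map prod_list (pieces (map length Xss) ps))
    (tab k (\<lambda>i. Hs i (pieces (map length Xss) ps ! i) (pieces (map length Xss) xs ! i)))"

lemma comp_fun_concat:
  "\<lbrakk>map length pss = map length Xss; map length xss = map length Xss\<rbrakk>
    \<Longrightarrow> comp_fun Xss k H Hs (concat pss) (concat xss) = H (map prod_list pss) (tab k (\<lambda>i. Hs i (pss ! i) (xss ! i)))"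
  by (simp add: comp_fun_def pieces_concat')

text \<open>\<open>O\<close> refers to the outer inputs \<open>Ys\<close>; below, \<open>C\<close>
  refers to the concatenated inputs of the composite. Their target \<open>Z\<close> is the
  same.\<close>

locale gamma_multi = O: gamma_cats Ys Z for Ys :: "('o, 'm) gcat list" and Z +
  fixes Xss :: "('o, 'm) gcat list list"
  assumes len_Xss: "length Xss = length Ys"
    and gamma_Xss: "\<lbrakk>Xs \<in> set Xss; X \<in> set Xs\<rbrakk> \<Longrightarrow> gamma_category X"

sublocale gamma_multi \<subseteq> C: gamma_cats "concat Xss" Z
  using gamma_Xss O.gamma_Z by unfold_locales auto

context gamma_multi
begin

abbreviation "k \<equiv> length Ys"
abbreviation "obss \<equiv> map (map ob_gset) Xss"
abbreviation "arss \<equiv> map (map ar_gset) Xss"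

lemma inner: "i < k \<Longrightarrow> gamma_cats (Xss ! i) (Ys ! i)"
  using gamma_Xss[of "Xss ! i"] O.gamma_Xs len_Xss by (simp add: gamma_cats_def)

lemma obs_concat: "C.obs = concat obss" "C.ars = concat arss"
  by (simp_all add: map_concat)

lemma gtup_len: "xs \<in> gtup Ss ps \<Longrightarrow> length xs = length Ss"
  by (simp add: gtup_def)

lemma gset_op_comp_fun:
  assumes H: "gset_op Ts U H" and Ts: "length Ts = k" and S: "length Sss = k" "\<And>i. i < k \<Longrightarrow> length (Sss ! i) = length (Xss ! i)"
    and Hs: "\<And>i. i < k \<Longrightarrow> gset_op (Sss ! i) (Ts ! i) (Hs i)"
  shows "gset_op (concat Sss) U (comp_fun Xss k H Hs)"
proof (rule gset_op_comp[OF H _ Hs])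
  fix pss :: "nat list list" and xss :: "'c list list"
  assume p: "map length pss = map length Sss" and x: "length xss = length Sss" "\<And>i. i < length Ts \<Longrightarrow> xss ! i \<in> gtup (Sss ! i) (pss ! i)"
  have SX: "map length Sss = map length Xss"
    using S len_Xss by (intro map_length_eqI) simp_all
  moreover have "map length xss = map length Sss"
    using x(1) S Ts gtup_len[OF x(2)] by (intro map_length_eqI) simp_all
  ultimately show "comp_fun Xss k H Hs (concat pss) (concat xss) = H (map prod_list pss) (tab (length Ts) (\<lambda>i. Hs i (pss ! i) (xss ! i)))"
    using p Ts by (simp add: comp_fun_concat)
qed (use Ts S in simp_all)

lemma hom_gprod_concatE:
  assumes "f \<in> hom (gprod (concat Xss) (concat pss)) x y" "map length pss = map length Xss"
  obtains fss xss yss where "f = concat fss" "x = concat xss" "y = concat yss"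
    "map length fss = map length Xss" "map length xss = map length Xss" "map length yss = map length Xss"
    "\<forall>i<k. fss ! i \<in> hom (gprod (Xss ! i) (pss ! i)) (xss ! i) (yss ! i)"
proof -
  have l: "length f = length (concat Xss)" "length x = length (concat Xss)" "length y = length (concat Xss)"
    using assms(1) by (simp_all add: hom_gprod)
  obtain fss where f: "f = concat fss" "map length fss = map length Xss" using l(1) by (rule concatE)
  obtain xss where x: "x = concat xss" "map length xss = map length Xss" using l(2) by (rule concatE)
  obtain yss where y: "y = concat yss" "map length yss = map length Xss" using l(3) by (rule concatE)
  have *: "fss ! i \<in> hom (gprod (Xss ! i) (pss ! i)) (xss ! i) (yss ! i)" if i: "i < k" for i
  proof -
    have "fss ! i ! j \<in> hom (FOb (Xss ! i ! j) (pss ! i ! j)) (xss ! i ! j) (yss ! i ! j)" if j: "j < length (Xss ! i)" for j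
    proof -
      have i': "i < length Xss" using i len_Xss by simp
      obtain l where l: "l < length (concat Xss)" "locate (map length Xss) l = (i, j)"
        using locate_surj[OF i' j] by blast
      have "concat fss ! l \<in> hom (FOb (concat Xss ! l) (concat pss ! l)) (concat xss ! l) (concat yss ! l)"
        using assms(1) l(1) by (simp add: hom_gprod f x y)
      then show ?thesis
        unfolding concat_cong_locate(3)[OF f(2) l] concat_cong_locate(3)[OF refl l] concat_cong_locate(3)[OF assms(2) l]
          concat_cong_locate(3)[OF x(2) l] concat_cong_locate(3)[OF y(2) l] .
    qed
    then show ?thesis
      using i len_Xss map_length_eqD(2)[OF f(2)] map_length_eqD(2)[OF x(2)] map_length_eqD(2)[OF y(2)]
      by (simp add: hom_gprod)
  qed
  show thesis by (rule that[OF f(1) x(1) y(1) f(2) x(2) y(2)]) (use * in blast)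
qed

lemma gprod_Ident_concat:
  assumes "map length pss = map length Xss" "map length xss = map length Xss"
  shows "Ident (gprod (concat Xss) (concat pss)) (concat xss) = concat (tab k (\<lambda>i. Ident (gprod (Xss ! i) (pss ! i)) (xss ! i)))"
  using tab_concat[OF assms assms(2), of "\<lambda>p x _ X. Ident (FOb X p) x"] by (simp add: gprod_Ident len_Xss)

lemma gprod_Comp_concat:
  assumes "map length pss = map length Xss" "map length fss = map length Xss" "map length gss = map length Xss"
  shows "Comp (gprod (concat Xss) (concat pss)) (concat gss) (concat fss) =
    concat (tab k (\<lambda>i. Comp (gprod (Xss ! i) (pss ! i)) (gss ! i) (fss ! i)))"
  using tab_concat[OF assms, of "\<lambda>p f g X. Comp (FOb X p) g f"] by (simp add: gprod_Comp len_Xss)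

lemma gprod_concatE:
  assumes "x \<in> Obj (gprod (concat Xss) (concat pss))" "map length pss = map length Xss"
  obtains xss where "x = concat xss" "map length xss = map length Xss"
    "\<And>i. i < k \<Longrightarrow> xss ! i \<in> Obj (gprod (Xss ! i) (pss ! i))"
proof -
  have "map length pss = map length obss"
    using assms(2) by (simp add: comp_def)
  then obtain xss where "x = concat xss" "map length xss = map length obss"
    "\<And>i. i < length obss \<Longrightarrow> xss ! i \<in> gtup (obss ! i) (pss ! i)"
    using gtup_concatE[of x obss pss] assms(1) by (metis gprod_Obj obs_concat(1))
  then show thesis using that[of xss] len_Xss by (simp add: comp_def)
qed

end

section \<open>The composite operation\<close>

locale gamma_multi_op = gamma_multi Ys Z Xss for Ys :: "('o, 'm) gcat list" and Z Xss +
  fixes F :: "('o, 'm) gop" and Fs :: "('o, 'm) gop list"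
  assumes F: "gamma_op Ys Z F" and len_Fs: "length Fs = length Ys"
    and Fs: "i < length Ys \<Longrightarrow> gamma_op (Xss ! i) (Ys ! i) (Fs ! i)"

sublocale gamma_multi_op \<subseteq> F: gamma_oper Ys Z F
  by unfold_locales (rule F)

context gamma_multi_op
begin

lemma inner_op: "i < k \<Longrightarrow> gamma_oper (Xss ! i) (Ys ! i) (Fs ! i)"
  using gamma_cats.gamma_operI[OF inner Fs] .

abbreviation "cF \<equiv> gamma_compOb Xss Ys Z F Fs"

lemma cF_Ob:
  assumes "length ps = length (concat Xss)"
  shows "FOb (cF ps) = (\<lambda>xs\<in>Obj (gprod (concat Xss) ps). comp_fun Xss k F.FO (\<lambda>i. \<lambda>ps. FOb ((Fs ! i) ps)) ps xs)"
  using assms by (simp add: gamma_compOb_def comp_fun_def Let_def)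

lemma cF_Ar:
  assumes "length ps = length (concat Xss)"
  shows "FAr (cF ps) = (\<lambda>fs\<in>Arr (gprod (concat Xss) ps). comp_fun Xss k F.FA (\<lambda>i. \<lambda>ps. FAr ((Fs ! i) ps)) ps fs)"
  using assms by (simp add: gamma_compOb_def comp_fun_def Let_def)

text \<open>The conditions concern only typed arguments, as \<open>gtup_act\<close> keeps arguments
  typed. This passes from \<open>comp_fun\<close> to the restricted functions in
  \<open>gamma_compOb\<close>.\<close>

lemma gset_op_cong:
  assumes "gset_op Ss T K" "\<And>ps xs. \<lbrakk>length ps = length Ss; xs \<in> gtup Ss ps\<rbrakk> \<Longrightarrow> L ps xs = K ps xs"
  shows "gset_op Ss T L"
proof -
  interpret gset_op Ss T K by fact
  show ?thesis
  proof (rule gset_op.intro)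
    fix ps xs assume ps: "length ps = length Ss" "xs \<in> gtup Ss ps"
    show "L ps xs \<in> GS T (prod_list ps)" using H_in[OF ps] assms(2)[OF ps] by simp
    show "L ps xs = GB T (prod_list ps)" if "i < length Ss" "xs ! i = GB (Ss ! i) (ps ! i)" for i
      using H_base[OF ps that] assms(2)[OF ps] by simp
    fix qs \<psi>s assume \<psi>: "Fcat_tuple ps qs \<psi>s"
    then have "length qs = length Ss" using ps by (simp add: Fcat_tuple_def)
    from assms(2)[OF this gtup_act[OF gset_Ss \<psi> ps]] H_nat[OF \<psi> ps] assms(2)[OF ps]
    show "GA T (smash_arr ps qs \<psi>s) (L ps xs) = L qs (tab (length Ss) (\<lambda>i. GA (Ss ! i) (ps ! i, qs ! i, \<psi>s ! i) (xs ! i)))"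
      by simp
  qed (rule gset_Ss)
qed

lemma cF_gset_Ob: "gset_op C.obs (ob_gset Z) (\<lambda>ps. FOb (cF ps))"
proof (rule gset_op_cong)
  show "gset_op C.obs (ob_gset Z) (comp_fun Xss k F.FO (\<lambda>i. \<lambda>ps. FOb ((Fs ! i) ps)))"
    unfolding obs_concat
    by (rule gset_op_comp_fun[OF F.Ob.gset_op_axioms]) (use gamma_cats.gamma_opD(3)[OF inner Fs] len_Xss in simp_all)
  show "FOb (cF ps) xs = comp_fun Xss k F.FO (\<lambda>i. \<lambda>ps. FOb ((Fs ! i) ps)) ps xs" if "length ps = length C.obs" "xs \<in> gtup C.obs ps" for ps xs
    using that by (simp add: cF_Ob)
qed

lemma cF_gset_Ar: "gset_op C.ars (ar_gset Z) (\<lambda>ps. FAr (cF ps))"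
proof (rule gset_op_cong)
  show "gset_op C.ars (ar_gset Z) (comp_fun Xss k F.FA (\<lambda>i. \<lambda>ps. FAr ((Fs ! i) ps)))"
    unfolding obs_concat
    by (rule gset_op_comp_fun[OF F.Ar.gset_op_axioms]) (use gamma_cats.gamma_opD(4)[OF inner Fs] len_Xss in simp_all)
  show "FAr (cF ps) xs = comp_fun Xss k F.FA (\<lambda>i. \<lambda>ps. FAr ((Fs ! i) ps)) ps xs" if "length ps = length C.ars" "xs \<in> gtup C.ars ps" for ps xs
    using that by (simp add: cF_Ar)
qed

lemma inner_cfunctor:
  assumes "map length pss = map length Xss" "i < k"
  shows "cfunctor (gprod (Xss ! i) (pss ! i)) (FOb (Ys ! i) (prod_list (pss ! i))) ((Fs ! i) (pss ! i))"
  using gamma_cats.gamma_opD(2)[OF inner Fs] assms(2) map_length_eqD(2)[OF assms(1)] len_Xss by simp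

lemma tab_hom:
  assumes "map length pss = map length Xss" "\<And>i. i < k \<Longrightarrow> fss ! i \<in> hom (gprod (Xss ! i) (pss ! i)) (xss ! i) (yss ! i)"
  shows "tab k (\<lambda>i. FAr ((Fs ! i) (pss ! i)) (fss ! i)) \<in> hom (gprod Ys (map prod_list pss))
    (tab k (\<lambda>i. FOb ((Fs ! i) (pss ! i)) (xss ! i))) (tab k (\<lambda>i. FOb ((Fs ! i) (pss ! i)) (yss ! i)))"
  using cfunctor.FAr_in[OF inner_cfunctor[OF assms(1)] assms(2)] map_length_eqD(1)[OF assms(1)] len_Xss
  by (simp add: hom_gprod)

lemma tab_Obj:
  assumes "map length pss = map length Xss" "\<And>i. i < k \<Longrightarrow> xss ! i \<in> Obj (gprod (Xss ! i) (pss ! i))"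
  shows "tab k (\<lambda>i. FOb ((Fs ! i) (pss ! i)) (xss ! i)) \<in> Obj (gprod Ys (map prod_list pss))"
  using cfunctor.FOb_in[OF inner_cfunctor[OF assms(1)] assms(2)] map_length_eqD(1)[OF assms(1)] len_Xss
  by (simp add: gtup_def)

lemma outer_cfunctor:
  assumes "map length pss = map length Xss"
  shows "cfunctor (gprod Ys (map prod_list pss)) (FOb Z (prod_list (concat pss))) (F (map prod_list pss))"
  using F.F_cfunctor[of "map prod_list pss"] map_length_eqD(1)[OF assms] len_Xss by (simp add: prod_list_concat)

lemma cF_cfunctor:
  assumes "length ps = length (concat Xss)"
  shows "cfunctor (gprod (concat Xss) ps) (FOb Z (prod_list ps)) (cF ps)"
proof -
  interpret C': category "gprod (concat Xss) ps" by (rule C.cat_gprod)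
  interpret Z': category "FOb Z (prod_list ps)" by (rule O.Z.cat_X)
  obtain pss where ps: "ps = concat pss" "map length pss = map length Xss" using assms by (rule concatE)
  interpret Fp: cfunctor "gprod Ys (map prod_list pss)" "FOb Z (prod_list ps)" "F (map prod_list pss)"
    using outer_cfunctor[OF ps(2)] ps(1) by simp
  show ?thesis
  proof
    fix x assume x: "x \<in> Obj (gprod (concat Xss) ps)"
    obtain xss where xss: "x = concat xss" "map length xss = map length Xss"
      "\<And>i. i < k \<Longrightarrow> xss ! i \<in> Obj (gprod (Xss ! i) (pss ! i))"
      using gprod_concatE[OF x[unfolded ps(1)] ps(2)] by metis
    have Fx: "FOb (cF ps) x = F.FO (map prod_list pss) (tab k (\<lambda>i. FOb ((Fs ! i) (pss ! i)) (xss ! i)))"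
      using x unfolding cF_Ob[OF assms] by (simp add: ps(1) xss(1) comp_fun_concat ps(2) xss(2))
    show "FOb (cF ps) x \<in> Obj (FOb Z (prod_list ps))"
      unfolding Fx by (rule Fp.FOb_in[OF tab_Obj[OF ps(2) xss(3)]])
    let ?Is = "tab k (\<lambda>i. Ident (gprod (Xss ! i) (pss ! i)) (xss ! i))"
    have Il: "map length ?Is = map length Xss"
      by (rule map_length_eqI) (simp_all add: len_Xss gprod_Ident)
    have I: "Ident (gprod (concat Xss) ps) x = concat ?Is"
      unfolding ps(1) xss(1) by (rule gprod_Ident_concat[OF ps(2) xss(2)])
    have "FAr (cF ps) (Ident (gprod (concat Xss) ps) x) = comp_fun Xss k F.FA (\<lambda>i. \<lambda>ps. FAr ((Fs ! i) ps)) ps (Ident (gprod (concat Xss) ps) x)"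
      unfolding cF_Ar[OF assms] using homD[OF C'.ident[OF x]] by (simp only: restrict_apply')
    also have "\<dots> = F.FA (map prod_list pss) (tab k (\<lambda>i. FAr ((Fs ! i) (pss ! i)) (?Is ! i)))"
      unfolding I unfolding ps(1) by (rule comp_fun_concat[OF ps(2) Il])
    also have "tab k (\<lambda>i. FAr ((Fs ! i) (pss ! i)) (?Is ! i)) = Ident (gprod Ys (map prod_list pss)) (tab k (\<lambda>i. FOb ((Fs ! i) (pss ! i)) (xss ! i)))"
      using cfunctor.FAr_ident[OF inner_cfunctor[OF ps(2)] xss(3)] map_length_eqD(1)[OF ps(2)] len_Xss by (simp add: gprod_Ident)
    finally show "FAr (cF ps) (Ident (gprod (concat Xss) ps) x) = Ident (FOb Z (prod_list ps)) (FOb (cF ps) x)"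
      unfolding Fx using Fp.FAr_ident[OF tab_Obj[OF ps(2) xss(3)]] by simp
  next
    fix f x y assume f: "f \<in> hom (gprod (concat Xss) ps) x y"
    obtain fss xss yss where fss: "f = concat fss" "x = concat xss" "y = concat yss"
      "map length fss = map length Xss" "map length xss = map length Xss" "map length yss = map length Xss"
      "\<forall>i<k. fss ! i \<in> hom (gprod (Xss ! i) (pss ! i)) (xss ! i) (yss ! i)"
      by (rule hom_gprod_concatE[OF f[unfolded ps(1)] ps(2)])
    have Fx: "FOb (cF ps) x = F.FO (map prod_list pss) (tab k (\<lambda>i. FOb ((Fs ! i) (pss ! i)) (xss ! i)))"
      "FOb (cF ps) y = F.FO (map prod_list pss) (tab k (\<lambda>i. FOb ((Fs ! i) (pss ! i)) (yss ! i)))"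
      using C'.hom_Obj[OF f] unfolding cF_Ob[OF assms] by (simp_all add: ps(1) fss(2,3) comp_fun_concat ps(2) fss(5,6))
    have Ff: "FAr (cF ps) f = F.FA (map prod_list pss) (tab k (\<lambda>i. FAr ((Fs ! i) (pss ! i)) (fss ! i)))"
      using homD[OF f] unfolding cF_Ar[OF assms] by (simp add: ps(1) fss(1) comp_fun_concat ps(2) fss(4))
    note fh = fss(7)[rule_format]
    note tf = tab_hom[OF ps(2) fh]
    show "FAr (cF ps) f \<in> hom (FOb Z (prod_list ps)) (FOb (cF ps) x) (FOb (cF ps) y)"
      unfolding Fx Ff by (rule Fp.FAr_in[OF tf])
    fix g z assume g: "g \<in> hom (gprod (concat Xss) ps) y z"
    obtain gss yss' zss where gss: "g = concat gss" "y = concat yss'" "z = concat zss"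
      "map length gss = map length Xss" "map length yss' = map length Xss" "map length zss = map length Xss"
      "\<forall>i<k. gss ! i \<in> hom (gprod (Xss ! i) (pss ! i)) (yss' ! i) (zss ! i)"
      by (rule hom_gprod_concatE[OF g[unfolded ps(1)] ps(2)])
    \<comment> \<open>\<open>y\<close> has been cut once as the target of \<open>f\<close> and once
      as the source of \<open>g\<close>; pieces of prescribed lengths are unique.\<close>
    have "yss' = yss"
      using gss(2,5) fss(3,6) pieces_concat[of yss] pieces_concat[of yss'] by simp
    note gh = gss(7)[unfolded this, rule_format]
    have Fg: "FAr (cF ps) g = F.FA (map prod_list pss) (tab k (\<lambda>i. FAr ((Fs ! i) (pss ! i)) (gss ! i)))"
      using homD[OF g] unfolding cF_Ar[OF assms] by (simp add: ps(1) gss(1) comp_fun_concat ps(2) gss(4))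
    note tg = tab_hom[OF ps(2) gh]
    let ?Cs = "tab k (\<lambda>i. Comp (gprod (Xss ! i) (pss ! i)) (gss ! i) (fss ! i))"
    have Cl: "map length ?Cs = map length Xss"
      by (rule map_length_eqI) (simp_all add: len_Xss gprod_Comp)
    have C: "Comp (gprod (concat Xss) ps) g f = concat ?Cs"
      unfolding ps(1) fss(1) gss(1) by (rule gprod_Comp_concat[OF ps(2) fss(4) gss(4)])
    have "FAr (cF ps) (Comp (gprod (concat Xss) ps) g f) = comp_fun Xss k F.FA (\<lambda>i. \<lambda>ps. FAr ((Fs ! i) ps)) ps (Comp (gprod (concat Xss) ps) g f)"
      unfolding cF_Ar[OF assms] using homD[OF C'.comp[OF f g]] by (simp only: restrict_apply')
    also have "\<dots> = F.FA (map prod_list pss) (tab k (\<lambda>i. FAr ((Fs ! i) (pss ! i)) (?Cs ! i)))"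
      unfolding C unfolding ps(1) by (rule comp_fun_concat[OF ps(2) Cl])
    also have "tab k (\<lambda>i. FAr ((Fs ! i) (pss ! i)) (?Cs ! i)) = Comp (gprod Ys (map prod_list pss))
        (tab k (\<lambda>i. FAr ((Fs ! i) (pss ! i)) (gss ! i))) (tab k (\<lambda>i. FAr ((Fs ! i) (pss ! i)) (fss ! i)))"
      using cfunctor.FAr_comp[OF inner_cfunctor[OF ps(2)] fh gh] map_length_eqD(1)[OF ps(2)] len_Xss by (simp add: gprod_Comp)
    finally show "FAr (cF ps) (Comp (gprod (concat Xss) ps) g f) = Comp (FOb Z (prod_list ps)) (FAr (cF ps) g) (FAr (cF ps) f)"
      unfolding Ff Fg using Fp.FAr_comp[OF tf tg] by simp
  qed (simp_all add: cF_Ob[OF assms] cF_Ar[OF assms])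
qed

lemma cF_op: "gamma_op (concat Xss) Z cF"
  unfolding C.gamma_op_iff using cF_cfunctor cF_gset_Ob cF_gset_Ar by (simp add: gamma_compOb_def)

end

sublocale gamma_multi_op \<subseteq> cF: gamma_oper "concat Xss" Z "gamma_compOb Xss Ys Z F Fs"
  by unfold_locales (rule cF_op)

section \<open>Nested tuples of objects, arrows and block elements\<close>

lemma Obj_prod_cat_concatE:
  assumes "x \<in> Obj (prod_cat (concat Css))"
  obtains xss where "x = concat xss" "map length xss = map length Css"
    "\<forall>i<length Css. xss ! i \<in> Obj (prod_cat (Css ! i))"
proof -
  have "length x = length (concat Css)" using assms by simp
  then obtain xss where x: "x = concat xss" "map length xss = map length Css" by (rule concatE)
  have "\<forall>i<length Css. xss ! i \<in> Obj (prod_cat (Css ! i))"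
    using assms all_concat_iff[OF x(2,2) x(2), of "\<lambda>x _ C _. x \<in> Obj C"] map_length_eqD[OF x(2)] by (simp add: x(1))
  then show thesis using that x by blast
qed

lemma hom_prod_cat_concatE:
  assumes "f \<in> hom (prod_cat (concat Css)) x y"
  obtains fss xss yss where "f = concat fss" "x = concat xss" "y = concat yss"
    "map length fss = map length Css" "map length xss = map length Css" "map length yss = map length Css"
    "\<forall>i<length Css. fss ! i \<in> hom (prod_cat (Css ! i)) (xss ! i) (yss ! i)"
proof -
  have l: "length f = length (concat Css)" "length x = length (concat Css)" "length y = length (concat Css)"
    using assms by (simp_all add: hom_prod_cat)
  obtain fss where f: "f = concat fss" "map length fss = map length Css" using l(1) by (rule concatE)
  obtain xss where x: "x = concat xss" "map length xss = map length Css" using l(2) by (rule concatE)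
  obtain yss where y: "y = concat yss" "map length yss = map length Css" using l(3) by (rule concatE)
  have "\<forall>l<length (concat Css). concat fss ! l \<in> hom (concat Css ! l) (concat xss ! l) (concat yss ! l)"
    using assms by (simp add: hom_prod_cat f x y)
  then have "\<forall>i<length Css. \<forall>j<length (Css ! i). fss ! i ! j \<in> hom (Css ! i ! j) (xss ! i ! j) (yss ! i ! j)"
    using all_concat_iff[OF f(2) x(2) y(2), of "\<lambda>f x C y. f \<in> hom C x y"] by blast
  then have "\<forall>i<length Css. fss ! i \<in> hom (prod_cat (Css ! i)) (xss ! i) (yss ! i)"
    using map_length_eqD(2)[OF f(2)] map_length_eqD(2)[OF x(2)] map_length_eqD(2)[OF y(2)] by (simp add: hom_prod_cat)
  with that f x y show thesis by blast
qed

text \<open>An instance of \<open>multi_concat\<close> with products of sizes in place of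
  operations, because a product of products is the product of the concatenated list.\<close>

lemma multi_seq_concat: "multi_seq (concat mss) = multi_seq (map multi_seq mss)"
proof -
  have "multi (\<lambda>ps xs. prod_list ps) (concat mss) (concat mss) =
      multi (\<lambda>ps xs. prod_list ps) (map multi_seq mss) (tab (length mss) (\<lambda>i. multi (\<lambda>ps xs. prod_list ps) (mss ! i) (mss ! i)))"
    by (rule multi_concat) (simp_all add: prod_list_concat)
  then show ?thesis by (simp add: multi_seq_eq multi_def)
qed

lemma boxp_concatE:
  assumes "us \<in> boxp (concat sss)"
  obtains uss where "us = concat uss" "map length uss = map length sss" "\<forall>i<length sss. uss ! i \<in> boxp (sss ! i)"
proof -
  have "length us = length (concat sss)" using boxpD[OF assms] by simp
  then obtain uss where u: "us = concat uss" "map length uss = map length sss" by (rule concatE)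
  have "map length uss = map length (map (map fst) sss)" using u(2) by (simp add: comp_def)
  from box_concat_iff[OF this] have "\<forall>i<length sss. uss ! i \<in> boxp (sss ! i)"
    using assms by (simp add: boxp_def u(1) map_concat)
  with that u show thesis by blast
qed

lemma enp_concat:
  assumes "length uss = length sss" "\<forall>i<length sss. uss ! i \<in> boxp (sss ! i)"
  shows "tab (length sss) (\<lambda>i. enp (sss ! i) (uss ! i)) \<in> boxp (tab (length sss) (\<lambda>i. PopOb (Fs i) (sss ! i)))"
    and "enp (concat sss) (concat uss) =
      enp (tab (length sss) (\<lambda>i. PopOb (Fs i) (sss ! i))) (tab (length sss) (\<lambda>i. enp (sss ! i) (uss ! i)))"
proof -
  let ?mss = "map (map fst) sss"
  have b: "length uss = length ?mss" "\<And>i. i < length ?mss \<Longrightarrow> uss ! i \<in> box (?mss ! i)"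
    using assms by (simp_all add: boxp_def)
  have f: "map fst (tab (length sss) (\<lambda>i. PopOb (Fs i) (sss ! i))) = map multi_seq ?mss"
    by (intro nth_equalityI) (simp_all add: PopOb_eq)
  have e: "map2 en ?mss uss = tab (length sss) (\<lambda>i. enp (sss ! i) (uss ! i))"
    using assms(1) by (intro nth_equalityI) (simp_all add: enp_def)
  show "tab (length sss) (\<lambda>i. enp (sss ! i) (uss ! i)) \<in> boxp (tab (length sss) (\<lambda>i. PopOb (Fs i) (sss ! i)))"
    using en_concat(1)[OF b] unfolding boxp_def f e .
  show "enp (concat sss) (concat uss) =
      enp (tab (length sss) (\<lambda>i. PopOb (Fs i) (sss ! i))) (tab (length sss) (\<lambda>i. enp (sss ! i) (uss ! i)))"
    using en_concat(2)[OF b] unfolding e by (simp only: enp_def f map_concat)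
qed

context gamma_multi
begin

abbreviation "Pss \<equiv> map (map Pobj) Xss"

lemma Ps_concat: "C.Ps = concat Pss"
  by (simp add: map_concat)

lemma map_length_Pss: "map length Pss = map length Xss"
  by (simp add: comp_def)

text \<open>Objects of the product over the concatenated inputs, kept in pieces so that each inner
  operation can be applied to its own.\<close>

definition objs :: "'o pob list list \<Rightarrow> bool" where
  "objs sss \<longleftrightarrow> map length sss = map length Xss \<and> (\<forall>i<k. sss ! i \<in> Obj (prod_cat (map Pobj (Xss ! i))))"

lemma objs_length: "objs sss \<Longrightarrow> length sss = k \<and> (\<forall>i<k. length (sss ! i) = length (Xss ! i))"
  using map_length_eqD[of sss Xss] len_Xss by (simp add: objs_def)

lemma objsD: "\<lbrakk>objs sss; i < k\<rbrakk> \<Longrightarrow> sss ! i \<in> Obj (prod_cat (map Pobj (Xss ! i)))"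
  by (simp add: objs_def)

lemma Obj_objsE:
  assumes "ss \<in> Obj (prod_cat C.Ps)"
  obtains sss where "ss = concat sss" "objs sss"
proof -
  obtain sss where "ss = concat sss" "map length sss = map length Pss" "\<forall>i<length Pss. sss ! i \<in> Obj (prod_cat (Pss ! i))"
    using assms unfolding Ps_concat by (rule Obj_prod_cat_concatE)
  then show thesis using that len_Xss by (simp add: objs_def comp_def)
qed

lemma hom_objsE:
  assumes "hs \<in> hom (prod_cat C.Ps) ss ts"
  obtains hss sss tss where "hs = concat hss" "ss = concat sss" "ts = concat tss"
    "map length hss = map length Xss" "objs sss" "objs tss"
    "\<forall>i<k. hss ! i \<in> hom (prod_cat (map Pobj (Xss ! i))) (sss ! i) (tss ! i)"
proof -
  obtain hss sss tss where h: "hs = concat hss" "ss = concat sss" "ts = concat tss"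
    "map length hss = map length Pss" "map length sss = map length Pss" "map length tss = map length Pss"
    "\<forall>i<length Pss. hss ! i \<in> hom (prod_cat (Pss ! i)) (sss ! i) (tss ! i)"
    using assms unfolding Ps_concat by (rule hom_prod_cat_concatE)
  have "\<forall>i<k. hss ! i \<in> hom (prod_cat (map Pobj (Xss ! i))) (sss ! i) (tss ! i)"
    using h(7) len_Xss by simp
  then show thesis
    using that[of hss sss tss] h category.hom_Obj[OF gamma_cats.category_Ps[OF inner]]
    unfolding objs_def map_length_Pss by blast
qed

lemma objs_fam:
  assumes "objs sss" "i < k"
  shows "fam (map ob_gset (Xss ! i)) (map fst (sss ! i)) (map snd (sss ! i))"
  using objsD[OF assms] gamma_cats.Obj_Ps[OF inner[OF assms(2)]] by blast

end

section \<open>Inverse K-theory of a composite operation\<close>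

context gamma_multi_op
begin

abbreviation "zs sss \<equiv> tab k (\<lambda>i. PopOb (Fs ! i) (sss ! i))"

lemma keval_Ob:
  assumes "map length pss = map length obss" "length xss = length obss" "\<And>i. i < k \<Longrightarrow> xss ! i \<in> gtup (obss ! i) (pss ! i)"
  shows "FOb (cF (concat pss)) (concat xss) = F.FO (map prod_list pss) (tab k (\<lambda>i. FOb ((Fs ! i) (pss ! i)) (xss ! i)))"
proof -
  have p: "map length pss = map length Xss" using assms(1) by (simp add: comp_def)
  have x: "map length xss = map length Xss"
    using assms(2) len_Xss gtup_len[OF assms(3)] by (intro map_length_eqI) simp_all
  have "concat xss \<in> Obj (gprod (concat Xss) (concat pss))"
    unfolding gprod_Obj obs_concat by (rule gtup_concat[OF assms(1,2)]) (use assms(3) len_Xss in simp)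
  then show ?thesis
    using map_length_eqD(3)[OF p] by (simp add: cF_Ob comp_fun_concat[OF p x])
qed

lemma keval_Ar:
  assumes "map length pss = map length arss" "length xss = length arss" "\<And>i. i < k \<Longrightarrow> xss ! i \<in> gtup (arss ! i) (pss ! i)"
  shows "FAr (cF (concat pss)) (concat xss) = F.FA (map prod_list pss) (tab k (\<lambda>i. FAr ((Fs ! i) (pss ! i)) (xss ! i)))"
proof -
  have p: "map length pss = map length Xss" using assms(1) by (simp add: comp_def)
  have x: "map length xss = map length Xss"
    using assms(2) len_Xss gtup_len[OF assms(3)] by (intro map_length_eqI) simp_all
  have "concat xss \<in> Arr (gprod (concat Xss) (concat pss))"
    unfolding gprod_Arr obs_concat by (rule gtup_concat[OF assms(1,2)]) (use assms(3) len_Xss in simp)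
  then show ?thesis
    using map_length_eqD(3)[OF p] by (simp add: cF_Ar comp_fun_concat[OF p x])
qed

lemma fst_zs: "objs sss \<Longrightarrow> map fst (zs sss) = map multi_seq (map (map fst) sss)"
  using objs_length by (intro nth_equalityI) (simp_all add: PopOb_eq)

lemma PopOb_comp:
  assumes "objs sss"
  shows "PopOb cF (concat sss) = PopOb F (zs sss)"
proof -
  note len = objs_length[OF assms]
  let ?mss = "map (map fst) sss" and ?xss = "map (map snd) sss"
  have "multi cF.FO (concat ?mss) (concat ?xss) =
      multi F.FO (map multi_seq ?mss) (tab k (\<lambda>i. multi (\<lambda>ps. FOb ((Fs ! i) ps)) (?mss ! i) (?xss ! i)))"
  proof (rule multi_comp[where Sss = obss and K = cF.FO and H = F.FO and Hs = "\<lambda>i ps. FOb ((Fs ! i) ps)"])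
    show "fam (obss ! i) (?mss ! i) (?xss ! i)" if "i < k" for i
      using objs_fam[OF assms that] that len len_Xss by simp
    show "cF.FO (concat pss) (concat xss) = F.FO (map prod_list pss) (tab k (\<lambda>i. FOb ((Fs ! i) (pss ! i)) (xss ! i)))"
      if "map length pss = map length obss" "length xss = length obss" "\<And>i. i < k \<Longrightarrow> xss ! i \<in> gtup (obss ! i) (pss ! i)" for pss xss
      by (rule keval_Ob[OF that])
  qed (use len len_Xss in simp_all)
  moreover have "map snd (zs sss) = tab k (\<lambda>i. multi (\<lambda>ps. FOb ((Fs ! i) ps)) (?mss ! i) (?xss ! i))"
    using len by (intro nth_equalityI) (simp_all add: PopOb_eq)
  ultimately show ?thesis
    unfolding PopOb_eq[of cF] PopOb_eq[of F] fst_zs[OF assms] map_concat by (simp add: multi_seq_concat del: map_map)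
qed

lemma zs_Obj: "objs sss \<Longrightarrow> zs sss \<in> Obj (prod_cat O.Ps)"
  using gamma_oper.PopOb_in[OF inner_op objsD] by simp

lemma tab_PopAr_hom:
  assumes "\<forall>i<k. hss ! i \<in> hom (prod_cat (map Pobj (Xss ! i))) (sss ! i) (tss ! i)"
  shows "tab k (\<lambda>i. PopAr (Fs ! i) (hss ! i)) \<in> hom (prod_cat O.Ps) (zs sss) (zs tss)"
  using gamma_oper.PopAr_hom[OF inner_op assms[rule_format]] by (simp add: hom_prod_cat)

lemma enp_zs:
  assumes "objs sss" "length uss = k" "\<forall>i<k. uss ! i \<in> boxp (sss ! i)"
  shows "tab k (\<lambda>i. enp (sss ! i) (uss ! i)) \<in> boxp (zs sss)"
    "enp (concat sss) (concat uss) = enp (zs sss) (tab k (\<lambda>i. enp (sss ! i) (uss ! i)))"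
  using enp_concat[of uss sss "\<lambda>i. Fs ! i"] assms objs_length[OF assms(1)] by simp_all

lemma boxp_objsE:
  assumes "us \<in> boxp (concat sss)" "objs sss"
  obtains uss where "us = concat uss" "map length uss = map length Xss" "length uss = k" "\<forall>i<k. uss ! i \<in> boxp (sss ! i)"
  using boxp_concatE[OF assms(1)] objs_length[OF assms(2)] assms(2) map_length_eqD(1) unfolding objs_def
  by (smt (verit))

text \<open>On elements, the enumeration of a flat tuple is the outer enumeration of the inner
  enumerations (\<open>enp_zs\<close>), so block maps can be computed in two stages. Components
  agree by \<open>multi_comp\<close> for the arrow maps.\<close>

lemma PopAr_comp:
  assumes hs: "concat hss \<in> hom (prod_cat C.Ps) (concat sss) (concat tss)" and hl: "map length hss = map length Xss"
    and s: "objs sss" and t: "objs tss"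
    and h: "\<forall>i<k. hss ! i \<in> hom (prod_cat (map Pobj (Xss ! i))) (sss ! i) (tss ! i)"
  shows "PopAr cF (concat hss) = PopAr F (tab k (\<lambda>i. PopAr (Fs ! i) (hss ! i)))"
proof -
  note len = objs_length[OF s] objs_length[OF t] map_length_eqD[OF hl]
  note L = cF.PopAr_hom[OF hs, unfolded PopOb_comp[OF s] PopOb_comp[OF t]]
  note th = tab_PopAr_hom[OF h] and R = F.PopAr_hom[OF tab_PopAr_hom[OF h]]
  show ?thesis
  proof (rule O.Z.P_eqI[OF L R])
    fix u assume u: "u \<in> blocks (fst (PopOb F (zs sss)))"
    then have "u \<in> blocks (fst (PopOb cF (concat sss)))" by (simp only: PopOb_comp[OF s])
    then obtain us where us: "us \<in> boxp (concat sss)" "u = enp (concat sss) us" by (rule enp_E)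
    obtain uss where uss: "us = concat uss" "map length uss = map length Xss" "length uss = k" "\<forall>i<k. uss ! i \<in> boxp (sss ! i)"
      using us(1) s by (rule boxp_objsE)
    let ?vss = "tab k (\<lambda>i. tab (length (Xss ! i)) (\<lambda>j. pmap (hss ! i ! j) (uss ! i ! j)))"
    have "tab (length (concat Xss)) (\<lambda>l. pmap (concat hss ! l) (concat uss ! l)) = concat ?vss"
      using tab_concat[OF hl uss(2) uss(2), of "\<lambda>h u _ X. pmap h u"] len_Xss by simp
    then have A: "pmap (PopAr cF (concat hss)) u = enp (concat tss) (concat ?vss)"
      unfolding us(2) uss(1) using cF.PopAr_enp(2)[OF hs us(1)[unfolded uss(1)]] by simp
    note i = gamma_oper.PopAr_enp[OF inner_op h[rule_format]]
    have "\<forall>i<k. ?vss ! i \<in> boxp (tss ! i)" using i(1) uss(4) by simp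
    from enp_zs(2)[OF t _ this] have B: "enp (concat tss) (concat ?vss) = enp (zs tss) (tab k (\<lambda>i. enp (tss ! i) (?vss ! i)))"
      by simp
    have "tab k (\<lambda>i. enp (tss ! i) (?vss ! i)) = tab k (\<lambda>i. pmap (tab k (\<lambda>i. PopAr (Fs ! i) (hss ! i)) ! i) (tab k (\<lambda>i. enp (sss ! i) (uss ! i)) ! i))"
      using i(2) uss(4) by simp
    then show "pmap (PopAr cF (concat hss)) u = pmap (PopAr F (tab k (\<lambda>i. PopAr (Fs ! i) (hss ! i)))) u"
      unfolding A B unfolding us(2) uss(1) enp_zs(2)[OF s uss(3,4)] F.PopAr_enp(2)[OF th enp_zs(1)[OF s uss(3,4)]] by (simp only:)
  next
    have fam: "fam (arss ! i) (map (map fst) tss ! i) (map (map pval) hss ! i)" if "i < k" for i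
      using gamma_cats.hom_Ps_arr(2)[OF inner h[rule_format], OF that that] that len len_Xss by simp
    have "multi cF.FA (concat (map (map fst) tss)) (concat (map (map pval) hss)) =
        multi F.FA (map multi_seq (map (map fst) tss)) (tab k (\<lambda>i. multi (\<lambda>ps. FAr ((Fs ! i) ps)) (map (map fst) tss ! i) (map (map pval) hss ! i)))"
    proof (rule multi_comp[where Sss = arss and K = cF.FA and H = F.FA and Hs = "\<lambda>i ps. FAr ((Fs ! i) ps)", OF _ _ _ fam])
      show "cF.FA (concat pss) (concat xss) = F.FA (map prod_list pss) (tab k (\<lambda>i. FAr ((Fs ! i) (pss ! i)) (xss ! i)))"
        if "map length pss = map length arss" "length xss = length arss" "\<And>i. i < k \<Longrightarrow> xss ! i \<in> gtup (arss ! i) (pss ! i)" for pss xss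
        by (rule keval_Ar[OF that])
    qed (use len len_Xss in simp_all)
    moreover have "map pval (tab k (\<lambda>i. PopAr (Fs ! i) (hss ! i))) =
        tab k (\<lambda>i. multi (\<lambda>ps. FAr ((Fs ! i) ps)) (map (map fst) tss ! i) (map (map pval) hss ! i))"
      using gamma_oper.PopAr_pval[OF inner_op h[rule_format]] len len_Xss by (intro nth_equalityI) simp_all
    ultimately show "pval (PopAr cF (concat hss)) = pval (PopAr F (tab k (\<lambda>i. PopAr (Fs ! i) (hss ! i))))"
      unfolding cF.PopAr_pval[OF hs] F.PopAr_pval[OF th] fst_zs[OF t] map_concat by (simp only:)
  qed
qed

lemma zs_update: "\<lbrakk>objs sss; i < k\<rbrakk> \<Longrightarrow> zs (sss[i := s]) = (zs sss)[i := PopOb (Fs ! i) s]"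
  using objs_length by (intro nth_equalityI) (auto simp: nth_list_update)

lemma objs_update:
  assumes "objs sss" "i < k" "s \<in> Obj (prod_cat (map Pobj (Xss ! i)))"
  shows "objs (sss[i := s])"
proof -
  have "map length (sss[i := s]) = map length Xss"
    using objs_length[OF assms(1)] assms(2,3) len_Xss by (intro map_length_eqI) (auto simp: nth_list_update)
  then show ?thesis using assms objs_length[OF assms(1)] by (auto simp: objs_def nth_list_update simp del: prod_cat_simps)
qed

text \<open>The composition formula for constraints, with variable \<open>l\<close> at place
  \<open>j\<close> of the \<open>i\<close>-th inner operation. Both sides are pure, so it is an
  identity of block maps: a shift of one flat coordinate is split into the outer constraint at
  \<open>i\<close> followed by the inner constraint at \<open>j\<close>.\<close>

lemma PopC_comp:
  assumes l: "l < length (concat Xss)" and ij: "locate (map length Xss) l = (i, j)" and s: "objs sss"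
    and y: "y \<in> Obj (Pobj (concat Xss ! l))"
  shows "PopC Z cF l (concat sss) y =
    Comp (Pobj Z) (PopAr F ((Ident (prod_cat O.Ps) (zs sss))[i := PopC (Ys ! i) (Fs ! i) j (sss ! i) y]))
      (PopC Z F i (zs sss) (PopOb (Fs ! i) ((sss ! i)[j := y])))"
proof -
  note len = objs_length[OF s]
  have sl: "map length sss = map length Xss" using s by (simp add: objs_def)
  note sX = concat_cong_locate[OF sl l ij] and X = concat_cong_locate[OF refl l ij]
  have i: "i < k" using X(1) len_Xss by simp
  have j: "j < length (Xss ! i)" by (rule X(2))
  interpret I: gamma_oper "Xss ! i" "Ys ! i" "Fs ! i" by (rule inner_op[OF i])
  have y': "y \<in> Obj (Pobj (Xss ! i ! j))" using y by (simp only: X(3))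
  have si: "sss ! i \<in> Obj (prod_cat I.Ps)" by (rule objsD[OF s i])
  then have sij: "sss ! i ! j \<in> Obj (Pobj (Xss ! i ! j))" using j by simp
  let ?y = "(sss ! i)[j := y]" and ?o = "(sss ! i)[j := oplus (sss ! i ! j) y]"
  note yO = I.update_Ps[OF si y'] and oO = I.update_Ps[OF si I.oplus_in[OF j sij y']]
  note s1 = objs_update[OF s i yO] and s2 = objs_update[OF s i oO]
  have sC: "concat sss \<in> Obj (prod_cat C.Ps)"
    unfolding Ps_concat using all_concat_iff[of sss Pss sss sss "\<lambda>s _ C _. s \<in> Obj C"] objsD[OF s] len sl len_Xss
      map_length_eqD(3)[OF sl] by (simp add: comp_def length_concat)
  have u1: "(concat sss)[l := y] = concat (sss[i := ?y])" and u2: "(concat sss)[l := oplus (concat sss ! l) y] = concat (sss[i := ?o])"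
    using sX(3,4) by simp_all
  let ?zs = "zs sss" and ?z = "PopOb (Fs ! i) ?y"
  have z1: "PopOb cF ((concat sss)[l := y]) = PopOb F (?zs[i := ?z])"
    unfolding u1 PopOb_comp[OF s1] zs_update[OF s i] ..
  have z2: "PopOb cF ((concat sss)[l := oplus (concat sss ! l) y]) = PopOb F (?zs[i := PopOb (Fs ! i) ?o])"
    unfolding u2 PopOb_comp[OF s2] zs_update[OF s i] ..
  note L = cF.PopC_hom[OF l sC y, unfolded PopOb_comp[OF s] z1 z2]
  note zO = zs_Obj[OF s]
  have zi: "?zs ! i = PopOb (Fs ! i) (sss ! i)" using i by simp
  note zy = I.PopOb_in[OF yO]
  note Ci = I.PopC_hom[OF j si y'] and C = F.PopC_hom[OF i zO zy, unfolded zi]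
  note Id = F.Ident_Ps[OF zO]
  let ?hs = "(Ident (prod_cat O.Ps) ?zs)[i := PopC (Ys ! i) (Fs ! i) j (sss ! i) y]"
  note hs = F.hom_Ps_update[OF Id(1) Ci(1)]
  have lI: "length (Ident (prod_cat O.Ps) ?zs) = k" "length ?zs = k" by simp_all
  have pure_hs: "pure Z (PopOb F (?zs[i := PopOb (Fs ! i) ?o])) (PopAr F ?hs)"
    using Id(3) Ci(3) i lI by (intro F.PopAr_pure[OF hs]) (auto simp: nth_list_update simp del: prod_cat_simps)
  note R = category.comp[OF O.Z.cat_P C(1) F.PopAr_hom[OF hs]]
  note pR = O.Z.pure_Comp[OF C(1) F.PopAr_hom[OF hs] C(3) pure_hs]
  have lc: "l < length (concat sss)" using l map_length_eqD(3)[OF sl] by simp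
  have iz: "i < length ?zs" and js: "j < length (sss ! i)" using i sX(2) by simp_all
  show ?thesis
  proof (rule O.Z.pure_eqI[OF L(1) R L(3) pR])
    fix u assume u: "u \<in> blocks (fst (oplus (PopOb F ?zs) (PopOb F (?zs[i := ?z]))))"
    then have "u \<in> blocks (fst (PopOb cF (concat sss)) @ fst (PopOb cF ((concat sss)[l := y])))"
      by (simp add: PopOb_comp[OF s] z1)
    then show "pmap (PopC Z cF l (concat sss) y) u = pmap (Comp (Pobj Z) (PopAr F ?hs) (PopC Z F i ?zs ?z)) u"
      unfolding O.Z.Comp_P(1)[OF C(1) F.PopAr_hom[OF hs] u]
    proof (cases rule: PopC_blocksE)
      case (left us)
      obtain uss where uss: "us = concat uss" "map length uss = map length Xss" "length uss = k" "\<forall>i<k. uss ! i \<in> boxp (sss ! i)"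
        using left(1) s by (rule boxp_objsE)
      have usi: "uss ! i \<in> boxp (sss ! i)" using uss(4) i by simp
      note li = I.popl[OF js usi, where t = y]
      have uo: "\<forall>h<k. uss ! h \<in> boxp (sss[i := ?o] ! h)" using uss(4) li(1) len i by (auto simp: nth_list_update)
      note e = enp_zs[OF s uss(3,4)] and eo = enp_zs[OF s2 uss(3) uo]
      have "pmap (PopC Z cF l (concat sss) y) u = enp (zs (sss[i := ?o])) (tab k (\<lambda>h. enp (sss[i := ?o] ! h) (uss ! h)))"
        unfolding left(2) uss(1) cF.popl(2)[OF lc left(1)[unfolded uss(1)]] u2 eo(2) ..
      also have "tab k (\<lambda>h. enp (sss[i := ?o] ! h) (uss ! h)) = tab k (\<lambda>h. pmap (?hs ! h) (tab k (\<lambda>i. enp (sss ! i) (uss ! i)) ! h))"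
        using Id(2) i len lI li(2) uss(4) enp_in[of _ "sss ! _" "Fs ! _"]
        by (intro nth_equalityI) (auto simp: nth_list_update simp del: prod_cat_simps)
      also have "enp (zs (sss[i := ?o])) \<dots> = pmap (PopAr F ?hs) (pmap (PopC Z F i ?zs ?z) u)"
        unfolding left(2) uss(1) e(2) F.popl(2)[OF iz e(1)] zi
          F.PopAr_enp(2)[OF hs F.popl(1)[OF iz e(1), where t = ?z, unfolded zi]] zs_update[OF s i] ..
      finally show "pmap (PopC Z cF l (concat sss) y) u = pmap (PopAr F ?hs) (pmap (PopC Z F i ?zs ?z) u)" .
    next
      case (right w)
      obtain us where us: "us \<in> boxp ((concat sss)[l := y])" "w = enp ((concat sss)[l := y]) us"
        using right(1) by (rule enp_E)
      obtain uss where uss: "us = concat uss" "map length uss = map length Xss" "length uss = k" "\<forall>h<k. uss ! h \<in> boxp (sss[i := ?y] ! h)"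
        using us(1)[unfolded u1] s1 by (rule boxp_objsE)
      have usi: "uss ! i \<in> boxp ?y" using uss(4)[rule_format, OF i] i len by simp
      note ri = I.popr[OF js usi] and uX = concat_cong_locate[OF uss(2) l ij]
      let ?vi = "(uss ! i)[j := sh (length (fst (sss ! i ! j))) (uss ! i ! j)]"
      have vo: "\<forall>h<k. uss[i := ?vi] ! h \<in> boxp (sss[i := ?o] ! h)" using uss(3,4) ri(1) len i by (auto simp: nth_list_update split: if_splits)
      have lv: "length (uss[i := ?vi]) = k" using uss(3) by simp
      note e = enp_zs[OF s1 uss(3,4), unfolded zs_update[OF s i]] and eo = enp_zs[OF s2 lv vo]
      let ?e = "tab k (\<lambda>h. enp (sss[i := ?y] ! h) (uss ! h))"
      have ei: "?e ! i = enp ?y (uss ! i)" using i len by simp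
      have "pmap (PopC Z cF l (concat sss) y) u = enp ((concat sss)[l := oplus (concat sss ! l) y])
          (us[l := sh (length (fst (concat sss ! l))) (us ! l)])"
        unfolding right(2) us(2) by (rule cF.popr(2)[OF lc us(1)])
      \<comment> \<open>The shift of the flat coordinate \<open>l\<close> is the shift of coordinate
        \<open>j\<close> in the \<open>i\<close>-th piece.\<close>
      also have "\<dots> = enp (concat (sss[i := ?o])) (concat (uss[i := ?vi]))"
        unfolding u2 unfolding uss(1) uX(4) uX(3) sX(3) ..
      also have "\<dots> = enp (zs (sss[i := ?o])) (tab k (\<lambda>h. enp (sss[i := ?o] ! h) (uss[i := ?vi] ! h)))"
        by (rule eo(2))
      \<comment> \<open>By \<open>ri\<close> the inner constraint sends the element of the second
        copy, shifted in the outer coordinate \<open>i\<close>, to the element enumerated by the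
        tuple shifted in the inner coordinate \<open>j\<close>; the other coordinates meet
        identities.\<close>
      also have "tab k (\<lambda>h. enp (sss[i := ?o] ! h) (uss[i := ?vi] ! h)) =
          tab k (\<lambda>h. pmap (?hs ! h) (?e[i := sh (length (fst (?zs ! i))) (?e ! i)] ! h))"
        using Id(2) i len lI ri(2) uss(3,4) enp_in[of _ "sss ! _" "Fs ! _"]
        by (intro nth_equalityI) (auto simp: nth_list_update simp del: prod_cat_simps)
      also have "enp (zs (sss[i := ?o])) \<dots> = pmap (PopAr F ?hs) (pmap (PopC Z F i ?zs ?z) u)"
        unfolding right(2) us(2) u1 uss(1) PopOb_comp[OF s] e(2) F.popr(2)[OF iz e(1)]
          zs_update[OF s i]
        using F.PopAr_enp(2)[OF hs F.popr(1)[OF iz e(1), unfolded zi]] by (simp only: zi)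
      finally show "pmap (PopC Z cF l (concat sss) y) u = pmap (PopAr F ?hs) (pmap (PopC Z F i ?zs ?z) u)" .
    qed
  qed
qed

lemma Pop_comp:
  "Pop (concat Xss) Z cF =
    perm_compOb (map (map Pobj) Xss) (map Pobj Ys) (Pobj Z) (Pop Ys Z F) (tab k (\<lambda>i. Pop (Xss ! i) (Ys ! i) (Fs ! i)))"
    (is "_ = ?R")
proof (rule lin_eqI)
  note [simp del] = prod_cat_simps
  have mp: "map length Pss = map length Xss" by (rule map_length_Pss)
  have zs: "tab (length (map Pobj Ys)) (\<lambda>i. FOb (LF (tab k (\<lambda>i. Pop (Xss ! i) (Ys ! i) (Fs ! i)) ! i)) (pieces (map length Pss) (concat sss) ! i)) = zs sss"
    if s: "objs sss" for sss
  proof -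
    have "map length sss = map length Pss" using s by (simp add: objs_def comp_def)
    then have "pieces (map length Pss) (concat sss) = sss" by (rule pieces_concat')
    then show ?thesis using objsD[OF s] gamma_oper.Pop_LF(1)[OF inner_op] by simp
  qed
  show "FOb (LF (Pop (concat Xss) Z cF)) = FOb (LF ?R)"
  proof -
    have "PopOb cF ss = FOb (LF (Pop Ys Z F)) (tab (length (map Pobj Ys)) (\<lambda>i. FOb (LF (tab k (\<lambda>i. Pop (Xss ! i) (Ys ! i) (Fs ! i)) ! i)) (pieces (map length Pss) ss ! i)))"
      if ss: "ss \<in> Obj (prod_cat C.Ps)" for ss
    proof -
      obtain sss where s: "ss = concat sss" "objs sss" using ss by (rule Obj_objsE)
      show ?thesis
        unfolding s(1) zs[OF s(2)] PopOb_comp[OF s(2)] F.Pop_LF using zs_Obj[OF s(2)] by simp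
    qed
    then show ?thesis
      unfolding cF.Pop_LF perm_compOb_def Ps_concat[symmetric] by (simp cong: restrict_cong)
  qed
  show "FAr (LF (Pop (concat Xss) Z cF)) = FAr (LF ?R)"
  proof -
    have "PopAr cF hs = FAr (LF (Pop Ys Z F)) (tab (length (map Pobj Ys)) (\<lambda>i. FAr (LF (tab k (\<lambda>i. Pop (Xss ! i) (Ys ! i) (Fs ! i)) ! i)) (pieces (map length Pss) hs ! i)))"
      if hs: "hs \<in> Arr (prod_cat C.Ps)" for hs
    proof -
      note h' = Arr_hom[OF hs]
      obtain hss sss tss where h: "hs = concat hss" "Dom (prod_cat C.Ps) hs = concat sss" "Cod (prod_cat C.Ps) hs = concat tss"
        "map length hss = map length Xss" "objs sss" "objs tss"
        "\<forall>i<k. hss ! i \<in> hom (prod_cat (map Pobj (Xss ! i))) (sss ! i) (tss ! i)"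
        using h' by (rule hom_objsE)
      have "pieces (map length Pss) (concat hss) = hss" using h(4) mp by (simp only: pieces_concat')
      then have tabeq: "tab (length (map Pobj Ys)) (\<lambda>i. FAr (LF (tab k (\<lambda>i. Pop (Xss ! i) (Ys ! i) (Fs ! i)) ! i)) (pieces (map length Pss) (concat hss) ! i)) =
          tab k (\<lambda>i. PopAr (Fs ! i) (hss ! i))"
        using homD[OF h(7)[rule_format]] gamma_oper.Pop_LF(2)[OF inner_op] by simp
      have "concat hss \<in> hom (prod_cat C.Ps) (concat sss) (concat tss)"
        using h'[unfolded h(2,3)] by (simp only: h(1))
      from PopAr_comp[OF this h(4-7)] show ?thesis
        unfolding h(1) tabeq F.Pop_LF using homD[OF tab_PopAr_hom[OF h(7)]] by simp
    qed
    then show ?thesis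
      unfolding cF.Pop_LF perm_compOb_def Ps_concat[symmetric] by (simp cong: restrict_cong)
  qed
  show "LC (Pop (concat Xss) Z cF) = LC ?R"
  proof (intro ext)
    fix l ss y
    show "LC (Pop (concat Xss) Z cF) l ss y = LC ?R l ss y"
    proof (cases "constraint_dom C.Ps l ss y")
      case False
      then show ?thesis unfolding perm_compOb_def Ps_concat[symmetric] by (simp add: Pop_def)
    next
      case c: True
      then have l: "l < length (concat Xss)" and ss: "ss \<in> Obj (prod_cat C.Ps)" and y: "y \<in> Obj (Pobj (concat Xss ! l))"
        by (simp_all only: C.constraint_dom_Ps)
      obtain sss where s: "ss = concat sss" "objs sss" using ss by (rule Obj_objsE)
      obtain i j where ij: "locate (map length Xss) l = (i, j)" by fastforce
      note X = concat_cong_locate[OF refl l ij]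
      have i: "i < k" using X(1) len_Xss by simp
      interpret I: gamma_oper "Xss ! i" "Ys ! i" "Fs ! i" by (rule inner_op[OF i])
      note si = objsD[OF s(2) i]
      have y': "y \<in> Obj (Pobj (Xss ! i ! j))" using y by (simp only: X(3))
      note yO = I.update_Ps[OF si y']
      have ci: "constraint_dom I.Ps j (sss ! i) y" using si X(2) y' by (simp only: I.constraint_dom_Ps)
      have cz: "constraint_dom O.Ps i (zs sss) (PopOb (Fs ! i) ((sss ! i)[j := y]))"
        using i zs_Obj[OF s(2)] I.PopOb_in[OF yO] by (simp only: O.constraint_dom_Ps)
      have zO: "zs sss \<in> Obj (prod_cat O.Ps)" by (rule zs_Obj[OF s(2)])
      have sij: "sss ! i ! j \<in> Obj (Pobj (Xss ! i ! j))" using si X(2) by (simp add: prod_cat_simps)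
      note hs = homD[OF F.hom_Ps_update[OF F.Ident_Ps(1)[OF zO] I.PopC_hom(1)[OF X(2) si y']]]
      have pc: "pieces (map length Pss) (concat sss) = sss"
        using s(2) mp by (simp only: objs_def pieces_concat')
      have zz: "tab k (\<lambda>h. FOb (LF (tab k (\<lambda>i. Pop (Xss ! i) (Ys ! i) (Fs ! i)) ! h)) (sss ! h)) = zs sss"
        using zs[OF s(2)] by (simp only: pc length_map)
      have "LC ?R l ss y = Comp (Pobj Z) (FAr (LF (Pop Ys Z F)) ((Ident (prod_cat O.Ps) (zs sss))[i := LC (Pop (Xss ! i) (Ys ! i) (Fs ! i)) j (sss ! i) y]))
          (LC (Pop Ys Z F) i (zs sss) (FOb (LF (Pop (Xss ! i) (Ys ! i) (Fs ! i))) ((sss ! i)[j := y])))"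
        using c unfolding perm_compOb_def Ps_concat[symmetric] s(1) mp
        by (simp add: ij pc[unfolded mp] i Let_def) (simp only: zz)
      also have "\<dots> = Comp (Pobj Z) (PopAr F ((Ident (prod_cat O.Ps) (zs sss))[i := PopC (Ys ! i) (Fs ! i) j (sss ! i) y]))
          (PopC Z F i (zs sss) (PopOb (Fs ! i) ((sss ! i)[j := y])))"
        using hs yO by (simp add: F.Pop_LF I.Pop_LF I.LC_Pop[OF ci] F.LC_Pop[OF cz])
      also have "\<dots> = PopC Z cF l ss y"
        unfolding s(1) by (rule PopC_comp[OF l ij s(2) y, symmetric])
      finally show ?thesis using cF.LC_Pop[OF c] by simp
    qed
  qed
qed

end

section \<open>Composition of modifications\<close>

text \<open>\<open>M\<close> is the outer modification, while \<open>a\<close> and \<open>b\<close>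
  are the composite operations formed from all sources and from all targets.\<close>

locale gamma_multi_modif = gamma_multi Ys Z Xss + M: gamma_modif Ys Z F G \<theta> +
  a: gamma_multi_op Ys Z Xss F Fs + b: gamma_multi_op Ys Z Xss G Gs
  for Ys :: "('o, 'm) gcat list" and Z Xss F G \<theta> Fs Gs +
  fixes \<theta>s :: "nat \<Rightarrow> nat list \<Rightarrow> 'o list \<Rightarrow> 'm"
  assumes \<theta>s: "i < length Ys \<Longrightarrow> gamma_mod (Xss ! i) (Ys ! i) (Fs ! i) (Gs ! i) (\<theta>s i)"
begin

lemma inner_modif: "i < k \<Longrightarrow> gamma_modif (Xss ! i) (Ys ! i) (Fs ! i) (Gs ! i) (\<theta>s i)"
  by (rule gamma_cats.gamma_modifI[OF inner a.Fs b.Fs \<theta>s])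

abbreviation "K1 \<equiv> comp_fun Xss k \<theta> (\<lambda>i ps. FOb ((Gs ! i) ps))"
abbreviation "K2 \<equiv> comp_fun Xss k M.F.FA \<theta>s"

text \<open>The horizontal composite, \<theta> at the inner target values after \<open>F\<close>
  applied to the inner modifications. The category is indexed by \<open>prod_list ps\<close> instead
  of the product of the inner products, which fits \<open>gset_op_Comp\<close>;
  \<open>gamma_compAr_eq\<close> reconciles the two.\<close>

definition c\<theta> :: "nat list \<Rightarrow> 'o list \<Rightarrow> 'm" where
  "c\<theta> = (\<lambda>ps\<in>{ps. length ps = length (concat Xss)}. \<lambda>xs\<in>Obj (gprod (concat Xss) ps).
    Comp (FOb Z (prod_list ps)) (K1 ps xs) (K2 ps xs))"

lemma gamma_compAr_eq:
  assumes "length ts = k" "\<And>i. i < k \<Longrightarrow> ts ! i = (Fs ! i, Gs ! i, \<theta>s i)"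
  shows "gamma_compAr Xss Ys Z (F, G, \<theta>) ts = (a.cF, b.cF, c\<theta>)"
proof -
  have Fs: "map fst ts = Fs" "map (fst \<circ> snd) ts = Gs"
    using assms a.len_Fs b.len_Fs by (auto intro!: nth_equalityI)
  have t: "tab k (\<lambda>i. FOb (fst (snd (ts ! i)) (pss ! i)) (xss ! i)) = tab k (\<lambda>i. FOb ((Gs ! i) (pss ! i)) (xss ! i))"
    "tab k (\<lambda>i. snd (snd (ts ! i)) (pss ! i) (xss ! i)) = tab k (\<lambda>i. \<theta>s i (pss ! i) (xss ! i))" for pss xss
    using assms(2) by simp_all
  have p: "prod_list (map prod_list (pieces (map length Xss) ps)) = prod_list ps" if "length ps = length (concat Xss)" for ps :: "nat list"
    using that by (simp add: prod_list_concat[symmetric] concat_pieces length_concat)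
  show ?thesis
    unfolding gamma_compAr_def prod.case Fs Let_def t c\<theta>_def comp_fun_def
    by (intro arg_cong2[where f = Pair] refl restrict_ext) (simp only: mem_Collect_eq p)
qed

lemma K1_op: "gset_op C.obs (ar_gset Z) K1"
  unfolding obs_concat
  by (rule gset_op_comp_fun[OF M.T.gset_op_axioms]) (use gamma_cats.gamma_opD(3)[OF inner b.Fs] len_Xss in simp_all)

lemma K2_op: "gset_op C.obs (ar_gset Z) K2"
  unfolding obs_concat
  by (rule gset_op_comp_fun[OF M.F.Ar.gset_op_axioms])
    (use gamma_cats.gamma_modD(3)[OF inner a.Fs b.Fs \<theta>s] len_Xss in simp_all)

lemma inner_nat:
  assumes "map length pss = map length Xss" "i < k"
  shows "nat_trans (gprod (Xss ! i) (pss ! i)) (FOb (Ys ! i) (prod_list (pss ! i))) ((Fs ! i) (pss ! i)) ((Gs ! i) (pss ! i)) (\<theta>s i (pss ! i))"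
  using gamma_cats.gamma_modD(2)[OF inner a.Fs b.Fs \<theta>s] assms(2) map_length_eqD(2)[OF assms(1)] len_Xss by simp

lemma outer_nat:
  assumes "map length pss = map length Xss"
  shows "nat_trans (gprod Ys (map prod_list pss)) (FOb Z (prod_list (concat pss))) (F (map prod_list pss)) (G (map prod_list pss)) (\<theta> (map prod_list pss))"
  using O.gamma_modD(2)[OF a.F b.F M.modif, of "map prod_list pss"] map_length_eqD(1)[OF assms] len_Xss
  by (simp add: prod_list_concat)

lemma tab_\<theta>_hom:
  assumes "map length pss = map length Xss" "\<And>i. i < k \<Longrightarrow> xss ! i \<in> Obj (gprod (Xss ! i) (pss ! i))"
  shows "tab k (\<lambda>i. \<theta>s i (pss ! i) (xss ! i)) \<in> hom (gprod Ys (map prod_list pss))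
    (tab k (\<lambda>i. FOb ((Fs ! i) (pss ! i)) (xss ! i))) (tab k (\<lambda>i. FOb ((Gs ! i) (pss ! i)) (xss ! i)))"
  using nat_trans_hom[OF inner_nat[OF assms(1)] assms(2)] map_length_eqD(1)[OF assms(1)] len_Xss
  by (simp add: hom_gprod)

context
  fixes pss xss
  assumes pss: "map length pss = map length Xss"
    and xss: "map length xss = map length Xss" "\<And>i. i < k \<Longrightarrow> xss ! i \<in> Obj (gprod (Xss ! i) (pss ! i))"
begin

lemma K1_hom: "K1 (concat pss) (concat xss) \<in> hom (FOb Z (prod_list (concat pss)))
    (M.F.FO (map prod_list pss) (tab k (\<lambda>i. FOb ((Gs ! i) (pss ! i)) (xss ! i))))
    (M.G.FO (map prod_list pss) (tab k (\<lambda>i. FOb ((Gs ! i) (pss ! i)) (xss ! i))))"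
  unfolding comp_fun_concat[OF pss xss(1)]
  by (rule nat_trans_hom[OF outer_nat[OF pss] b.tab_Obj[OF pss xss(2)]])

lemma K2_hom: "K2 (concat pss) (concat xss) \<in> hom (FOb Z (prod_list (concat pss)))
    (M.F.FO (map prod_list pss) (tab k (\<lambda>i. FOb ((Fs ! i) (pss ! i)) (xss ! i))))
    (M.F.FO (map prod_list pss) (tab k (\<lambda>i. FOb ((Gs ! i) (pss ! i)) (xss ! i))))"
  unfolding comp_fun_concat[OF pss xss(1)]
  by (rule cfunctor.FAr_in[OF a.outer_cfunctor[OF pss] tab_\<theta>_hom[OF pss xss(2)]])

lemma cF_concat:
  "a.cF.FO (concat pss) (concat xss) = M.F.FO (map prod_list pss) (tab k (\<lambda>i. FOb ((Fs ! i) (pss ! i)) (xss ! i)))"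
  "b.cF.FO (concat pss) (concat xss) = M.G.FO (map prod_list pss) (tab k (\<lambda>i. FOb ((Gs ! i) (pss ! i)) (xss ! i)))"
  using pss xss map_length_eqD(1)[OF xss(1)] len_Xss by (auto intro!: a.keval_Ob b.keval_Ob simp: comp_def)

end

text \<open>Naturality of the inner modifications gives an equation between tuples of arrows over
  \<open>Ys\<close>, which functoriality of \<open>F\<close> carries to \<open>Z\<close>; naturality
  of \<theta> then moves the outer factor across.\<close>

lemma c\<theta>_natural:
  assumes pss: "map length pss = map length Xss" and f: "f \<in> hom (gprod (concat Xss) (concat pss)) x y"
  shows "Comp (FOb Z (prod_list (concat pss))) (Comp (FOb Z (prod_list (concat pss))) (K1 (concat pss) y) (K2 (concat pss) y)) (FAr (a.cF (concat pss)) f) =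
    Comp (FOb Z (prod_list (concat pss))) (FAr (b.cF (concat pss)) f) (Comp (FOb Z (prod_list (concat pss))) (K1 (concat pss) x) (K2 (concat pss) x))"
proof -
  interpret V: category "FOb Z (prod_list (concat pss))" by (rule O.Z.cat_X)
  obtain fss xss yss where fss: "f = concat fss" "x = concat xss" "y = concat yss"
    "map length fss = map length Xss" "map length xss = map length Xss" "map length yss = map length Xss"
    "\<forall>i<k. fss ! i \<in> hom (gprod (Xss ! i) (pss ! i)) (xss ! i) (yss ! i)"
    by (rule hom_gprod_concatE[OF f pss])
  note fh = fss(7)[rule_format]
  have xy: "xss ! i \<in> Obj (gprod (Xss ! i) (pss ! i))" "yss ! i \<in> Obj (gprod (Xss ! i) (pss ! i))" if "i < k" for i
    using category.hom_Obj[OF gamma_cats.cat_gprod[OF inner[OF that]] fh[OF that]] by simp_all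
  let ?q = "map prod_list pss" and ?C = "Comp (FOb Z (prod_list (concat pss)))"
  let ?f = "tab k (\<lambda>i. FAr ((Fs ! i) (pss ! i)) (fss ! i))" and ?g = "tab k (\<lambda>i. FAr ((Gs ! i) (pss ! i)) (fss ! i))"
  let ?tx = "tab k (\<lambda>i. \<theta>s i (pss ! i) (xss ! i))" and ?ty = "tab k (\<lambda>i. \<theta>s i (pss ! i) (yss ! i))"
  let ?Gx = "tab k (\<lambda>i. FOb ((Gs ! i) (pss ! i)) (xss ! i))" and ?Gy = "tab k (\<lambda>i. FOb ((Gs ! i) (pss ! i)) (yss ! i))"
  note th = a.tab_hom[OF pss fh] and gh = b.tab_hom[OF pss fh]
  note tx = tab_\<theta>_hom[OF pss xy(1)] and ty = tab_\<theta>_hom[OF pss xy(2)]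
  interpret Fq: cfunctor "gprod Ys ?q" "FOb Z (prod_list (concat pss))" "F ?q" by (rule a.outer_cfunctor[OF pss])
  interpret Gq: cfunctor "gprod Ys ?q" "FOb Z (prod_list (concat pss))" "G ?q" by (rule b.outer_cfunctor[OF pss])
  have fa: "fss ! i \<in> gtup (arss ! i) (pss ! i)" if "i < k" for i
    using homD[OF fh[OF that]] that len_Xss by simp
  have Ff: "FAr (a.cF (concat pss)) f = M.F.FA ?q ?f" "FAr (b.cF (concat pss)) f = M.G.FA ?q ?g"
    unfolding fss(1) using pss map_length_eqD(1)[OF fss(4)] fa
    by (auto intro!: a.keval_Ar b.keval_Ar simp: comp_def)
  have inner_eq: "Comp (gprod Ys ?q) ?ty ?f = Comp (gprod Ys ?q) ?g ?tx"
    using nat_trans_nat[OF inner_nat[OF pss] fh] map_length_eqD(1)[OF pss] len_Xss by (simp add: gprod_Comp)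
  note t = outer_nat[OF pss]
  have "?C (?C (\<theta> ?q ?Gy) (M.F.FA ?q ?ty)) (M.F.FA ?q ?f) = ?C (\<theta> ?q ?Gy) (?C (M.F.FA ?q ?ty) (M.F.FA ?q ?f))"
    by (rule V.comp_assoc[OF Fq.FAr_in[OF th] Fq.FAr_in[OF ty] nat_trans_hom[OF t b.tab_Obj[OF pss xy(2)]], symmetric])
  also have "?C (M.F.FA ?q ?ty) (M.F.FA ?q ?f) = ?C (M.F.FA ?q ?g) (M.F.FA ?q ?tx)"
    using Fq.FAr_comp[OF th ty] Fq.FAr_comp[OF tx gh] inner_eq by simp
  also have "?C (\<theta> ?q ?Gy) \<dots> = ?C (?C (\<theta> ?q ?Gy) (M.F.FA ?q ?g)) (M.F.FA ?q ?tx)"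
    by (rule V.comp_assoc[OF Fq.FAr_in[OF tx] Fq.FAr_in[OF gh] nat_trans_hom[OF t b.tab_Obj[OF pss xy(2)]]])
  also have "?C (\<theta> ?q ?Gy) (M.F.FA ?q ?g) = ?C (M.G.FA ?q ?g) (\<theta> ?q ?Gx)"
    by (rule nat_trans_nat[OF t gh])
  also have "?C \<dots> (M.F.FA ?q ?tx) = ?C (M.G.FA ?q ?g) (?C (\<theta> ?q ?Gx) (M.F.FA ?q ?tx))"
    by (rule V.comp_assoc[OF Fq.FAr_in[OF tx] nat_trans_hom[OF t b.tab_Obj[OF pss xy(1)]] Gq.FAr_in[OF gh], symmetric])
  finally show ?thesis
    unfolding Ff unfolding fss(2,3) comp_fun_concat[OF pss fss(5)] comp_fun_concat[OF pss fss(6)] .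
qed

lemma c\<theta>_mod: "gamma_mod (concat Xss) Z a.cF b.cF c\<theta>"
proof -
  have homs: "K2 ps x \<in> hom (FOb Z (prod_list ps)) (a.cF.FO ps x) (Cod (FOb Z (prod_list ps)) (K2 ps x))"
    "K1 ps x \<in> hom (FOb Z (prod_list ps)) (Cod (FOb Z (prod_list ps)) (K2 ps x)) (b.cF.FO ps x)"
    if ps: "length ps = length (concat Xss)" and x: "x \<in> Obj (gprod (concat Xss) ps)" for ps x
  proof -
    obtain pss where p: "ps = concat pss" "map length pss = map length Xss" using ps by (rule concatE)
    obtain xss where xss: "x = concat xss" "map length xss = map length Xss"
      "\<And>i. i < k \<Longrightarrow> xss ! i \<in> Obj (gprod (Xss ! i) (pss ! i))"
      using gprod_concatE[OF x[unfolded p(1)] p(2)] by metis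
    note h = K1_hom[OF p(2) xss(2,3)] K2_hom[OF p(2) xss(2,3)] cF_concat[OF p(2) xss(2,3)]
    show "K2 ps x \<in> hom (FOb Z (prod_list ps)) (a.cF.FO ps x) (Cod (FOb Z (prod_list ps)) (K2 ps x))"
      "K1 ps x \<in> hom (FOb Z (prod_list ps)) (Cod (FOb Z (prod_list ps)) (K2 ps x)) (b.cF.FO ps x)"
      using h unfolding p(1) xss(1) by (simp_all add: hom_def)
  qed
  have "gset_op C.obs (ar_gset Z) c\<theta>"
  proof (rule C.gset_op_Comp[OF K2_op K1_op])
    fix ps xs assume "length ps = length C.obs" "xs \<in> gtup C.obs ps"
    then have px: "length ps = length (concat Xss)" "xs \<in> Obj (gprod (concat Xss) ps)" by simp_all
    show "Dom (FOb Z (prod_list ps)) (K1 ps xs) = Cod (FOb Z (prod_list ps)) (K2 ps xs)"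
      using homD[OF homs(2)[OF px]] by simp
    show "c\<theta> ps xs = Comp (FOb Z (prod_list ps)) (K1 ps xs) (K2 ps xs)"
      using px by (simp add: c\<theta>_def)
  qed
  moreover have "nat_trans (gprod (concat Xss) ps) (FOb Z (prod_list ps)) (a.cF ps) (b.cF ps) (c\<theta> ps)"
    if ps: "length ps = length (concat Xss)" for ps
  proof -
    obtain pss where p: "ps = concat pss" "map length pss = map length Xss" using ps by (rule concatE)
    have c: "c\<theta> ps = (\<lambda>xs\<in>Obj (gprod (concat Xss) ps). Comp (FOb Z (prod_list ps)) (K1 ps xs) (K2 ps xs))"
      using ps by (simp add: c\<theta>_def)
    show ?thesis
      unfolding nat_trans_def c
      using category.comp[OF O.Z.cat_X homs[OF ps]] category.dom_cod[OF C.cat_gprod]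
        c\<theta>_natural[OF p(2) Arr_hom, folded p(1)]
      by (simp del: gprod_Obj gprod_Arr)
  qed
  ultimately show ?thesis
    unfolding C.gamma_mod_iff[OF a.cF_op b.cF_op] by (simp add: c\<theta>_def)
qed

sublocale c: gamma_modif "concat Xss" Z "gamma_compOb Xss Ys Z F Fs" "gamma_compOb Xss Ys Z G Gs" c\<theta>
  by (rule C.gamma_modifI[OF a.cF_op b.cF_op c\<theta>_mod])

abbreviation "ali i s \<equiv> (PopOb (Fs ! i) s, PopOb (Gs ! i) s, (Ident Acat (multi_seq (map fst s)), multi (\<theta>s i) (map fst s) (map snd s)))"

lemma fst_zs_eq: "objs sss \<Longrightarrow> map fst (b.zs sss) = map fst (a.zs sss)"
  by (simp add: PopOb_eq)

text \<open>Block maps on both sides are identities, because operations with the same inputs give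
  the same sequences. The component of \<open>c\<theta>\<close> splits into the families
  \<open>K1\<close> and \<open>K2\<close>; each is a composite family, so \<open>multi_comp\<close>
  evaluates them as the two factors on the right.\<close>

lemma al_comp:
  assumes s: "objs sss"
  shows "c.al (concat sss) = Comp (Pobj Z) (M.al (b.zs sss)) (PopAr F (tab k (\<lambda>i. ali i (sss ! i))))"
proof -
  note len = objs_length[OF s]
  let ?hs = "tab k (\<lambda>i. ali i (sss ! i))"
  have sC: "concat sss \<in> Obj (prod_cat C.Ps)"
    unfolding Ps_concat using all_concat_iff[of sss Pss sss sss "\<lambda>s _ C _. s \<in> Obj C"] objsD[OF s] len len_Xss
      s map_length_eqD(3)[of sss Xss] by (simp add: comp_def length_concat objs_def)
  have hs: "?hs \<in> hom (prod_cat O.Ps) (a.zs sss) (b.zs sss)"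
    using gamma_modif.al_hom[OF inner_modif objsD[OF s]] by (simp add: hom_prod_cat)
  have A: "c.al (concat sss) \<in> hom C.D (PopOb F (a.zs sss)) (PopOb G (b.zs sss))"
    using c.al_hom[OF sC] by (simp only: a.PopOb_comp[OF s] b.PopOb_comp[OF s])
  note bO = b.zs_Obj[OF s]
  note B = M.al_hom[OF bO] and P = M.F.PopAr_hom[OF hs]
  let ?mss = "map (map fst) sss" and ?xss = "map (map snd) sss"
  show ?thesis
  proof (rule O.Z.P_eqI[OF A category.comp[OF O.Z.cat_P P B]])
    fix u assume u: "u \<in> blocks (fst (PopOb F (a.zs sss)))"
    then obtain vs where vs: "vs \<in> boxp (a.zs sss)" "u = enp (a.zs sss) vs" by (rule enp_E)
    have "tab k (\<lambda>i. pmap (?hs ! i) (vs ! i)) = vs"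
      using boxpD[OF vs(1)] gamma_modif.al_pmap[OF inner_modif]
      by (intro nth_equalityI) (simp_all del: Acat_simps)
    then have "pmap (PopAr F ?hs) u = enp (b.zs sss) vs"
      using M.F.PopAr_enp(2)[OF hs vs(1)] vs(2) by simp
    also have "\<dots> = u" unfolding vs(2) enp_def fst_zs_eq[OF s] ..
    finally have pu: "pmap (PopAr F ?hs) u = u" .
    have "fst (PopOb F (b.zs sss)) = fst (PopOb F (a.zs sss))"
      by (simp add: PopOb_eq comp_def)
    then have "u \<in> blocks (fst (PopOb F (b.zs sss)))"
      using u by (simp only:)
    then have "pmap (Comp (Pobj Z) (M.al (b.zs sss)) (PopAr F ?hs)) u = u"
      unfolding O.Z.Comp_P(1)[OF P B u] pu by (rule M.al_pmap)
    moreover have "pmap (c.al (concat sss)) u = u"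
      using u by (intro c.al_pmap) (simp only: a.PopOb_comp[OF s])
    ultimately show "pmap (c.al (concat sss)) u = pmap (Comp (Pobj Z) (M.al (b.zs sss)) (PopAr F ?hs)) u"
      by simp
  next
    have fam: "fam (obss ! i) (?mss ! i) (?xss ! i)" if "i < k" for i
      using objs_fam[OF s that] that len len_Xss by simp
    have xl: "map length xss = map length Xss"
      if "length xss = length obss" "\<And>i. i < k \<Longrightarrow> xss ! i \<in> gtup (obss ! i) (pss ! i)" for xss :: "'o list list" and pss
      using that(1) len_Xss gtup_len[OF that(2)] by (intro map_length_eqI) simp_all
    have k1: "multi K1 (concat ?mss) (concat ?xss) =
        multi \<theta> (map multi_seq ?mss) (tab k (\<lambda>i. multi (\<lambda>ps. FOb ((Gs ! i) ps)) (?mss ! i) (?xss ! i)))"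
    proof (rule multi_comp[where Sss = obss and K = K1 and H = \<theta> and Hs = "\<lambda>i ps. FOb ((Gs ! i) ps)", OF _ _ _ fam])
      show "K1 (concat pss) (concat xss) = \<theta> (map prod_list pss) (tab k (\<lambda>i. FOb ((Gs ! i) (pss ! i)) (xss ! i)))"
        if "map length pss = map length obss" "length xss = length obss" "\<And>i. i < k \<Longrightarrow> xss ! i \<in> gtup (obss ! i) (pss ! i)" for pss xss
        using that(1) by (intro comp_fun_concat xl[OF that(2,3)]) (simp_all add: comp_def)
    qed (use len len_Xss in simp_all)
    have k2: "multi K2 (concat ?mss) (concat ?xss) =
        multi M.F.FA (map multi_seq ?mss) (tab k (\<lambda>i. multi (\<theta>s i) (?mss ! i) (?xss ! i)))"
    proof (rule multi_comp[where Sss = obss and K = K2 and H = M.F.FA and Hs = \<theta>s, OF _ _ _ fam])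
      show "K2 (concat pss) (concat xss) = M.F.FA (map prod_list pss) (tab k (\<lambda>i. \<theta>s i (pss ! i) (xss ! i)))"
        if "map length pss = map length obss" "length xss = length obss" "\<And>i. i < k \<Longrightarrow> xss ! i \<in> gtup (obss ! i) (pss ! i)" for pss xss
        using that(1) by (intro comp_fun_concat xl[OF that(2,3)]) (simp_all add: comp_def)
    qed (use len len_Xss in simp_all)
    have famC: "fam C.obs (concat ?mss) (concat ?xss)"
      using iffD1[OF C.Obj_Ps sC] unfolding map_concat by blast
    have "multi c\<theta> (concat ?mss) (concat ?xss) = Comp (AXob Z (multi_seq (concat ?mss))) (multi K1 (concat ?mss) (concat ?xss)) (multi K2 (concat ?mss) (concat ?xss))"
      unfolding multi_def C.Comp_multi_seq using pick_gtup[OF famC] by (simp add: c\<theta>_def del: map_map length_pick)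
    then have L: "pval (c.al (concat sss)) = Comp (AXob Z (multi_seq (map multi_seq ?mss)))
        (multi \<theta> (map multi_seq ?mss) (tab k (\<lambda>i. multi (\<lambda>ps. FOb ((Gs ! i) ps)) (?mss ! i) (?xss ! i))))
        (multi M.F.FA (map multi_seq ?mss) (tab k (\<lambda>i. multi (\<theta>s i) (?mss ! i) (?xss ! i))))"
      unfolding k1 k2 multi_seq_concat by (simp only: pmap_pval map_concat)
    have hz: "map snd (b.zs sss) = tab k (\<lambda>i. multi (\<lambda>ps. FOb ((Gs ! i) ps)) (?mss ! i) (?xss ! i))"
      "map pval ?hs = tab k (\<lambda>i. multi (\<theta>s i) (?mss ! i) (?xss ! i))"
      using len by (auto intro!: nth_equalityI simp: PopOb_eq)
    have fF: "fst (PopOb F (b.zs sss)) = multi_seq (map fst (b.zs sss))" by (simp only: PopOb_eq fst_conv)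
    show "pval (c.al (concat sss)) = pval (Comp (Pobj Z) (M.al (b.zs sss)) (PopAr F ?hs))"
      unfolding L O.Z.Comp_P(2)[OF P B] M.fst_PopOb
      unfolding M.axact_al[OF bO O.Z.hom_PE(5)[OF P]]
      unfolding M.F.PopAr_pval[OF hs] pmap_pval
      unfolding fF hz b.fst_zs[OF s] ..
  qed
qed

lemma Pmod_comp_multi:
  assumes "length ts = k" "\<And>i. i < k \<Longrightarrow> ts ! i = (Fs ! i, Gs ! i, \<theta>s i)"
  shows "Pmod (concat Xss) Z (gamma_compAr Xss Ys Z (F, G, \<theta>) ts) =
    perm_compAr (map (map Pobj) Xss) (map Pobj Ys) (Pobj Z) (Pmod Ys Z (F, G, \<theta>))
      (tab k (\<lambda>i. Pmod (Xss ! i) (Ys ! i) (ts ! i)))"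
proof -
  note [simp del] = prod_cat_simps Acat_simps
  let ?ts = "tab k (\<lambda>i. Pmod (Xss ! i) (Ys ! i) (ts ! i))"
  have pm: "Pmod (Xss ! i) (Ys ! i) (ts ! i) = (Pop (Xss ! i) (Ys ! i) (Fs ! i), Pop (Xss ! i) (Ys ! i) (Gs ! i),
      \<lambda>s\<in>Obj (prod_cat (map Pobj (Xss ! i))). ali i s)" if "i < k" for i
    using that gamma_modif.Pmod_eq[OF inner_modif[OF that]] assms(2) by simp
  have f: "map fst ?ts = tab k (\<lambda>i. Pop (Xss ! i) (Ys ! i) (Fs ! i))" "map (fst \<circ> snd) ?ts = tab k (\<lambda>i. Pop (Xss ! i) (Ys ! i) (Gs ! i))"
    using pm by (auto intro!: nth_equalityI)
  have "c.al ss = Comp (Pobj Z) ((\<lambda>ss\<in>Obj (prod_cat O.Ps). M.al ss)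
        (tab (length (map Pobj Ys)) (\<lambda>i. FOb (LF (fst (snd (?ts ! i)))) (pieces (map length Pss) ss ! i))))
      (FAr (LF (Pop Ys Z F)) (tab (length (map Pobj Ys)) (\<lambda>i. snd (snd (?ts ! i)) (pieces (map length Pss) ss ! i))))"
    if ss: "ss \<in> Obj (prod_cat C.Ps)" for ss
  proof -
    obtain sss where s: "ss = concat sss" "objs sss" using ss by (rule Obj_objsE)
    have pc: "pieces (map length Pss) (concat sss) = sss"
      using s(2) map_length_Pss by (simp only: objs_def pieces_concat')
    have t1: "tab (length (map Pobj Ys)) (\<lambda>i. FOb (LF (fst (snd (?ts ! i)))) (sss ! i)) = b.zs sss"
      using objsD[OF s(2)] gamma_oper.Pop_LF(1)[OF b.inner_op] by (intro nth_equalityI) (simp_all add: pm)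
    have t2: "tab (length (map Pobj Ys)) (\<lambda>i. snd (snd (?ts ! i)) (sss ! i)) = tab k (\<lambda>i. ali i (sss ! i))"
      using objsD[OF s(2)] by (intro nth_equalityI) (simp_all add: pm)
    have "tab k (\<lambda>i. ali i (sss ! i)) \<in> Arr (prod_cat O.Ps)"
      using homD[OF gamma_modif.al_hom[OF inner_modif objsD[OF s(2)]]] by (simp add: prod_cat_simps)
    then show ?thesis
      unfolding s(1) pc t1 t2 al_comp[OF s(2)] using b.zs_Obj[OF s(2)] by (simp add: M.F.Pop_LF)
  qed
  then have al: "(\<lambda>ss\<in>Obj (prod_cat C.Ps). c.al ss) = (\<lambda>ss\<in>Obj (prod_cat C.Ps). Comp (Pobj Z) ((\<lambda>ss\<in>Obj (prod_cat O.Ps). M.al ss)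
        (tab (length (map Pobj Ys)) (\<lambda>i. FOb (LF (fst (snd (?ts ! i)))) (pieces (map length Pss) ss ! i))))
      (FAr (LF (Pop Ys Z F)) (tab (length (map Pobj Ys)) (\<lambda>i. snd (snd (?ts ! i)) (pieces (map length Pss) ss ! i)))))"
    by (rule restrict_ext)
  have g: "gamma_compAr Xss Ys Z (F, G, \<theta>) ts = (a.cF, b.cF, c\<theta>)"
    by (rule gamma_compAr_eq) (use assms in simp_all)
  show ?thesis
    unfolding g c.Pmod_eq M.Pmod_eq al
    unfolding perm_compAr_def prod.case f a.Pop_comp b.Pop_comp
    unfolding Ps_concat Let_def ..
qed

end

theorem theorem1p3:
  shows "nonsym_cat_multifunctor
           (GammaCat :: (('o, 'm) gcat, ('o, 'm) gop, ('o, 'm) gop_arr) multicat)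
           PermCatSus
           inverse_K"
proof (rule nonsym_cat_multifunctor.intro)
  let ?M = "GammaCat :: (('o, 'm) gcat, ('o, 'm) gop, ('o, 'm) gop_arr) multicat"
  fix X :: "('o, 'm) gcat" assume "X \<in> MObj ?M"
  then interpret gamma_cat X by unfold_locales (simp add: GammaCat_def)
  show "MFOb inverse_K X \<in> MObj PermCatSus"
    using permutative_P by (simp add: inverse_K_def PermCatSus_def)
  have "gamma_unit X \<in> Obj (gamma_ops [X] X)"
    using gamma_unit_op by (simp add: gamma_ops_def)
  then show "FOb (MFOps inverse_K [X] X) (MUnit GammaCat X) = MUnit PermCatSus (MFOb inverse_K X)"
    using Pop_unit by (simp add: inverse_K_def GammaCat_def PermCatSus_def)
next
  let ?M = "GammaCat :: (('o, 'm) gcat, ('o, 'm) gop, ('o, 'm) gop_arr) multicat"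
  fix Xs :: "('o, 'm) gcat list" and Z :: "('o, 'm) gcat" assume "set Xs \<subseteq> MObj ?M" "Z \<in> MObj ?M"
  then interpret gamma_cats Xs Z by unfold_locales (auto simp: GammaCat_def)
  show "cfunctor (MOps GammaCat Xs Z) (MOps PermCatSus (map (MFOb inverse_K) Xs) (MFOb inverse_K Z)) (MFOps inverse_K Xs Z)"
    using Pop_functor by (simp add: inverse_K_def GammaCat_def PermCatSus_def)
next
  fix Ys :: "('o, 'm) gcat list" and Z :: "('o, 'm) gcat" and Xss F Fs
  assume "set Ys \<subseteq> MObj (GammaCat :: (('o, 'm) gcat, ('o, 'm) gop, ('o, 'm) gop_arr) multicat)" "Z \<in> MObj GammaCat" "length Xss = length Ys"
    "\<forall>Xs\<in>set Xss. set Xs \<subseteq> MObj GammaCat" "F \<in> Obj (MOps GammaCat Ys Z)" "length Fs = length Ys"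
    "\<forall>i<length Ys. Fs ! i \<in> Obj (MOps GammaCat (Xss ! i) (Ys ! i))"
  then interpret gamma_multi_op Ys Z Xss F Fs
    by unfold_locales (auto simp: GammaCat_def gamma_ops_def)
  have "F \<in> Obj (gamma_ops Ys Z)" "cF \<in> Obj (gamma_ops (concat Xss) Z)"
    "\<And>i. i < length Ys \<Longrightarrow> Fs ! i \<in> Obj (gamma_ops (Xss ! i) (Ys ! i))"
    using F cF_op Fs by (simp_all add: gamma_ops_def)
  then have pop: "tab k (\<lambda>i. FOb (MFOps inverse_K (Xss ! i) (Ys ! i)) (Fs ! i)) = tab k (\<lambda>i. Pop (Xss ! i) (Ys ! i) (Fs ! i))"
    "FOb (MFOps inverse_K Ys Z) F = Pop Ys Z F" "FOb (MFOps inverse_K (concat Xss) Z) cF = Pop (concat Xss) Z cF"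
    by (simp_all add: inverse_K_def)
  have sel: "MCompOb GammaCat = (gamma_compOb :: ('o, 'm) gcat list list \<Rightarrow> _)" "MCompOb PermCatSus = perm_compOb" "MFOb inverse_K = Pobj"
    by (simp_all add: GammaCat_def PermCatSus_def inverse_K_def)
  show "FOb (MFOps inverse_K (concat Xss) Z) (MCompOb GammaCat Xss Ys Z F Fs) =
    MCompOb PermCatSus (map (map (MFOb inverse_K)) Xss) (map (MFOb inverse_K) Ys) (MFOb inverse_K Z)
      (FOb (MFOps inverse_K Ys Z) F) (tab (length Ys) (\<lambda>i. FOb (MFOps inverse_K (Xss ! i) (Ys ! i)) (Fs ! i)))"
    unfolding sel pop by (rule Pop_comp)
next
  fix Ys :: "('o, 'm) gcat list" and Z :: "('o, 'm) gcat" and Xss t ts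
  assume *: "set Ys \<subseteq> MObj (GammaCat :: (('o, 'm) gcat, ('o, 'm) gop, ('o, 'm) gop_arr) multicat)" "Z \<in> MObj GammaCat" "length Xss = length Ys"
    "\<forall>Xs\<in>set Xss. set Xs \<subseteq> MObj GammaCat" "t \<in> Arr (MOps GammaCat Ys Z)" "length ts = length Ys"
    "\<forall>i<length Ys. ts ! i \<in> Arr (MOps GammaCat (Xss ! i) (Ys ! i))"
  \<comment> \<open>Sources and targets of the inner modifications are kept as lists, as
    \<open>gamma_compOb\<close> takes them, and the modifications themselves as a function of the
    position.\<close>
  define Fs Gs \<theta>s where "Fs = map fst ts" and "Gs = map (fst \<circ> snd) ts" and "\<theta>s i = snd (snd (ts ! i))" for i
  obtain F G \<theta> where t: "t = (F, G, \<theta>)" by (cases t)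
  have ti: "ts ! i = (Fs ! i, Gs ! i, \<theta>s i)" if "i < length Ys" for i
    using that *(6) by (simp add: Fs_def Gs_def \<theta>s_def)
  have arr: "gamma_op (Xss ! i) (Ys ! i) (Fs ! i) \<and> gamma_op (Xss ! i) (Ys ! i) (Gs ! i) \<and>
      gamma_mod (Xss ! i) (Ys ! i) (Fs ! i) (Gs ! i) (\<theta>s i)" if "i < length Ys" for i
    using *(7)[rule_format, OF that] unfolding ti[OF that] by (simp add: GammaCat_def gamma_ops_def)
  have len: "length Fs = length Ys" "length Gs = length Ys" using *(6) by (simp_all add: Fs_def Gs_def)
  interpret gamma_multi_modif Ys Z Xss F G \<theta> Fs Gs \<theta>s
    using *(1-5) arr len by unfold_locales (auto simp: GammaCat_def gamma_ops_def t)
  have "t \<in> Arr (gamma_ops Ys Z)" "gamma_compAr Xss Ys Z t ts \<in> Arr (gamma_ops (concat Xss) Z)"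
    "\<And>i. i < length Ys \<Longrightarrow> ts ! i \<in> Arr (gamma_ops (Xss ! i) (Ys ! i))"
    using *(5,7) gamma_compAr_eq[OF *(6) ti] a.cF_op b.cF_op c\<theta>_mod by (simp_all add: GammaCat_def gamma_ops_def t)
  then have pop: "tab k (\<lambda>i. FAr (MFOps inverse_K (Xss ! i) (Ys ! i)) (ts ! i)) = tab k (\<lambda>i. Pmod (Xss ! i) (Ys ! i) (ts ! i))"
    "FAr (MFOps inverse_K Ys Z) t = Pmod Ys Z t"
    "FAr (MFOps inverse_K (concat Xss) Z) (gamma_compAr Xss Ys Z t ts) = Pmod (concat Xss) Z (gamma_compAr Xss Ys Z t ts)"
    by (simp_all add: inverse_K_def)
  have sel: "MCompAr GammaCat = (gamma_compAr :: ('o, 'm) gcat list list \<Rightarrow> _)" "MCompAr PermCatSus = perm_compAr" "MFOb inverse_K = Pobj"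
    by (simp_all add: GammaCat_def PermCatSus_def inverse_K_def)
  show "FAr (MFOps inverse_K (concat Xss) Z) (MCompAr GammaCat Xss Ys Z t ts) =
    MCompAr PermCatSus (map (map (MFOb inverse_K)) Xss) (map (MFOb inverse_K) Ys) (MFOb inverse_K Z)
      (FAr (MFOps inverse_K Ys Z) t) (tab (length Ys) (\<lambda>i. FAr (MFOps inverse_K (Xss ! i) (Ys ! i)) (ts ! i)))"
    unfolding sel pop unfolding t by (rule Pmod_comp_multi[OF *(6) ti])
qed

end
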